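(* Let $Y\subset\mathrm{Gr}(2,5)$ be the quintic del Pezzo fourfold, i.e. the linear section of $\mathrm{Gr}(2,5)\subset\mathbb{P}^9$ by $p_{12}-p_{03}=p_{13}-p_{24}=0$. Let $Z$ be the locus of non-free lines in the Hilbert scheme $\mathbf{H}_1(Y)$ of lines in $Y$. Then $Z$ is isomorphic to a $\mathbb{P}^1$-fibration over the vertex conic $C_v(\cong\mathbb{P}^1)$.
   Context: Work over $\mathbb{C}$. $\mathrm{Gr}(2,5)$ is the Grassmannian of $2$-dimensional subspaces of $V_5=\mathbb{C}^5$ with standard basis $e_0,\dots,e_4$, embedded in $\mathbb{P}(\wedge^2V_5)=\mathbb{P}^9$ by the Plücker embedding with Plücker coordinates $p_{ij}$, $0\le i<j\le 4$. The quintic del Pezzo fourfold is $Y=\mathrm{Gr}(2,5)\cap\{p_{12}-p_{03}=p_{13}-p_{24}=0\}$. $\mathbf{H}_1(Y)$ is the Hilbert scheme of lines in $Y$ (with respect to $Y\subset\mathbb{P}^9$). For every line $L\subset Y$, the normal bundle $N_{L/Y}$ is isomorphic either to $\mathcal{O}_L(1)\oplus\mathcal{O}_L^{\oplus 2}$, in which case $L$ is called free, or to $\mathcal{O}_L(-1)\oplus\mathcal{O}_L(1)^{\oplus 2}$, in which case $L$ is called non-free. A line in $\mathrm{Gr}(2,5)$ has the form $\{\ell \mid p\in\ell\subset\mathbb{P}^2\}$ for a unique flag $p\in\mathbb{P}^2\subset\mathbb{P}(V_5)$, and $p$ is called its vertex; the vertex map $\mathbf{H}_1(Y)\to\mathbb{P}(V_5)=\mathrm{Gr}(1,5)$,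 sending a line to its vertex, is the blow-up along a smooth conic $C_v$, called the vertex conic, given explicitly by $$C_v=\{[a_0:a_1:a_2:a_3:a_4]\mid a_0a_4+a_1^2=a_2=a_3=0\}\subset\mathbb{P}(V_5).$$ *)

theory Defs
  imports "HOL-Analysis.Analysis"
begin

section \<open>Projective space and the Zariski topology\<close>

text \<open>A point of \<open>\<P>(\<complex>\<^sup>n)\<close> is a one-dimensional subspace of \<open>\<complex>\<^sup>n\<close>, and a line in
  \<open>\<P>(\<complex>\<^sup>n)\<close> is a two-dimensional one.\<close>

type_synonym 'n subsp = "(complex ^ 'n) set"

definition Gr :: "nat \<Rightarrow> 'n::finite subsp set" where
  "Gr k = {W. vec.subspace W \<and> vec.dim W = k}"

abbreviation Proj :: "'n::finite subsp set" where
  "Proj \<equiv> Gr 1"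

text \<open>Homogeneous polynomials are represented by the functions they define; the zero function
  is a form of every degree.\<close>

inductive form :: "nat \<Rightarrow> (complex ^ 'n \<Rightarrow> complex) \<Rightarrow> bool" where
  zero: "form d (\<lambda>v. 0)"
| const: "form 0 (\<lambda>v. c)"
| coord: "form 1 (\<lambda>v. v $ i)"
| add: "form d f \<Longrightarrow> form d g \<Longrightarrow> form d (\<lambda>v. f v + g v)"
| mult: "form d f \<Longrightarrow> form e g \<Longrightarrow> form (d + e) (\<lambda>v. f v * g v)"

definition zariski :: "'n::finite subsp topology" where
  "zariski = topology_generated_by {{x \<in> Proj. \<forall>v\<in>x - {0}. f v \<noteq> 0} | d f. form d f}"

abbreviation zopen :: "'n::finite subsp set \<Rightarrow> 'n subsp set \<Rightarrow> bool" where
  "zopen X U \<equiv> openin (subtopology zariski X) U"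

section \<open>Regular functions and morphisms\<close>

text \<open>Subsets of projective space carry the reduced structure: regular functions are locally
  quotients of two forms of the same degree. Sections over \<open>U\<close> are functions that are
  \<open>undefined\<close> off \<open>U\<close>, so that they can be compared by equality.\<close>

definition regular :: "'n::finite subsp set \<Rightarrow> 'n subsp set \<Rightarrow> ('n subsp \<Rightarrow> complex) set" where
  "regular X U = {f \<in> extensional U. \<forall>x\<in>U. \<exists>V d P Q. zopen X V \<and> x \<in> V \<and> V \<subseteq> U \<and>
     form d P \<and> form d Q \<and> (\<forall>y\<in>V. \<forall>v\<in>y - {0}. Q v \<noteq> 0 \<and> f y = P v / Q v)}"

definition morphism ::
  "'n::finite subsp set \<Rightarrow> 'm::finite subsp set \<Rightarrow> ('n subsp \<Rightarrow> 'm subsp) \<Rightarrow> bool" where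
  "morphism X Y \<phi> \<longleftrightarrow> \<phi> ` X \<subseteq> Y \<and>
     continuous_map (subtopology zariski X) (subtopology zariski Y) \<phi> \<and>
     (\<forall>V f. zopen Y V \<and> f \<in> regular Y V \<longrightarrow>
        restrict (f \<circ> \<phi>) {x \<in> X. \<phi> x \<in> V} \<in> regular X {x \<in> X. \<phi> x \<in> V})"

definition isomorphism ::
  "'n::finite subsp set \<Rightarrow> 'm::finite subsp set \<Rightarrow> ('n subsp \<Rightarrow> 'm subsp) \<Rightarrow> bool" where
  "isomorphism X Y \<phi> \<longleftrightarrow>
     bij_betw \<phi> X Y \<and> morphism X Y \<phi> \<and> morphism Y X (inv_into X \<phi>)"

definition isomorphic :: "'n::finite subsp set \<Rightarrow> 'm::finite subsp set \<Rightarrow> bool" where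
  "isomorphic X Y \<longleftrightarrow> (\<exists>\<phi>. isomorphism X Y \<phi>)"

text \<open>The product of \<open>X\<close> and \<open>Y\<close> is realised as a variety by its Segre image.\<close>

definition segre :: "'n::finite subsp \<Rightarrow> 'm::finite subsp \<Rightarrow> ('n \<times> 'm) subsp" where
  "segre x y = vec.span {(\<chi> ij. u $ fst ij * w $ snd ij) | u w. u \<in> x \<and> w \<in> y}"

definition product :: "'n::finite subsp set \<Rightarrow> 'm::finite subsp set \<Rightarrow> ('n \<times> 'm) subsp set" where
  "product X Y = {segre x y | x y. x \<in> X \<and> y \<in> Y}"

text \<open>A \<open>\<P>\<^sup>1\<close>-fibration is a morphism that is, Zariski locally on the base, a product with
  \<open>\<P>\<^sup>1 = \<P>(\<complex>\<^sup>2)\<close>.\<close>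

definition P1_fibration ::
  "'n::finite subsp set \<Rightarrow> 'm::finite subsp set \<Rightarrow> ('n subsp \<Rightarrow> 'm subsp) \<Rightarrow> bool" where
  "P1_fibration E B \<pi> \<longleftrightarrow> morphism E B \<pi> \<and>
     (\<forall>b\<in>B. \<exists>U \<Phi>. zopen B U \<and> b \<in> U \<and>
        isomorphism {z \<in> E. \<pi> z \<in> U} (product U (Proj :: 2 subsp set)) \<Phi> \<and>
        (\<forall>z\<in>E. \<pi> z \<in> U \<longrightarrow> (\<exists>t\<in>Proj. \<Phi> z = segre (\<pi> z) t)))"

section \<open>Sheaves of modules\<close>

text \<open>A sheaf of modules over the regular functions on \<open>X\<close>, given by its sections over each
  open \<open>U\<close>, their addition, the action of \<open>regular X U\<close>, and the restriction maps
  \<open>sres F U V\<close> from \<open>U\<close> to \<open>V \<subseteq> U\<close>.\<close>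

record ('p, 's) osheaf =
  ssec :: "'p set \<Rightarrow> 's set"
  sadd :: "'p set \<Rightarrow> 's \<Rightarrow> 's \<Rightarrow> 's"
  smul :: "'p set \<Rightarrow> ('p \<Rightarrow> complex) \<Rightarrow> 's \<Rightarrow> 's"
  sres :: "'p set \<Rightarrow> 'p set \<Rightarrow> 's \<Rightarrow> 's"

definition opens_in :: "'n::finite subsp set \<Rightarrow> 'n subsp set \<Rightarrow> 'n subsp set set" where
  "opens_in X U = {V. zopen X V \<and> V \<subseteq> U}"

text \<open>Homomorphisms \<open>F|\<^sub>U \<rightarrow> G|\<^sub>U\<close> of sheaves of modules.\<close>

definition sheaf_homs ::
  "'n::finite subsp set \<Rightarrow> 'n subsp set \<Rightarrow> ('n subsp, 's) osheaf \<Rightarrow> ('n subsp, 't) osheaf \<Rightarrow>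
   ('n subsp set \<Rightarrow> 's \<Rightarrow> 't) set" where
  "sheaf_homs X U F G = {\<eta> \<in> extensional (opens_in X U). \<forall>V\<in>opens_in X U.
     \<eta> V \<in> ssec F V \<rightarrow>\<^sub>E ssec G V \<and>
     (\<forall>s\<in>ssec F V. \<forall>t\<in>ssec F V. \<eta> V (sadd F V s t) = sadd G V (\<eta> V s) (\<eta> V t)) \<and>
     (\<forall>f\<in>regular X V. \<forall>s\<in>ssec F V. \<eta> V (smul F V f s) = smul G V f (\<eta> V s)) \<and>
     (\<forall>W\<in>opens_in X V. \<forall>s\<in>ssec F V. \<eta> W (sres F V W s) = sres G V W (\<eta> V s))}"

definition sheaf_isomorphic ::
  "'n::finite subsp set \<Rightarrow> ('n subsp, 's) osheaf \<Rightarrow> ('n subsp, 't) osheaf \<Rightarrow> bool" where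
  "sheaf_isomorphic X F G \<longleftrightarrow>
     (\<exists>\<eta>\<in>sheaf_homs X X F G. \<forall>U\<in>opens_in X X. bij_betw (\<eta> U) (ssec F U) (ssec G U))"

definition structure_sheaf ::
  "'n::finite subsp set \<Rightarrow> ('n subsp, 'n subsp \<Rightarrow> complex) osheaf" where
  "structure_sheaf X = \<lparr>ssec = regular X,
     sadd = (\<lambda>U f g. \<lambda>x\<in>U. f x + g x),
     smul = (\<lambda>U f g. \<lambda>x\<in>U. f x * g x),
     sres = (\<lambda>U V f. restrict f V)\<rparr>"

text \<open>The ideal sheaf \<open>\<I>\<^sub>L \<subseteq> \<O>\<^sub>Y\<close> of \<open>L \<subseteq> Y\<close>.\<close>

definition ideal_sheaf ::
  "'n::finite subsp set \<Rightarrow> 'n subsp set \<Rightarrow> ('n subsp, 'n subsp \<Rightarrow> complex) osheaf" where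
  "ideal_sheaf Y L =
     (structure_sheaf Y)\<lparr>ssec := (\<lambda>U. {f \<in> regular Y U. \<forall>x\<in>U \<inter> L. f x = 0})\<rparr>"

text \<open>The twist \<open>\<O>\<^sub>X(d)\<close>, \<open>d \<in> \<int>\<close>: its sections over \<open>U\<close> are the functions on the
  punctured affine cone over \<open>U\<close> that are locally quotients of forms of degree difference \<open>d\<close>.\<close>

definition cone :: "'n::finite subsp set \<Rightarrow> (complex ^ 'n) set" where
  "cone U = \<Union>U - {0}"

definition twist :: "'n::finite subsp set \<Rightarrow> int \<Rightarrow> ('n subsp, complex ^ 'n \<Rightarrow> complex) osheaf" where
  "twist X d = \<lparr>
     ssec = (\<lambda>U. {s \<in> extensional (cone U). \<forall>x\<in>U. \<exists>V m k P Q. zopen X V \<and> x \<in> V \<and> V \<subseteq> U \<and>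
       form m P \<and> form k Q \<and> int m = int k + d \<and> (\<forall>v\<in>cone V. Q v \<noteq> 0 \<and> s v = P v / Q v)}),
     sadd = (\<lambda>U s t. \<lambda>v\<in>cone U. s v + t v),
     smul = (\<lambda>U f s. \<lambda>v\<in>cone U. f (vec.span {v}) * s v),
     sres = (\<lambda>U V s. restrict s (cone V))\<rparr>"

definition direct_sum ::
  "('p, 's) osheaf \<Rightarrow> ('p, 't) osheaf \<Rightarrow> ('p, 's \<times> 't) osheaf"  (infixr "\<oplus>\<^sub>S" 65) where
  "F \<oplus>\<^sub>S G = \<lparr>
     ssec = (\<lambda>U. ssec F U \<times> ssec G U),
     sadd = (\<lambda>U s t. (sadd F U (fst s) (fst t), sadd G U (snd s) (snd t))),
     smul = (\<lambda>U f s. (smul F U f (fst s), smul G U f (snd s))),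
     sres = (\<lambda>U V s. (sres F U V (fst s), sres G U V (snd s)))\<rparr>"

text \<open>Pushforward of a sheaf along the inclusion of \<open>L\<close> into a larger variety.\<close>

definition pushforward :: "'p set \<Rightarrow> ('p, 's) osheaf \<Rightarrow> ('p, 's) osheaf" where
  "pushforward L F = \<lparr>
     ssec = (\<lambda>U. ssec F (U \<inter> L)),
     sadd = (\<lambda>U. sadd F (U \<inter> L)),
     smul = (\<lambda>U f. smul F (U \<inter> L) (restrict f (U \<inter> L))),
     sres = (\<lambda>U V. sres F (U \<inter> L) (V \<inter> L))\<rparr>"

definition hom_sheaf ::
  "'n::finite subsp set \<Rightarrow> ('n subsp, 's) osheaf \<Rightarrow> ('n subsp, 't) osheaf \<Rightarrow>
   ('n subsp, 'n subsp set \<Rightarrow> 's \<Rightarrow> 't) osheaf" where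
  "hom_sheaf X F G = \<lparr>
     ssec = (\<lambda>U. sheaf_homs X U F G),
     sadd = (\<lambda>U \<phi> \<psi>. \<lambda>V\<in>opens_in X U. \<lambda>s\<in>ssec F V. sadd G V (\<phi> V s) (\<psi> V s)),
     smul = (\<lambda>U f \<phi>. \<lambda>V\<in>opens_in X U. \<lambda>s\<in>ssec F V. smul G V (restrict f V) (\<phi> V s)),
     sres = (\<lambda>U U' \<phi>. restrict \<phi> (opens_in X U'))\<rparr>"

text \<open>For \<open>\<iota> : L \<subseteq> Y\<close> closed, modules on \<open>L\<close> are identified with their pushforwards to \<open>Y\<close>.
  The normal sheaf \<open>\<H>om\<^sub>L(\<I>\<^sub>L/\<I>\<^sub>L\<^sup>2, \<O>\<^sub>L)\<close> then becomes \<open>\<H>om\<^sub>Y(\<I>\<^sub>L, \<iota>\<^sub>*\<O>\<^sub>L)\<close>, since every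
  homomorphism from \<open>\<I>\<^sub>L\<close> to an \<open>\<O>\<^sub>L\<close>-module kills \<open>\<I>\<^sub>L\<^sup>2\<close>.\<close>

definition normal_sheaf ::
  "'n::finite subsp set \<Rightarrow> 'n subsp set \<Rightarrow>
   ('n subsp, 'n subsp set \<Rightarrow> ('n subsp \<Rightarrow> complex) \<Rightarrow> 'n subsp \<Rightarrow> complex) osheaf" where
  "normal_sheaf Y L = hom_sheaf Y (ideal_sheaf Y L) (pushforward L (structure_sheaf L))"

section \<open>Pluecker embeddings and lines\<close>

text \<open>\<open>\<And>\<^sup>2\<complex>\<^sup>n\<close> is the space of antisymmetric tensors inside \<open>\<complex>\<^sup>n \<otimes> \<complex>\<^sup>n\<close>; the Pluecker coordinate
  \<open>p\<^sub>i\<^sub>j\<close> is the \<open>(i, j)\<close> entry. So \<open>\<P>(\<And>\<^sup>2\<complex>\<^sup>5) = \<P>\<^sup>9\<close> is a linear subspace of \<open>\<P>(\<complex>\<^sup>5 \<otimes> \<complex>\<^sup>5)\<close>.\<close>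

definition wedge :: "complex ^ 'n \<Rightarrow> complex ^ 'n \<Rightarrow> complex ^ ('n::finite \<times> 'n)" where
  "wedge u w = (\<chi> ij. u $ fst ij * w $ snd ij - u $ snd ij * w $ fst ij)"

definition pluecker :: "'n::finite subsp \<Rightarrow> ('n \<times> 'n) subsp" where
  "pluecker W = vec.span {wedge u w | u w. u \<in> W \<and> w \<in> W}"

definition points_of :: "'n::finite subsp \<Rightarrow> 'n subsp set" where
  "points_of \<Lambda> = {x \<in> Proj. x \<subseteq> \<Lambda>}"

definition lines_in :: "'n::finite subsp set \<Rightarrow> 'n subsp set" where
  "lines_in Y = {\<Lambda> \<in> Gr 2. points_of \<Lambda> \<subseteq> Y}"

text \<open>The Hilbert scheme of lines in \<open>Y\<close>, with its reduced structure, as a subvariety of the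
  Pluecker embedded Grassmannian of lines in the ambient projective space.\<close>

definition H1 :: "'n::finite subsp set \<Rightarrow> ('n \<times> 'n) subsp set" where
  "H1 Y = pluecker ` lines_in Y"

section \<open>The quintic del Pezzo fourfold\<close>

definition dP5 :: "(5 \<times> 5) subsp set" where
  "dP5 = {x \<in> pluecker ` (Gr 2 :: 5 subsp set).
     \<forall>p\<in>x. p $ (1, 2) - p $ (0, 3) = 0 \<and> p $ (1, 3) - p $ (2, 4) = 0}"

definition non_free :: "(5 \<times> 5) subsp \<Rightarrow> bool" where
  "non_free \<Lambda> \<longleftrightarrow> (let L = points_of \<Lambda> in
     sheaf_isomorphic dP5 (normal_sheaf dP5 L)
       (pushforward L (twist L (- 1) \<oplus>\<^sub>S twist L 1 \<oplus>\<^sub>S twist L 1)))"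

definition non_free_locus :: "((5 \<times> 5) \<times> (5 \<times> 5)) subsp set" where
  "non_free_locus = {h \<in> H1 dP5. \<exists>\<Lambda>\<in>lines_in dP5. h = pluecker \<Lambda> \<and> non_free \<Lambda>}"

definition vertex_conic :: "5 subsp set" where
  "vertex_conic = {x \<in> Proj. \<forall>a\<in>x. a $ 0 * a $ 4 + (a $ 1)\<^sup>2 = 0 \<and> a $ 2 = 0 \<and> a $ 3 = 0}"

end

theory Submission
  imports Defs "HOL-Complex_Analysis.Cauchy_Integral_Formula"
begin

text \<open>A line in the fourfold is given by a vertex \<open>a\<close> and a plane \<open>\<langle>a, b, c\<rangle>\<close> on which \<open>a\<close> pairs to zero
  under the two skew forms defining the fourfold. If no member of the pencil of forms kills \<open>a\<close>, or
  if one does (so that \<open>a\<close> is on the vertex conic) but the plane does not contain the tangent line of the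
  conic at \<open>a\<close>, then three vector fields that are linear along the line give global sections of
  the normal sheaf which are generically independent; this excludes a summand \<open>\<O>(-1)\<close>. In the
  remaining case one field of degree 2 and two constant ones are a frame of the normal sheaf, so that it is
  \<open>\<O>(-1) \<oplus> \<O>(1) \<oplus> \<O>(1)\<close>. Vector fields act on the ideal of the line through derivatives along curves
  in the fourfold. Hence the non-free lines are the pairs of a point of the conic and a plane between its tangent line
  and a hyperplane; their Pluecker vectors sweep out a rational normal scroll \<open>S(2, 5)\<close>.\<close>

section \<open>Subsets of projective space: forms, Zariski topology, regular functions,
  morphisms\<close>

section \<open>Forms\<close>

text \<open>Functions on the fourfold are defined only at its points, so a derivative in a normal
  direction makes sense only along a curve that stays in it; every field therefore has to be shown
  tangent by exhibiting curves. For f in the ideal of the line and F of degree k,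
  \<open>der Y f v (F v)\<close> has degree k - 1 in v, so a section of O(1 - k) times F is a
  section of the normal sheaf. This links degrees 2, 1, 0 to O(-1), O, O(1). The two halves are
  asymmetric. For a non-free line the whole normal sheaf is computed, which requires three
  generators of the ideal near every point of the line. For a free line one splitting has to be
  refuted: global sections of O(-1) vanish by Liouville, so three sections would be squeezed into
  rank 2; independence near one point is enough, and no generators of the ideal are needed. The
  degrees of the scroll come from the parameter (s, t) of the conic: for a vertex a with tangent
  direction b, the bivector of a and b is quadratic in (s, t). The second generator is a combination
  of a cubic bivector, which leads to degree 2 + 3 = 5, and one whose wedge with the first is s q -
  t p = 1 times a quadratic vector.\<close>

lemma form_scale: "form d f \<Longrightarrow> f (c *s v) = c ^ d * f v"
  by (induction rule: form.induct) (auto simp: algebra_simps power_add)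

lemma form_cmult: "form d f \<Longrightarrow> form d (\<lambda>v. k * f v)"
  using form.mult[OF form.const[of k], of d f] by simp

lemma form_uminus: "form d f \<Longrightarrow> form d (\<lambda>v. - f v)"
  using form_cmult[of d f "-1"] by simp

lemma form_diff: "form d f \<Longrightarrow> form d g \<Longrightarrow> form d (\<lambda>v. f v - g v)"
  using form.add[OF _ form_uminus, of d f g] by simp

lemma form_sum: "(\<And>i. i \<in> I \<Longrightarrow> form d (f i)) \<Longrightarrow> form d (\<lambda>v. \<Sum>i\<in>I. f i v)"
  by (induction I rule: infinite_finite_induct) (auto intro: form.zero form.add)

lemma form_mult_eq: "form d f \<Longrightarrow> form e g \<Longrightarrow> d + e = m \<Longrightarrow> form m (\<lambda>v. f v * g v)"
  using form.mult by blast

lemma form_power: "form d f \<Longrightarrow> form (d * k) (\<lambda>v. f v ^ k)"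
  by (induction k) (auto intro: form.const form_mult_eq)

lemma form_const_eq: "form 0 f \<Longrightarrow> f v = f w"
proof -
  have "form d f \<Longrightarrow> d = 0 \<Longrightarrow> \<exists>c. f = (\<lambda>v. c)" for d and f :: "complex ^ 'a \<Rightarrow> complex"
    by (induction rule: form.induct) auto
  then show "form 0 f \<Longrightarrow> f v = f w" by metis
qed

lemma form_comp:
  assumes "form d f" "\<And>i. form e (\<lambda>v. F v $ i)"
  shows "form (d * e) (\<lambda>v. f (F v))"
  using assms
proof (induction rule: form.induct)
  case (coord i)
  then show ?case by simp
next
  case (mult d f e' g)
  then show ?case using form.mult[of "d * e" "\<lambda>v. f (F v)" "e' * e" "\<lambda>v. g (F v)"]
    by (simp add: add_mult_distrib)
qed (auto intro: form.zero form.const form.add)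

lemma form_sub: "form d f \<Longrightarrow> (\<And>i. form 1 (\<lambda>v. F v $ i)) \<Longrightarrow> form d (\<lambda>v. f (F v))"
  using form_comp[of d f 1 F] by simp

section \<open>The Zariski topology\<close>

definition basic :: "(complex ^ 'n \<Rightarrow> complex) \<Rightarrow> 'n::finite subsp set" where
  "basic f = {x \<in> Proj. \<forall>v\<in>x - {0}. f v \<noteq> 0}"

abbreviation pt :: "complex ^ 'n \<Rightarrow> 'n::finite subsp" where
  "pt v \<equiv> vec.span {v}"

lemma pt_in_Proj [simp]: "v \<noteq> 0 \<Longrightarrow> pt v \<in> Proj"
  by (simp add: Gr_def vec.dim_span_eq_card_independent)

lemma pt_in_Gr_Suc_0 [simp]: "v \<noteq> 0 \<Longrightarrow> pt v \<in> Gr (Suc 0)"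
  using pt_in_Proj by simp

lemma in_pt: "w \<in> pt v \<longleftrightarrow> (\<exists>k. w = k *s v)"
  by (auto simp: vec.span_singleton)

lemma pt_scale [simp]: "k \<noteq> 0 \<Longrightarrow> pt (k *s v) = pt v"
proof -
  assume k: "k \<noteq> 0"
  have "w \<in> pt (k *s v) \<longleftrightarrow> w \<in> pt v" for w
  proof
    assume "w \<in> pt v"
    then obtain j where "w = j *s v" by (auto simp: in_pt)
    then have "w = (j / k) *s (k *s v)" using k by (simp add: vec_eq_iff)
    then show "w \<in> pt (k *s v)" unfolding in_pt by blast
  qed (auto simp: in_pt vector_smult_assoc)
  then show ?thesis by blast
qed

lemma Proj_eq_pt:
  assumes "x \<in> Proj" "v \<in> x" "v \<noteq> 0"
  shows "x = pt v"
proof -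
  have x: "vec.subspace x" "vec.dim x = 1" using assms by (auto simp: Gr_def)
  show ?thesis
  proof (rule vec.subspace_dim_equal[symmetric])
    show "vec.subspace (pt v)" by (rule vec.subspace_span)
    show "vec.subspace x" by fact
    show "pt v \<subseteq> x" using assms x by (simp add: vec.span_minimal)
    show "vec.dim x \<le> vec.dim (pt v)"
      using x pt_in_Proj[OF assms(3)] by (simp add: Gr_def)
  qed
qed

lemma ProjE:
  assumes "x \<in> Proj"
  obtains v where "v \<noteq> 0" "x = pt v" "v \<in> x"
proof -
  have "x \<noteq> {0}" "vec.subspace x" using assms by (auto simp: Gr_def)
  then have "\<exists>v\<in>x. v \<noteq> 0" using vec.subspace_0 by fastforce
  then show ?thesis using that Proj_eq_pt[OF assms] by blast
qed

lemma pt_eq_iff: "w \<noteq> 0 \<Longrightarrow> v \<noteq> 0 \<Longrightarrow> pt v = pt w \<longleftrightarrow> (\<exists>k. k \<noteq> 0 \<and> v = k *s w)"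
proof
  assume "w \<noteq> 0" "v \<noteq> 0" "pt v = pt w"
  then have "v \<in> pt w" using vec.span_base by blast
  then show "\<exists>k. k \<noteq> 0 \<and> v = k *s w" using \<open>v \<noteq> 0\<close> by (auto simp: in_pt)
qed auto

lemma self_in_pt [simp]: "v \<in> pt v"
  by (simp add: vec.span_base)

lemma basic_subset: "basic f \<subseteq> Proj"
  by (auto simp: basic_def)

lemma pt_in_basic: "form d f \<Longrightarrow> v \<noteq> 0 \<Longrightarrow> pt v \<in> basic f \<longleftrightarrow> f v \<noteq> 0"
  by (auto simp: basic_def in_pt form_scale)

lemma basic_Int: "basic f \<inter> basic g = basic (\<lambda>v. f v * g v)"
  by (auto simp: basic_def)

lemma basic_one [simp]: "basic (\<lambda>v. 1) = Proj"
  by (auto simp: basic_def)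

lemma openin_basic: "form d f \<Longrightarrow> openin zariski (basic f)"
  unfolding zariski_def basic_def
  by (rule topology_generated_by_Basis) blast

text \<open>Forms can be multiplied, so the sets \<open>basic f\<close> are closed under
  intersection and the generating family is a base, not just a subbase.\<close>

lemma openin_zariski:
  "openin zariski T \<longleftrightarrow> (\<forall>x\<in>T. \<exists>d f. form d f \<and> x \<in> basic f \<and> basic f \<subseteq> T)"
proof
  assume "openin zariski T"
  then have "generate_topology_on {basic f | d f. form d f} T"
    by (simp add: zariski_def basic_def openin_topology_generated_by_iff)
  then show "\<forall>x\<in>T. \<exists>d f. form d f \<and> x \<in> basic f \<and> basic f \<subseteq> T"
  proof induction
    case (Int a b)
    show ?case
    proof
      fix x assume "x \<in> a \<inter> b"
      then obtain d f e g where "form d f" "x \<in> basic f" "basic f \<subseteq> a"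
        "form e g" "x \<in> basic g" "basic g \<subseteq> b" using Int by (meson IntE)
      then have "form (d + e) (\<lambda>v. f v * g v)" "x \<in> basic (\<lambda>v. f v * g v)"
        "basic (\<lambda>v. f v * g v) \<subseteq> a \<inter> b"
        by (auto simp: basic_Int[symmetric] intro: form.mult)
      then show "\<exists>d f. form d f \<and> x \<in> basic f \<and> basic f \<subseteq> a \<inter> b" by blast
    qed
  next
    case (UN K)
    show ?case
    proof
      fix x assume "x \<in> \<Union>K"
      then obtain k where k: "k \<in> K" "x \<in> k" by blast
      then obtain d f where "form d f" "x \<in> basic f" "basic f \<subseteq> k" using UN by blast
      then show "\<exists>d f. form d f \<and> x \<in> basic f \<and> basic f \<subseteq> \<Union>K" using k by blast
    qed
  qed auto
next
  assume *: "\<forall>x\<in>T. \<exists>d f. form d f \<and> x \<in> basic f \<and> basic f \<subseteq> T"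
  show "openin zariski T"
    using * openin_basic by (subst openin_subopen) blast
qed

lemma topspace_zariski [simp]: "topspace zariski = (Proj :: 'n::finite subsp set)"
proof
  show "topspace zariski \<subseteq> (Proj :: 'n subsp set)"
  proof
    fix x :: "'n subsp" assume "x \<in> topspace zariski"
    then obtain f :: "complex ^ 'n \<Rightarrow> complex" where "x \<in> basic f"
      using openin_topspace[of zariski] unfolding openin_zariski by blast
    then show "x \<in> Proj" by (simp add: basic_def)
  qed
  have "openin zariski (Proj :: 'n subsp set)"
    using openin_basic[OF form.const[of 1]] by simp
  then show "(Proj :: 'n subsp set) \<subseteq> topspace zariski" by (rule openin_subset)
qed

lemma zopen_iff:
  assumes "X \<subseteq> Proj"
  shows "zopen X V \<longleftrightarrow> V \<subseteq> X \<and> (\<forall>x\<in>V. \<exists>d f. form d f \<and> x \<in> basic f \<and> X \<inter> basic f \<subseteq> V)"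
proof
  assume "zopen X V"
  then show "V \<subseteq> X \<and> (\<forall>x\<in>V. \<exists>d f. form d f \<and> x \<in> basic f \<and> X \<inter> basic f \<subseteq> V)"
    unfolding openin_subtopology openin_zariski by blast
next
  assume *: "V \<subseteq> X \<and> (\<forall>x\<in>V. \<exists>d f. form d f \<and> x \<in> basic f \<and> X \<inter> basic f \<subseteq> V)"
  let ?T = "\<Union>{basic f | f. (\<exists>d. form d f) \<and> X \<inter> basic f \<subseteq> V}"
  have "V = ?T \<inter> X" using * by blast
  moreover have "openin zariski ?T" using openin_basic by blast
  ultimately show "zopen X V" unfolding openin_subtopology by blast
qed

lemma zopen_basic: "form d f \<Longrightarrow> zopen X (X \<inter> basic f)"
  using openin_basic openin_subtopology by fast

lemma zopen_subset: "zopen X U \<Longrightarrow> U \<subseteq> X"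
  unfolding openin_subtopology by blast

lemma zopen_self: "X \<subseteq> Proj \<Longrightarrow> zopen X X"
  unfolding openin_subtopology
  by (rule exI[of _ Proj]) (use openin_topspace[of zariski] in auto)

lemma zopen_Int_sub: "zopen Y U \<Longrightarrow> L \<subseteq> Y \<Longrightarrow> zopen L (U \<inter> L)"
  unfolding openin_subtopology by blast

lemma closedin_forms:
  assumes "\<And>f. f \<in> S \<Longrightarrow> \<exists>d. form d f"
  shows "closedin zariski {x \<in> Proj. \<forall>v\<in>x - {0}. \<forall>f\<in>S. f v = 0}"
    (is "closedin _ ?C")
proof -
  have "openin zariski (Proj - ?C)"
    unfolding openin_zariski
  proof
    fix x assume x: "x \<in> Proj - ?C"
    then obtain v f where v: "v \<in> x - {0}" "f \<in> S" "f v \<noteq> 0" by blast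
    then obtain d where d: "form d f" using assms by blast
    have xv: "x = pt v" using x v Proj_eq_pt by blast
    have "x \<in> basic f" using v d pt_in_basic xv by blast
    moreover have "basic f \<subseteq> Proj - ?C"
    proof
      fix y assume y: "y \<in> basic f"
      then have "y \<in> Proj" using basic_subset by blast
      then obtain w where "w \<noteq> 0" "w \<in> y" by (rule ProjE)
      then have "w \<in> y - {0}" "f w \<noteq> 0" using y by (auto simp: basic_def)
      then show "y \<in> Proj - ?C" using \<open>y \<in> Proj\<close> v(2) by blast
    qed
    ultimately show "\<exists>d f. form d f \<and> x \<in> basic f \<and> basic f \<subseteq> Proj - ?C" using d by blast
  qed
  then show ?thesis unfolding closedin_def by auto
qed

section \<open>Local quotients of forms\<close>

text \<open>Regular functions and sections of twists are both described by this predicate, which makes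
  sense for functions on the affine cone near \<open>x\<close>.\<close>

definition local_quot ::
  "'n::finite subsp set \<Rightarrow> 'n subsp \<Rightarrow> int \<Rightarrow> (complex ^ 'n \<Rightarrow> complex) \<Rightarrow> bool" where
  "local_quot X x d s \<longleftrightarrow> (\<exists>e g m k P Q. form e g \<and> x \<in> basic g \<and> form m P \<and> form k Q \<and> int m = int k + d \<and>
     (\<forall>v. v \<noteq> 0 \<longrightarrow> pt v \<in> X \<inter> basic g \<longrightarrow> Q v \<noteq> 0 \<and> s v = P v / Q v))"

lemma local_quotI:
  assumes "form e g" "x \<in> basic g" "form m P" "form k Q" "int m = int k + d"
    "\<And>v. v \<noteq> 0 \<Longrightarrow> pt v \<in> X \<Longrightarrow> pt v \<in> basic g \<Longrightarrow> Q v \<noteq> 0 \<and> s v = P v / Q v"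
  shows "local_quot X x d s"
  unfolding local_quot_def using assms by blast

lemma local_quotE:
  assumes "local_quot X x d s"
  obtains e g m k P Q where "form e g" "x \<in> basic g" "form m P" "form k Q" "int m = int k + d"
    "\<And>v. v \<noteq> 0 \<Longrightarrow> pt v \<in> X \<Longrightarrow> pt v \<in> basic g \<Longrightarrow> Q v \<noteq> 0 \<and> s v = P v / Q v"
  using assms unfolding local_quot_def by blast

lemma local_quot_mono: "local_quot X x d s \<Longrightarrow> X' \<subseteq> X \<Longrightarrow> local_quot X' x d s"
  unfolding local_quot_def by blast

lemma local_quot_cong:
  assumes "local_quot X x d s" "zopen X U" "x \<in> U" "X \<subseteq> Proj"
    "\<And>v. v \<noteq> 0 \<Longrightarrow> pt v \<in> U \<Longrightarrow> t v = s v"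
  shows "local_quot X x d t"
proof -
  obtain e g m k P Q where *: "form e g" "x \<in> basic g" "form m P" "form k Q" "int m = int k + d"
    "\<And>v. v \<noteq> 0 \<Longrightarrow> pt v \<in> X \<Longrightarrow> pt v \<in> basic g \<Longrightarrow> Q v \<noteq> 0 \<and> s v = P v / Q v"
    using assms(1) by (rule local_quotE) blast
  obtain e' g' where **: "form e' g'" "x \<in> basic g'" "X \<inter> basic g' \<subseteq> U"
    using assms(2-4) zopen_iff by meson
  show ?thesis
  proof (rule local_quotI)
    show "form (e + e') (\<lambda>v. g v * g' v)" using * ** form.mult by blast
    show "x \<in> basic (\<lambda>v. g v * g' v)" using * ** by (simp add: basic_Int[symmetric])
    show "Q v \<noteq> 0 \<and> t v = P v / Q v"
      if "v \<noteq> 0" "pt v \<in> X" "pt v \<in> basic (\<lambda>v. g v * g' v)" for v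
      using that *(6)[of v] **(3) assms(5)[of v] by (auto simp: basic_Int[symmetric])
  qed (use * in auto)
qed

lemma local_quot_add:
  assumes "local_quot X x d s" "local_quot X x d t"
  shows "local_quot X x d (\<lambda>v. s v + t v)"
proof -
  obtain e g m k P Q where *: "form e g" "x \<in> basic g" "form m P" "form k Q" "int m = int k + d"
    "\<And>v. v \<noteq> 0 \<Longrightarrow> pt v \<in> X \<Longrightarrow> pt v \<in> basic g \<Longrightarrow> Q v \<noteq> 0 \<and> s v = P v / Q v"
    using assms(1) by (rule local_quotE) blast
  obtain e' g' m' k' P' Q' where **: "form e' g'" "x \<in> basic g'" "form m' P'" "form k' Q'"
    "int m' = int k' + d"
    "\<And>v. v \<noteq> 0 \<Longrightarrow> pt v \<in> X \<Longrightarrow> pt v \<in> basic g' \<Longrightarrow> Q' v \<noteq> 0 \<and> t v = P' v / Q' v"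
    using assms(2) by (rule local_quotE) blast
  show ?thesis
  proof (rule local_quotI)
    show "form (e + e') (\<lambda>v. g v * g' v)" using * ** form.mult by blast
    show "x \<in> basic (\<lambda>v. g v * g' v)" using * ** by (simp add: basic_Int[symmetric])
    show "form (m + k') (\<lambda>v. P v * Q' v + P' v * Q v)"
      using * ** by (intro form.add form_mult_eq[of m P k' Q'] form_mult_eq[of m' P' k Q]) auto
    show "form (k + k') (\<lambda>v. Q v * Q' v)" using * ** form.mult by blast
    show "int (m + k') = int (k + k') + d" using * by simp
    show "Q v * Q' v \<noteq> 0 \<and> s v + t v = (P v * Q' v + P' v * Q v) / (Q v * Q' v)"
      if "v \<noteq> 0" "pt v \<in> X" "pt v \<in> basic (\<lambda>v. g v * g' v)" for v
      using that *(6)[of v] **(6)[of v] by (simp add: basic_Int[symmetric] field_simps)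
  qed
qed

lemma local_quot_mult:
  assumes "local_quot X x d s" "local_quot X x d' t" "d + d' = d''"
  shows "local_quot X x d'' (\<lambda>v. s v * t v)"
proof -
  obtain e g m k P Q where *: "form e g" "x \<in> basic g" "form m P" "form k Q" "int m = int k + d"
    "\<And>v. v \<noteq> 0 \<Longrightarrow> pt v \<in> X \<Longrightarrow> pt v \<in> basic g \<Longrightarrow> Q v \<noteq> 0 \<and> s v = P v / Q v"
    using assms(1) by (rule local_quotE) blast
  obtain e' g' m' k' P' Q' where **: "form e' g'" "x \<in> basic g'" "form m' P'" "form k' Q'"
    "int m' = int k' + d'"
    "\<And>v. v \<noteq> 0 \<Longrightarrow> pt v \<in> X \<Longrightarrow> pt v \<in> basic g' \<Longrightarrow> Q' v \<noteq> 0 \<and> t v = P' v / Q' v"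
    using assms(2) by (rule local_quotE) blast
  show ?thesis
  proof (rule local_quotI)
    show "form (e + e') (\<lambda>v. g v * g' v)" using * ** form.mult by blast
    show "x \<in> basic (\<lambda>v. g v * g' v)" using * ** by (simp add: basic_Int[symmetric])
    show "form (m + m') (\<lambda>v. P v * P' v)" using * ** form.mult by blast
    show "form (k + k') (\<lambda>v. Q v * Q' v)" using * ** form.mult by blast
    show "int (m + m') = int (k + k') + d''" using * ** assms by simp
    show "Q v * Q' v \<noteq> 0 \<and> s v * t v = (P v * P' v) / (Q v * Q' v)"
      if "v \<noteq> 0" "pt v \<in> X" "pt v \<in> basic (\<lambda>v. g v * g' v)" for v
      using that *(6)[of v] **(6)[of v] by (simp add: basic_Int[symmetric] field_simps)
  qed
qed

lemma local_quot_form: "form m P \<Longrightarrow> x \<in> Proj \<Longrightarrow> int m = d \<Longrightarrow> local_quot X x d P"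
  by (rule local_quotI[OF form.const[of 1] _ _ form.const[of 1]]) auto

lemma local_quot_const: "x \<in> Proj \<Longrightarrow> local_quot X x 0 (\<lambda>v. c)"
  by (rule local_quot_form[OF form.const]) auto

lemma local_quot_inverse:
  assumes "form m Q" "x \<in> basic Q" "- int m = d"
  shows "local_quot X x d (\<lambda>v. 1 / Q v)"
  by (rule local_quotI[OF assms(1,2) form.const[of 1] assms(1)])
     (use assms pt_in_basic[OF assms(1)] in auto)

lemma local_quot_divide:
  assumes "local_quot X x d s" "form m Q" "x \<in> basic Q" "d = d' + int m"
  shows "local_quot X x d' (\<lambda>v. s v / Q v)"
proof -
  have "local_quot X x d' (\<lambda>v. s v * (1 / Q v))"
    by (rule local_quot_mult[OF assms(1) local_quot_inverse[OF assms(2,3) refl]]) (use assms in simp)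
  then show ?thesis by simp
qed

lemma local_quot_uminus: "local_quot X x d s \<Longrightarrow> x \<in> Proj \<Longrightarrow> local_quot X x d (\<lambda>v. - s v)"
  using local_quot_mult[OF local_quot_const[of x X "-1"], of d s] by simp

lemma local_quot_diff: "local_quot X x d s \<Longrightarrow> local_quot X x d t \<Longrightarrow> x \<in> Proj \<Longrightarrow> local_quot X x d (\<lambda>v. s v - t v)"
  using local_quot_add[OF _ local_quot_uminus, of X x d s t] by simp

lemma local_quot_scale:
  assumes "local_quot X (pt v) d s" "v \<noteq> 0" "pt v \<in> X" "c \<noteq> 0"
  shows "s (c *s v) = c powi d * s v"
proof -
  obtain e g m k P Q where *: "form e g" "pt v \<in> basic g" "form m P" "form k Q" "int m = int k + d"
    "\<And>v. v \<noteq> 0 \<Longrightarrow> pt v \<in> X \<Longrightarrow> pt v \<in> basic g \<Longrightarrow> Q v \<noteq> 0 \<and> s v = P v / Q v"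
    using assms(1) by (rule local_quotE) blast
  have 1: "s v = P v / Q v" "Q v \<noteq> 0" using * assms by auto
  have 2: "s (c *s v) = P (c *s v) / Q (c *s v)" using *(6)[of "c *s v"] * assms by simp
  have d: "d = int m - int k" using * by simp
  have "c powi d = c ^ m / c ^ k" unfolding d using assms(4) by (simp add: power_int_diff)
  then show ?thesis unfolding 2 1 form_scale[OF *(3)] form_scale[OF *(4)] by simp
qed

lemma mem_cone: "X \<subseteq> Proj \<Longrightarrow> v \<in> cone X \<longleftrightarrow> v \<noteq> 0 \<and> pt v \<in> X"
proof
  assume X: "X \<subseteq> Proj" and "v \<in> cone X"
  then obtain x where x: "x \<in> X" "v \<in> x" "v \<noteq> 0" by (auto simp: cone_def)
  then have "x = pt v" using X Proj_eq_pt by blast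
  then show "v \<noteq> 0 \<and> pt v \<in> X" using x by blast
qed (auto simp: cone_def intro!: bexI[of _ "pt v"])

lemma zopen_Proj: "zopen X U \<Longrightarrow> U \<subseteq> Proj"
  using openin_subset[of zariski] unfolding openin_subtopology topspace_zariski by blast

lemma cone_iff: "zopen X U \<Longrightarrow> v \<in> cone U \<longleftrightarrow> v \<noteq> 0 \<and> pt v \<in> U"
  by (rule mem_cone[OF zopen_Proj])

lemma twist_local_quot:
  assumes X: "X \<subseteq> Proj" and U: "zopen X U"
  shows "s \<in> ssec (twist X d) U \<longleftrightarrow> s \<in> extensional (cone U) \<and> (\<forall>x\<in>U. local_quot X x d s)"
proof -
  have "(\<exists>V m k P Q. zopen X V \<and> x \<in> V \<and> V \<subseteq> U \<and>
       form m P \<and> form k Q \<and> int m = int k + d \<and> (\<forall>v\<in>cone V. Q v \<noteq> 0 \<and> s v = P v / Q v))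
     \<longleftrightarrow> local_quot X x d s" (is "?l \<longleftrightarrow> _") if x: "x \<in> U" for x
  proof
    assume ?l
    then obtain V m k P Q where *: "zopen X V" "x \<in> V" "V \<subseteq> U"
       "form m P" "form k Q" "int m = int k + d" "\<forall>v\<in>cone V. Q v \<noteq> 0 \<and> s v = P v / Q v" by blast
    obtain e g where "form e g" "x \<in> basic g" "X \<inter> basic g \<subseteq> V" using * zopen_iff[OF X] by meson
    then show "local_quot X x d s" using * cone_iff[OF *(1)] by (intro local_quotI[of e g x m P k Q]) blast+
  next
    assume "local_quot X x d s"
    then obtain e g m k P Q where *: "form e g" "x \<in> basic g" "form m P" "form k Q" "int m = int k + d"
      "\<And>v. v \<noteq> 0 \<Longrightarrow> pt v \<in> X \<Longrightarrow> pt v \<in> basic g \<Longrightarrow> Q v \<noteq> 0 \<and> s v = P v / Q v"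
      by (rule local_quotE) blast
    have V: "zopen X (U \<inter> (X \<inter> basic g))"
      by (rule openin_Int[OF U zopen_basic[OF *(1)]])
    show ?l
    proof (intro exI conjI)
      show "x \<in> U \<inter> (X \<inter> basic g)" using x * zopen_subset[OF U] by blast
      show "\<forall>v\<in>cone (U \<inter> (X \<inter> basic g)). Q v \<noteq> 0 \<and> s v = P v / Q v"
        using * cone_iff[OF V] by blast
    qed (use V * in auto)
  qed
  then show ?thesis by (simp add: twist_def)
qed

lemma regular_local_quot:
  assumes X: "X \<subseteq> Proj" and U: "zopen X U"
  shows "f \<in> regular X U \<longleftrightarrow> f \<in> extensional U \<and> (\<forall>x\<in>U. local_quot X x 0 (\<lambda>v. f (pt v)))"
proof -
  have "(\<exists>V d P Q. zopen X V \<and> x \<in> V \<and> V \<subseteq> U \<and>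
     form d P \<and> form d Q \<and> (\<forall>y\<in>V. \<forall>v\<in>y - {0}. Q v \<noteq> 0 \<and> f y = P v / Q v))
     \<longleftrightarrow> local_quot X x 0 (\<lambda>v. f (pt v))" (is "?l \<longleftrightarrow> _") if x: "x \<in> U" for x
  proof
    assume ?l
    then obtain V m P Q where *: "zopen X V" "x \<in> V" "V \<subseteq> U"
       "form m P" "form m Q" "\<forall>y\<in>V. \<forall>v\<in>y - {0}. Q v \<noteq> 0 \<and> f y = P v / Q v" by blast
    obtain e g where "form e g" "x \<in> basic g" "X \<inter> basic g \<subseteq> V" using * zopen_iff[OF X] by meson
    then show "local_quot X x 0 (\<lambda>v. f (pt v))" using * by (intro local_quotI[of e g x m P m Q]) fastforce+
  next
    assume "local_quot X x 0 (\<lambda>v. f (pt v))"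
    then obtain e g m k P Q where *: "form e g" "x \<in> basic g" "form m P" "form k Q" "int m = int k + 0"
      "\<And>v. v \<noteq> 0 \<Longrightarrow> pt v \<in> X \<Longrightarrow> pt v \<in> basic g \<Longrightarrow> Q v \<noteq> 0 \<and> f (pt v) = P v / Q v"
      by (rule local_quotE) blast
    have V: "zopen X (U \<inter> (X \<inter> basic g))"
      by (rule openin_Int[OF U zopen_basic[OF *(1)]])
    have "\<forall>y\<in>U \<inter> (X \<inter> basic g). \<forall>v\<in>y - {0}. Q v \<noteq> 0 \<and> f y = P v / Q v"
    proof (intro ballI)
      fix y v assume yv: "y \<in> U \<inter> (X \<inter> basic g)" "v \<in> y - {0}"
      then have "y = pt v" using Proj_eq_pt X by blast
      then show "Q v \<noteq> 0 \<and> f y = P v / Q v" using *(6)[of v] yv by blast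
    qed
    show ?l
    proof (intro exI conjI)
      show "x \<in> U \<inter> (X \<inter> basic g)" using x * zopen_subset[OF U] by blast
      show "\<forall>y\<in>U \<inter> (X \<inter> basic g). \<forall>v\<in>y - {0}. Q v \<noteq> 0 \<and> f y = P v / Q v" by fact
    qed (use V * in auto)
  qed
  then show ?thesis by (simp add: regular_def)
qed

section \<open>Morphisms given by forms\<close>

text \<open>A local presentation by forms of one common degree d suffices: preimages of basic sets
  are locally basic, and substituting F into a quotient P / Q multiplies both degrees by d, so they
  stay equal.\<close>

lemma morphismI:
  fixes \<phi> :: "'n::finite subsp \<Rightarrow> 'm::finite subsp"
  assumes X: "X \<subseteq> Proj" and Y: "Y \<subseteq> Proj" and im: "\<And>x. x \<in> X \<Longrightarrow> \<phi> x \<in> Y"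
    and loc: "\<And>x. x \<in> X \<Longrightarrow> \<exists>e g d F. form e g \<and> x \<in> basic g \<and> (\<forall>i. form d (\<lambda>v. F v $ i)) \<and>
      (\<forall>v. v \<noteq> 0 \<longrightarrow> pt v \<in> X \<inter> basic g \<longrightarrow> F v \<noteq> 0 \<and> \<phi> (pt v) = pt (F v))"
  shows "morphism X Y \<phi>"
proof -
  have op: "zopen X {x \<in> X. \<phi> x \<in> V}" if V: "zopen Y V" for V
    unfolding zopen_iff[OF X]
  proof (intro conjI ballI)
    fix x assume "x \<in> {x \<in> X. \<phi> x \<in> V}"
    then have x: "x \<in> X" "\<phi> x \<in> V" by auto
    obtain e g d F where g: "form e g" "x \<in> basic g" "\<forall>i. form d (\<lambda>v. F v $ i)"
      "\<And>v. v \<noteq> 0 \<Longrightarrow> pt v \<in> X \<inter> basic g \<Longrightarrow> F v \<noteq> 0 \<and> \<phi> (pt v) = pt (F v)"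
      using loc[OF x(1)] by blast
    obtain e' h where h: "form e' h" "\<phi> x \<in> basic h" "Y \<inter> basic h \<subseteq> V"
      using V x zopen_iff[OF Y] by meson
    have hF: "form (e' * d) (\<lambda>v. h (F v))" using h g form_comp by blast
    have key: "y \<in> basic (\<lambda>v. h (F v)) \<longleftrightarrow> \<phi> y \<in> basic h" if y: "y \<in> X \<inter> basic g" for y
    proof -
      have "y \<in> Proj" using y X by blast
      then obtain v where v: "v \<noteq> 0" "y = pt v" by (rule ProjE)
      then show ?thesis using g(4)[OF v(1)] y pt_in_basic[OF hF v(1)] pt_in_basic[OF h(1)] by auto
    qed
    show "\<exists>d f. form d f \<and> x \<in> basic f \<and> X \<inter> basic f \<subseteq> {x \<in> X. \<phi> x \<in> V}"
    proof (intro exI conjI)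
      show "form (e + e' * d) (\<lambda>v. g v * h (F v))" using form.mult g hF by blast
      show "x \<in> basic (\<lambda>v. g v * h (F v))" using key[of x] x g h by (auto simp: basic_Int[symmetric])
      show "X \<inter> basic (\<lambda>v. g v * h (F v)) \<subseteq> {x \<in> X. \<phi> x \<in> V}"
        using key h im by (auto simp: basic_Int[symmetric])
    qed
  qed auto
  have cont: "continuous_map (subtopology zariski X) (subtopology zariski Y) \<phi>"
    unfolding continuous_map_def
    using op im X Y by (auto simp: inf.absorb2)
  have "restrict (f \<circ> \<phi>) {x \<in> X. \<phi> x \<in> V} \<in> regular X {x \<in> X. \<phi> x \<in> V}"
    if V: "zopen Y V" and f: "f \<in> regular Y V" for V f
    unfolding regular_local_quot[OF X op[OF V]]
  proof (intro conjI ballI)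
    let ?W = "{x \<in> X. \<phi> x \<in> V}"
    fix x assume xW: "x \<in> ?W"
    then have x: "x \<in> X" "\<phi> x \<in> V" by auto
    have "local_quot Y (\<phi> x) 0 (\<lambda>v. f (pt v))" using f x regular_local_quot[OF Y V] by blast
    then obtain e' h m k P Q where *: "form e' h" "\<phi> x \<in> basic h" "form m P" "form k Q"
      "int m = int k + 0"
      "\<And>v. v \<noteq> 0 \<Longrightarrow> pt v \<in> Y \<Longrightarrow> pt v \<in> basic h \<Longrightarrow> Q v \<noteq> 0 \<and> f (pt v) = P v / Q v"
      by (rule local_quotE) blast
    obtain e g d F where g: "form e g" "x \<in> basic g" "\<forall>i. form d (\<lambda>v. F v $ i)"
      "\<And>v. v \<noteq> 0 \<Longrightarrow> pt v \<in> X \<inter> basic g \<Longrightarrow> F v \<noteq> 0 \<and> \<phi> (pt v) = pt (F v)"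
      using loc[OF x(1)] by blast
    have hF: "form (e' * d) (\<lambda>v. h (F v))" using * g form_comp by blast
    have "x \<in> Proj" using x X by blast
    then obtain v0 where v0: "v0 \<noteq> 0" "x = pt v0" by (rule ProjE)
    have "local_quot X x 0 (\<lambda>v. f (\<phi> (pt v)))"
    proof (rule local_quotI)
      show "form (e + e' * d) (\<lambda>v. g v * h (F v))" using form.mult g hF by blast
      show "form (m * d) (\<lambda>v. P (F v))" "form (k * d) (\<lambda>v. Q (F v))" using * g form_comp by blast+
      show "int (m * d) = int (k * d) + 0" using * by simp
      show "x \<in> basic (\<lambda>v. g v * h (F v))" using g(4)[OF v0(1)] v0 x g(2) *(2)
          pt_in_basic[OF hF v0(1)] pt_in_basic[OF *(1)] by (auto simp: basic_Int[symmetric])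
      show "Q (F v) \<noteq> 0 \<and> f (\<phi> (pt v)) = P (F v) / Q (F v)"
        if v: "v \<noteq> 0" "pt v \<in> X" "pt v \<in> basic (\<lambda>v. g v * h (F v))" for v
      proof -
        have 1: "pt v \<in> basic g" "h (F v) \<noteq> 0"
          using v pt_in_basic[OF hF v(1)] by (auto simp: basic_Int[symmetric])
        then have 2: "F v \<noteq> 0" "\<phi> (pt v) = pt (F v)" using g(4) v by auto
        then have "pt (F v) \<in> Y" "pt (F v) \<in> basic h"
          using im[OF v(2)] pt_in_basic[OF *(1)] 1 by auto
        then show ?thesis using *(6)[OF 2(1)] 2 by simp
      qed
    qed
    then show "local_quot X x 0 (\<lambda>v. restrict (f \<circ> \<phi>) ?W (pt v))"
      by (rule local_quot_cong[OF _ op[OF V] xW X]) auto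
  qed simp
  then show ?thesis unfolding morphism_def using im cont by blast
qed

lemma morphism_id: "X \<subseteq> Proj \<Longrightarrow> morphism X X (\<lambda>x. x)"
proof (rule morphismI)
  fix x assume "X \<subseteq> Proj" "x \<in> X"
  then show "\<exists>e g d F. form e g \<and> x \<in> basic g \<and> (\<forall>i. form d (\<lambda>v. F v $ i)) \<and>
      (\<forall>v. v \<noteq> 0 \<longrightarrow> pt v \<in> X \<inter> basic g \<longrightarrow> F v \<noteq> 0 \<and> pt v = pt (F v))"
    by (intro exI[of _ 0] exI[of _ "\<lambda>v. 1"] exI[of _ 1] exI[of _ "\<lambda>v. v"])
       (auto intro: form.const form.coord[simplified])
qed auto

lemma morphism_cong:
  assumes "morphism X Y \<phi>" "\<And>x. x \<in> X \<Longrightarrow> \<psi> x = \<phi> x" "X \<subseteq> Proj"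
  shows "morphism X Y \<psi>"
proof -
  have eq: "{x \<in> X. \<psi> x \<in> V} = {x \<in> X. \<phi> x \<in> V}" for V using assms(2) by auto
  have req: "restrict (f \<circ> \<psi>) {x \<in> X. \<phi> x \<in> V} = restrict (f \<circ> \<phi>) {x \<in> X. \<phi> x \<in> V}" for V f
    using assms(2) by auto
  have "continuous_map (subtopology zariski X) (subtopology zariski Y) \<psi>"
    by (rule continuous_map_eq[of _ _ \<phi>]) (use assms in \<open>auto simp: morphism_def\<close>)
  then show ?thesis using assms(1) unfolding morphism_def eq req
    using assms(2) by (metis (no_types, lifting) image_cong)
qed

lemma isomorphismI:
  assumes "X \<subseteq> Proj" "Y \<subseteq> Proj" "morphism X Y \<phi>" "morphism Y X \<psi>"
    "\<And>x. x \<in> X \<Longrightarrow> \<psi> (\<phi> x) = x" "\<And>y. y \<in> Y \<Longrightarrow> \<phi> (\<psi> y) = y"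
  shows "isomorphism X Y \<phi>"
proof -
  have m: "\<phi> x \<in> Y" if "x \<in> X" for x using that assms(3) by (auto simp: morphism_def)
  have m': "\<psi> y \<in> X" if "y \<in> Y" for y using that assms(4) by (auto simp: morphism_def)
  have bij: "bij_betw \<phi> X Y"
    by (rule bij_betwI[of _ _ _ \<psi>]) (use assms m m' in auto)
  have "inv_into X \<phi> y = \<psi> y" if "y \<in> Y" for y
    using that bij m'[OF that] assms(6)[OF that]
    by (metis bij_betw_imp_inj_on inv_into_f_f)
  then have "morphism Y X (inv_into X \<phi>)" using morphism_cong[OF assms(4)] assms(2) by blast
  then show ?thesis using bij assms(3) by (simp add: isomorphism_def)
qed

lemma isomorphic_refl: "X \<subseteq> Proj \<Longrightarrow> isomorphic X X"
  unfolding isomorphic_def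
  using isomorphismI[OF _ _ morphism_id morphism_id] by blast

section \<open>Derivatives of regular functions and the sections of the normal sheaf they
  define\<close>

section \<open>Derivatives along curves\<close>

definition curve_deriv :: "(complex \<Rightarrow> complex ^ 'n) \<Rightarrow> complex ^ 'n \<Rightarrow> bool" where
  "curve_deriv \<gamma> \<xi> \<longleftrightarrow> (\<forall>i. ((\<lambda>t. \<gamma> t $ i) has_field_derivative \<xi> $ i) (at 0))"

definition dform :: "(complex ^ 'n \<Rightarrow> complex) \<Rightarrow> complex ^ 'n \<Rightarrow> complex ^ 'n \<Rightarrow> complex" where
  "dform P v \<xi> = deriv (\<lambda>t. P (v + t *s \<xi>)) 0"

lemma curve_deriv_line: "curve_deriv (\<lambda>t. v + t *s \<xi>) \<xi>"
  unfolding curve_deriv_def by (auto intro!: derivative_eq_intros)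

text \<open>A form is known only as a function, so its derivative is built by induction together
  with the properties needed later. The clause on \<open>d = 0\<close> carries the product case: for
  a constant factor and a constant field the degree d + e - 1 would be negative, and only the
  vanishing of that summand saves the degree count.\<close>

lemma form_deriv_ex:
  fixes P :: "complex ^ 'n \<Rightarrow> complex"
  assumes "form d P"
  shows "\<exists>P'. (\<forall>\<gamma> \<xi>. curve_deriv \<gamma> \<xi> \<longrightarrow> ((\<lambda>t. P (\<gamma> t)) has_field_derivative P' (\<gamma> 0) \<xi>) (at 0)) \<and>
    (d = 0 \<longrightarrow> (\<forall>v \<xi>. P' v \<xi> = 0)) \<and>
    (\<forall>e F m. (\<forall>i. form e (\<lambda>v. F v $ i)) \<longrightarrow> Suc m = d + e \<longrightarrow> form m (\<lambda>v. P' v (F v)))"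
  using assms
proof (induction rule: form.induct)
  case (zero d)
  show ?case by (rule exI[of _ "\<lambda>v \<xi>. 0"]) (auto intro: form.zero)
next
  case (const c)
  show ?case by (rule exI[of _ "\<lambda>v \<xi>. 0"]) (auto intro: form.zero)
next
  case (coord i)
  show ?case by (rule exI[of _ "\<lambda>v \<xi>. \<xi> $ i"]) (auto simp: curve_deriv_def)
next
  case (add d f g)
  obtain f' where f': "\<And>\<gamma> \<xi>. curve_deriv \<gamma> \<xi> \<Longrightarrow> ((\<lambda>t. f (\<gamma> t)) has_field_derivative f' (\<gamma> 0) \<xi>) (at 0)"
    "\<And>v \<xi>. d = 0 \<Longrightarrow> f' v \<xi> = 0"
    "\<And>e F m. (\<forall>i. form e (\<lambda>v. F v $ i)) \<Longrightarrow> Suc m = d + e \<Longrightarrow> form m (\<lambda>v. f' v (F v))"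
    using add.IH(1) by blast
  obtain g' where g': "\<And>\<gamma> \<xi>. curve_deriv \<gamma> \<xi> \<Longrightarrow> ((\<lambda>t. g (\<gamma> t)) has_field_derivative g' (\<gamma> 0) \<xi>) (at 0)"
    "\<And>v \<xi>. d = 0 \<Longrightarrow> g' v \<xi> = 0"
    "\<And>e F m. (\<forall>i. form e (\<lambda>v. F v $ i)) \<Longrightarrow> Suc m = d + e \<Longrightarrow> form m (\<lambda>v. g' v (F v))"
    using add.IH(2) by blast
  show ?case
    by (rule exI[of _ "\<lambda>v \<xi>. f' v \<xi> + g' v \<xi>"])
       (use f' g' in \<open>auto intro: DERIV_add form.add\<close>)
next
  case (mult d f d2 g)
  obtain f' where f': "\<And>\<gamma> \<xi>. curve_deriv \<gamma> \<xi> \<Longrightarrow> ((\<lambda>t. f (\<gamma> t)) has_field_derivative f' (\<gamma> 0) \<xi>) (at 0)"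
    "\<And>v \<xi>. d = 0 \<Longrightarrow> f' v \<xi> = 0"
    "\<And>e F m. (\<forall>i. form e (\<lambda>v. F v $ i)) \<Longrightarrow> Suc m = d + e \<Longrightarrow> form m (\<lambda>v. f' v (F v))"
    using mult.IH(1) by blast
  obtain g' where g': "\<And>\<gamma> \<xi>. curve_deriv \<gamma> \<xi> \<Longrightarrow> ((\<lambda>t. g (\<gamma> t)) has_field_derivative g' (\<gamma> 0) \<xi>) (at 0)"
    "\<And>v \<xi>. d2 = 0 \<Longrightarrow> g' v \<xi> = 0"
    "\<And>e F m. (\<forall>i. form e (\<lambda>v. F v $ i)) \<Longrightarrow> Suc m = d2 + e \<Longrightarrow> form m (\<lambda>v. g' v (F v))"
    using mult.IH(2) by blast
  show ?case
  proof (intro exI[of _ "\<lambda>v \<xi>. f' v \<xi> * g v + g' v \<xi> * f v"] conjI allI impI)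
    fix \<gamma> :: "complex \<Rightarrow> complex ^ 'n" and \<xi> assume "curve_deriv \<gamma> \<xi>"
    then show "((\<lambda>t. f (\<gamma> t) * g (\<gamma> t)) has_field_derivative
        f' (\<gamma> 0) \<xi> * g (\<gamma> 0) + g' (\<gamma> 0) \<xi> * f (\<gamma> 0)) (at 0)"
      using DERIV_mult[OF f'(1) g'(1)] by blast
  next
    fix v \<xi> assume "d + d2 = 0"
    then show "f' v \<xi> * g v + g' v \<xi> * f v = 0" using f'(2) g'(2) by simp
  next
    fix e m and F :: "complex ^ 'n \<Rightarrow> complex ^ 'n"
    assume F: "\<forall>i. form e (\<lambda>v. F v $ i)" and m: "Suc m = d + d2 + e"
    have "form m (\<lambda>v. f' v (F v) * g v)"
    proof (cases "d = 0")
      case True then show ?thesis using f'(2) by (simp add: form.zero)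
    next
      case False
      then show ?thesis using m by (intro form_mult_eq[OF f'(3)[OF F, of "d + e - 1"] mult.hyps(2)]) auto
    qed
    moreover have "form m (\<lambda>v. g' v (F v) * f v)"
    proof (cases "d2 = 0")
      case True then show ?thesis using g'(2) by (simp add: form.zero)
    next
      case False
      then show ?thesis using m by (intro form_mult_eq[OF g'(3)[OF F, of "d2 + e - 1"] mult.hyps(1)]) auto
    qed
    ultimately show "form m (\<lambda>v. f' v (F v) * g v + g' v (F v) * f v)" by (rule form.add)
  qed
qed

lemma form_deriv:
  assumes "form d P"
  shows "curve_deriv \<gamma> \<xi> \<Longrightarrow> ((\<lambda>t. P (\<gamma> t)) has_field_derivative dform P (\<gamma> 0) \<xi>) (at 0)"
    and "(\<And>i. form e (\<lambda>v. F v $ i)) \<Longrightarrow> Suc m = d + e \<Longrightarrow> form m (\<lambda>v. dform P v (F v))"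
proof -
  obtain P' where P': "\<And>\<gamma> \<xi>. curve_deriv \<gamma> \<xi> \<Longrightarrow> ((\<lambda>t. P (\<gamma> t)) has_field_derivative P' (\<gamma> 0) \<xi>) (at 0)"
    "\<And>e F m. (\<forall>i. form e (\<lambda>v. F v $ i)) \<Longrightarrow> Suc m = d + e \<Longrightarrow> form m (\<lambda>v. P' v (F v))"
    using form_deriv_ex[OF assms] by blast
  have eq: "dform P = P'"
  proof (intro ext)
    fix v \<xi>
    show "dform P v \<xi> = P' v \<xi>" unfolding dform_def
      using DERIV_imp_deriv[OF P'(1)[OF curve_deriv_line[of v \<xi>]]] by simp
  qed
  show "curve_deriv \<gamma> \<xi> \<Longrightarrow> ((\<lambda>t. P (\<gamma> t)) has_field_derivative dform P (\<gamma> 0) \<xi>) (at 0)"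
    using P'(1) eq by simp
  show "(\<And>i. form e (\<lambda>v. F v $ i)) \<Longrightarrow> Suc m = d + e \<Longrightarrow> form m (\<lambda>v. dform P v (F v))"
    using P'(2)[of e F m] eq by simp
qed

lemma form_1_add: "form d P \<Longrightarrow> d = 1 \<Longrightarrow> P (v + w) = P v + P w"
proof (induction rule: form.induct)
  case (mult d f e g)
  then consider "d = 1" "e = 0" | "d = 0" "e = 1" by linarith
  then show ?case
  proof cases
    case 1
    then show ?thesis using mult form_const_eq[of g "v + w" v] form_const_eq[of g w v]
      by (simp add: algebra_simps)
  next
    case 2
    then show ?thesis using mult form_const_eq[of f "v + w" v] form_const_eq[of f w v]
      by (simp add: algebra_simps)
  qed
qed auto

lemma dform_linear: "form 1 P \<Longrightarrow> dform P v \<xi> = P \<xi>"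
proof -
  assume P: "form 1 P"
  have "P (v + t *s \<xi>) = P v + t * P \<xi>" for t
    using form_1_add[OF P refl] form_scale[OF P] by simp
  moreover have "((\<lambda>t. P v + t * P \<xi>) has_field_derivative P \<xi>) (at 0)"
    by (auto intro!: derivative_eq_intros)
  ultimately show ?thesis unfolding dform_def by (simp add: DERIV_imp_deriv)
qed

definition tangent_curve :: "'n::finite subsp set \<Rightarrow> complex ^ 'n \<Rightarrow> complex ^ 'n \<Rightarrow> (complex \<Rightarrow> complex ^ 'n) \<Rightarrow> bool"
  where "tangent_curve Y v \<xi> \<gamma> \<longleftrightarrow> \<gamma> 0 = v \<and> curve_deriv \<gamma> \<xi> \<and> (\<forall>\<^sub>F t in nhds 0. \<gamma> t \<noteq> 0 \<and> pt (\<gamma> t) \<in> Y)"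

text \<open>Tangency means being the velocity of an actual curve in the cone over \<open>Y\<close>,
  so that functions defined only on \<open>Y\<close> can be differentiated in this
  direction.\<close>

definition tangent :: "'n::finite subsp set \<Rightarrow> complex ^ 'n \<Rightarrow> complex ^ 'n \<Rightarrow> bool" where
  "tangent Y v \<xi> \<longleftrightarrow> (\<exists>\<gamma>. tangent_curve Y v \<xi> \<gamma>)"

text \<open>By \<open>der_rep\<close> below the choice of the curve does not matter for regular \<open>f\<close>.\<close>

definition der :: "'n::finite subsp set \<Rightarrow> ('n subsp \<Rightarrow> complex) \<Rightarrow> complex ^ 'n \<Rightarrow> complex ^ 'n \<Rightarrow> complex" where
  "der Y f v \<xi> = deriv (\<lambda>t. f (pt ((SOME \<gamma>. tangent_curve Y v \<xi> \<gamma>) t))) 0"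

lemma tangent_curve_some: "tangent Y v \<xi> \<Longrightarrow> tangent_curve Y v \<xi> (SOME \<gamma>. tangent_curve Y v \<xi> \<gamma>)"
  unfolding tangent_def by (erule someI_ex)

lemma tangent_curve_nonzero: "tangent_curve Y v \<xi> \<gamma> \<Longrightarrow> v \<noteq> 0 \<and> pt v \<in> Y"
  using eventually_nhds_x_imp_x[of "\<lambda>t. \<gamma> t \<noteq> 0 \<and> pt (\<gamma> t) \<in> Y" 0] by (auto simp: tangent_curve_def)

lemma tangent_curve_basic:
  assumes "tangent_curve Y v \<xi> \<gamma>" "form e g" "pt v \<in> basic g"
  shows "\<forall>\<^sub>F t in nhds 0. \<gamma> t \<noteq> 0 \<and> pt (\<gamma> t) \<in> Y \<inter> basic g"
proof -
  have 0: "\<gamma> 0 = v" and d: "curve_deriv \<gamma> \<xi>" and e: "\<forall>\<^sub>F t in nhds 0. \<gamma> t \<noteq> 0 \<and> pt (\<gamma> t) \<in> Y"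
    using assms(1) by (auto simp: tangent_curve_def)
  have "v \<noteq> 0" using tangent_curve_nonzero[OF assms(1)] by blast
  then have "g (\<gamma> 0) \<noteq> 0" using assms pt_in_basic 0 by blast
  moreover have "isCont (\<lambda>t. g (\<gamma> t)) 0" using form_deriv(1)[OF assms(2) d] DERIV_isCont by blast
  ultimately have "\<forall>\<^sub>F t in nhds 0. g (\<gamma> t) \<noteq> 0"
    unfolding isCont_def eventually_nhds_conv_at by (auto intro: tendsto_imp_eventually_ne)
  with e show ?thesis
    by eventually_elim (use pt_in_basic[OF assms(2)] in blast)
qed

lemma tangent_curve_zopen:
  assumes "tangent_curve Y v \<xi> \<gamma>" "zopen Y U" "pt v \<in> U" "Y \<subseteq> Proj"
  shows "\<forall>\<^sub>F t in nhds 0. \<gamma> t \<noteq> 0 \<and> pt (\<gamma> t) \<in> U"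
proof -
  obtain e g where g: "form e g" "pt v \<in> basic g" "Y \<inter> basic g \<subseteq> U"
    using assms(2-4) zopen_iff by meson
  from tangent_curve_basic[OF assms(1) g(1,2)] show ?thesis by eventually_elim (use g in blast)
qed

text \<open>By the quotient rule, the derivative sees the curve only through \<open>v\<close> and
  \<open>\<xi>\<close>; this is the independence of the curve.\<close>

lemma tangent_curve_rep:
  assumes "tangent_curve Y v \<xi> \<gamma>" "form e g" "pt v \<in> basic g" "form m P" "form k Q"
    "\<And>v. v \<noteq> 0 \<Longrightarrow> pt v \<in> Y \<Longrightarrow> pt v \<in> basic g \<Longrightarrow> Q v \<noteq> 0 \<and> f (pt v) = P v / Q v"
  shows "((\<lambda>t. f (pt (\<gamma> t))) has_field_derivative (dform P v \<xi> * Q v - P v * dform Q v \<xi>) / (Q v)\<^sup>2) (at 0)"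
proof -
  have 0: "\<gamma> 0 = v" and d: "curve_deriv \<gamma> \<xi>" using assms(1) by (auto simp: tangent_curve_def)
  have "v \<noteq> 0" "pt v \<in> Y" using tangent_curve_nonzero[OF assms(1)] by auto
  then have Q: "Q v \<noteq> 0" using assms by blast
  have ev: "\<forall>\<^sub>F t in nhds 0. P (\<gamma> t) / Q (\<gamma> t) = f (pt (\<gamma> t))"
    using tangent_curve_basic[OF assms(1-3)] by eventually_elim (use assms(6) in fastforce)
  have "((\<lambda>t. P (\<gamma> t) / Q (\<gamma> t)) has_field_derivative
      (dform P v \<xi> * Q v - P v * dform Q v \<xi>) / (Q v * Q v)) (at 0)"
    using DERIV_divide[OF form_deriv(1)[OF assms(4) d] form_deriv(1)[OF assms(5) d]] Q 0 by simp
  then show ?thesis using DERIV_cong_ev[OF refl ev refl] by (simp add: power2_eq_square)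
qed

lemma der_rep:
  assumes "tangent Y v \<xi>" "form e g" "pt v \<in> basic g" "form m P" "form k Q"
    "\<And>v. v \<noteq> 0 \<Longrightarrow> pt v \<in> Y \<Longrightarrow> pt v \<in> basic g \<Longrightarrow> Q v \<noteq> 0 \<and> f (pt v) = P v / Q v"
  shows "der Y f v \<xi> = (dform P v \<xi> * Q v - P v * dform Q v \<xi>) / (Q v)\<^sup>2"
  unfolding der_def
  by (rule DERIV_imp_deriv, rule tangent_curve_rep[OF tangent_curve_some[OF assms(1)] assms(2-5)]) (rule assms(6))

lemma der_has:
  assumes "tangent Y v \<xi>" "local_quot Y (pt v) 0 (\<lambda>v. f (pt v))"
  shows "((\<lambda>t. f (pt ((SOME \<gamma>. tangent_curve Y v \<xi> \<gamma>) t))) has_field_derivative der Y f v \<xi>) (at 0)"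
proof -
  obtain e g m k P Q where *: "form e g" "pt v \<in> basic g" "form m P" "form k Q" "int m = int k + 0"
    "\<And>v. v \<noteq> 0 \<Longrightarrow> pt v \<in> Y \<Longrightarrow> pt v \<in> basic g \<Longrightarrow> Q v \<noteq> 0 \<and> f (pt v) = P v / Q v"
    using assms(2) by (rule local_quotE) blast
  have "der Y f v \<xi> = (dform P v \<xi> * Q v - P v * dform Q v \<xi>) / (Q v)\<^sup>2"
    by (rule der_rep[OF assms(1) *(1-4)]) (rule *(6))
  moreover have "((\<lambda>t. f (pt ((SOME \<gamma>. tangent_curve Y v \<xi> \<gamma>) t))) has_field_derivative
      (dform P v \<xi> * Q v - P v * dform Q v \<xi>) / (Q v)\<^sup>2) (at 0)"
    by (rule tangent_curve_rep[OF tangent_curve_some[OF assms(1)] *(1-4)]) (rule *(6))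
  ultimately show ?thesis by simp
qed

lemma der_cong:
  assumes "tangent Y v \<xi>" "zopen Y U" "pt v \<in> U" "Y \<subseteq> Proj" "\<And>y. y \<in> U \<Longrightarrow> f y = g y"
  shows "der Y f v \<xi> = der Y g v \<xi>"
  unfolding der_def
proof (rule deriv_cong_ev)
  show "\<forall>\<^sub>F t in nhds 0. f (pt ((SOME \<gamma>. tangent_curve Y v \<xi> \<gamma>) t)) = g (pt ((SOME \<gamma>. tangent_curve Y v \<xi> \<gamma>) t))"
    using tangent_curve_zopen[OF tangent_curve_some[OF assms(1)] assms(2-4)] by eventually_elim (use assms(5) in blast)
qed simp

lemma der_add:
  assumes "tangent Y v \<xi>" "local_quot Y (pt v) 0 (\<lambda>v. f (pt v))" "local_quot Y (pt v) 0 (\<lambda>v. g (pt v))"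
  shows "der Y (\<lambda>x. f x + g x) v \<xi> = der Y f v \<xi> + der Y g v \<xi>"
  unfolding der_def[of Y "\<lambda>x. f x + g x"]
  by (rule DERIV_imp_deriv, rule DERIV_add) (use der_has assms in auto)

lemma der_mult:
  assumes "tangent Y v \<xi>" "local_quot Y (pt v) 0 (\<lambda>v. f (pt v))" "local_quot Y (pt v) 0 (\<lambda>v. g (pt v))"
  shows "der Y (\<lambda>x. f x * g x) v \<xi> = der Y f v \<xi> * g (pt v) + der Y g v \<xi> * f (pt v)"
proof -
  have "(SOME \<gamma>. tangent_curve Y v \<xi> \<gamma>) 0 = v" using tangent_curve_some[OF assms(1)] by (simp add: tangent_curve_def)
  then show ?thesis
    unfolding der_def[of Y "\<lambda>x. f x * g x"]
    using DERIV_imp_deriv[OF DERIV_mult[OF der_has[OF assms(1,2)] der_has[OF assms(1,3)]]] by simp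
qed

definition tangent_field :: "'n::finite subsp set \<Rightarrow> 'n subsp set \<Rightarrow> nat \<Rightarrow> (complex ^ 'n \<Rightarrow> complex ^ 'n) \<Rightarrow> bool" where
  "tangent_field Y L k F \<longleftrightarrow> (\<forall>i. form k (\<lambda>v. F v $ i)) \<and> (\<forall>v. v \<noteq> 0 \<longrightarrow> pt v \<in> L \<longrightarrow> tangent Y v (F v))"

text \<open>Where f = P / Q vanishes, so does P, and the quotient rule collapses to the derivative
  of P divided by Q. The numerator loses one degree by differentiation and gains k from the
  field.\<close>

lemma der_local_quot:
  assumes Y: "Y \<subseteq> Proj" "L \<subseteq> Y" and F: "tangent_field Y L k F"
    and V: "zopen Y V" "x \<in> V" "x \<in> L" and f: "local_quot Y x 0 (\<lambda>v. f (pt v))" "\<And>y. y \<in> V \<inter> L \<Longrightarrow> f y = 0"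
  shows "local_quot L x (int k - 1) (\<lambda>v. der Y f v (F v))"
proof -
  obtain e g m k' P Q where *: "form e g" "x \<in> basic g" "form m P" "form k' Q" "int m = int k' + 0"
    "\<And>v. v \<noteq> 0 \<Longrightarrow> pt v \<in> Y \<Longrightarrow> pt v \<in> basic g \<Longrightarrow> Q v \<noteq> 0 \<and> f (pt v) = P v / Q v"
    using f(1) by (rule local_quotE) blast
  obtain e' h where h: "form e' h" "x \<in> basic h" "Y \<inter> basic h \<subseteq> V"
    using V Y zopen_iff by meson
  obtain u where u: "u \<noteq> 0" "x = pt u" using V Y by (meson ProjE subsetD)
  obtain i where i: "u $ i \<noteq> 0" using u by (auto simp: vec_eq_iff)
  \<comment> \<open>Expanding the fraction by a coordinate that is nonzero at x makes the numerator
    have positive degree; otherwise m = k = 0 would ask for a derivative of degree -1.\<close>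
  let ?l = "\<lambda>v. v $ i"
  have l: "form 1 ?l" by (rule form.coord)
  have P': "form (m + 1) (\<lambda>v. P v * ?l v)" and Q': "form (m + 1) (\<lambda>v. Q v * ?l v)"
    using * l by (auto intro: form_mult_eq)
  let ?G = "\<lambda>v. (g v * h v) * ?l v"
  have G: "form (e + e' + 1) ?G" using * h l by (intro form.mult) auto
  have Gs: "basic ?G = basic g \<inter> basic h \<inter> basic ?l" by (simp add: basic_Int)
  have F1: "\<And>i. form k (\<lambda>v. F v $ i)" and F2: "\<And>v. v \<noteq> 0 \<Longrightarrow> pt v \<in> L \<Longrightarrow> tangent Y v (F v)"
    using F by (auto simp: tangent_field_def)
  show ?thesis
  proof (rule local_quotI[OF G])
    show "x \<in> basic ?G" using * h u i pt_in_basic[OF l] by (simp add: Gs)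
    show "form (m + k) (\<lambda>v. dform (\<lambda>v. P v * ?l v) v (F v))"
      by (rule form_deriv(2)[OF P' F1]) simp
    show "form (m + 1) (\<lambda>v. Q v * ?l v)" by (rule Q')
    show "int (m + k) = int (m + 1) + (int k - 1)" by simp
    fix v assume v: "v \<noteq> 0" "pt v \<in> L" "pt v \<in> basic ?G"
    have vl: "?l v \<noteq> 0" using v pt_in_basic[OF l v(1)] by (simp add: Gs)
    have rep: "Q v * ?l v \<noteq> 0 \<and> f (pt v) = (P v * ?l v) / (Q v * ?l v)"
      if "v \<noteq> 0" "pt v \<in> Y" "pt v \<in> basic ?G" for v
      using that *(6)[of v] pt_in_basic[OF l that(1)] by (simp add: Gs)
    have "pt v \<in> V \<inter> L" using v h(3) Y by (auto simp: Gs)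
    then have "f (pt v) = 0" using f by blast
    then have Pv: "P v * ?l v = 0" using rep[OF v(1) _ v(3)] v(2) Y by auto
    have "der Y f v (F v) = (dform (\<lambda>v. P v * ?l v) v (F v) * (Q v * ?l v)
        - (P v * ?l v) * dform (\<lambda>v. Q v * ?l v) v (F v)) / (Q v * ?l v)\<^sup>2"
      by (rule der_rep[OF F2[OF v(1,2)] G v(3) P' Q']) (rule rep)
    then show "Q v * ?l v \<noteq> 0 \<and> der Y f v (F v) = dform (\<lambda>v. P v * ?l v) v (F v) / (Q v * ?l v)"
      using rep[OF v(1) _ v(3)] v(2) Y Pv
      by (auto simp: power2_eq_square)
  qed
qed

section \<open>Sections of the normal sheaf\<close>

definition rep :: "'n::finite subsp \<Rightarrow> complex ^ 'n" where
  "rep x = (SOME v. v \<noteq> 0 \<and> x = pt v)"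

lemma rep: "x \<in> Proj \<Longrightarrow> rep x \<noteq> 0 \<and> pt (rep x) = x"
proof -
  assume "x \<in> Proj"
  then have "\<exists>v. v \<noteq> 0 \<and> x = pt v" by (meson ProjE)
  then show ?thesis unfolding rep_def by (metis (mono_tags, lifting) someI_ex)
qed

text \<open>Quotients of degree 0 are constant along punctured lines through the origin, so the
  arbitrary choice made by \<open>rep\<close> is invisible to them.\<close>

lemma rep_local_quot_0:
  assumes "local_quot L (pt v) 0 T" "v \<noteq> 0" "pt v \<in> L"
  shows "T (rep (pt v)) = T v"
proof -
  have r: "rep (pt v) \<noteq> 0" "pt (rep (pt v)) = pt v" using rep[OF pt_in_Proj[OF assms(2)]] by auto
  then obtain c where "c \<noteq> 0" "rep (pt v) = c *s v" using pt_eq_iff[OF assms(2) r(1)] by auto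
  then show ?thesis using local_quot_scale[OF assms(1-3)] by simp
qed

lemma regular_rep:
  assumes L: "L \<subseteq> Proj" and W: "zopen L W" and T: "\<And>x. x \<in> W \<Longrightarrow> local_quot L x 0 T"
  shows "(\<lambda>x\<in>W. T (rep x)) \<in> regular L W"
  unfolding regular_local_quot[OF L W]
proof (intro conjI ballI)
  fix x assume x: "x \<in> W"
  show "local_quot L x 0 (\<lambda>v. (\<lambda>x\<in>W. T (rep x)) (pt v))"
  proof (rule local_quot_cong[OF T[OF x] W x L])
    fix v :: "complex ^ 'a" assume v: "v \<noteq> 0" "pt v \<in> W"
    then show "(\<lambda>x\<in>W. T (rep x)) (pt v) = T v"
      using rep_local_quot_0[OF T[OF v(2)] v(1)] zopen_subset[OF W] by auto
  qed
qed simp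

lemma opens_in_iff: "V \<in> opens_in Y U \<longleftrightarrow> zopen Y V \<and> V \<subseteq> U"
  by (simp add: opens_in_def)

abbreviation idl :: "'n::finite subsp set \<Rightarrow> 'n subsp set \<Rightarrow> 'n subsp set \<Rightarrow> ('n subsp \<Rightarrow> complex) set" where
  "idl Y L V \<equiv> {f \<in> regular Y V. \<forall>x\<in>V \<inter> L. f x = 0}"

lemma ideal_simps [simp]:
  "ssec (ideal_sheaf Y L) U = idl Y L U"
  "sadd (ideal_sheaf Y L) = (\<lambda>U f g. \<lambda>x\<in>U. f x + g x)"
  "smul (ideal_sheaf Y L) = (\<lambda>U f g. \<lambda>x\<in>U. f x * g x)"
  "sres (ideal_sheaf Y L) = (\<lambda>U V f. restrict f V)"
  by (simp_all add: ideal_sheaf_def structure_sheaf_def)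

lemma push_simps [simp]:
  "ssec (pushforward L F) U = ssec F (U \<inter> L)"
  "sadd (pushforward L F) U = sadd F (U \<inter> L)"
  "smul (pushforward L F) U f = smul F (U \<inter> L) (restrict f (U \<inter> L))"
  "sres (pushforward L F) U V = sres F (U \<inter> L) (V \<inter> L)"
  by (simp_all add: pushforward_def)

lemma structure_simps [simp]:
  "ssec (structure_sheaf Y) U = regular Y U"
  "sadd (structure_sheaf Y) = (\<lambda>U f g. \<lambda>x\<in>U. f x + g x)"
  "smul (structure_sheaf Y) = (\<lambda>U f g. \<lambda>x\<in>U. f x * g x)"
  "sres (structure_sheaf Y) = (\<lambda>U V f. restrict f V)"
  by (simp_all add: structure_sheaf_def)

lemma normal_simps [simp]:
  "ssec (normal_sheaf Y L) U = sheaf_homs Y U (ideal_sheaf Y L) (pushforward L (structure_sheaf L))"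
  "sadd (normal_sheaf Y L) U \<phi> \<psi> = (\<lambda>V\<in>opens_in Y U. \<lambda>s\<in>idl Y L V. \<lambda>x\<in>V \<inter> L. \<phi> V s x + \<psi> V s x)"
  "smul (normal_sheaf Y L) U f \<phi> =
     (\<lambda>V\<in>opens_in Y U. \<lambda>s\<in>idl Y L V. \<lambda>x\<in>V \<inter> L. f x * \<phi> V s x)"
  "sres (normal_sheaf Y L) U U' \<phi> = restrict \<phi> (opens_in Y U')"
  by (auto simp: normal_sheaf_def hom_sheaf_def fun_eq_iff restrict_def)

abbreviation normal_homs :: "'n::finite subsp set \<Rightarrow> 'n subsp set \<Rightarrow> 'n subsp set \<Rightarrow>
    ('n subsp set \<Rightarrow> ('n subsp \<Rightarrow> complex) \<Rightarrow> 'n subsp \<Rightarrow> complex) set" where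
  "normal_homs Y L U \<equiv> sheaf_homs Y U (ideal_sheaf Y L) (pushforward L (structure_sheaf L))"

lemma normal_homs_iff:
  "h \<in> normal_homs Y L U \<longleftrightarrow> h \<in> extensional (opens_in Y U) \<and> (\<forall>V\<in>opens_in Y U.
     h V \<in> idl Y L V \<rightarrow>\<^sub>E regular L (V \<inter> L) \<and>
     (\<forall>s\<in>idl Y L V. \<forall>t\<in>idl Y L V. h V (\<lambda>x\<in>V. s x + t x) = (\<lambda>x\<in>V \<inter> L. h V s x + h V t x)) \<and>
     (\<forall>f\<in>regular Y V. \<forall>s\<in>idl Y L V. h V (\<lambda>x\<in>V. f x * s x) = (\<lambda>x\<in>V \<inter> L. f x * h V s x)) \<and>
     (\<forall>W\<in>opens_in Y V. \<forall>s\<in>idl Y L V. h W (restrict s W) = restrict (h V s) (W \<inter> L)))"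
  by (simp add: sheaf_homs_def cong: restrict_cong)

lemma regular_lambda:
  assumes L: "L \<subseteq> Proj" and W: "zopen L W" and T: "\<And>x. x \<in> W \<Longrightarrow> local_quot L x 0 (\<lambda>v. t (pt v))"
  shows "(\<lambda>x\<in>W. t x) \<in> regular L W"
  unfolding regular_local_quot[OF L W]
proof (intro conjI ballI)
  fix x assume x: "x \<in> W"
  show "local_quot L x 0 (\<lambda>v. (\<lambda>x\<in>W. t x) (pt v))"
    by (rule local_quot_cong[OF T[OF x] W x L]) auto
qed simp

lemma regularD: "f \<in> regular L W \<Longrightarrow> L \<subseteq> Proj \<Longrightarrow> zopen L W \<Longrightarrow> x \<in> W \<Longrightarrow> local_quot L x 0 (\<lambda>v. f (pt v))"
  using regular_local_quot by blast

lemma regular_add: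
  assumes "L \<subseteq> Proj" "zopen L W" "f \<in> regular L W" "g \<in> regular L W"
  shows "(\<lambda>x\<in>W. f x + g x) \<in> regular L W"
  by (rule regular_lambda[OF assms(1,2)], rule local_quot_add) (use assms regularD in blast)+

lemma regular_mult:
  assumes "L \<subseteq> Proj" "zopen L W" "f \<in> regular L W" "g \<in> regular L W"
  shows "(\<lambda>x\<in>W. f x * g x) \<in> regular L W"
proof (rule regular_lambda[OF assms(1,2)])
  fix x assume "x \<in> W"
  then show "local_quot L x 0 (\<lambda>v. f (pt v) * g (pt v))"
    using local_quot_mult[of L x 0 "\<lambda>v. f (pt v)" 0 "\<lambda>v. g (pt v)" 0]
      regularD[OF assms(3,1,2)] regularD[OF assms(4,1,2)] by simp
qed

lemma regular_restrict:
  assumes "Y \<subseteq> Proj" "zopen Y V" "zopen L W" "L \<subseteq> Y" "W \<subseteq> V" "f \<in> regular Y V"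
  shows "restrict f W \<in> regular L W"
proof (rule regular_lambda)
  show "local_quot L x 0 (\<lambda>v. f (pt v))" if "x \<in> W" for x
    by (rule local_quot_mono[OF regularD[OF assms(6,1,2)]]) (use assms that in auto)
qed (use assms in auto)

lemma regular_ext: "f \<in> regular L W \<Longrightarrow> f \<in> extensional W"
  by (simp add: regular_def)

lemma idl_restrict:
  assumes "Y \<subseteq> Proj" "zopen Y V" "zopen Y W" "W \<subseteq> V" "f \<in> idl Y L V"
  shows "restrict f W \<in> idl Y L W"
  using regular_restrict[OF assms(1-3) subset_refl assms(4)] assms by auto

lemma idl_add:
  assumes "Y \<subseteq> Proj" "zopen Y V" "f \<in> idl Y L V" "g \<in> idl Y L V"
  shows "(\<lambda>x\<in>V. f x + g x) \<in> idl Y L V"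
  using regular_add[OF assms(1,2)] assms by auto

lemma idl_mult:
  assumes "Y \<subseteq> Proj" "zopen Y V" "f \<in> regular Y V" "g \<in> idl Y L V"
  shows "(\<lambda>x\<in>V. f x * g x) \<in> idl Y L V"
  using regular_mult[OF assms(1,2)] assms by auto

lemma opens_in_trans: "V \<in> opens_in Y U \<Longrightarrow> W \<in> opens_in Y V \<Longrightarrow> W \<in> opens_in Y U"
  by (auto simp: opens_in_iff)

subsection \<open>Module operations on homomorphisms\<close>

locale subvariety =
  fixes Y L :: "'n::finite subsp set"
  assumes Y: "Y \<subseteq> Proj" and L: "L \<subseteq> Y"
begin

lemma LP: "L \<subseteq> Proj" using Y L by blast

lemma zL: "zopen Y U \<Longrightarrow> zopen L (U \<inter> L)"
  using zopen_Int_sub L by blast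

lemma normal_homsD:
  assumes "h \<in> normal_homs Y L U" "V \<in> opens_in Y U"
  shows "f \<in> idl Y L V \<Longrightarrow> h V f \<in> regular L (V \<inter> L)"
    and "f \<in> idl Y L V \<Longrightarrow> g \<in> idl Y L V \<Longrightarrow> x \<in> V \<inter> L \<Longrightarrow> h V (\<lambda>x\<in>V. f x + g x) x = h V f x + h V g x"
    and "c \<in> regular Y V \<Longrightarrow> f \<in> idl Y L V \<Longrightarrow> x \<in> V \<inter> L \<Longrightarrow> h V (\<lambda>x\<in>V. c x * f x) x = c x * h V f x"
    and "W \<in> opens_in Y V \<Longrightarrow> f \<in> idl Y L V \<Longrightarrow> x \<in> W \<inter> L \<Longrightarrow> h W (restrict f W) x = h V f x"
proof -
  have *: "h V \<in> idl Y L V \<rightarrow>\<^sub>E regular L (V \<inter> L)"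
    "\<forall>s\<in>idl Y L V. \<forall>t\<in>idl Y L V. h V (\<lambda>x\<in>V. s x + t x) = (\<lambda>x\<in>V \<inter> L. h V s x + h V t x)"
    "\<forall>f\<in>regular Y V. \<forall>s\<in>idl Y L V. h V (\<lambda>x\<in>V. f x * s x) = (\<lambda>x\<in>V \<inter> L. f x * h V s x)"
    "\<forall>W\<in>opens_in Y V. \<forall>s\<in>idl Y L V. h W (restrict s W) = restrict (h V s) (W \<inter> L)"
    using assms unfolding normal_homs_iff by blast+
  show "f \<in> idl Y L V \<Longrightarrow> h V f \<in> regular L (V \<inter> L)" using *(1) by (rule PiE_mem)
  show "f \<in> idl Y L V \<Longrightarrow> g \<in> idl Y L V \<Longrightarrow> x \<in> V \<inter> L \<Longrightarrow> h V (\<lambda>x\<in>V. f x + g x) x = h V f x + h V g x"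
    using *(2) by simp
  show "c \<in> regular Y V \<Longrightarrow> f \<in> idl Y L V \<Longrightarrow> x \<in> V \<inter> L \<Longrightarrow> h V (\<lambda>x\<in>V. c x * f x) x = c x * h V f x"
    using *(3) by simp
  show "W \<in> opens_in Y V \<Longrightarrow> f \<in> idl Y L V \<Longrightarrow> x \<in> W \<inter> L \<Longrightarrow> h W (restrict f W) x = h V f x"
    using *(4) by simp
qed

lemma normal_homsI:
  assumes "\<And>V f. V \<in> opens_in Y U \<Longrightarrow> f \<in> idl Y L V \<Longrightarrow> (\<lambda>x\<in>V \<inter> L. k V f x) \<in> regular L (V \<inter> L)"
    and "\<And>V f g x. V \<in> opens_in Y U \<Longrightarrow> f \<in> idl Y L V \<Longrightarrow> g \<in> idl Y L V \<Longrightarrow> x \<in> V \<inter> L \<Longrightarrow>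
      k V (\<lambda>x\<in>V. f x + g x) x = k V f x + k V g x"
    and "\<And>V c f x. V \<in> opens_in Y U \<Longrightarrow> c \<in> regular Y V \<Longrightarrow> f \<in> idl Y L V \<Longrightarrow> x \<in> V \<inter> L \<Longrightarrow>
      k V (\<lambda>x\<in>V. c x * f x) x = c x * k V f x"
    and "\<And>V W f x. V \<in> opens_in Y U \<Longrightarrow> W \<in> opens_in Y V \<Longrightarrow> f \<in> idl Y L V \<Longrightarrow> x \<in> W \<inter> L \<Longrightarrow>
      k W (restrict f W) x = k V f x"
  shows "(\<lambda>V\<in>opens_in Y U. \<lambda>f\<in>idl Y L V. \<lambda>x\<in>V \<inter> L. k V f x) \<in> normal_homs Y L U" (is "?h \<in> _")
  unfolding normal_homs_iff
proof (intro conjI ballI)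
  show "?h \<in> extensional (opens_in Y U)" by simp
  fix V assume V: "V \<in> opens_in Y U"
  then have zV: "zopen Y V" by (simp add: opens_in_iff)
  show "?h V \<in> idl Y L V \<rightarrow>\<^sub>E regular L (V \<inter> L)"
    using assms(1)[OF V] V by (auto simp: PiE_iff)
  show "?h V (\<lambda>x\<in>V. s x + t x) = (\<lambda>x\<in>V \<inter> L. ?h V s x + ?h V t x)"
    if "s \<in> idl Y L V" "t \<in> idl Y L V" for s t
    using that idl_add[OF Y zV that] assms(2)[OF V that] V by (auto intro!: restrict_ext)
  show "?h V (\<lambda>x\<in>V. c x * s x) = (\<lambda>x\<in>V \<inter> L. c x * ?h V s x)"
    if "c \<in> regular Y V" "s \<in> idl Y L V" for c s
    using that idl_mult[OF Y zV that] assms(3)[OF V that] V by (auto intro!: restrict_ext)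
  show "?h W (restrict s W) = restrict (?h V s) (W \<inter> L)"
    if W: "W \<in> opens_in Y V" and s: "s \<in> idl Y L V" for W s
  proof -
    have Ws: "zopen Y W" "W \<subseteq> V" using W by (auto simp: opens_in_iff)
    have "restrict s W \<in> idl Y L W"
      by (rule idl_restrict[OF Y zV Ws s])
    moreover have "W \<in> opens_in Y U" "W \<subseteq> V" using opens_in_trans[OF V W] W by (auto simp: opens_in_iff)
    moreover from this have "V \<inter> L \<inter> (W \<inter> L) = W \<inter> L" by blast
    ultimately show ?thesis using assms(4)[OF V W s] V s by (auto intro!: restrict_ext)
  qed
qed

lemma normal_homs_ext:
  assumes "h \<in> normal_homs Y L U" "k \<in> normal_homs Y L U"
    "\<And>V f x. V \<in> opens_in Y U \<Longrightarrow> f \<in> idl Y L V \<Longrightarrow> x \<in> V \<inter> L \<Longrightarrow> h V f x = k V f x"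
  shows "h = k"
proof (rule extensionalityI)
  show "h \<in> extensional (opens_in Y U)" "k \<in> extensional (opens_in Y U)"
    using assms unfolding normal_homs_iff by blast+
  fix V assume V: "V \<in> opens_in Y U"
  show "h V = k V"
  proof (rule extensionalityI)
    show "h V \<in> extensional (idl Y L V)" "k V \<in> extensional (idl Y L V)"
      using assms(1,2) V unfolding normal_homs_iff PiE_def by blast+
    fix f assume f: "f \<in> idl Y L V"
    show "h V f = k V f"
      using regular_ext[OF normal_homsD(1)[OF assms(1) V f]] regular_ext[OF normal_homsD(1)[OF assms(2) V f]]
        assms(3)[OF V f] by (rule extensionalityI)
  qed
qed

lemma normal_homs_add:
  assumes U: "zopen Y U" and h: "h \<in> normal_homs Y L U" and k: "k \<in> normal_homs Y L U"
  shows "(\<lambda>V\<in>opens_in Y U. \<lambda>f\<in>idl Y L V. \<lambda>x\<in>V \<inter> L. h V f x + k V f x) \<in> normal_homs Y L U"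
proof (rule normal_homsI)
  fix V f assume V: "V \<in> opens_in Y U" and f: "f \<in> idl Y L V"
  then have "zopen Y V" by (simp add: opens_in_iff)
  then show "(\<lambda>x\<in>V \<inter> L. h V f x + k V f x) \<in> regular L (V \<inter> L)"
    by (intro regular_add LP zL normal_homsD(1)[OF h V f] normal_homsD(1)[OF k V f])
qed (simp_all only: normal_homsD[OF h] normal_homsD[OF k], simp_all add: algebra_simps)

lemma normal_homs_smul:
  assumes U: "zopen Y U" and h: "h \<in> normal_homs Y L U" and c: "c \<in> regular Y U"
  shows "(\<lambda>V\<in>opens_in Y U. \<lambda>f\<in>idl Y L V. \<lambda>x\<in>V \<inter> L. c x * h V f x) \<in> normal_homs Y L U"
proof (rule normal_homsI)
  fix V f assume V: "V \<in> opens_in Y U" and f: "f \<in> idl Y L V"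
  then have zV: "zopen Y V" "V \<subseteq> U" by (auto simp: opens_in_iff)
  have "restrict c (V \<inter> L) \<in> regular L (V \<inter> L)"
    by (rule regular_restrict[OF Y U zL[OF zV(1)] L _ c]) (use zV in blast)
  then have "(\<lambda>x\<in>V \<inter> L. restrict c (V \<inter> L) x * h V f x) \<in> regular L (V \<inter> L)"
    using zV by (intro regular_mult LP zL normal_homsD(1)[OF h V f])
  then show "(\<lambda>x\<in>V \<inter> L. c x * h V f x) \<in> regular L (V \<inter> L)"
    by (simp cong: restrict_cong)
qed (simp_all only: normal_homsD[OF h], simp_all add: algebra_simps)

lemma normal_homs_restrict:
  assumes "h \<in> normal_homs Y L U" "W \<in> opens_in Y U"
  shows "restrict h (opens_in Y W) \<in> normal_homs Y L W"
proof -
  have sub: "V \<in> opens_in Y U" if "V \<in> opens_in Y W" for V using opens_in_trans assms(2) that by blast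
  have *: "\<forall>V\<in>opens_in Y U.
     h V \<in> idl Y L V \<rightarrow>\<^sub>E regular L (V \<inter> L) \<and>
     (\<forall>s\<in>idl Y L V. \<forall>t\<in>idl Y L V. h V (\<lambda>x\<in>V. s x + t x) = (\<lambda>x\<in>V \<inter> L. h V s x + h V t x)) \<and>
     (\<forall>f\<in>regular Y V. \<forall>s\<in>idl Y L V. h V (\<lambda>x\<in>V. f x * s x) = (\<lambda>x\<in>V \<inter> L. f x * h V s x)) \<and>
     (\<forall>W\<in>opens_in Y V. \<forall>s\<in>idl Y L V. h W (restrict s W) = restrict (h V s) (W \<inter> L))"
    using assms(1) unfolding normal_homs_iff by blast
  show ?thesis unfolding normal_homs_iff
  proof (intro conjI ballI)
    fix V assume V: "V \<in> opens_in Y W"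
    note ** = bspec[OF * sub[OF V]]
    show "restrict h (opens_in Y W) V \<in> idl Y L V \<rightarrow>\<^sub>E regular L (V \<inter> L)" using ** V by simp
    show "restrict h (opens_in Y W) V (\<lambda>x\<in>V. s x + t x) =
        (\<lambda>x\<in>V \<inter> L. restrict h (opens_in Y W) V s x + restrict h (opens_in Y W) V t x)"
      if "s \<in> idl Y L V" "t \<in> idl Y L V" for s t using ** V that by simp
    show "restrict h (opens_in Y W) V (\<lambda>x\<in>V. f x * s x) =
        (\<lambda>x\<in>V \<inter> L. f x * restrict h (opens_in Y W) V s x)"
      if "f \<in> regular Y V" "s \<in> idl Y L V" for f s using ** V that by simp
    show "restrict h (opens_in Y W) W' (restrict s W') = restrict (restrict h (opens_in Y W) V s) (W' \<inter> L)"
      if "W' \<in> opens_in Y V" "s \<in> idl Y L V" for W' s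
      using ** V that opens_in_trans[OF V that(1)] by simp
  qed simp
qed

subsection \<open>Sections given by tangent fields\<close>

lemma der_field:
  assumes F: "tangent_field Y L k F" and V: "zopen Y V" and x: "x \<in> V \<inter> L" and f: "f \<in> idl Y L V"
  shows "local_quot L x (int k - 1) (\<lambda>v. der Y f v (F v))"
  by (rule der_local_quot[OF Y L F V]) (use x f regularD[OF _ Y V] in auto)

definition field_section :: "(complex ^ 'n \<Rightarrow> complex ^ 'n) \<Rightarrow> (complex ^ 'n \<Rightarrow> complex) \<Rightarrow> 'n subsp set \<Rightarrow>
    'n subsp set \<Rightarrow> ('n subsp \<Rightarrow> complex) \<Rightarrow> 'n subsp \<Rightarrow> complex" where
  "field_section F s U = (\<lambda>V\<in>opens_in Y U. \<lambda>f\<in>idl Y L V. \<lambda>x\<in>V \<inter> L. s (rep x) * der Y f (rep x) (F (rep x)))"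

lemma repL: "x \<in> L \<Longrightarrow> rep x \<noteq> 0 \<and> pt (rep x) = x"
  using rep LP by blast

text \<open>Linearity over functions on \<open>Y\<close> is the Leibniz rule: the term containing
  the derivative of the scalar is multiplied by f, which vanishes on \<open>L\<close>. The condition
  \<open>d + int k = 1\<close> makes the value of degree d + (k - 1) = 0, that is, a function on
  \<open>L\<close>.\<close>

lemma field_section_normal:
  assumes U: "zopen Y U" and F: "tangent_field Y L k F" and s: "\<And>x. x \<in> U \<inter> L \<Longrightarrow> local_quot L x d s" and d: "d + int k = 1"
  shows "field_section F s U \<in> normal_homs Y L U"
  unfolding field_section_def
proof (rule normal_homsI)
  have tF: "tangent Y (rep x) (F (rep x))" if "x \<in> L" for x
    using F repL[OF that] that by (simp add: tangent_field_def)
  fix V assume V: "V \<in> opens_in Y U"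
  then have zV: "zopen Y V" and VU: "V \<subseteq> U" by (auto simp: opens_in_iff)
  have local_quot: "local_quot Y (pt (rep x)) 0 (\<lambda>v. f (pt v))" if "f \<in> regular Y V" "x \<in> V \<inter> L" for f x
    using regularD[OF that(1) Y zV] repL that(2) by auto
  show "(\<lambda>x\<in>V \<inter> L. s (rep x) * der Y f (rep x) (F (rep x))) \<in> regular L (V \<inter> L)"
    if f: "f \<in> idl Y L V" for f
    by (rule regular_rep[OF LP zL[OF zV]], rule local_quot_mult[OF s der_field[OF F zV _ f]])
       (use VU d in auto)
  show "s (rep x) * der Y (\<lambda>x\<in>V. f x + g x) (rep x) (F (rep x)) =
      s (rep x) * der Y f (rep x) (F (rep x)) + s (rep x) * der Y g (rep x) (F (rep x))"
    if "f \<in> idl Y L V" "g \<in> idl Y L V" and x: "x \<in> V \<inter> L" for f g x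
  proof -
    have "der Y (\<lambda>x\<in>V. f x + g x) (rep x) (F (rep x)) = der Y (\<lambda>x. f x + g x) (rep x) (F (rep x))"
      by (rule der_cong[OF tF zV _ Y]) (use x repL in auto)
    also have "\<dots> = der Y f (rep x) (F (rep x)) + der Y g (rep x) (F (rep x))"
      using that local_quot by (intro der_add tF) auto
    finally show ?thesis by (simp add: algebra_simps)
  qed
  show "s (rep x) * der Y (\<lambda>x\<in>V. c x * f x) (rep x) (F (rep x)) =
      c x * (s (rep x) * der Y f (rep x) (F (rep x)))"
    if "c \<in> regular Y V" "f \<in> idl Y L V" and x: "x \<in> V \<inter> L" for c f x
  proof -
    have "der Y (\<lambda>x\<in>V. c x * f x) (rep x) (F (rep x)) = der Y (\<lambda>x. c x * f x) (rep x) (F (rep x))"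
      by (rule der_cong[OF tF zV _ Y]) (use x repL in auto)
    also have "\<dots> = der Y c (rep x) (F (rep x)) * f (pt (rep x)) + der Y f (rep x) (F (rep x)) * c (pt (rep x))"
      using that local_quot by (intro der_mult tF) auto
    finally show ?thesis using that repL by (simp add: algebra_simps)
  qed
  show "s (rep x) * der Y (restrict f W) (rep x) (F (rep x)) = s (rep x) * der Y f (rep x) (F (rep x))"
    if W: "W \<in> opens_in Y V" and "f \<in> idl Y L V" and x: "x \<in> W \<inter> L" for W f x
  proof -
    have zW: "zopen Y W" using W by (simp add: opens_in_iff)
    have "der Y (restrict f W) (rep x) (F (rep x)) = der Y f (rep x) (F (rep x))"
      by (rule der_cong[OF tF zW _ Y]) (use x repL in auto)
    then show ?thesis by simp
  qed
qed

lemma field_section_eval: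
  assumes F: "tangent_field Y L k F" and s: "local_quot L (pt v) d s" and d: "d + int k = 1"
    and "V \<in> opens_in Y U" "f \<in> idl Y L V" "v \<noteq> 0" "pt v \<in> V \<inter> L"
  shows "field_section F s U V f (pt v) = s v * der Y f v (F v)"
proof -
  have zV: "zopen Y V" using assms by (simp add: opens_in_iff)
  have "local_quot L (pt v) 0 (\<lambda>v. s v * der Y f v (F v))"
    by (rule local_quot_mult[OF s der_field[OF F zV assms(7,5)]]) (use d in auto)
  then have "s (rep (pt v)) * der Y f (rep (pt v)) (F (rep (pt v))) = s v * der Y f v (F v)"
    by (rule rep_local_quot_0) (use assms in auto)
  then show ?thesis unfolding field_section_def using assms by simp
qed

end

section \<open>Recognising a split normal sheaf from charts and frames\<close>

section \<open>Sheaf isomorphisms\<close>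

text \<open>The map that is easy to write down goes from the twists to the normal sheaf, against the
  direction of \<open>sheaf_isomorphic\<close>. The inverse of a sectionwise bijective homomorphism
  inherits all compatibilities by injectivity.\<close>

lemma sheaf_isomorphicI:
  assumes bij: "\<And>U. U \<in> opens_in X X \<Longrightarrow> bij_betw (\<Phi> U) (ssec G U) (ssec F U)"
    and add: "\<And>U s t. U \<in> opens_in X X \<Longrightarrow> s \<in> ssec G U \<Longrightarrow> t \<in> ssec G U \<Longrightarrow>
      sadd G U s t \<in> ssec G U \<and> \<Phi> U (sadd G U s t) = sadd F U (\<Phi> U s) (\<Phi> U t)"
    and mul: "\<And>U c s. U \<in> opens_in X X \<Longrightarrow> c \<in> regular X U \<Longrightarrow> s \<in> ssec G U \<Longrightarrow>
      smul G U c s \<in> ssec G U \<and> \<Phi> U (smul G U c s) = smul F U c (\<Phi> U s)"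
    and res: "\<And>U W s. U \<in> opens_in X X \<Longrightarrow> W \<in> opens_in X U \<Longrightarrow> s \<in> ssec G U \<Longrightarrow>
      sres G U W s \<in> ssec G W \<and> \<Phi> W (sres G U W s) = sres F U W (\<Phi> U s)"
  shows "sheaf_isomorphic X F G"
proof -
  define \<eta> where "\<eta> = (\<lambda>U\<in>opens_in X X. \<lambda>s\<in>ssec F U. inv_into (ssec G U) (\<Phi> U) s)"
  have inG: "\<eta> U s \<in> ssec G U" and inv: "\<Phi> U (\<eta> U s) = s"
    if "U \<in> opens_in X X" "s \<in> ssec F U" for U s
    using that bij[OF that(1)] unfolding \<eta>_def
    by (auto simp: bij_betw_def inv_into_into f_inv_into_f)
  have uniq: "\<eta> U s = t" if "U \<in> opens_in X X" "s \<in> ssec F U" "t \<in> ssec G U" "\<Phi> U t = s" for U s t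
    using that bij[OF that(1)] unfolding \<eta>_def by (auto simp: bij_betw_def)
  have im: "\<Phi> U t \<in> ssec F U" if "U \<in> opens_in X X" "t \<in> ssec G U" for U t
    using that bij[OF that(1)] by (auto simp: bij_betw_def)
  have "\<eta> \<in> sheaf_homs X X F G"
    unfolding sheaf_homs_def mem_Collect_eq
  proof (intro conjI ballI)
    show "\<eta> \<in> extensional (opens_in X X)" by (simp add: \<eta>_def)
    fix U assume U: "U \<in> opens_in X X"
    show "\<eta> U \<in> ssec F U \<rightarrow>\<^sub>E ssec G U"
      using inG[OF U] U by (auto simp: PiE_iff) (simp add: \<eta>_def)
    show "\<eta> U (sadd F U s t) = sadd G U (\<eta> U s) (\<eta> U t)"
      if st: "s \<in> ssec F U" "t \<in> ssec F U" for s t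
    proof -
      have *: "sadd G U (\<eta> U s) (\<eta> U t) \<in> ssec G U"
        "\<Phi> U (sadd G U (\<eta> U s) (\<eta> U t)) = sadd F U s t"
        using add[OF U inG[OF U st(1)] inG[OF U st(2)]] inv[OF U st(1)] inv[OF U st(2)] by auto
      show ?thesis by (rule uniq[OF U _ *]) (use im[OF U *(1)] *(2) in simp)
    qed
    show "\<eta> U (smul F U c s) = smul G U c (\<eta> U s)"
      if c: "c \<in> regular X U" and s: "s \<in> ssec F U" for c s
    proof -
      have *: "smul G U c (\<eta> U s) \<in> ssec G U" "\<Phi> U (smul G U c (\<eta> U s)) = smul F U c s"
        using mul[OF U c inG[OF U s]] inv[OF U s] by auto
      show ?thesis by (rule uniq[OF U _ *]) (use im[OF U *(1)] *(2) in simp)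
    qed
    show "\<eta> W (sres F U W s) = sres G U W (\<eta> U s)"
      if W: "W \<in> opens_in X U" and s: "s \<in> ssec F U" for W s
    proof -
      have WX: "W \<in> opens_in X X" by (rule opens_in_trans[OF U W])
      have *: "sres G U W (\<eta> U s) \<in> ssec G W" "\<Phi> W (sres G U W (\<eta> U s)) = sres F U W s"
        using res[OF U W inG[OF U s]] inv[OF U s] by auto
      show ?thesis by (rule uniq[OF WX _ *]) (use im[OF WX *(1)] *(2) in simp)
    qed
  qed
  moreover have "bij_betw (\<eta> U) (ssec F U) (ssec G U)" if U: "U \<in> opens_in X X" for U
  proof -
    have "bij_betw (inv_into (ssec G U) (\<Phi> U)) (ssec F U) (ssec G U)"
      using bij_betw_inv_into[OF bij[OF U]] .
    moreover have "\<eta> U s = inv_into (ssec G U) (\<Phi> U) s" if "s \<in> ssec F U" for s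
      using that U by (simp add: \<eta>_def)
    ultimately show ?thesis by (simp cong: bij_betw_cong)
  qed
  ultimately show ?thesis unfolding sheaf_isomorphic_def by blast
qed

section \<open>Charts\<close>

text \<open>Near \<open>L\<close> and where the linear form \<open>l\<close> does not vanish, the linear projection \<open>\<rho>\<close> retracts \<open>Y\<close>
  to \<open>L\<close>, and the difference of a coordinate and its pullback along \<open>\<rho>\<close> lies in the ideal generated by
  the three linear forms \<open>q j\<close>.\<close>

definition chart :: "'n::finite subsp set \<Rightarrow> 'n subsp set \<Rightarrow> (complex ^ 'n \<Rightarrow> complex) \<Rightarrow>
    (complex ^ 'n \<Rightarrow> complex ^ 'n) \<Rightarrow> (nat \<Rightarrow> complex ^ 'n \<Rightarrow> complex) \<Rightarrow> bool" where
  "chart Y L l \<rho> q \<longleftrightarrow> form 1 l \<and> (\<forall>i. form 1 (\<lambda>v. \<rho> v $ i)) \<and> (\<forall>j<3. form 1 (q j)) \<and>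
     (\<forall>v. v \<noteq> 0 \<longrightarrow> pt v \<in> L \<longrightarrow> \<rho> v = v \<and> (\<forall>j<3. q j v = 0)) \<and>
     (\<forall>v. v \<noteq> 0 \<longrightarrow> pt v \<in> Y \<longrightarrow> l v \<noteq> 0 \<longrightarrow> \<rho> v \<noteq> 0 \<and> pt (\<rho> v) \<in> L) \<and>
     (\<forall>i. \<exists>n A. (\<forall>j<3. form n (A j)) \<and>
       (\<forall>v. v \<noteq> 0 \<longrightarrow> pt v \<in> Y \<longrightarrow> l v ^ n * (v $ i - \<rho> v $ i) = (\<Sum>j<3. q j v * A j v)))"

text \<open>The defining property of a chart passes from coordinates to all forms, because the
  difference of a form and its pullback along \<open>\<rho>\<close> behaves like a derivation under
  sums and products.\<close>

lemma chart_form: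
  fixes P :: "complex ^ 'n::finite \<Rightarrow> complex"
  assumes C: "chart Y L l \<rho> q" and P: "form d P"
  shows "\<exists>n m A. Suc m = n + d \<and> (\<forall>j<3. form m (A j)) \<and>
    (\<forall>v. v \<noteq> 0 \<longrightarrow> pt v \<in> Y \<longrightarrow> l v ^ n * (P v - P (\<rho> v)) = (\<Sum>j<3. q j v * A j v))"
  using P
proof (induction rule: form.induct)
  case (zero d)
  show ?case by (rule exI[of _ 1], rule exI[of _ d], rule exI[of _ "\<lambda>j v. 0"]) (auto intro: form.zero)
next
  case (const c)
  \<comment> \<open>The exponent is 1 and not 0: \<open>Suc m = n + d\<close> has no solution with n
    = d = 0.\<close>
  show ?case by (rule exI[of _ 1], rule exI[of _ 0], rule exI[of _ "\<lambda>j v. 0"]) (auto intro: form.zero)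
next
  case (coord i)
  obtain n A where "\<forall>j<3. form n (A j)"
    "\<forall>v. v \<noteq> 0 \<longrightarrow> pt v \<in> Y \<longrightarrow> l v ^ n * (v $ i - \<rho> v $ i) = (\<Sum>j<3. q j v * A j v)"
    using C unfolding chart_def by blast
  then show ?case by (intro exI[of _ n] exI[of _ A]) auto
next
  case (add d f g)
  obtain n1 m1 A where A: "Suc m1 = n1 + d" "\<And>j. j < 3 \<Longrightarrow> form m1 (A j)"
    "\<And>v. v \<noteq> 0 \<Longrightarrow> pt v \<in> Y \<Longrightarrow> l v ^ n1 * (f v - f (\<rho> v)) = (\<Sum>j<3. q j v * A j v)"
    using add.IH(1) by blast
  obtain n2 m2 B where B: "Suc m2 = n2 + d" "\<And>j. j < 3 \<Longrightarrow> form m2 (B j)"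
    "\<And>v. v \<noteq> 0 \<Longrightarrow> pt v \<in> Y \<Longrightarrow> l v ^ n2 * (g v - g (\<rho> v)) = (\<Sum>j<3. q j v * B j v)"
    using add.IH(2) by blast
  have l: "form n (\<lambda>v. l v ^ n)" for n using form_power[of 1 l n] C by (simp add: chart_def)
  let ?C = "\<lambda>j v. l v ^ n2 * A j v + l v ^ n1 * B j v"
  show ?case
  proof (rule exI[of _ "n1 + n2"], rule exI[of _ "n2 + m1"], rule exI[of _ ?C], intro conjI allI impI)
    show "Suc (n2 + m1) = n1 + n2 + d" using A by simp
    show "form (n2 + m1) (?C j)" if "j < 3" for j
      using form_mult_eq[OF l[of n2] A(2)[OF that]] form_mult_eq[OF l[of n1] B(2)[OF that], of "n2 + m1"] A(1) B(1)
      by (intro form.add) auto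
    show "l v ^ (n1 + n2) * (f v + g v - (f (\<rho> v) + g (\<rho> v))) = (\<Sum>j<3. q j v * ?C j v)"
      if "v \<noteq> 0" "pt v \<in> Y" for v
    proof -
      have "l v ^ (n1 + n2) * (f v + g v - (f (\<rho> v) + g (\<rho> v))) =
        l v ^ n2 * (l v ^ n1 * (f v - f (\<rho> v))) + l v ^ n1 * (l v ^ n2 * (g v - g (\<rho> v)))"
        by (simp add: algebra_simps power_add)
      then show ?thesis unfolding A(3)[OF that] B(3)[OF that]
        by (simp add: algebra_simps sum_distrib_left sum.distrib)
    qed
  qed
next
  case (mult d f d2 g)
  obtain n1 m1 A where A: "Suc m1 = n1 + d" "\<And>j. j < 3 \<Longrightarrow> form m1 (A j)"
    "\<And>v. v \<noteq> 0 \<Longrightarrow> pt v \<in> Y \<Longrightarrow> l v ^ n1 * (f v - f (\<rho> v)) = (\<Sum>j<3. q j v * A j v)"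
    using mult.IH(1) by blast
  obtain n2 m2 B where B: "Suc m2 = n2 + d2" "\<And>j. j < 3 \<Longrightarrow> form m2 (B j)"
    "\<And>v. v \<noteq> 0 \<Longrightarrow> pt v \<in> Y \<Longrightarrow> l v ^ n2 * (g v - g (\<rho> v)) = (\<Sum>j<3. q j v * B j v)"
    using mult.IH(2) by blast
  have l: "form n (\<lambda>v. l v ^ n)" for n using form_power[of 1 l n] C by (simp add: chart_def)
  have g\<rho>: "form d2 (\<lambda>v. g (\<rho> v))" by (rule form_sub[OF mult.hyps(2)]) (use C in \<open>simp add: chart_def\<close>)
  \<comment> \<open>Read off from \<open>f v * g v - f (\<rho> v) * g (\<rho> v) = f v * (g v - g
    (\<rho> v)) + g (\<rho> v) * (f v - f (\<rho> v))\<close>.\<close>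
  let ?C = "\<lambda>j v. (l v ^ n1 * f v) * B j v + (l v ^ n2 * A j v) * g (\<rho> v)"
  show ?case
  proof (rule exI[of _ "n1 + n2"], rule exI[of _ "n1 + d + m2"], rule exI[of _ ?C], intro conjI allI impI)
    show "Suc (n1 + d + m2) = n1 + n2 + (d + d2)" using B by simp
    show "form (n1 + d + m2) (?C j)" if "j < 3" for j
      using form_mult_eq[OF form.mult[OF l[of n1] mult.hyps(1)] B(2)[OF that]]
        form_mult_eq[OF form.mult[OF l[of n2] A(2)[OF that]] g\<rho>, of "n1 + d + m2"] A(1) B(1)
      by (intro form.add) auto
    show "l v ^ (n1 + n2) * (f v * g v - f (\<rho> v) * g (\<rho> v)) = (\<Sum>j<3. q j v * ?C j v)"
      if "v \<noteq> 0" "pt v \<in> Y" for v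
    proof -
      have "l v ^ (n1 + n2) * (f v * g v - f (\<rho> v) * g (\<rho> v)) =
        (l v ^ n1 * f v) * (l v ^ n2 * (g v - g (\<rho> v))) + (l v ^ n2 * g (\<rho> v)) * (l v ^ n1 * (f v - f (\<rho> v)))"
        by (simp add: algebra_simps power_add)
      then show ?thesis unfolding A(3)[OF that] B(3)[OF that]
        by (simp add: algebra_simps sum_distrib_left sum.distrib)
    qed
  qed
qed

text \<open>With f = P / Q near x, the retraction carries nearby points into \<open>L\<close>, where
  f and hence P vanish. So P equals its difference with the pullback along \<open>\<rho>\<close>,
  which \<open>chart_form\<close> expands in the \<open>q j\<close>.\<close>

lemma (in subvariety) chart_gen:
  assumes C: "chart Y L l \<rho> q" and V: "zopen Y V" and x: "x \<in> V" "x \<in> L" "x \<in> basic l"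
    and f: "f \<in> idl Y L V"
  shows "\<exists>V' g. zopen Y V' \<and> x \<in> V' \<and> V' \<subseteq> V \<inter> basic l \<and> (\<forall>j<3. g j \<in> regular Y V') \<and>
    (\<forall>v. v \<noteq> 0 \<longrightarrow> pt v \<in> V' \<longrightarrow> f (pt v) = (\<Sum>j<3. g j (pt v) * (q j v / l v)))"
proof -
  have "local_quot Y x 0 (\<lambda>v. f (pt v))" using regularD[OF _ Y V x(1)] f by blast
  then obtain e g m k P Q where *: "form e g" "x \<in> basic g" "form m P" "form k Q" "int m = int k + 0"
    "\<And>v. v \<noteq> 0 \<Longrightarrow> pt v \<in> Y \<Longrightarrow> pt v \<in> basic g \<Longrightarrow> Q v \<noteq> 0 \<and> f (pt v) = P v / Q v"
    by (rule local_quotE) blast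
  then have k: "k = m" by simp
  obtain e' h where h: "form e' h" "x \<in> basic h" "Y \<inter> basic h \<subseteq> V"
    using V x Y zopen_iff by meson
  obtain u where u: "u \<noteq> 0" "x = pt u" using x LP by (meson ProjE subsetD)
  have l: "form 1 l" and \<rho>: "\<And>i. form 1 (\<lambda>v. \<rho> v $ i)"
    and \<rho>L: "\<And>v. v \<noteq> 0 \<Longrightarrow> pt v \<in> L \<Longrightarrow> \<rho> v = v"
    and \<rho>Y: "\<And>v. v \<noteq> 0 \<Longrightarrow> pt v \<in> Y \<Longrightarrow> l v \<noteq> 0 \<Longrightarrow> \<rho> v \<noteq> 0 \<and> pt (\<rho> v) \<in> L"
    using C by (auto simp: chart_def)
  have gr: "form e (\<lambda>v. g (\<rho> v))" and hr: "form e' (\<lambda>v. h (\<rho> v))"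
    by (rule form_sub[OF *(1) \<rho>], rule form_sub[OF h(1) \<rho>])
  \<comment> \<open>The conditions on \<open>\<rho> v\<close> keep the retracted point inside
    \<open>V\<close> and inside the set where f = P / Q, so that the vanishing of f on
    \<open>L\<close> can be used there.\<close>
  let ?V = "(((Y \<inter> basic g) \<inter> (Y \<inter> basic h)) \<inter> ((Y \<inter> basic (\<lambda>v. g (\<rho> v))) \<inter> (Y \<inter> basic (\<lambda>v. h (\<rho> v))))) \<inter> (Y \<inter> basic l)"
  have zV: "zopen Y ?V"
    by (intro openin_Int zopen_basic[OF *(1)] zopen_basic[OF h(1)] zopen_basic[OF gr] zopen_basic[OF hr] zopen_basic[OF l])
  have xV: "x \<in> ?V"
    using x * h u \<rho>L[OF u(1)] pt_in_basic[OF gr u(1)] pt_in_basic[OF hr u(1)] L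
      pt_in_basic[OF *(1) u(1)] pt_in_basic[OF h(1) u(1)] by auto
  obtain n M A where A: "Suc M = n + m" "\<And>j. j < 3 \<Longrightarrow> form M (A j)"
    "\<And>v. v \<noteq> 0 \<Longrightarrow> pt v \<in> Y \<Longrightarrow> l v ^ n * (P v - P (\<rho> v)) = (\<Sum>j<3. q j v * A j v)"
    using chart_form[OF C *(3)] by blast
  have ln: "form n (\<lambda>v. l v ^ n)" using form_power[of 1 l n] l by simp
  let ?T = "\<lambda>j v. A j v * l v / (l v ^ n * Q v)"
  have T: "local_quot Y y 0 (?T j)" if y: "y \<in> ?V" and j: "j < 3" for y j
  proof (rule local_quot_divide)
    have "y \<in> Proj" using y Y by blast
    then show "local_quot Y y (int (M + 1)) (\<lambda>v. A j v * l v)"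
      by (intro local_quot_form[OF form.mult[OF A(2)[OF j] l]]) auto
    show "form (n + k) (\<lambda>v. l v ^ n * Q v)" by (rule form.mult[OF ln *(4)])
    obtain w where w: "w \<noteq> 0" "y = pt w" using \<open>y \<in> Proj\<close> by (rule ProjE)
    have "l w \<noteq> 0" "Q w \<noteq> 0"
      using y w pt_in_basic[OF l w(1)] *(6)[OF w(1)] by auto
    then show "y \<in> basic (\<lambda>v. l v ^ n * Q v)"
      unfolding w(2) pt_in_basic[OF form.mult[OF ln *(4)] w(1)] by simp
    show "int (M + 1) = 0 + int (n + k)" using A(1) k by simp
  qed
  let ?g = "\<lambda>j. \<lambda>y\<in>?V. ?T j (rep y)"
  have reg: "?g j \<in> regular Y ?V" if "j < 3" for j
    by (rule regular_rep[OF Y zV T]) (use that in auto)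
  have val: "f (pt v) = (\<Sum>j<3. ?g j (pt v) * (q j v / l v))" if v: "v \<noteq> 0" "pt v \<in> ?V" for v
  proof -
    have lv: "l v \<noteq> 0" and Q: "Q v \<noteq> 0" and fv: "f (pt v) = P v / Q v"
      using v pt_in_basic[OF l v(1)] *(6)[OF v(1)] by auto
    have r: "\<rho> v \<noteq> 0" "pt (\<rho> v) \<in> L" using \<rho>Y[OF v(1) _ lv] v by auto
    have "g (\<rho> v) \<noteq> 0" "h (\<rho> v) \<noteq> 0"
      using v pt_in_basic[OF gr v(1)] pt_in_basic[OF hr v(1)] by auto
    then have r2: "pt (\<rho> v) \<in> basic g" "pt (\<rho> v) \<in> basic h"
      using pt_in_basic[OF *(1) r(1)] pt_in_basic[OF h(1) r(1)] by auto
    then have "pt (\<rho> v) \<in> V" using h(3) r L by blast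
    then have "f (pt (\<rho> v)) = 0" using f r by blast
    then have P0: "P (\<rho> v) = 0" using *(6)[OF r(1) _ r2(1)] r(2) L by auto
    have "(\<Sum>j<3. ?g j (pt v) * (q j v / l v)) = (\<Sum>j<3. ?T j v * (q j v / l v))"
      by (rule sum.cong) (use v rep_local_quot_0[OF T[OF v(2)] v(1)] in auto)
    also have "\<dots> = (\<Sum>j<3. q j v * A j v / (l v ^ n * Q v))"
      by (rule sum.cong) (use lv Q in \<open>auto simp: field_simps\<close>)
    also have "\<dots> = l v ^ n * P v / (l v ^ n * Q v)"
      using A(3)[OF v(1)] v P0 by (simp add: sum_divide_distrib[symmetric])
    also have "\<dots> = f (pt v)" using lv Q fv by simp
    finally show ?thesis by simp
  qed
  show ?thesis
  proof (intro exI conjI allI impI)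
    show "?V \<subseteq> V \<inter> basic l" using h(3) by blast
  qed (use zV xV reg val in auto)
qed

section \<open>Splitting the normal sheaf\<close>

text \<open>Indexing the components of a threefold direct sum by 0, 1, 2 lets one argument serve all
  summands.\<close>

definition triple :: "(nat \<Rightarrow> 's) \<Rightarrow> 's \<times> 's \<times> 's" where
  "triple t = (t 0, t 1, t 2)"

definition nth3 :: "'s \<times> 's \<times> 's \<Rightarrow> nat \<Rightarrow> 's" where
  "nth3 s j = (if j = 0 then fst s else if j = 1 then fst (snd s) else snd (snd s))"

lemma nth3_triple: "j < 3 \<Longrightarrow> nth3 (triple t) j = t j"
  by (auto simp: nth3_def triple_def less_Suc_eq numeral_3_eq_3 numeral_2_eq_2)

lemma nth3_eqI: "(\<And>j. j < 3 \<Longrightarrow> nth3 s j = nth3 t j) \<Longrightarrow> s = t"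
proof -
  assume *: "\<And>j. j < 3 \<Longrightarrow> nth3 s j = nth3 t j"
  show "s = t" using *[of 0] *[of 1] *[of 2] by (simp add: nth3_def prod_eq_iff)
qed

lemma sum3: "(\<Sum>j<3. f j) = f 0 + f 1 + f (2::nat)" for f :: "nat \<Rightarrow> complex"
  by (simp add: numeral_3_eq_3 numeral_2_eq_2)

lemma less3: "j < (3::nat) \<longleftrightarrow> j = 0 \<or> j = 1 \<or> j = 2"
  by auto

lemma twist_simps [simp]:
  "sadd (twist X d) U s t = (\<lambda>v\<in>cone U. s v + t v)"
  "smul (twist X d) U f s = (\<lambda>v\<in>cone U. f (pt v) * s v)"
  "sres (twist X d) U V s = restrict s (cone V)"
  by (simp_all add: twist_def)

abbreviation twist3 :: "'n::finite subsp set \<Rightarrow> (nat \<Rightarrow> int) \<Rightarrow>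
    ('n subsp, (complex ^ 'n \<Rightarrow> complex) \<times> (complex ^ 'n \<Rightarrow> complex) \<times> (complex ^ 'n \<Rightarrow> complex)) osheaf"
  where "twist3 L d \<equiv> pushforward L (twist L (d 0) \<oplus>\<^sub>S twist L (d 1) \<oplus>\<^sub>S twist L (d 2))"

lemma twist3_sec:
  "s \<in> ssec (twist3 L d) U \<longleftrightarrow> (\<forall>j<3. nth3 s j \<in> ssec (twist L (d j)) (U \<inter> L))"
  unfolding less3 by (cases s) (auto simp: direct_sum_def nth3_def)

lemma twist3_ops:
  "j < 3 \<Longrightarrow> nth3 (sadd (twist3 L d) U s t) j = (\<lambda>v\<in>cone (U \<inter> L). nth3 s j v + nth3 t j v)"
  "j < 3 \<Longrightarrow> nth3 (smul (twist3 L d) U f s) j = (\<lambda>v\<in>cone (U \<inter> L). restrict f (U \<inter> L) (pt v) * nth3 s j v)"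
  "j < 3 \<Longrightarrow> nth3 (sres (twist3 L d) U V s) j = restrict (nth3 s j) (cone (V \<inter> L))"
  by (auto simp: direct_sum_def nth3_def)

context subvariety
begin

lemma twist_iff:
  "zopen Y U \<Longrightarrow> s \<in> ssec (twist L d) (U \<inter> L) \<longleftrightarrow>
    s \<in> extensional (cone (U \<inter> L)) \<and> (\<forall>x\<in>U \<inter> L. local_quot L x d s)"
  by (rule twist_local_quot[OF LP zL])

lemma cone_L: "zopen Y U \<Longrightarrow> v \<in> cone (U \<inter> L) \<longleftrightarrow> v \<noteq> 0 \<and> pt v \<in> U \<inter> L"
  by (rule cone_iff[OF zL])

lemma twist_lambda:
  assumes U: "zopen Y U" and s: "\<And>x. x \<in> U \<inter> L \<Longrightarrow> local_quot L x d s"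
  shows "(\<lambda>v\<in>cone (U \<inter> L). s v) \<in> ssec (twist L d) (U \<inter> L)"
  unfolding twist_iff[OF U]
proof (intro conjI ballI)
  show "local_quot L x d (\<lambda>v\<in>cone (U \<inter> L). s v)" if x: "x \<in> U \<inter> L" for x
    by (rule local_quot_cong[OF s[OF x] zL[OF U] x LP]) (use cone_L[OF U] in simp)
qed simp

lemma twist3_closed:
  assumes U: "zopen Y U" and s: "s \<in> ssec (twist3 L d) U"
  shows "t \<in> ssec (twist3 L d) U \<Longrightarrow> sadd (twist3 L d) U s t \<in> ssec (twist3 L d) U"
    and "c \<in> regular Y U \<Longrightarrow> smul (twist3 L d) U c s \<in> ssec (twist3 L d) U"
    and "W \<in> opens_in Y U \<Longrightarrow> sres (twist3 L d) U W s \<in> ssec (twist3 L d) W"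
proof -
  have sr: "local_quot L x (d j) (nth3 s j)" if "j < 3" "x \<in> U \<inter> L" for j x
    using s that unfolding twist3_sec twist_iff[OF U] by blast
  show "sadd (twist3 L d) U s t \<in> ssec (twist3 L d) U" if t: "t \<in> ssec (twist3 L d) U"
  proof -
    have tr: "local_quot L x (d j) (nth3 t j)" if "j < 3" "x \<in> U \<inter> L" for j x
      using t that unfolding twist3_sec twist_iff[OF U] by blast
    show ?thesis unfolding twist3_sec
    proof (intro allI impI)
      fix j :: nat assume j: "j < 3"
      show "nth3 (sadd (twist3 L d) U s t) j \<in> ssec (twist L (d j)) (U \<inter> L)"
        unfolding twist3_ops(1)[OF j] by (intro twist_lambda[OF U] local_quot_add sr tr j)
    qed
  qed
  show "smul (twist3 L d) U c s \<in> ssec (twist3 L d) U" if c: "c \<in> regular Y U"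
    unfolding twist3_sec
  proof (intro allI impI)
    fix j :: nat assume j: "j < 3"
    have rc: "restrict c (U \<inter> L) \<in> regular L (U \<inter> L)"
      by (rule regular_restrict[OF Y U zL[OF U] L _ c]) blast
    show "nth3 (smul (twist3 L d) U c s) j \<in> ssec (twist L (d j)) (U \<inter> L)"
      unfolding twist3_ops(2)[OF j]
      by (rule twist_lambda[OF U], rule local_quot_mult[OF regularD[OF rc LP zL[OF U]] sr[OF j]]) auto
  qed
  show "sres (twist3 L d) U W s \<in> ssec (twist3 L d) W" if W: "W \<in> opens_in Y U"
    unfolding twist3_sec
  proof (intro allI impI)
    fix j :: nat assume j: "j < 3"
    have WU: "zopen Y W" "W \<subseteq> U" using W by (auto simp: opens_in_iff)
    show "nth3 (sres (twist3 L d) U W s) j \<in> ssec (twist L (d j)) (W \<inter> L)"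
      unfolding twist3_ops(3)[OF j] by (rule twist_lambda[OF WU(1) sr[OF j]]) (use WU in auto)
  qed
qed

subsection \<open>Frames\<close>

text \<open>The fields are dual to the linear equations \<open>q i\<close> up to the factors
  \<open>\<theta> i\<close>: a linear form is its own derivative, so \<open>q i (F j v)\<close> is
  the derivative of \<open>q i\<close> along \<open>F j\<close>. The degrees of
  \<open>\<theta> i\<close> and \<open>F i\<close> agree, and \<open>\<theta> i\<close> can be
  divided by where \<open>l\<close> does not vanish.\<close>

definition frame :: "(nat \<Rightarrow> nat) \<Rightarrow> (nat \<Rightarrow> complex ^ 'n \<Rightarrow> complex ^ 'n) \<Rightarrow> (complex ^ 'n \<Rightarrow> complex) \<Rightarrow>
    (nat \<Rightarrow> complex ^ 'n \<Rightarrow> complex) \<Rightarrow> (nat \<Rightarrow> complex ^ 'n \<Rightarrow> complex) \<Rightarrow> bool" where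
  "frame k F l q \<theta> \<longleftrightarrow> form 1 l \<and> (\<forall>j<3. form 1 (q j) \<and> form (k j) (\<theta> j)) \<and>
     (\<forall>v. v \<noteq> 0 \<longrightarrow> pt v \<in> L \<longrightarrow> (\<forall>i<3. q i v = 0 \<and> (l v \<noteq> 0 \<longrightarrow> \<theta> i v \<noteq> 0) \<and>
       (\<forall>j<3. q i (F j v) = (if i = j then \<theta> i v else 0))))"

definition coordfun :: "(complex ^ 'n \<Rightarrow> complex) \<Rightarrow> (complex ^ 'n \<Rightarrow> complex) \<Rightarrow> 'n subsp \<Rightarrow> complex" where
  "coordfun l p x = p (rep x) / l (rep x)"

lemma coordfun_eval:
  assumes "form 1 l" "form 1 p" "v \<noteq> 0"
  shows "coordfun l p (pt v) = p v / l v"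
proof -
  have r: "rep (pt v) \<noteq> 0" "pt (rep (pt v)) = pt v" using rep[OF pt_in_Proj[OF assms(3)]] by auto
  then obtain c where "c \<noteq> 0" "rep (pt v) = c *s v" using pt_eq_iff[OF assms(3) r(1)] by auto
  then show ?thesis unfolding coordfun_def
    by (simp add: form_scale[OF assms(1)] form_scale[OF assms(2)])
qed

lemma coordfun_local_quot:
  assumes "form 1 l" "form 1 p" "x \<in> basic l"
  shows "local_quot Y x 0 (\<lambda>v. coordfun l p (pt v))"
  by (rule local_quotI[OF assms(1,3,2,1)])
     (use coordfun_eval[OF assms(1,2)] pt_in_basic[OF assms(1)] in auto)

lemma coordfun_idl:
  assumes "frame k F l q \<theta>" "j < 3" "zopen Y W" "W \<subseteq> basic l"
  shows "restrict (coordfun l (q j)) W \<in> idl Y L W"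
proof -
  have f: "form 1 l" "form 1 (q j)" using assms by (auto simp: frame_def)
  have "restrict (coordfun l (q j)) W \<in> regular Y W"
    by (rule regular_lambda[OF Y assms(3) coordfun_local_quot[OF f]]) (use assms in blast)
  moreover have "coordfun l (q j) x = 0" if "x \<in> L" for x
  proof -
    have "q j (rep x) = 0" using assms(1,2) repL[OF that] that by (auto simp: frame_def)
    then show ?thesis by (simp add: coordfun_def)
  qed
  ultimately show ?thesis by auto
qed

lemma coordfun_der:
  assumes "frame k F l q \<theta>" "i < 3" "j < 3" "zopen Y W" "W \<subseteq> basic l" "tangent_field Y L (k j) (F j)"
    "v \<noteq> 0" "pt v \<in> W \<inter> L"
  shows "der Y (restrict (coordfun l (q i)) W) v (F j v) = (if i = j then \<theta> i v / l v else 0)"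
proof -
  have f: "form 1 l" "form 1 (q i)" using assms by (auto simp: frame_def)
  have t: "tangent Y v (F j v)" using assms by (auto simp: tangent_field_def)
  have b: "pt v \<in> basic l" "l v \<noteq> 0" using assms pt_in_basic[OF f(1) assms(7)] by auto
  have z: "q i v = 0" "q i (F j v) = (if i = j then \<theta> i v else 0)"
    using assms(1,2,3,7,8) by (auto simp: frame_def)
  have "der Y (restrict (coordfun l (q i)) W) v (F j v) = der Y (coordfun l (q i)) v (F j v)"
    by (rule der_cong[OF t assms(4) _ Y]) (use assms in auto)
  also have "\<dots> = (dform (q i) v (F j v) * l v - q i v * dform l v (F j v)) / (l v)\<^sup>2"
    by (rule der_rep[OF t f(1) b(1) f(2,1)]) (use coordfun_eval[OF f] pt_in_basic[OF f(1)] in auto)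
  also have "\<dots> = q i (F j v) / l v" using b z dform_linear[OF f(2)] by (simp add: power2_eq_square)
  finally show ?thesis using z by simp
qed

text \<open>The order of quantifiers is the point: the coefficients depend on f and x but not on the
  homomorphism h, so they can be determined by testing on homomorphisms that are already
  known.\<close>

lemma chart_hom:
  assumes C: "chart Y L l \<rho> q" and fr: "frame k F l q \<theta>"
    and V: "zopen Y V" and x: "x \<in> V" "x \<in> L" "x \<in> basic l" and f: "f \<in> idl Y L V"
  shows "\<exists>V' c. V' \<in> opens_in Y V \<and> x \<in> V' \<and> V' \<subseteq> basic l \<and> (\<forall>h\<in>normal_homs Y L V'.
    h V' (restrict f V') x = (\<Sum>j<3. c j * h V' (restrict (coordfun l (q j)) V') x))"
proof -
  obtain V' g where V': "zopen Y V'" "x \<in> V'" "V' \<subseteq> V \<inter> basic l"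
    and g: "\<And>j. j < 3 \<Longrightarrow> g j \<in> regular Y V'"
    and fe: "\<And>v. v \<noteq> 0 \<Longrightarrow> pt v \<in> V' \<Longrightarrow> f (pt v) = (\<Sum>j<3. g j (pt v) * (q j v / l v))"
    using chart_gen[OF C V x f] by blast
  have l: "form 1 l" and q: "\<And>j. j < 3 \<Longrightarrow> form 1 (q j)" using fr by (auto simp: frame_def)
  let ?X = "\<lambda>j. restrict (coordfun l (q j)) V'"
  let ?m = "\<lambda>j. \<lambda>y\<in>V'. g j y * ?X j y"
  have fe': "restrict f V' = (\<lambda>y\<in>V'. (\<lambda>y\<in>V'. ?m 0 y + ?m 1 y) y + ?m 2 y)"
  proof
    fix y
    show "restrict f V' y = (\<lambda>y\<in>V'. (\<lambda>y\<in>V'. ?m 0 y + ?m 1 y) y + ?m 2 y) y"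
    proof (cases "y \<in> V'")
      case True
      then have "y \<in> Proj" using zopen_Proj[OF V'(1)] by blast
      then obtain v where v: "v \<noteq> 0" "y = pt v" by (rule ProjE)
      then show ?thesis using True fe[OF v(1)] coordfun_eval[OF l q v(1)] by (simp add: sum3)
    qed simp
  qed
  have X: "?X j \<in> idl Y L V'" if "j < 3" for j
    by (rule coordfun_idl[OF fr that V'(1)]) (use V' in blast)
  have m: "?m j \<in> idl Y L V'" if "j < 3" for j by (rule idl_mult[OF Y V'(1) g[OF that] X[OF that]])
  have V'V': "V' \<in> opens_in Y V'" using V' by (simp add: opens_in_iff)
  have xx: "x \<in> V' \<inter> L" using V' x by blast
  have "h V' (restrict f V') x = (\<Sum>j<3. g j x * h V' (?X j) x)" if h: "h \<in> normal_homs Y L V'" for h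
  proof -
    have hm: "h V' (?m j) x = g j x * h V' (?X j) x" if "j < 3" for j
      by (rule normal_homsD(3)[OF h V'V' g[OF that] X[OF that] xx])
    have "h V' (restrict f V') x = h V' (\<lambda>y\<in>V'. ?m 0 y + ?m 1 y) x + h V' (?m 2) x"
      unfolding fe' by (rule normal_homsD(2)[OF h V'V' _ _ xx]) (intro idl_add[OF Y V'(1)] m; simp)+
    also have "h V' (\<lambda>y\<in>V'. ?m 0 y + ?m 1 y) x = h V' (?m 0) x + h V' (?m 1) x"
      by (rule normal_homsD(2)[OF h V'V' _ _ xx]) (intro m; simp)+
    finally have *: "h V' (restrict f V') x = h V' (?m 0) x + h V' (?m 1) x + h V' (?m 2) x" .
    have "h V' (?m 0) x = g 0 x * h V' (?X 0) x" "h V' (?m 1) x = g 1 x * h V' (?X 1) x"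
      "h V' (?m 2) x = g 2 x * h V' (?X 2) x"
      by (rule hm; simp)+
    then show ?thesis by (simp only: * sum3)
  qed
  moreover have "V' \<in> opens_in Y V" using V' by (auto simp: opens_in_iff)
  ultimately show ?thesis using V' by (intro exI[of _ V'] exI[of _ "\<lambda>j. g j x"]) auto
qed

text \<open>The unknown coefficients of \<open>chart_hom\<close> are found by inserting the
  homomorphism defined by the field \<open>F j\<close> itself. It kills the coordinate functions of
  \<open>q i\<close> for i different from j, so it isolates one coefficient and shows it to be a
  multiple of the derivative of f along \<open>F j\<close>.\<close>

lemma chart_key:
  assumes C: "chart Y L l \<rho> q" and fr: "frame k F l q \<theta>"
    and tf: "\<And>j. j < 3 \<Longrightarrow> tangent_field Y L (k j) (F j)"
    and U: "zopen Y U" and h: "h \<in> normal_homs Y L U" and V: "V \<in> opens_in Y U" and f: "f \<in> idl Y L V"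
    and v: "v \<noteq> 0" "pt v \<in> V \<inter> L" "l v \<noteq> 0"
  shows "h V f (pt v) = (\<Sum>j<3. h (U \<inter> (Y \<inter> basic l)) (restrict (coordfun l (q j)) (U \<inter> (Y \<inter> basic l))) (pt v) *
    l v / \<theta> j v * der Y f v (F j v))"
proof -
  have l: "form 1 l" using fr by (auto simp: frame_def)
  have zV: "zopen Y V" "V \<subseteq> U" using V by (auto simp: opens_in_iff)
  have bl: "pt v \<in> basic l" using v pt_in_basic[OF l] by blast
  let ?W = "U \<inter> (Y \<inter> basic l)"
  have zW: "zopen Y ?W" by (rule openin_Int[OF U zopen_basic[OF l]])
  have W: "?W \<in> opens_in Y U" using zW by (auto simp: opens_in_iff)
  obtain V' c where V': "V' \<in> opens_in Y V" "pt v \<in> V'" "V' \<subseteq> basic l"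
    and c: "\<And>h. h \<in> normal_homs Y L V' \<Longrightarrow>
      h V' (restrict f V') (pt v) = (\<Sum>j<3. c j * h V' (restrict (coordfun l (q j)) V') (pt v))"
    using chart_hom[OF C fr zV(1) _ _ bl f] v by blast
  have zV': "zopen Y V'" "V' \<subseteq> V" using V' by (auto simp: opens_in_iff)
  have V'U: "V' \<in> opens_in Y U" using opens_in_trans[OF V V'(1)] .
  have V'W: "V' \<in> opens_in Y ?W" using zV' zopen_subset[OF zV'(1)] V'(3) zV(2) by (auto simp: opens_in_iff)
  have V'V': "V' \<in> opens_in Y V'" using zV' by (simp add: opens_in_iff)
  have xV': "pt v \<in> V' \<inter> L" using V' v by blast
  have Xid: "restrict (coordfun l (q j)) ?W \<in> idl Y L ?W" if "j < 3" for j
    by (rule coordfun_idl[OF fr that zW]) blast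
  have rX: "restrict (restrict (coordfun l (q j)) ?W) V' = restrict (coordfun l (q j)) V'" for j
    using V'W by (auto simp: opens_in_iff fun_eq_iff restrict_def)
  have "h V f (pt v) = h V' (restrict f V') (pt v)"
    using normal_homsD(4)[OF h V V'(1) f xV'] by simp
  also have "\<dots> = restrict h (opens_in Y V') V' (restrict f V') (pt v)" using V'V' by simp
  also have "\<dots> = (\<Sum>j<3. c j * h V' (restrict (coordfun l (q j)) V') (pt v))"
    using c[OF normal_homs_restrict[OF h V'U]] V'V' by simp
  also have "\<dots> = (\<Sum>j<3. c j * h ?W (restrict (coordfun l (q j)) ?W) (pt v))"
    by (rule sum.cong) (use normal_homsD(4)[OF h W V'W Xid xV'] rX in auto)
  finally have 1: "h V f (pt v) = (\<Sum>j<3. c j * h ?W (restrict (coordfun l (q j)) ?W) (pt v))" .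
  have 2: "c j * (\<theta> j v / l v) = der Y f v (F j v)" if j: "j < 3" for j
  proof -
    \<comment> \<open>A factor of degree 1 - k j, as a field section requires, without zeros where
      \<open>l\<close> is nonzero.\<close>
    let ?s = "\<lambda>v. l v / l v ^ k j"
    have lk: "form (k j) (\<lambda>v. l v ^ k j)" using form_power[OF l, of "k j"] by simp
    have sr: "local_quot L x (1 - int (k j)) ?s" if x: "x \<in> V' \<inter> L" for x
    proof (rule local_quot_divide[OF local_quot_form[OF l _ refl] lk])
      show xP: "x \<in> Proj" using x LP by blast
      then obtain w where w: "w \<noteq> 0" "x = pt w" by (rule ProjE)
      then show "x \<in> basic (\<lambda>v. l v ^ k j)"
        using x V'(3) pt_in_basic[OF l w(1)] pt_in_basic[OF lk w(1)] by auto
    qed simp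
    let ?h = "field_section (F j) ?s V'"
    have hn: "?h \<in> normal_homs Y L V'" by (rule field_section_normal[OF zV'(1) tf[OF j] sr]) auto
    have ev: "?h V' f' (pt v) = ?s v * der Y f' v (F j v)" if "f' \<in> idl Y L V'" for f'
      by (rule field_section_eval[OF tf[OF j] sr[OF xV'] _ V'V' that v(1) xV']) simp
    have rf: "restrict f V' \<in> idl Y L V'" by (rule idl_restrict[OF Y zV(1) zV' f])
    have t: "tangent Y v (F j v)" using tf[OF j] v by (auto simp: tangent_field_def)
    have X: "?h V' (restrict (coordfun l (q i)) V') (pt v) = (if i = j then ?s v * (\<theta> j v / l v) else 0)"
      if i: "i < 3" for i
      using ev[OF coordfun_idl[OF fr i zV'(1) V'(3)]]
        coordfun_der[OF fr i j zV'(1) V'(3) tf[OF j] v(1) xV'] by simp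
    have "?s v * der Y f v (F j v) = ?s v * der Y (restrict f V') v (F j v)"
      using der_cong[OF t zV'(1) V'(2) Y, of f "restrict f V'"] by simp
    also have "\<dots> = (\<Sum>i<3. c i * (if i = j then ?s v * (\<theta> j v / l v) else 0))"
      unfolding ev[OF rf, symmetric] c[OF hn] by (rule sum.cong) (use X in auto)
    also have "\<dots> = ?s v * (c j * (\<theta> j v / l v))" using j by (auto simp: sum3 less3)
    finally show ?thesis using v(3) by (simp add: field_simps)
  qed
  have th: "\<theta> j v \<noteq> 0" if "j < 3" for j using fr that v by (auto simp: frame_def)
  show ?thesis unfolding 1
    by (rule sum.cong) (use v(3) th 2[symmetric] in auto)
qed

text \<open>The isomorphism sends three sections s j of the twists to the homomorphism that maps f
  to the sum of s j times the derivative of f along \<open>F j\<close>. Testing on the functions q i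
  / l gives injectivity; surjectivity is \<open>chart_key\<close>, which recovers the s j from the
  values of a given homomorphism on these same functions.\<close>

theorem normal_sheaf_split:
  assumes tf: "\<And>j. j < 3 \<Longrightarrow> tangent_field Y L (k j) (F j)"
    and charts: "\<And>x. x \<in> L \<Longrightarrow> \<exists>l \<rho> q \<theta>. x \<in> basic l \<and> chart Y L l \<rho> q \<and> frame k F l q \<theta>"
  shows "sheaf_isomorphic Y (normal_sheaf Y L) (twist3 L (\<lambda>j. 1 - int (k j)))"
proof -
  define d where "d = (\<lambda>j. 1 - int (k j))"
  define nadd where "nadd = (\<lambda>U (h :: 'n subsp set \<Rightarrow> ('n subsp \<Rightarrow> complex) \<Rightarrow> 'n subsp \<Rightarrow> complex) h'.
    \<lambda>V\<in>opens_in Y U. \<lambda>f\<in>idl Y L V. \<lambda>x\<in>V \<inter> L. h V f x + h' V f x)"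
  define \<Phi> where "\<Phi> = (\<lambda>U s. nadd U (nadd U (field_section (F 0) (nth3 s 0) U) (field_section (F 1) (nth3 s 1) U))
    (field_section (F 2) (nth3 s 2) U))"
  have sr: "local_quot L x (d j) (nth3 s j)" if "zopen Y U" "s \<in> ssec (twist3 L d) U" "j < 3" "x \<in> U \<inter> L" for U s j x
    using that unfolding twist3_sec twist_iff[OF that(1)] by blast
  have \<Phi>n: "\<Phi> U s \<in> normal_homs Y L U" if "zopen Y U" "s \<in> ssec (twist3 L d) U" for U s
    unfolding \<Phi>_def nadd_def
    by (intro normal_homs_add that(1) field_section_normal[OF that(1) tf sr[OF that]]) (auto simp: d_def)
  have \<Phi>e: "\<Phi> U s V f (pt v) = (\<Sum>j<3. nth3 s j v * der Y f v (F j v))"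
    if "zopen Y U" "s \<in> ssec (twist3 L d) U" "V \<in> opens_in Y U" "f \<in> idl Y L V" "v \<noteq> 0" "pt v \<in> V \<inter> L" for U s V f v
  proof -
    have vU: "pt v \<in> U \<inter> L" using that by (auto simp: opens_in_iff)
    have "field_section (F j) (nth3 s j) U V f (pt v) = nth3 s j v * der Y f v (F j v)" if j: "j < 3" for j
      by (rule field_section_eval[OF tf[OF j] sr[OF \<open>zopen Y U\<close> _ j vU] _ \<open>V \<in> _\<close> \<open>f \<in> _\<close> \<open>v \<noteq> 0\<close> \<open>pt v \<in> V \<inter> L\<close>])
        (use \<open>s \<in> _\<close> in \<open>auto simp: d_def\<close>)
    then show ?thesis using that(3,4,6) unfolding \<Phi>_def nadd_def sum3 by simp
  qed
  have "sheaf_isomorphic Y (normal_sheaf Y L) (twist3 L d)"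
  proof (rule sheaf_isomorphicI[where \<Phi> = \<Phi>])
    fix U assume "U \<in> opens_in Y Y"
    then have U: "zopen Y U" by (simp add: opens_in_iff)
    have UU: "U \<in> opens_in Y U" using U by (simp add: opens_in_iff)
    show "bij_betw (\<Phi> U) (ssec (twist3 L d) U) (ssec (normal_sheaf Y L) U)"
      unfolding bij_betw_def
    proof
      show "inj_on (\<Phi> U) (ssec (twist3 L d) U)"
      proof (rule inj_onI, rule nth3_eqI)
        fix s t and j :: nat
        assume s: "s \<in> ssec (twist3 L d) U" and t: "t \<in> ssec (twist3 L d) U"
          and eq: "\<Phi> U s = \<Phi> U t" and j: "j < 3"
        have ext: "nth3 s j \<in> extensional (cone (U \<inter> L))" "nth3 t j \<in> extensional (cone (U \<inter> L))"
          using s t j unfolding twist3_sec twist_iff[OF U] by blast+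
        show "nth3 s j = nth3 t j"
        proof (rule extensionalityI[OF ext])
          fix v assume "v \<in> cone (U \<inter> L)"
          then have v: "v \<noteq> 0" "pt v \<in> U" "pt v \<in> L" using cone_L[OF U] by auto
          obtain l \<rho> q \<theta> where fr: "pt v \<in> basic l" "chart Y L l \<rho> q" "frame k F l q \<theta>"
            using charts[OF v(3)] by blast
          have l: "form 1 l" using fr by (auto simp: frame_def)
          have lv: "l v \<noteq> 0" using fr(1) pt_in_basic[OF l v(1)] by blast
          have th: "\<theta> j v \<noteq> 0" using fr(3) j v lv by (auto simp: frame_def)
          let ?W = "U \<inter> (Y \<inter> basic l)"
          have zW: "zopen Y ?W" by (rule openin_Int[OF U zopen_basic[OF l]])
          have W: "?W \<in> opens_in Y U" using zW by (auto simp: opens_in_iff)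
          have vW: "pt v \<in> ?W \<inter> L" using v L fr(1) by blast
          have sub: "?W \<subseteq> basic l" by blast
          let ?X = "restrict (coordfun l (q j)) ?W"
          have X: "?X \<in> idl Y L ?W" by (rule coordfun_idl[OF fr(3) j zW sub])
          have "\<Phi> U s' ?W ?X (pt v) = nth3 s' j v * (\<theta> j v / l v)"
            if s': "s' \<in> ssec (twist3 L d) U" for s'
            unfolding \<Phi>e[OF U s' W X v(1) vW] sum3
            using coordfun_der[OF fr(3) j _ zW sub tf v(1) vW] j by (auto simp: less3)
          from this[OF s] this[OF t] eq show "nth3 s j v = nth3 t j v" using lv th by simp
        qed
      qed
      show "\<Phi> U ` ssec (twist3 L d) U = ssec (normal_sheaf Y L) U"
      proof
        show "\<Phi> U ` ssec (twist3 L d) U \<subseteq> ssec (normal_sheaf Y L) U"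
          using \<Phi>n[OF U] by auto
        show "ssec (normal_sheaf Y L) U \<subseteq> \<Phi> U ` ssec (twist3 L d) U"
        proof
          fix h assume "h \<in> ssec (normal_sheaf Y L) U"
          then have h: "h \<in> normal_homs Y L U" by simp
          \<comment> \<open>The coefficient of the field \<open>F j\<close> in the expansion of h,
            as computed in one chart.\<close>
          define \<sigma> where "\<sigma> = (\<lambda>l (q :: nat \<Rightarrow> complex ^ 'n \<Rightarrow> complex) (\<theta> :: nat \<Rightarrow> complex ^ 'n \<Rightarrow> complex) j v. h (U \<inter> (Y \<inter> basic l))
            (restrict (coordfun l (q j)) (U \<inter> (Y \<inter> basic l))) (pt v) * l v / \<theta> j v)"
          define good where "good = (\<lambda>v (l, \<rho>, q, \<theta>). chart Y L l \<rho> q \<and> frame k F l q \<theta> \<and> l v \<noteq> 0)"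
          \<comment> \<open>A chart is chosen separately at every vector; by \<open>indep\<close>
            the value does not depend on it, which glues the local coefficients.\<close>
          define s where "s = (\<lambda>j v. case (SOME z. good v z) of (l, \<rho>, q, \<theta>) \<Rightarrow> \<sigma> l q \<theta> j v)"
          have goodex: "\<exists>z. good v z" if v: "v \<noteq> 0" "pt v \<in> U \<inter> L" for v
          proof -
            obtain l \<rho> q \<theta> where fr: "pt v \<in> basic l" "chart Y L l \<rho> q" "frame k F l q \<theta>"
              using charts v by blast
            then have "l v \<noteq> 0" using pt_in_basic[OF _ v(1)] unfolding frame_def by blast
            then show ?thesis using fr by (intro exI[of _ "(l, \<rho>, q, \<theta>)"]) (simp add: good_def)
          qed
          have key: "h V f (pt v) = (\<Sum>j<3. \<sigma> l q \<theta> j v * der Y f v (F j v))"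
            if "good v (l, \<rho>, q, \<theta>)" "V \<in> opens_in Y U" "f \<in> idl Y L V" "v \<noteq> 0" "pt v \<in> V \<inter> L" for v l \<rho> q \<theta> V f
            unfolding \<sigma>_def by (rule chart_key[OF _ _ tf U h that(2-5)]) (use that(1) in \<open>auto simp: good_def\<close>)
          \<comment> \<open>The expansion of h in the second chart is evaluated on the test function
            q j / l of the first chart; duality of the frame leaves only the j-th
            coefficient.\<close>
          have indep: "\<sigma> l q \<theta> j v = \<sigma> l' q' \<theta>' j v"
            if g: "good v (l, \<rho>, q, \<theta>)" "good v (l', \<rho>', q', \<theta>')" and v: "v \<noteq> 0" "pt v \<in> U \<inter> L" and j: "j < 3"
            for v l \<rho> q \<theta> l' \<rho>' q' \<theta>' j
          proof -
            have fr: "frame k F l q \<theta>" "l v \<noteq> 0" using g by (auto simp: good_def)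
            have l: "form 1 l" using fr by (auto simp: frame_def)
            have th: "\<theta> j v \<noteq> 0" using fr j v by (auto simp: frame_def)
            let ?W = "U \<inter> (Y \<inter> basic l)"
            have zW: "zopen Y ?W" by (rule openin_Int[OF U zopen_basic[OF l]])
            have W: "?W \<in> opens_in Y U" using zW by (auto simp: opens_in_iff)
            have vW: "pt v \<in> ?W \<inter> L" using v L fr(2) pt_in_basic[OF l v(1)] by blast
            have sub: "?W \<subseteq> basic l" by blast
            let ?X = "restrict (coordfun l (q j)) ?W"
            have X: "?X \<in> idl Y L ?W" by (rule coordfun_idl[OF fr(1) j zW sub])
            have "h ?W ?X (pt v) = \<sigma> l' q' \<theta>' j v * (\<theta> j v / l v)"
              unfolding key[OF g(2) W X v(1) vW] sum3
              using coordfun_der[OF fr(1) j _ zW sub tf v(1) vW] j by (auto simp: less3)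
            moreover have "\<sigma> l q \<theta> j v = h ?W ?X (pt v) * l v / \<theta> j v" by (simp add: \<sigma>_def)
            ultimately show ?thesis using fr(2) th by simp
          qed
          have s\<sigma>: "s j v = \<sigma> l q \<theta> j v"
            if g: "good v (l, \<rho>, q, \<theta>)" and v: "v \<noteq> 0" "pt v \<in> U \<inter> L" and j: "j < 3" for v l \<rho> q \<theta> j
          proof -
            obtain l' \<rho>' q' \<theta>' where e: "(SOME z. good v z) = (l', \<rho>', q', \<theta>')" by (metis prod_cases4)
            have "good v (l', \<rho>', q', \<theta>')" using someI[of "good v", OF g] e by simp
            then show ?thesis using indep[OF g _ v j] by (simp add: s_def e)
          qed
          \<comment> \<open>Near x a single chart may be used throughout. There the coefficient is a
            regular function times l / \<theta> j, of degree 0 + 1 - k j.\<close>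
          have srat: "local_quot L x (d j) (s j)" if x: "x \<in> U \<inter> L" and j: "j < 3" for x j
          proof -
            obtain l \<rho> q \<theta> where fr: "x \<in> basic l" "chart Y L l \<rho> q" "frame k F l q \<theta>"
              using charts x by blast
            have l: "form 1 l" and th: "form (k j) (\<theta> j)" using fr j by (auto simp: frame_def)
            let ?W = "U \<inter> (Y \<inter> basic l)"
            have zW: "zopen Y ?W" by (rule openin_Int[OF U zopen_basic[OF l]])
            have W: "?W \<in> opens_in Y U" using zW by (auto simp: opens_in_iff)
            have sub: "?W \<subseteq> basic l" by blast
            have xW: "x \<in> ?W \<inter> L" using x fr L by blast
            have xP: "x \<in> Proj" using x LP by blast
            obtain w where w: "w \<noteq> 0" "x = pt w" using xP by (rule ProjE)
            have "l w \<noteq> 0" using fr(1) pt_in_basic[OF l w(1)] w by blast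
            then have "\<theta> j w \<noteq> 0" using fr(3) j w x by (auto simp: frame_def)
            then have xth: "x \<in> basic (\<theta> j)" using pt_in_basic[OF th w(1)] w by blast
            have X: "restrict (coordfun l (q j)) ?W \<in> idl Y L ?W" by (rule coordfun_idl[OF fr(3) j zW sub])
            have "local_quot L x 0 (\<lambda>v. h ?W (restrict (coordfun l (q j)) ?W) (pt v))"
              by (rule regularD[OF normal_homsD(1)[OF h W X] LP zL[OF zW] xW])
            then have "local_quot L x 1 (\<lambda>v. h ?W (restrict (coordfun l (q j)) ?W) (pt v) * l v)"
              by (rule local_quot_mult[OF _ local_quot_form[OF l xP refl]]) simp
            then have "local_quot L x (d j) (\<sigma> l q \<theta> j)"
              unfolding \<sigma>_def by (rule local_quot_divide[OF _ th xth]) (simp add: d_def)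
            then show ?thesis
            proof (rule local_quot_cong[OF _ zL[OF zW] xW LP])
              fix v :: "complex ^ 'n" assume v: "v \<noteq> 0" "pt v \<in> ?W \<inter> L"
              then have "l v \<noteq> 0" using pt_in_basic[OF l v(1)] by blast
              then show "s j v = \<sigma> l q \<theta> j v"
                using fr v by (intro s\<sigma>[of v l \<rho>] j) (auto simp: good_def)
            qed
          qed
          define S where "S = triple (\<lambda>j. \<lambda>v\<in>cone (U \<inter> L). s j v)"
          have S: "S \<in> ssec (twist3 L d) U"
            unfolding twist3_sec
          proof (intro allI impI)
            fix j :: nat assume j: "j < 3"
            show "nth3 S j \<in> ssec (twist L (d j)) (U \<inter> L)"
              unfolding S_def nth3_triple[OF j] by (rule twist_lambda[OF U srat[OF _ j]])
          qed
          have "\<Phi> U S = h"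
          proof (rule normal_homs_ext[OF \<Phi>n[OF U S] h])
            fix V f x assume V: "V \<in> opens_in Y U" and f: "f \<in> idl Y L V" and x: "x \<in> V \<inter> L"
            have "x \<in> Proj" using x LP by blast
            then obtain v where v: "v \<noteq> 0" "x = pt v" by (rule ProjE)
            have xU: "pt v \<in> U \<inter> L" using x V v by (auto simp: opens_in_iff)
            obtain l \<rho> q \<theta> where g: "good v (l, \<rho>, q, \<theta>)" using goodex[OF v(1) xU] by (metis prod_cases4)
            have "nth3 S j v = \<sigma> l q \<theta> j v" if "j < 3" for j
              unfolding S_def nth3_triple[OF that] using s\<sigma>[OF g v(1) xU that] v xU cone_L[OF U] by simp
            then show "\<Phi> U S V f x = h V f x"
              using \<Phi>e[OF U S V f v(1)] key[OF g V f v(1)] x v by (simp add: sum3)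
          qed
          then show "h \<in> \<Phi> U ` ssec (twist3 L d) U" using S by blast
        qed
      qed
    qed
    fix s assume s: "s \<in> ssec (twist3 L d) U"
    show "sadd (twist3 L d) U s t \<in> ssec (twist3 L d) U \<and>
        \<Phi> U (sadd (twist3 L d) U s t) = sadd (normal_sheaf Y L) U (\<Phi> U s) (\<Phi> U t)"
      if t: "t \<in> ssec (twist3 L d) U" for t
    proof
      show st: "sadd (twist3 L d) U s t \<in> ssec (twist3 L d) U" by (rule twist3_closed(1)[OF U s t])
      show "\<Phi> U (sadd (twist3 L d) U s t) = sadd (normal_sheaf Y L) U (\<Phi> U s) (\<Phi> U t)"
        unfolding normal_simps
      proof (rule normal_homs_ext[OF \<Phi>n[OF U st] normal_homs_add[OF U \<Phi>n[OF U s] \<Phi>n[OF U t]]])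
        fix V f x assume V: "V \<in> opens_in Y U" and f: "f \<in> idl Y L V" and x: "x \<in> V \<inter> L"
        have "x \<in> Proj" using x LP by blast
        then obtain v where v: "v \<noteq> 0" "x = pt v" by (rule ProjE)
        have xV: "pt v \<in> V \<inter> L" and vU: "v \<in> cone (U \<inter> L)"
          using x v V cone_L[OF U] by (auto simp: opens_in_iff)
        have n: "nth3 (sadd (twist3 L d) U s t) j v = nth3 s j v + nth3 t j v" if "j < 3" for j
          unfolding twist3_ops(1)[OF that] using vU by simp
        have eq: "\<Phi> U (sadd (twist3 L d) U s t) V f x =
            (\<Sum>j<3. (nth3 s j v + nth3 t j v) * der Y f v (F j v))"
          unfolding v(2) \<Phi>e[OF U st V f v(1) xV] by (rule sum.cong) (simp_all only: n lessThan_iff)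
        show "\<Phi> U (sadd (twist3 L d) U s t) V f x =
            (\<lambda>V\<in>opens_in Y U. \<lambda>f\<in>idl Y L V. \<lambda>x\<in>V \<inter> L. \<Phi> U s V f x + \<Phi> U t V f x) V f x"
          using V f xV v(2) eq \<Phi>e[OF U s V f v(1) xV] \<Phi>e[OF U t V f v(1) xV]
          by (simp add: sum3 algebra_simps)
      qed
    qed
    show "smul (twist3 L d) U c s \<in> ssec (twist3 L d) U \<and>
        \<Phi> U (smul (twist3 L d) U c s) = smul (normal_sheaf Y L) U c (\<Phi> U s)"
      if c: "c \<in> regular Y U" for c
    proof
      show st: "smul (twist3 L d) U c s \<in> ssec (twist3 L d) U" by (rule twist3_closed(2)[OF U s c])
      show "\<Phi> U (smul (twist3 L d) U c s) = smul (normal_sheaf Y L) U c (\<Phi> U s)"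
        unfolding normal_simps
      proof (rule normal_homs_ext[OF \<Phi>n[OF U st] normal_homs_smul[OF U \<Phi>n[OF U s] c]])
        fix V f x assume V: "V \<in> opens_in Y U" and f: "f \<in> idl Y L V" and x: "x \<in> V \<inter> L"
        have "x \<in> Proj" using x LP by blast
        then obtain v where v: "v \<noteq> 0" "x = pt v" by (rule ProjE)
        have xV: "pt v \<in> V \<inter> L" and vU: "v \<in> cone (U \<inter> L)" and xU: "pt v \<in> U \<inter> L"
          using x v V cone_L[OF U] by (auto simp: opens_in_iff)
        have n: "nth3 (smul (twist3 L d) U c s) j v = c x * nth3 s j v" if "j < 3" for j
          unfolding twist3_ops(2)[OF that] using vU xU v(2) by simp
        have eq: "\<Phi> U (smul (twist3 L d) U c s) V f x = (\<Sum>j<3. (c x * nth3 s j v) * der Y f v (F j v))"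
          unfolding v(2) \<Phi>e[OF U st V f v(1) xV]
          by (rule sum.cong) (simp_all only: n lessThan_iff v(2)[symmetric])
        show "\<Phi> U (smul (twist3 L d) U c s) V f x =
            (\<lambda>V\<in>opens_in Y U. \<lambda>f\<in>idl Y L V. \<lambda>x\<in>V \<inter> L. c x * \<Phi> U s V f x) V f x"
          using V f xV v(2) eq \<Phi>e[OF U s V f v(1) xV]
          by (simp add: sum3 algebra_simps)
      qed
    qed
    show "sres (twist3 L d) U W s \<in> ssec (twist3 L d) W \<and>
        \<Phi> W (sres (twist3 L d) U W s) = sres (normal_sheaf Y L) U W (\<Phi> U s)"
      if W: "W \<in> opens_in Y U" for W
    proof
      have zW: "zopen Y W" using W by (simp add: opens_in_iff)
      show st: "sres (twist3 L d) U W s \<in> ssec (twist3 L d) W" by (rule twist3_closed(3)[OF U s W])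
      show "\<Phi> W (sres (twist3 L d) U W s) = sres (normal_sheaf Y L) U W (\<Phi> U s)"
        unfolding normal_simps
      proof (rule normal_homs_ext[OF \<Phi>n[OF zW st] normal_homs_restrict[OF \<Phi>n[OF U s] W]])
        fix V f x assume V: "V \<in> opens_in Y W" and f: "f \<in> idl Y L V" and x: "x \<in> V \<inter> L"
        have "x \<in> Proj" using x LP by blast
        then obtain v where v: "v \<noteq> 0" "x = pt v" by (rule ProjE)
        have xV: "pt v \<in> V \<inter> L" and vW: "v \<in> cone (W \<inter> L)"
          using x v V cone_L[OF zW] by (auto simp: opens_in_iff)
        have n: "nth3 (sres (twist3 L d) U W s) j v = nth3 s j v" if "j < 3" for j
          unfolding twist3_ops(3)[OF that] using vW by simp
        have eq: "\<Phi> W (sres (twist3 L d) U W s) V f x = (\<Sum>j<3. nth3 s j v * der Y f v (F j v))"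
          unfolding v(2) \<Phi>e[OF zW st V f v(1) xV] by (rule sum.cong) (simp_all only: n lessThan_iff)
        show "\<Phi> W (sres (twist3 L d) U W s) V f x = restrict (\<Phi> U s) (opens_in Y W) V f x"
          using V f xV v(2) eq \<Phi>e[OF U s opens_in_trans[OF W V] f v(1) xV] by simp
      qed
    qed
  qed
  then show ?thesis unfolding d_def .
qed

end

section \<open>Refuting a splitting with a summand O(-1)\<close>

section \<open>Negative twists on a line\<close>

lemma local_quot_holomorphic:
  assumes s: "local_quot L (pt v) d s" and v: "v \<noteq> 0" and near: "\<forall>\<^sub>F t in nhds 0. v + t *s w \<noteq> 0 \<and> pt (v + t *s w) \<in> L"
  shows "(\<lambda>t. s (v + t *s w)) field_differentiable (at 0)"
proof -
  obtain e g m k P Q where *: "form e g" "pt v \<in> basic g" "form m P" "form k Q" "int m = int k + d"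
    "\<And>v. v \<noteq> 0 \<Longrightarrow> pt v \<in> L \<Longrightarrow> pt v \<in> basic g \<Longrightarrow> Q v \<noteq> 0 \<and> s v = P v / Q v"
    using s by (rule local_quotE) blast
  let ?\<gamma> = "\<lambda>t. v + t *s w"
  have t: "tangent_curve L v w ?\<gamma>" using near by (simp add: tangent_curve_def curve_deriv_line)
  have ev: "\<forall>\<^sub>F t in nhds 0. P (?\<gamma> t) / Q (?\<gamma> t) = s (?\<gamma> t)"
    using tangent_curve_basic[OF t *(1,2)] by eventually_elim (use *(6) in fastforce)
  have Q: "Q (?\<gamma> 0) \<noteq> 0" using *(6)[OF v] *(2) tangent_curve_nonzero[OF t] by simp
  have "((\<lambda>t. P (?\<gamma> t) / Q (?\<gamma> t)) has_field_derivative
      (dform P (?\<gamma> 0) w * Q (?\<gamma> 0) - P (?\<gamma> 0) * dform Q (?\<gamma> 0) w) / (Q (?\<gamma> 0) * Q (?\<gamma> 0))) (at 0)"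
    by (rule DERIV_divide[OF form_deriv(1)[OF *(3) curve_deriv_line] form_deriv(1)[OF *(4) curve_deriv_line] Q])
  then show ?thesis using DERIV_cong_ev[OF refl ev refl] unfolding field_differentiable_def by blast
qed

text \<open>On the affine line of vectors v + t w the section is an entire function g. Homogeneity
  of degree -1 rewrites g(t) as the inverse of t times s at w + v / t, which tends to 0 at infinity
  because s is continuous at w. By Liouville g vanishes identically.\<close>

lemma no_global_sections_minus_1:
  assumes v: "v \<noteq> 0" and w: "w \<notin> pt v"
    and L: "\<And>a b. a *s v + b *s w \<noteq> 0 \<Longrightarrow> pt (a *s v + b *s w) \<in> L"
    and s: "\<And>x. x \<in> L \<Longrightarrow> local_quot L x (- 1) s"
  shows "s v = 0"
proof -
  have nz: "a *s v + b *s w \<noteq> 0" if "a \<noteq> 0 \<or> b \<noteq> 0" for a b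
  proof
    assume 0: "a *s v + b *s w = 0"
    show False
    proof (cases "b = 0")
      case True
      then show False using 0 that v by simp
    next
      case False
      have "b *s w = (- a) *s v" using 0 by (simp add: vec_eq_iff add_eq_0_iff)
      then have "inverse b *s (b *s w) = inverse b *s ((- a) *s v)" by simp
      then have "w = (inverse b * (- a)) *s v" using False by (simp add: vector_smult_assoc)
      then show False using w unfolding in_pt by blast
    qed
  qed
  have w0: "w \<noteq> 0" using nz[of 0 1] by simp
  \<comment> \<open>A nonzero determinant means that p and q are independent, so the affine line of
    the p + t q avoids the origin.\<close>
  have diff: "(\<lambda>t. s (p + t *s q)) field_differentiable (at 0)"
    if "p = a *s v + b *s w" "q = c *s v + e *s w" "a * e - b * c \<noteq> 0" for p q a b c e
  proof -
    have pq: "p + t *s q = (a + t * c) *s v + (b + t * e) *s w" for t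
      by (simp add: that vec_eq_iff algebra_simps)
    have nn: "p + t *s q \<noteq> 0" for t
      unfolding pq
    proof (rule nz, rule ccontr)
      assume "\<not> (a + t * c \<noteq> 0 \<or> b + t * e \<noteq> 0)"
      then have ab: "a = - (t * c)" "b = - (t * e)" by (auto simp: add_eq_0_iff2)
      have "a * e - b * c = 0" unfolding ab by (simp add: algebra_simps)
      then show False using that(3) by simp
    qed
    have inL: "pt (p + t *s q) \<in> L" for t using L nn[of t] unfolding pq by blast
    have p: "p \<noteq> 0" "pt p \<in> L" using nn[of 0] inL[of 0] by auto
    show ?thesis by (rule local_quot_holomorphic[OF s[OF p(2)] p(1)]) (use nn inL in auto)
  qed
  define g where "g = (\<lambda>t. s (v + t *s w))"
  have hol: "g field_differentiable (at t0)" for t0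
  proof -
    have "(\<lambda>t. s ((v + t0 *s w) + t *s w)) field_differentiable (at 0)"
      by (rule diff[of _ 1 t0 _ 0 1]) (simp_all add: vec_eq_iff)
    moreover have "(v + t0 *s w) + t *s w = v + (t + t0) *s w" for t
      by (simp add: vec_eq_iff algebra_simps)
    ultimately obtain D where "((\<lambda>t. g (t + t0)) has_field_derivative D) (at 0)"
      unfolding field_differentiable_def g_def by auto
    then have "(g has_field_derivative D) (at t0)" using DERIV_shift[of g D 0 t0] by simp
    then show ?thesis unfolding field_differentiable_def by blast
  qed
  have holo: "g holomorphic_on UNIV"
    by (simp add: holomorphic_on_def field_differentiable_at_within hol)
  define u where "u = (\<lambda>t. s (w + t *s v))"
  have "u field_differentiable (at 0)" unfolding u_def
    by (rule diff[of _ 0 1 _ 1 0]) (simp_all add: vec_eq_iff)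
  then have "isCont u 0" by (rule field_differentiable_imp_continuous_at)
  then have "((\<lambda>t. u (inverse t)) \<longlongrightarrow> u 0) at_infinity"
    by (rule isCont_tendsto_compose) (rule tendsto_inverse_0)
  then have "((\<lambda>t. inverse t * u (inverse t)) \<longlongrightarrow> 0 * u 0) at_infinity"
    by (intro tendsto_mult tendsto_inverse_0)
  moreover have "\<forall>\<^sub>F t in at_infinity. inverse t * u (inverse t) = g t"
    using eventually_not_equal_at_infinity[of 0]
  proof eventually_elim
    fix t :: complex assume t: "t \<noteq> 0"
    have e: "v + t *s w = t *s (w + inverse t *s v)" using t by (simp add: vec_eq_iff algebra_simps)
    have e': "w + inverse t *s v = inverse t *s v + 1 *s w" by (simp add: vec_eq_iff)
    have n: "w + inverse t *s v \<noteq> 0" unfolding e' by (rule nz) simp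
    have l: "pt (w + inverse t *s v) \<in> L" using L n unfolding e' by blast
    show "inverse t * u (inverse t) = g t"
      unfolding g_def u_def e local_quot_scale[OF s[OF l] n l t] by (simp add: power_int_minus)
  qed
  ultimately have "(g \<longlongrightarrow> 0) at_infinity" using Lim_transform_eventually by fastforce
  then have "g 0 = 0" by (rule Liouville_weak[OF holo])
  then show ?thesis by (simp add: g_def)
qed

section \<open>An obstruction to splitting off a negative twist\<close>

lemma sheaf_homsD:
  assumes "H \<in> sheaf_homs X U F G" "V \<in> opens_in X U"
  shows "s \<in> ssec F V \<Longrightarrow> t \<in> ssec F V \<Longrightarrow> H V (sadd F V s t) = sadd G V (H V s) (H V t)"
    and "f \<in> regular X V \<Longrightarrow> s \<in> ssec F V \<Longrightarrow> H V (smul F V f s) = smul G V f (H V s)"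
    and "W \<in> opens_in X V \<Longrightarrow> s \<in> ssec F V \<Longrightarrow> H W (sres F V W s) = sres G V W (H V s)"
  using assms by (auto simp: sheaf_homs_def)

text \<open>Two linear equations in three unknowns have a nonzero solution; here this is made
  precise over a ring R of functions, without division. The solutions used are the cross product of
  a and b, then syzygies built from a or b, and finally a constant vector; each has to vanish on S
  by hypothesis, and the last one forces S to be empty.\<close>

lemma cross_vanish:
  fixes a b :: "nat \<Rightarrow> 'p \<Rightarrow> complex"
  assumes rel: "\<And>c. R (c 0) \<Longrightarrow> R (c 1) \<Longrightarrow> R (c (2::nat)) \<Longrightarrow>
      (\<And>x. x \<in> S \<Longrightarrow> c 0 x * a 0 x + c 1 x * a 1 x + c 2 x * a 2 x = 0) \<Longrightarrow>
      (\<And>x. x \<in> S \<Longrightarrow> c 0 x * b 0 x + c 1 x * b 1 x + c 2 x * b 2 x = 0) \<Longrightarrow>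
      (\<forall>x\<in>S. c 0 x = 0 \<and> c 1 x = 0 \<and> c 2 x = 0)"
    and R: "\<And>j. j < 3 \<Longrightarrow> R (a j)" "\<And>j. j < 3 \<Longrightarrow> R (b j)"
    and alg: "R (\<lambda>x. 0)" "R (\<lambda>x. 1)" "\<And>f g. R f \<Longrightarrow> R g \<Longrightarrow> R (\<lambda>x. f x * g x)"
      "\<And>f g. R f \<Longrightarrow> R g \<Longrightarrow> R (\<lambda>x. f x - g x)"
  shows "S = {}"
proof -
  have Ra: "R (a 0)" "R (a 1)" "R (a 2)" "R (b 0)" "R (b 1)" "R (b 2)" using R by auto
  have neg: "R (\<lambda>x. - f x)" if "R f" for f using alg(4)[OF alg(1) that] by simp
  \<comment> \<open>The cross product is orthogonal to both a and b, so \<open>rel\<close> makes it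
    vanish: a and b are proportional at every point of S.\<close>
  have 1: "\<forall>x\<in>S. a 1 x * b 2 x - a 2 x * b 1 x = 0 \<and> a 2 x * b 0 x - a 0 x * b 2 x = 0 \<and>
      a 0 x * b 1 x - a 1 x * b 0 x = 0"
    using rel[of "\<lambda>j. if j = 0 then (\<lambda>x. a 1 x * b 2 x - a 2 x * b 1 x) else
      if j = 1 then (\<lambda>x. a 2 x * b 0 x - a 0 x * b 2 x) else (\<lambda>x. a 0 x * b 1 x - a 1 x * b 0 x)"]
    using Ra alg by (simp add: algebra_simps)
  \<comment> \<open>If c is proportional to both a and b, then (c 1, -c 0, 0) and (0, c 2, -c 1) are
    orthogonal to both. Applied to a and b themselves, this makes all six functions vanish on
    S.\<close>
  have vanish: "\<forall>x\<in>S. c 0 x = 0 \<and> c 1 x = 0 \<and> c (2::nat) x = 0"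
    if c: "R (c 0)" "R (c 1)" "R (c 2)" and
      ca: "\<And>i j x. x \<in> S \<Longrightarrow> i < 3 \<Longrightarrow> j < 3 \<Longrightarrow> c i x * a j x = c j x * a i x"
      and cb: "\<And>i j x. x \<in> S \<Longrightarrow> i < 3 \<Longrightarrow> j < 3 \<Longrightarrow> c i x * b j x = c j x * b i x" for c
  proof -
    let ?p = "\<lambda>j::nat. if j = 0 then c 1 else if j = 1 then (\<lambda>x. - c 0 x) else (\<lambda>x. 0)"
    have "\<forall>x\<in>S. ?p 0 x = 0 \<and> ?p 1 x = 0 \<and> ?p 2 x = 0"
    proof (rule rel[of ?p])
      show "R (?p 0)" "R (?p 1)" "R (?p 2)" using c alg(1) neg by simp_all
      fix x assume x: "x \<in> S"
      show "?p 0 x * a 0 x + ?p 1 x * a 1 x + ?p 2 x * a 2 x = 0"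
        using ca[OF x, of 1 0] by simp
      show "?p 0 x * b 0 x + ?p 1 x * b 1 x + ?p 2 x * b 2 x = 0"
        using cb[OF x, of 1 0] by simp
    qed
    moreover
    let ?q = "\<lambda>j::nat. if j = 0 then (\<lambda>x. 0) else if j = 1 then c 2 else (\<lambda>x. - c 1 x)"
    have "\<forall>x\<in>S. ?q 0 x = 0 \<and> ?q 1 x = 0 \<and> ?q 2 x = 0"
    proof (rule rel[of ?q])
      show "R (?q 0)" "R (?q 1)" "R (?q 2)" using c alg(1) neg by simp_all
      fix x assume x: "x \<in> S"
      show "?q 0 x * a 0 x + ?q 1 x * a 1 x + ?q 2 x * a 2 x = 0"
        using ca[OF x, of 2 1] by simp
      show "?q 0 x * b 0 x + ?q 1 x * b 1 x + ?q 2 x * b 2 x = 0"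
        using cb[OF x, of 2 1] by simp
    qed
    ultimately show ?thesis by simp
  qed
  have ab: "a i x * b j x = a j x * b i x" if "x \<in> S" "i < 3" "j < 3" for i j x
    using bspec[OF 1 that(1)] that(2,3) unfolding less3 by auto
  have ba: "b i x * a j x = b j x * a i x" if "x \<in> S" "i < 3" "j < 3" for i j x
    using ab[OF that(1,3,2)] by (simp add: mult.commute)
  have a0: "\<forall>x\<in>S. a 0 x = 0 \<and> a 1 x = 0 \<and> a 2 x = 0"
    by (rule vanish[of a, OF Ra(1-3) _ ab]) (simp_all add: mult.commute)
  have b0: "\<forall>x\<in>S. b 0 x = 0 \<and> b 1 x = 0 \<and> b 2 x = 0"
    by (rule vanish[of b, OF Ra(4-6) ba]) (simp_all add: mult.commute)
  have "\<forall>x\<in>S. (1::complex) = 0 \<and> (1::complex) = 0 \<and> (1::complex) = 0"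
    using rel[of "\<lambda>j x. 1"] alg a0 b0 by simp
  then show "S = {}" by auto
qed

context subvariety
begin

text \<open>The normal sheaf is a module over functions on \<open>Y\<close>, so coefficients that
  arise on \<open>L\<close> have to be lifted. The same quotient of forms, read on \<open>Y\<close>
  where its denominator is nonzero, does it.\<close>

lemma local_quot_extend:
  assumes s: "local_quot L x 0 s" and x: "x \<in> L"
  shows "\<exists>V c. zopen Y V \<and> x \<in> V \<and> (\<forall>y\<in>V. local_quot Y y 0 (\<lambda>v. c (pt v))) \<and>
    (\<forall>v. v \<noteq> 0 \<longrightarrow> pt v \<in> V \<inter> L \<longrightarrow> c (pt v) = s v)"
proof -
  obtain e g m k P Q where *: "form e g" "x \<in> basic g" "form m P" "form k Q" "int m = int k + 0"
    "\<And>v. v \<noteq> 0 \<Longrightarrow> pt v \<in> L \<Longrightarrow> pt v \<in> basic g \<Longrightarrow> Q v \<noteq> 0 \<and> s v = P v / Q v"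
    using s by (rule local_quotE) blast
  have k: "k = m" using * by simp
  define c where "c y = P (rep y) / Q (rep y)" for y
  have conic_vec: "c (pt v) = P v / Q v" if v: "v \<noteq> 0" for v
  proof -
    have r: "rep (pt v) \<noteq> 0" "pt (rep (pt v)) = pt v" using rep[OF pt_in_Proj[OF v]] by auto
    then obtain r where "r \<noteq> 0" "rep (pt v) = r *s v" using pt_eq_iff[OF v r(1)] by auto
    then show ?thesis unfolding c_def using k by (simp add: form_scale[OF *(3)] form_scale[OF *(4)])
  qed
  let ?V = "(Y \<inter> basic g) \<inter> (Y \<inter> basic Q)"
  have xP: "x \<in> Proj" using x LP by blast
  obtain u where u: "u \<noteq> 0" "x = pt u" using xP by (rule ProjE)
  have xQ: "x \<in> basic Q" using *(6)[OF u(1)] *(2) x u pt_in_basic[OF *(4) u(1)] by simp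
  show ?thesis
  proof (intro exI conjI ballI allI impI)
    show "zopen Y ?V" by (rule openin_Int[OF zopen_basic[OF *(1)] zopen_basic[OF *(4)]])
    show "x \<in> ?V" using x L *(2) xQ by blast
    show "local_quot Y y 0 (\<lambda>v. c (pt v))" if "y \<in> ?V" for y
      by (rule local_quotI[OF *(4) _ *(3,4,5)]) (use that conic_vec pt_in_basic[OF *(4)] in auto)
    show "c (pt v) = s v" if "v \<noteq> 0" "pt v \<in> ?V \<inter> L" for v
      using that conic_vec[OF that(1)] *(6)[OF that(1)] by auto
  qed
qed

lemma local_quot_extend_family:
  assumes "finite I" "\<And>i. i \<in> I \<Longrightarrow> local_quot L x 0 (s i)" "x \<in> L"
  shows "\<exists>V c. zopen Y V \<and> x \<in> V \<and> (\<forall>i\<in>I. \<forall>y\<in>V. local_quot Y y 0 (\<lambda>v. c i (pt v))) \<and>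
    (\<forall>i\<in>I. \<forall>v. v \<noteq> 0 \<longrightarrow> pt v \<in> V \<inter> L \<longrightarrow> c i (pt v) = s i v)"
proof -
  have "\<exists>V c. zopen Y V \<and> x \<in> V \<and> (\<forall>y\<in>V. local_quot Y y 0 (\<lambda>v. c (pt v))) \<and>
    (\<forall>v. v \<noteq> 0 \<longrightarrow> pt v \<in> V \<inter> L \<longrightarrow> c (pt v) = s i v)" if "i \<in> I" for i
    by (rule local_quot_extend[OF assms(2)[OF that] assms(3)])
  then obtain V c where V: "\<And>i. i \<in> I \<Longrightarrow> zopen Y (V i) \<and> x \<in> V i \<and> (\<forall>y\<in>V i. local_quot Y y 0 (\<lambda>v. c i (pt v))) \<and>
    (\<forall>v. v \<noteq> 0 \<longrightarrow> pt v \<in> V i \<inter> L \<longrightarrow> c i (pt v) = s i v)"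
    by metis
  let ?W = "\<Inter>i\<in>I. V i"
  show ?thesis
  proof (intro exI conjI)
    show "zopen Y (Y \<inter> ?W)"
    proof (cases "I = {}")
      case True then show ?thesis using zopen_self[OF Y] by simp
    next
      case False
      have "zopen Y ?W" by (rule openin_INT2[OF assms(1) False]) (use V in blast)
      then show ?thesis using openin_Int[OF zopen_self[OF Y]] by blast
    qed
    show "x \<in> Y \<inter> ?W" using assms(3) L V by blast
    show "\<forall>i\<in>I. \<forall>y\<in>Y \<inter> ?W. local_quot Y y 0 (\<lambda>v. c i (pt v))"
      "\<forall>i\<in>I. \<forall>v. v \<noteq> 0 \<longrightarrow> pt v \<in> Y \<inter> ?W \<inter> L \<longrightarrow> c i (pt v) = s i v"
      using V by blast+
  qed
qed

text \<open>Three global sections that are generically independent cannot live in a rank 3 bundle one of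
  whose summands has no global sections.\<close>

theorem normal_sheaf_not_split:
  assumes tf: "\<And>j. j < 3 \<Longrightarrow> tangent_field Y L 1 (F j)"
    and fr: "frame (\<lambda>j. 1) F l q \<theta>" and x0: "x0 \<in> L" "x0 \<in> basic l"
    and neg: "\<And>s v. (\<And>x. x \<in> L \<Longrightarrow> local_quot L x (- 1) s) \<Longrightarrow> v \<noteq> 0 \<Longrightarrow> pt v \<in> L \<Longrightarrow> s v = 0"
    and d: "d 0 = - 1" "d 1 = 1" "d 2 = 1"
  shows "\<not> sheaf_isomorphic Y (normal_sheaf Y L) (twist3 L d)"
proof
  assume "sheaf_isomorphic Y (normal_sheaf Y L) (twist3 L d)"
  then obtain H where H: "H \<in> sheaf_homs Y Y (normal_sheaf Y L) (twist3 L d)"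
    and bij: "\<And>U. U \<in> opens_in Y Y \<Longrightarrow> bij_betw (H U) (normal_homs Y L U) (ssec (twist3 L d) U)"
    unfolding sheaf_isomorphic_def by auto
  have zY: "zopen Y Y" by (rule zopen_self[OF Y])
  have YY: "Y \<in> opens_in Y Y" using zY by (simp add: opens_in_iff)
  have Hin: "H U h \<in> ssec (twist3 L d) U" if "U \<in> opens_in Y Y" "h \<in> normal_homs Y L U" for U h
    using bij[OF that(1)] that(2) by (rule bij_betwE[THEN bspec])
  have Hinj: "h = h'" if "U \<in> opens_in Y Y" "h \<in> normal_homs Y L U" "h' \<in> normal_homs Y L U" "H U h = H U h'" for U h h'
    using bij_betw_imp_inj_on[OF bij[OF that(1)]] that by (auto dest: inj_onD)
  have Hadd: "H V (sadd (normal_sheaf Y L) V s t) = sadd (twist3 L d) V (H V s) (H V t)"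
    if "V \<in> opens_in Y Y" "s \<in> normal_homs Y L V" "t \<in> normal_homs Y L V" for V s t
    by (rule sheaf_homsD(1)[OF H that(1)]) (simp_all only: normal_simps(1) that)
  have Hmul: "H V (smul (normal_sheaf Y L) V f s) = smul (twist3 L d) V f (H V s)"
    if "V \<in> opens_in Y Y" "f \<in> regular Y V" "s \<in> normal_homs Y L V" for V f s
    by (rule sheaf_homsD(2)[OF H that(1,2)]) (simp only: normal_simps(1) that)
  have Hres: "H W (sres (normal_sheaf Y L) V W s) = sres (twist3 L d) V W (H V s)"
    if "V \<in> opens_in Y Y" "W \<in> opens_in Y V" "s \<in> normal_homs Y L V" for V W s
    by (rule sheaf_homsD(3)[OF H that(1,2)]) (simp only: normal_simps(1) that)
  have l: "form 1 l" using fr by (simp add: frame_def)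
  define \<eta> where "\<eta> j = field_section (F j) (\<lambda>v. 1) Y" for j :: nat
  have one: "local_quot L x 0 (\<lambda>v. 1)" if "x \<in> L" for x by (rule local_quot_const) (use that LP in blast)
  have \<eta>n: "\<eta> j \<in> normal_homs Y L Y" if "j < 3" for j
    unfolding \<eta>_def by (rule field_section_normal[OF zY tf[OF that] one]) auto
  have \<eta>e: "\<eta> j V f (pt v) = der Y f v (F j v)"
    if "j < 3" "zopen Y V" "f \<in> idl Y L V" "v \<noteq> 0" "pt v \<in> V \<inter> L" for j V f v
  proof -
    have V: "V \<in> opens_in Y Y" using that zopen_subset by (auto simp: opens_in_iff)
    have "\<eta> j V f (pt v) = 1 * der Y f v (F j v)"
      unfolding \<eta>_def by (rule field_section_eval[OF tf[OF that(1)] one _ V that(3-5)]) (use that in auto)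
    then show ?thesis by simp
  qed
  define \<sigma> where "\<sigma> j i = nth3 (H Y (\<eta> j)) i" for i j
  have \<sigma>r: "local_quot L x (d i) (\<sigma> j i)" if "i < 3" "j < 3" "x \<in> L" for i j x
  proof -
    have "H Y (\<eta> j) \<in> ssec (twist3 L d) Y" by (rule Hin[OF YY \<eta>n[OF that(2)]])
    then show ?thesis using that L unfolding twist3_sec twist_iff[OF zY] \<sigma>_def by blast
  qed
  \<comment> \<open>The O(-1)-components of the images of the three global sections vanish; only a
    matrix of two components for three sections is left.\<close>
  have \<sigma>0: "\<sigma> j 0 v = 0" if "j < 3" "v \<noteq> 0" "pt v \<in> L" for j v
    by (rule neg[OF _ that(2,3)]) (use \<sigma>r[of 0 j] that d in auto)
  have x0P: "x0 \<in> Proj" using x0 LP by blast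
  let ?a = "\<lambda>p v. \<sigma> (fst p) (snd p) v / l v"
  let ?I = "{..<3} \<times> {1, 2} :: (nat \<times> nat) set"
  have ar: "local_quot L x0 0 (?a p)" if "p \<in> ?I" for p
  proof (rule local_quot_divide[OF _ l x0(2)])
    show "local_quot L x0 (d (snd p)) (\<lambda>v. \<sigma> (fst p) (snd p) v)" using \<sigma>r[of "snd p" "fst p"] that x0 by auto
    show "d (snd p) = 0 + int 1" using that d by auto
  qed
  have "\<exists>V c. zopen Y V \<and> x0 \<in> V \<and> (\<forall>p\<in>?I. \<forall>y\<in>V. local_quot Y y 0 (\<lambda>v. c p (pt v))) \<and>
    (\<forall>p\<in>?I. \<forall>v. v \<noteq> 0 \<longrightarrow> pt v \<in> V \<inter> L \<longrightarrow> c p (pt v) = ?a p v)"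
    by (rule local_quot_extend_family[of ?I x0 ?a, OF _ ar x0(1)]) simp
  then obtain V0 c where V0: "zopen Y V0" "x0 \<in> V0"
    and c': "\<forall>p\<in>?I. \<forall>y\<in>V0. local_quot Y y 0 (\<lambda>v. c p (pt v))"
    and ca': "\<forall>p\<in>?I. \<forall>v. v \<noteq> 0 \<longrightarrow> pt v \<in> V0 \<inter> L \<longrightarrow> c p (pt v) = ?a p v"
    by blast
  have c: "local_quot Y y 0 (\<lambda>v. c p (pt v))" if "p \<in> ?I" "y \<in> V0" for p y
    using c' that by blast
  have ca: "c p (pt v) = ?a p v" if "p \<in> ?I" "v \<noteq> 0" "pt v \<in> V0 \<inter> L" for p v
    using ca' that by blast
  define V where "V = V0 \<inter> (Y \<inter> basic l)"
  have zV: "zopen Y V" unfolding V_def by (rule openin_Int[OF V0(1) zopen_basic[OF l]])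
  have VY: "V \<in> opens_in Y Y" and VV: "V \<in> opens_in Y V"
    using zV zopen_subset by (auto simp: opens_in_iff)
  have Vl: "V \<subseteq> basic l" unfolding V_def by blast
  have x0V: "x0 \<in> V \<inter> L" using V0 x0 L unfolding V_def by blast
  define \<eta>V where "\<eta>V j = restrict (\<eta> j) (opens_in Y V)" for j
  have \<eta>Vn: "\<eta>V j \<in> normal_homs Y L V" if "j < 3" for j
    unfolding \<eta>V_def by (rule normal_homs_restrict[OF \<eta>n[OF that] VY])
  have H\<eta>V: "nth3 (H V (\<eta>V j)) i v = \<sigma> j i v" if "i < 3" "j < 3" "v \<in> cone (V \<inter> L)" for i j v
  proof -
    have "H V (\<eta>V j) = sres (twist3 L d) Y V (H Y (\<eta> j))"
      using Hres[OF YY VY \<eta>n[OF that(2)]] unfolding \<eta>V_def normal_simps(4) .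
    then have "nth3 (H V (\<eta>V j)) i = restrict (nth3 (H Y (\<eta> j)) i) (cone (V \<inter> L))"
      using twist3_ops(3)[OF that(1)] by metis
    then show ?thesis using that unfolding \<sigma>_def by simp
  qed
  define R where "R = (\<lambda>f. \<forall>y\<in>V. local_quot Y y 0 (\<lambda>v. f (pt v)))"
  have YP: "y \<in> Proj" if "y \<in> V" for y using that zopen_Proj[OF zV] by blast
  have "V \<inter> L = {}"
  \<comment> \<open>The two vectors consist of the O(1)-components of the three images, divided by
    l. A combination orthogonal to both is sent to 0 by H, so it is the zero section by injectivity,
    and its values on the functions q i / l show that its coefficients vanish on
    \<open>V \<inter> L\<close>.\<close>
  proof (rule cross_vanish[where R = R and a = "\<lambda>j. c (j, 1)" and b = "\<lambda>j. c (j, 2)"])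
    show "R (c (j, 1))" "R (c (j, 2))" if "j < 3" for j
      unfolding R_def using c[of "(j, 1)"] c[of "(j, 2)"] that V_def by auto
    show "R (\<lambda>x. 0)" "R (\<lambda>x. 1)" unfolding R_def using local_quot_const YP by blast+
    show "R (\<lambda>x. f x * g x)" if "R f" "R g" for f g
      using that local_quot_mult[of Y _ 0 _ 0 _ 0] unfolding R_def by simp
    show "R (\<lambda>x. f x - g x)" if "R f" "R g" for f g
      using that local_quot_diff YP unfolding R_def by blast
    fix r :: "nat \<Rightarrow> _"
    assume r: "R (r 0)" "R (r 1)" "R (r 2)"
      and rel: "\<And>x. x \<in> V \<inter> L \<Longrightarrow> r 0 x * c (0, 1) x + r 1 x * c (1, 1) x + r 2 x * c (2, 1) x = 0"
        "\<And>x. x \<in> V \<inter> L \<Longrightarrow> r 0 x * c (0, 2) x + r 1 x * c (1, 2) x + r 2 x * c (2, 2) x = 0"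
    have rr: "restrict (r j) V \<in> regular Y V" if "j < 3" for j
      by (rule regular_lambda[OF Y zV]) (use r that in \<open>auto simp: R_def less3\<close>)
    define M where "M j = smul (normal_sheaf Y L) V (restrict (r j) V) (\<eta>V j)" for j
    have Mn: "M j \<in> normal_homs Y L V" if "j < 3" for j
      unfolding M_def normal_simps by (rule normal_homs_smul[OF zV \<eta>Vn[OF that] rr[OF that]])
    define Z where "Z = sadd (normal_sheaf Y L) V (sadd (normal_sheaf Y L) V (M 0) (M 1)) (M 2)"
    have M01: "sadd (normal_sheaf Y L) V (M 0) (M 1) \<in> normal_homs Y L V"
      unfolding normal_simps by (rule normal_homs_add[OF zV Mn Mn]) auto
    have Zn: "Z \<in> normal_homs Y L V" unfolding Z_def normal_simps(2)[of Y L V _ "M 2"]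
      by (rule normal_homs_add[OF zV M01 Mn]) auto
    \<comment> \<open>The zero section, written as 0 times a section so that linearity of H computes
      its image.\<close>
    define N where "N = smul (normal_sheaf Y L) V (restrict (\<lambda>x. 0) V) (\<eta>V 0)"
    have r0: "restrict (\<lambda>x. 0) V \<in> regular Y V"
      by (rule regular_lambda[OF Y zV local_quot_const]) (use YP in blast)
    have Nn: "N \<in> normal_homs Y L V" unfolding N_def normal_simps
      by (rule normal_homs_smul[OF zV \<eta>Vn r0]) simp
    have HM: "nth3 (H V (M j)) i v = r j (pt v) * \<sigma> j i v"
      if "i < 3" "j < 3" "v \<in> cone (V \<inter> L)" for i j v
    proof -
      have pv: "pt v \<in> V \<inter> L" using that cone_L[OF zV] by blast
      have "H V (M j) = smul (twist3 L d) V (restrict (r j) V) (H V (\<eta>V j))"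
        unfolding M_def by (rule Hmul[OF VY rr[OF that(2)] \<eta>Vn[OF that(2)]])
      then show ?thesis
        using twist3_ops(2)[OF that(1), of L d V "restrict (r j) V" "H V (\<eta>V j)"] H\<eta>V[OF that] that pv by simp
    qed
    have HN: "nth3 (H V N) i v = 0" if "i < 3" "v \<in> cone (V \<inter> L)" for i v
    proof -
      have pv: "pt v \<in> V \<inter> L" using that cone_L[OF zV] by blast
      have "H V N = smul (twist3 L d) V (restrict (\<lambda>x. 0) V) (H V (\<eta>V 0))"
        unfolding N_def by (rule Hmul[OF VY r0 \<eta>Vn]) simp
      then show ?thesis
        using twist3_ops(2)[OF that(1), of L d V "restrict (\<lambda>x. 0) V" "H V (\<eta>V 0)"] that pv by simp
    qed
    have HZ: "nth3 (H V Z) i v = r 0 (pt v) * \<sigma> 0 i v + r 1 (pt v) * \<sigma> 1 i v + r 2 (pt v) * \<sigma> 2 i v"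
      if "i < 3" "v \<in> cone (V \<inter> L)" for i v
    proof -
      have "H V Z = sadd (twist3 L d) V (H V (sadd (normal_sheaf Y L) V (M 0) (M 1))) (H V (M 2))"
        unfolding Z_def by (rule Hadd[OF VY M01 Mn]) simp
      also have "H V (sadd (normal_sheaf Y L) V (M 0) (M 1)) = sadd (twist3 L d) V (H V (M 0)) (H V (M 1))"
        by (rule Hadd[OF VY Mn Mn]) simp_all
      finally have "nth3 (H V Z) i v = nth3 (H V (M 0)) i v + nth3 (H V (M 1)) i v + nth3 (H V (M 2)) i v"
        using that(2) by (simp only: twist3_ops(1)[OF that(1)] restrict_apply' if_True)
      then show ?thesis using HM[OF that(1) _ that(2)] by simp
    qed
    have "H V Z = H V N"
    proof (rule nth3_eqI)
      fix i :: nat assume i: "i < 3"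
      have "nth3 (H V Z) i \<in> extensional (cone (V \<inter> L))" "nth3 (H V N) i \<in> extensional (cone (V \<inter> L))"
        using Hin[OF VY Zn] Hin[OF VY Nn] i unfolding twist3_sec twist_iff[OF zV] by blast+
      then show "nth3 (H V Z) i = nth3 (H V N) i"
      proof (rule extensionalityI)
        fix v assume v: "v \<in> cone (V \<inter> L)"
        then have v': "v \<noteq> 0" "pt v \<in> V \<inter> L" using cone_L[OF zV] by auto
        have lv: "l v \<noteq> 0" using v' Vl pt_in_basic[OF l v'(1)] by blast
        have vV0: "pt v \<in> V0 \<inter> L" using v' unfolding V_def by blast
        have cs: "\<sigma> j i' v = l v * c (j, i') (pt v)" if "j < 3" "i' = 1 \<or> i' = 2" for j i'
          using ca[of "(j, i')" v] that v'(1) vV0 lv by auto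
        consider "i = 0" | "i = 1" | "i = 2" using i by linarith
        then have "r 0 (pt v) * \<sigma> 0 i v + r 1 (pt v) * \<sigma> 1 i v + r 2 (pt v) * \<sigma> 2 i v = 0"
        proof cases
          case 1
          then show ?thesis using \<sigma>0[of _ v] v' by simp
        next
          case 2
          have "r 0 (pt v) * \<sigma> 0 i v + r 1 (pt v) * \<sigma> 1 i v + r 2 (pt v) * \<sigma> 2 i v =
            l v * (r 0 (pt v) * c (0, 1) (pt v) + r 1 (pt v) * c (1, 1) (pt v) + r 2 (pt v) * c (2, 1) (pt v))"
            using 2 cs[of _ 1] by (simp add: algebra_simps)
          then show ?thesis using rel(1)[OF v'(2)] by simp
        next
          case 3
          have "r 0 (pt v) * \<sigma> 0 i v + r 1 (pt v) * \<sigma> 1 i v + r 2 (pt v) * \<sigma> 2 i v =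
            l v * (r 0 (pt v) * c (0, 2) (pt v) + r 1 (pt v) * c (1, 2) (pt v) + r 2 (pt v) * c (2, 2) (pt v))"
            using 3 cs[of _ 2] by (simp add: algebra_simps)
          then show ?thesis using rel(2)[OF v'(2)] by simp
        qed
        then show "nth3 (H V Z) i v = nth3 (H V N) i v" using HZ[OF i v] HN[OF i v] by simp
      qed
    qed
    then have ZN: "Z = N" by (rule Hinj[OF VY Zn Nn])
    show "\<forall>x\<in>V \<inter> L. r 0 x = 0 \<and> r 1 x = 0 \<and> r 2 x = 0"
    proof
      fix x assume x: "x \<in> V \<inter> L"
      have "x \<in> Proj" using x LP by blast
      then obtain v where v: "v \<noteq> 0" "x = pt v" by (rule ProjE)
      have lv: "l v \<noteq> 0" using v x Vl pt_in_basic[OF l v(1)] by blast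
      have "r i x = 0" if i: "i < 3" for i
      proof -
        let ?X = "restrict (coordfun l (q i)) V"
        have X: "?X \<in> idl Y L V" by (rule coordfun_idl[OF fr i zV Vl])
        have th: "\<theta> i v \<noteq> 0" using fr i v x lv by (auto simp: frame_def)
        have xv: "pt v \<in> V \<inter> L" using x v by simp
        have e: "\<eta>V j V ?X x = (if i = j then \<theta> i v / l v else 0)" if "j < 3" for j
          using \<eta>e[OF that zV X v(1) xv] coordfun_der[OF fr i that zV Vl tf[OF that] v(1) xv] VV v(2)
          unfolding \<eta>V_def by simp
        have "Z V ?X x = r 0 x * \<eta>V 0 V ?X x + r 1 x * \<eta>V 1 V ?X x + r 2 x * \<eta>V 2 V ?X x"
          unfolding Z_def M_def normal_simps using VV X x by simp
        moreover have "N V ?X x = 0" unfolding N_def normal_simps using VV X x by simp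
        ultimately have "r i x * (\<theta> i v / l v) = 0" using ZN e[of 0] e[of 1] e[of 2] i unfolding less3 by auto
        then show ?thesis using th lv by simp
      qed
      from this[of 0] this[of 1] this[of 2] show "r 0 x = 0 \<and> r 1 x = 0 \<and> r 2 x = 0" by simp
    qed
  qed
  then show False using x0V by blast
qed

end

section \<open>Multilinear algebra of the fourfold and its tangent vectors\<close>

section \<open>Bivectors\<close>

lemma exhaust_5:
  fixes x :: 5
  shows "x = 0 \<or> x = 1 \<or> x = 2 \<or> x = 3 \<or> x = 4"
proof (induct x)
  case (of_int z)
  then have "0 \<le> z" "z < 5" by simp_all
  then have "z = 0 \<or> z = 1 \<or> z = 2 \<or> z = 3 \<or> z = 4" by arith
  then show ?case by auto
qed

lemma UNIV_5: "UNIV = {0, 1, 2, 3, 4 :: 5}"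
  using exhaust_5 by auto

lemma forall_5: "(\<forall>i::5. P i) \<longleftrightarrow> P 0 \<and> P 1 \<and> P 2 \<and> P 3 \<and> P 4"
  by (metis exhaust_5)

lemma sum_5: "sum f (UNIV :: 5 set) = f 0 + f 1 + f 2 + f 3 + f 4"
  unfolding UNIV_5 by (simp add: add.assoc)

lemma wedge_index: "wedge u w $ (i, j) = u $ i * w $ j - u $ j * w $ i"
  by (simp add: wedge_def)

lemma wedge_add_left: "wedge (u + u') w = wedge u w + wedge u' w"
  and wedge_add_right: "wedge u (w + w') = wedge u w + wedge u w'"
  and wedge_scale_left: "wedge (k *s u) w = k *s wedge u w"
  and wedge_scale_right: "wedge u (k *s w) = k *s wedge u w"
  and wedge_self: "wedge u u = 0"
  and wedge_swap: "wedge w u = - wedge u w"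
  and wedge_zero_left: "wedge 0 w = 0"
  and wedge_zero_right: "wedge u 0 = 0"
  by (simp_all add: vec_eq_iff wedge_def algebra_simps)

lemmas wedge_bilinear = wedge_add_left wedge_add_right wedge_scale_left wedge_scale_right wedge_self
  wedge_zero_left wedge_zero_right

lemma wedge_eq_0_iff: "wedge u w = 0 \<longleftrightarrow> u = 0 \<or> (\<exists>k. w = k *s u)"
proof
  assume 0: "wedge u w = 0"
  show "u = 0 \<or> (\<exists>k. w = k *s u)"
  proof (cases "u = 0")
    case False
    then obtain i where i: "u $ i \<noteq> 0" by (auto simp: vec_eq_iff)
    have "w $ j = (w $ i / u $ i) * u $ j" for j
      using arg_cong[OF 0, of "\<lambda>v. v $ (i, j)"] i by (simp add: wedge_index field_simps)
    then have "w = (w $ i / u $ i) *s u" unfolding vec_eq_iff vector_smult_component by blast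
    then show ?thesis by blast
  qed simp
qed (auto simp: wedge_bilinear)

lemma wedge_neq_0_independent:
  "wedge u w \<noteq> 0 \<longleftrightarrow> (\<forall>a b. a *s u + b *s w = 0 \<longrightarrow> a = 0 \<and> b = 0)"
proof
  assume n: "wedge u w \<noteq> 0"
  show "\<forall>a b. a *s u + b *s w = 0 \<longrightarrow> a = 0 \<and> b = 0"
  proof (intro allI impI)
    fix a b assume 0: "a *s u + b *s w = 0"
    have "wedge (a *s u + b *s w) w = a *s wedge u w" "wedge u (a *s u + b *s w) = b *s wedge u w"
      by (simp_all add: wedge_bilinear)
    then have "a *s wedge u w = 0" "b *s wedge u w = 0" unfolding 0 by (simp_all add: wedge_bilinear)
    then show "a = 0 \<and> b = 0" using n by (auto simp: vec_eq_iff)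
  qed
next
  assume *: "\<forall>a b. a *s u + b *s w = 0 \<longrightarrow> a = 0 \<and> b = 0"
  show "wedge u w \<noteq> 0"
  proof
    assume "wedge u w = 0"
    then consider "u = 0" | k where "w = k *s u" unfolding wedge_eq_0_iff by blast
    then show False
    proof cases
      case 1
      then show False using *[rule_format, of 1 0] by simp
    next
      case 2
      then have "k *s u + (- 1) *s w = 0" by (simp add: vec_eq_iff)
      then show False using * by fastforce
    qed
  qed
qed

lemma in_span2:
  fixes v :: "complex ^ 'n"
  shows "v \<in> vec.span {u, w} \<longleftrightarrow> (\<exists>a b. v = a *s u + b *s w)"
proof -
  have "v \<in> vec.span {u, w} \<longleftrightarrow> (\<exists>a. v - a *s u \<in> pt w)" by (simp add: vec.span_breakdown_eq)
  also have "\<dots> \<longleftrightarrow> (\<exists>a b. v - a *s u = b *s w)" by (simp add: in_pt)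
  also have "\<dots> \<longleftrightarrow> (\<exists>a b. v = a *s u + b *s w)" by (simp add: diff_eq_eq add.commute)
  finally show ?thesis .
qed

lemma Gr2_iff: "W \<in> Gr 2 \<longleftrightarrow> (\<exists>u w. W = vec.span {u, w} \<and> wedge u w \<noteq> 0)"
proof
  assume "W \<in> Gr 2"
  then have W: "vec.subspace W" "vec.dim W = 2" by (auto simp: Gr_def)
  obtain B where B: "B \<subseteq> W" "vec.independent B" "W \<subseteq> vec.span B" "card B = vec.dim W"
    using vec.basis_exists by blast
  then obtain u w where uw: "B = {u, w}" "u \<noteq> w" using W by (auto simp: card_2_iff)
  have "W = vec.span {u, w}" using B W(1) unfolding uw by (simp add: subset_antisym vec.span_minimal)
  moreover have "wedge u w \<noteq> 0"
  proof
    assume "wedge u w = 0"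
    then have "u = 0 \<or> w \<in> pt u" unfolding wedge_eq_0_iff in_pt .
    moreover have "vec.independent {w, u}" using B uw by (simp add: insert_commute)
    ultimately show False using uw(2) by (auto simp: vec.independent_insert)
  qed
  ultimately show "\<exists>u w. W = vec.span {u, w} \<and> wedge u w \<noteq> 0" by blast
next
  assume "\<exists>u w. W = vec.span {u, w} \<and> wedge u w \<noteq> 0"
  then obtain u w where W: "W = vec.span {u, w}" "wedge u w \<noteq> 0" by blast
  then have n: "u \<noteq> 0" "w \<notin> pt u" using wedge_eq_0_iff in_pt by blast+
  then have ne: "w \<noteq> u" by auto
  have "vec.independent {w, u}" using n ne by (simp add: vec.independent_insert)
  moreover have "W = vec.span {w, u}" using W by (simp add: insert_commute)
  ultimately show "W \<in> Gr 2" using ne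
    by (simp add: Gr_def vec.dim_span_eq_card_independent vec.dim_eq_card_independent)
qed

lemma pluecker_span2: "wedge u w \<noteq> 0 \<Longrightarrow> pluecker (vec.span {u, w}) = pt (wedge u w)"
proof -
  assume "wedge u w \<noteq> 0"
  let ?S = "{wedge a b | a b. a \<in> vec.span {u, w} \<and> b \<in> vec.span {u, w}}"
  have "?S \<subseteq> pt (wedge u w)"
  proof clarify
    fix a b assume "a \<in> vec.span {u, w}" "b \<in> vec.span {u, w}"
    then obtain x y z t where "a = x *s u + y *s w" "b = z *s u + t *s w" unfolding in_span2 by blast
    then have "wedge a b = (x * t - y * z) *s wedge u w"
      by (simp add: vec_eq_iff wedge_def algebra_simps)
    then show "wedge a b \<in> pt (wedge u w)" unfolding in_pt by blast
  qed
  then have "vec.span ?S \<subseteq> pt (wedge u w)" by (simp add: vec.span_minimal)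
  moreover have "u \<in> vec.span {u, w}" "w \<in> vec.span {u, w}" by (simp_all add: vec.span_base)
  then have "wedge u w \<in> ?S" by blast
  then have "pt (wedge u w) \<subseteq> vec.span ?S" by (simp add: vec.span_mono)
  ultimately show ?thesis unfolding pluecker_def by blast
qed

lemma span2_change:
  assumes "p = x *s u + y *s w" "q = z *s u + t *s w" "x * t - y * z \<noteq> (0 :: complex)"
  shows "vec.span {p, q} = vec.span {u, w}"
proof -
  let ?d = "x * t - y * z"
  have "u = (t / ?d) *s p + (- y / ?d) *s q"
  proof -
    have "t / ?d * x + - y / ?d * z = 1" "t / ?d * y + - y / ?d * t = 0"
      using assms(3) by (simp_all add: diff_divide_distrib[symmetric] add_divide_distrib[symmetric])
    moreover have "(t / ?d) *s p + (- y / ?d) *s q =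
      (t / ?d * x + - y / ?d * z) *s u + (t / ?d * y + - y / ?d * t) *s w"
      unfolding assms(1,2) by (simp add: vec_eq_iff algebra_simps)
    ultimately show ?thesis by simp
  qed
  moreover have "w = (- z / ?d) *s p + (x / ?d) *s q"
  proof -
    have "- z / ?d * x + x / ?d * z = 0" "- z / ?d * y + x / ?d * t = 1"
      using assms(3) by (simp_all add: diff_divide_distrib[symmetric] add_divide_distrib[symmetric] algebra_simps)
    moreover have "(- z / ?d) *s p + (x / ?d) *s q =
      (- z / ?d * x + x / ?d * z) *s u + (- z / ?d * y + x / ?d * t) *s w"
      unfolding assms(1,2) by (simp add: vec_eq_iff algebra_simps)
    ultimately show ?thesis by simp
  qed
  ultimately have "u \<in> vec.span {p, q}" "w \<in> vec.span {p, q}" unfolding in_span2 by blast+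
  moreover have "p \<in> vec.span {u, w}" "q \<in> vec.span {u, w}" unfolding in_span2 using assms by blast+
  ultimately show ?thesis by (simp add: vec.span_eq)
qed

section \<open>Points and lines of the fourfold\<close>

definition om1 :: "complex ^ (5 \<times> 5) \<Rightarrow> complex" where
  "om1 v = v $ (1, 2) - v $ (0, 3)"

definition om2 :: "complex ^ (5 \<times> 5) \<Rightarrow> complex" where
  "om2 v = v $ (1, 3) - v $ (2, 4)"

lemma form_om: "form 1 om1" "form 1 om2"
  unfolding om1_def[abs_def] om2_def[abs_def] by (intro form_diff form.coord)+

lemma form_1_simps:
  assumes "form 1 f"
  shows "f (v + w) = f v + f w" "f (k *s v) = k * f v" "f 0 = 0" "f (- v) = - f v" "f (v - w) = f v - f w"
proof -
  show add: "f (v + w) = f v + f w" for v w by (rule form_1_add[OF assms refl])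
  show sc: "f (k *s v) = k * f v" for k v using form_scale[OF assms] by simp
  show "f 0 = 0" using sc[of 0 0] by simp
  show m: "f (- v) = - f v" for v using sc[of "-1" v] by simp
  show "f (v - w) = f v - f w" using add[of v "- w"] m[of w] by simp
qed

lemma dP5_Proj: "dP5 \<subseteq> Proj"
proof
  fix x assume "x \<in> dP5"
  then obtain W :: "5 subsp" where "W \<in> Gr 2" "x = pluecker W" by (auto simp: dP5_def)
  then show "x \<in> Proj" unfolding Gr2_iff using pluecker_span2 pt_in_Proj by metis
qed

lemma pt_in_dP5:
  assumes "v \<noteq> 0"
  shows "pt v \<in> dP5 \<longleftrightarrow> (\<exists>u w. v = wedge u w) \<and> om1 v = 0 \<and> om2 v = 0"
proof
  assume pv: "pt v \<in> dP5"
  then have "\<exists>W::5 subsp. W \<in> Gr 2 \<and> pt v = pluecker W" by (auto simp: dP5_def)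
  then obtain u w :: "complex ^ 5" where uw: "wedge u w \<noteq> 0" "pt v = pt (wedge u w)"
    unfolding Gr2_iff using pluecker_span2 by metis
  then obtain k where "v = k *s wedge u w" using assms pt_eq_iff by blast
  then have "v = wedge (k *s u) w" by (simp add: wedge_bilinear)
  moreover have "v \<in> pt v" by simp
  then have "om1 v = 0 \<and> om2 v = 0" using pv unfolding dP5_def om1_def om2_def by blast
  ultimately show "(\<exists>u w. v = wedge u w) \<and> om1 v = 0 \<and> om2 v = 0" by blast
next
  assume *: "(\<exists>u w. v = wedge u w) \<and> om1 v = 0 \<and> om2 v = 0"
  then obtain u w :: "complex ^ 5" where v: "v = wedge u w" by blast
  have "pt v = pluecker (vec.span {u, w})" unfolding v by (rule pluecker_span2[symmetric]) (use assms v in simp)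
  moreover have "vec.span {u, w} \<in> Gr 2" unfolding Gr2_iff using assms v by blast
  moreover have "\<forall>p\<in>pt v. p $ (1, 2) - p $ (0, 3) = 0 \<and> p $ (1, 3) - p $ (2, 4) = 0"
  proof
    fix p assume "p \<in> pt v"
    then obtain k where "p = k *s v" by (auto simp: in_pt)
    then have "om1 p = 0" "om2 p = 0" using * form_1_simps(2)[OF form_om(1)] form_1_simps(2)[OF form_om(2)] by auto
    then show "p $ (1, 2) - p $ (0, 3) = 0 \<and> p $ (1, 3) - p $ (2, 4) = 0"
      by (simp add: om1_def om2_def)
  qed
  ultimately show "pt v \<in> dP5" unfolding dP5_def by blast
qed

text \<open>If the two planes meet, a common vector is the common factor a. Otherwise the four
  vectors are independent, and contracting the sum with functionals dual to them puts all four into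
  the span of x and y, which is too small.\<close>

lemma decomposable_sum:
  assumes n: "wedge u w \<noteq> 0" "wedge u' w' \<noteq> 0" and sum: "wedge u w + wedge u' w' = wedge x y"
  shows "\<exists>a b c. a \<noteq> 0 \<and> wedge u w = wedge a b \<and> wedge u' w' = wedge a c"
proof (cases "\<exists>p q r t. (p \<noteq> 0 \<or> q \<noteq> 0) \<and> p *s u + q *s w = r *s u' + t *s w'")
  case True
  then obtain p q r t where pq: "p \<noteq> 0 \<or> q \<noteq> 0" and e: "p *s u + q *s w = r *s u' + t *s w'" by blast
  let ?a = "p *s u + q *s w"
  have a0: "?a \<noteq> 0" using n(1) pq unfolding wedge_neq_0_independent by blast
  have fact: "\<exists>b. wedge u w = wedge (p *s u + q *s w) b" if "p \<noteq> 0 \<or> q \<noteq> 0" for p q :: complex and u w :: "complex ^ 'a"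
  proof (cases "p = 0")
    case False
    then have "wedge u w = wedge (p *s u + q *s w) (inverse p *s w)"
      by (simp add: wedge_bilinear vector_smult_assoc)
    then show ?thesis by blast
  next
    case True
    then have "wedge u w = wedge (p *s u + q *s w) (- inverse q *s u)" using that
      by (simp add: True vec_eq_iff wedge_def field_simps)
    then show ?thesis by blast
  qed
  have "r \<noteq> 0 \<or> t \<noteq> 0" using a0 e by auto
  then obtain c where "wedge u' w' = wedge ?a c" using fact[of r t u' w'] e by auto
  moreover obtain b where "wedge u w = wedge ?a b" using fact[OF pq] by blast
  ultimately show ?thesis using a0 by blast
next
  case False
  define S where "S = {u, w, u', w'}"
  have ind: "p = 0 \<and> q = 0 \<and> r = 0 \<and> t = 0" if e: "p *s u + q *s w + r *s u' + t *s w' = 0" for p q r t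
  proof -
    have e': "p *s u + q *s w = (- r) *s u' + (- t) *s w'"
    proof -
      have "(p *s u + q *s w) + (r *s u' + t *s w') = 0" using e by (simp add: add.assoc)
      then have "p *s u + q *s w = - (r *s u' + t *s w')" by (simp only: eq_neg_iff_add_eq_0)
      then show ?thesis by (simp add: vec_eq_iff)
    qed
    then have pq: "p = 0 \<and> q = 0" using False by blast
    then have "r *s u' + t *s w' = 0" using e by simp
    then show ?thesis using pq n(2) unfolding wedge_neq_0_independent by blast
  qed
  have distinct: "distinct [u, w, u', w']"
  proof -
    have "u \<noteq> w" using ind[of 1 "-1" 0 0] by auto
    moreover have "u \<noteq> u'" using ind[of 1 0 "-1" 0] by auto
    moreover have "u \<noteq> w'" using ind[of 1 0 0 "-1"] by auto
    moreover have "w \<noteq> u'" using ind[of 0 1 "-1" 0] by auto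
    moreover have "w \<noteq> w'" using ind[of 0 1 0 "-1"] by auto
    moreover have "u' \<noteq> w'" using ind[of 0 0 1 "-1"] by auto
    ultimately show ?thesis by simp
  qed
  have finS: "finite S" by (simp add: S_def)
  have indS: "vec.independent S"
    unfolding vec.dependent_finite[OF finS]
  proof (rule notI, elim exE conjE bexE)
    fix c v assume v: "v \<in> S" "c v \<noteq> 0" and 0: "(\<Sum>v\<in>S. c v *s v) = 0"
    have "(\<Sum>v\<in>S. c v *s v) = c u *s u + c w *s w + c u' *s u' + c w' *s w'"
      unfolding S_def using distinct by (simp add: add.assoc)
    then have "c u = 0 \<and> c w = 0 \<and> c u' = 0 \<and> c w' = 0" using 0 ind by simp
    then show False using v unfolding S_def by auto
  qed
  \<comment> \<open>Contracting both sides with \<phi> leaves r on the left, since \<phi> kills all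
    but p, and a combination of x and y on the right.\<close>
  have contract: "r \<in> vec.span {x, y}" if r: "\<phi> p = 1 \<and> \<phi> r = 0 \<and> \<phi> p' = 0 \<and> \<phi> r' = 0"
    and \<phi>: "Vector_Spaces.linear (*s) (*) \<phi>" and eq: "wedge p r + wedge p' r' = k *s wedge x y" for p r p' r' \<phi> k
  proof -
    interpret \<phi>: Vector_Spaces.linear "(*s)" "(*)" \<phi> by (rule \<phi>)
    have lin: "(\<Sum>i\<in>UNIV. \<phi> (axis i 1) * z $ i) = \<phi> z" for z
    proof -
      have "\<phi> z = \<phi> (\<Sum>i\<in>UNIV. z $ i *s axis i 1)" by (simp add: basis_expansion)
      also have "\<dots> = (\<Sum>i\<in>UNIV. z $ i * \<phi> (axis i 1))"
        by (simp add: \<phi>.sum \<phi>.scale)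
      finally show ?thesis by (simp add: mult.commute)
    qed
    have con: "(\<Sum>i\<in>UNIV. \<phi> (axis i 1) * wedge z z' $ (i, j)) = \<phi> z * z' $ j - \<phi> z' * z $ j" for z z' j
    proof -
      have "(\<Sum>i\<in>UNIV. \<phi> (axis i 1) * wedge z z' $ (i, j)) =
        (\<Sum>i\<in>UNIV. \<phi> (axis i 1) * z $ i) * z' $ j - (\<Sum>i\<in>UNIV. \<phi> (axis i 1) * z' $ i) * z $ j"
        by (simp add: wedge_index algebra_simps sum_subtractf sum_distrib_left)
      then show ?thesis unfolding lin .
    qed
    have "r $ j = (k * \<phi> x) * y $ j + (- k * \<phi> y) * x $ j" for j
    proof -
      have "r $ j = (\<Sum>i\<in>UNIV. \<phi> (axis i 1) * (wedge p r + wedge p' r') $ (i, j))"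
        using con[of p r j] con[of p' r' j] r by (simp add: algebra_simps sum.distrib)
      also have "\<dots> = k * (\<Sum>i\<in>UNIV. \<phi> (axis i 1) * wedge x y $ (i, j))"
        unfolding eq by (simp add: sum_distrib_left algebra_simps)
      finally show ?thesis unfolding con by (simp add: algebra_simps)
    qed
    then have "r = (k * \<phi> x) *s y + (- k * \<phi> y) *s x"
      unfolding vec_eq_iff vector_smult_component vector_add_component by blast
    then have "r = (- k * \<phi> y) *s x + (k * \<phi> x) *s y" by (simp only: add.commute)
    then show ?thesis unfolding in_span2 by blast
  qed
  have dualf: "\<exists>\<phi>. Vector_Spaces.linear (*s) (*) \<phi> \<and> \<phi> p = (1::complex) \<and> (\<forall>z\<in>S - {p}. \<phi> z = 0)"
    if "p \<in> S" for p
  proof -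
    interpret vector_space_pair "(*s) :: complex \<Rightarrow> complex ^ 'a \<Rightarrow> _" "(*) :: complex \<Rightarrow> complex \<Rightarrow> complex"
      by unfold_locales (auto simp: algebra_simps)
    obtain \<phi> where "Vector_Spaces.linear (*s) (*) \<phi>" "\<forall>z\<in>S. \<phi> z = (if z = p then 1 else 0)"
      using linear_independent_extend[OF indS, of "\<lambda>z. if z = p then 1 else 0"] by blast
    then show ?thesis using that by (intro exI[of _ \<phi>]) auto
  qed
  have sp: "w \<in> vec.span {x, y}" "u \<in> vec.span {x, y}" "w' \<in> vec.span {x, y}" "u' \<in> vec.span {x, y}"
  proof -
    obtain \<phi> where "Vector_Spaces.linear (*s) (*) \<phi>" "\<phi> u = (1::complex)" "\<forall>z\<in>S - {u}. \<phi> z = 0"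
      using dualf[of u] unfolding S_def by blast
    then show "w \<in> vec.span {x, y}" using sum distinct unfolding S_def
      by (intro contract[of \<phi> u w u' w' 1]) auto
    obtain \<phi> where "Vector_Spaces.linear (*s) (*) \<phi>" "\<phi> w = (1::complex)" "\<forall>z\<in>S - {w}. \<phi> z = 0"
      using dualf[of w] unfolding S_def by blast
    then show "u \<in> vec.span {x, y}" using sum distinct unfolding S_def
      by (intro contract[of \<phi> w u w' u' "-1"]) (auto simp: wedge_swap[of w u] wedge_swap[of w' u'] simp flip: sum)
    obtain \<phi> where "Vector_Spaces.linear (*s) (*) \<phi>" "\<phi> u' = (1::complex)" "\<forall>z\<in>S - {u'}. \<phi> z = 0"
      using dualf[of u'] unfolding S_def by blast
    then show "w' \<in> vec.span {x, y}" using sum distinct unfolding S_def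
      by (intro contract[of \<phi> u' w' u w 1]) (auto simp: add.commute)
    obtain \<phi> where "Vector_Spaces.linear (*s) (*) \<phi>" "\<phi> w' = (1::complex)" "\<forall>z\<in>S - {w'}. \<phi> z = 0"
      using dualf[of w'] unfolding S_def by blast
    then show "u' \<in> vec.span {x, y}" using sum distinct unfolding S_def
      by (intro contract[of \<phi> w' u' w u "-1"]) (auto simp: wedge_swap[of w u] wedge_swap[of w' u'] add.commute simp flip: sum)
  qed
  have "card S \<le> card {x, y}"
    using vec.independent_span_bound[OF _ indS, of "{x, y}"] sp unfolding S_def by auto
  moreover have "card S = 4" unfolding S_def using distinct by auto
  moreover have "card {x, y} \<le> 2" by (simp add: card_insert_le_m1)
  ultimately show ?thesis by simp
qed

text \<open>It suffices to know that p, q and p + q, three points of the line, are decomposable: two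
  bivectors with decomposable sum have a common factor, which spans the vertex.\<close>

lemma line_vertex:
  assumes "\<Lambda> \<in> lines_in dP5"
  shows "\<exists>a b c. \<Lambda> = vec.span {wedge a b, wedge a c} \<and> wedge (wedge a b) (wedge a c) \<noteq> 0 \<and>
    om1 (wedge a b) = 0 \<and> om2 (wedge a b) = 0 \<and> om1 (wedge a c) = 0 \<and> om2 (wedge a c) = 0"
proof -
  obtain p q where pq: "\<Lambda> = vec.span {p, q}" "wedge p q \<noteq> 0"
    using assms unfolding lines_in_def Gr2_iff by blast
  have sub: "points_of \<Lambda> \<subseteq> dP5" using assms by (simp add: lines_in_def)
  have ind: "a = 0 \<and> b = 0" if "a *s p + b *s q = 0" for a b
    using pq(2) that unfolding wedge_neq_0_independent by blast
  have pt\<Lambda>: "pt v \<in> dP5" if "v \<in> \<Lambda>" "v \<noteq> 0" for v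
  proof -
    have "vec.subspace \<Lambda>" unfolding pq(1) by (rule vec.subspace_span)
    then have "pt v \<subseteq> \<Lambda>" using that by (simp add: vec.span_minimal)
    then show ?thesis using sub that by (auto simp: points_of_def)
  qed
  have in\<Lambda>: "p \<in> \<Lambda>" "q \<in> \<Lambda>" "p + q \<in> \<Lambda>" unfolding pq(1)
    by (auto intro: vec.span_base vec.span_add)
  have n0: "p \<noteq> 0" "q \<noteq> 0" "p + q \<noteq> 0"
    using ind[of 1 0] ind[of 0 1] ind[of 1 1] by auto
  have p: "(\<exists>u w. p = wedge u w) \<and> om1 p = 0 \<and> om2 p = 0"
    and q: "(\<exists>u w. q = wedge u w) \<and> om1 q = 0 \<and> om2 q = 0"
    and s: "\<exists>u w. p + q = wedge u w"
    using pt\<Lambda>[OF in\<Lambda>(1) n0(1)] pt\<Lambda>[OF in\<Lambda>(2) n0(2)] pt\<Lambda>[OF in\<Lambda>(3) n0(3)] n0 by (simp_all add: pt_in_dP5)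
  obtain a b c where "p = wedge a b" "q = wedge a c"
    using p q s n0 decomposable_sum by metis
  then show ?thesis using pq p q by blast
qed

definition dot :: "complex ^ 'n \<Rightarrow> complex ^ 'n \<Rightarrow> complex" where
  "dot A u = (\<Sum>i\<in>UNIV. A $ i * u $ i)"

definition pcoord :: "complex ^ 'n \<Rightarrow> complex ^ 'n \<Rightarrow> complex ^ ('n \<times> 'n) \<Rightarrow> complex" where
  "pcoord A B v = (\<Sum>i\<in>UNIV. \<Sum>j\<in>UNIV. A $ i * B $ j * v $ (i, j))"

text \<open>If A is 1 on a and 0 on w, this recovers w from the bivector of a and w, linearly.
  Fields expressed through w thereby become forms in the point of the line.\<close>

definition contract :: "complex ^ 'n \<Rightarrow> complex ^ ('n \<times> 'n) \<Rightarrow> complex ^ 'n" where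
  "contract A v = (\<chi> j. \<Sum>i\<in>UNIV. A $ i * v $ (i, j))"

lemma dot_simps:
  "dot A (u + w) = dot A u + dot A w" "dot A (k *s u) = k * dot A u" "dot A 0 = 0"
  "dot A (u - w) = dot A u - dot A w" "dot A (- u) = - dot A u"
  by (simp_all add: dot_def algebra_simps sum.distrib sum_distrib_left sum_subtractf sum_negf)

lemma pcoord_wedge: "pcoord A B (wedge u w) = dot A u * dot B w - dot A w * dot B u"
proof -
  have "pcoord A B (wedge u w) =
    (\<Sum>i\<in>UNIV. \<Sum>j\<in>UNIV. (A $ i * u $ i) * (B $ j * w $ j)) - (\<Sum>i\<in>UNIV. \<Sum>j\<in>UNIV. (A $ i * w $ i) * (B $ j * u $ j))"
    unfolding pcoord_def by (simp add: wedge_index sum_subtractf[symmetric] algebra_simps)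
  then show ?thesis unfolding dot_def by (simp add: sum_product)
qed

lemma contract_wedge: "contract A (wedge u w) = dot A u *s w - dot A w *s u"
  by (simp add: vec_eq_iff contract_def dot_def wedge_index algebra_simps sum_subtractf sum_distrib_left)

lemma form_pcoord: "form 1 (pcoord A B)"
proof -
  have "form 1 (\<lambda>v. \<Sum>i\<in>UNIV. \<Sum>j\<in>UNIV. A $ i * B $ j * v $ (i, j))"
    by (intro form_sum form_cmult form.coord)
  then show ?thesis by (simp add: pcoord_def[abs_def])
qed

lemma form_contract: "form 1 (\<lambda>v. contract A v $ j)"
  unfolding contract_def vec_lambda_beta by (intro form_sum form_cmult form.coord)

lemma dual_basis_ex:
  fixes f :: "'n::finite \<Rightarrow> complex ^ 'n"
  assumes "\<And>r. (\<Sum>i\<in>UNIV. r i *s f i) = 0 \<Longrightarrow> \<forall>i. r i = 0"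
  shows "\<exists>\<phi>. \<forall>i j. dot (\<phi> i) (f j) = (if i = j then 1 else 0)"
proof -
  let ?N = "(\<chi> k i. f i $ k) :: complex ^ 'n ^ 'n"
  have "\<exists>B. B ** ?N = mat 1"
    unfolding matrix_left_invertible_independent_columns
  proof (intro allI impI)
    fix c i assume "(\<Sum>i\<in>UNIV. c i *s column i ?N) = 0"
    moreover have "column i ?N = f i" for i by (simp add: column_def vec_eq_iff)
    ultimately show "c i = 0" using assms by simp
  qed
  then obtain B :: "complex ^ 'n ^ 'n" where B: "B ** ?N = mat 1" by blast
  have "dot (B $ i) (f j) = (if i = j then 1 else 0)" for i j
    using arg_cong[OF B, of "\<lambda>M. M $ i $ j"] by (simp add: dot_def matrix_matrix_mult_def mat_def)
  then show ?thesis by blast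
qed

lemma dual_basis_expand:
  fixes f \<phi> :: "'n::finite \<Rightarrow> complex ^ 'n"
  assumes "\<And>i j. dot (\<phi> i) (f j) = (if i = j then 1 else 0)"
  shows "u = (\<Sum>i\<in>UNIV. dot (\<phi> i) u *s f i)"
proof -
  let ?M = "(\<chi> i. \<phi> i) :: complex ^ 'n ^ 'n"
  let ?N = "(\<chi> k i. f i $ k) :: complex ^ 'n ^ 'n"
  have "?M ** ?N = mat 1"
    using assms by (simp add: vec_eq_iff matrix_matrix_mult_def mat_def dot_def)
  then have NM: "?N ** ?M = mat 1" by (simp add: matrix_left_right_inverse)
  have "u = (?N ** ?M) *v u" unfolding NM by simp
  also have "\<dots> = ?N *v (?M *v u)" by (simp add: matrix_vector_mul_assoc)
  also have "\<dots> = (\<Sum>i\<in>UNIV. dot (\<phi> i) u *s f i)"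
    by (simp add: vec_eq_iff matrix_vector_mult_def dot_def mult.commute)
  finally show ?thesis .
qed

section \<open>Tangent vectors of the fourfold\<close>

lemma DERIV_small:
  fixes p q :: "complex \<Rightarrow> complex"
  assumes "p field_differentiable (at 0)" "q field_differentiable (at 0)" "q 0 \<noteq> 0"
  shows "((\<lambda>t. t\<^sup>2 * (p t / q t)) has_field_derivative 0) (at 0)"
proof -
  have "(\<lambda>t. p t / q t) field_differentiable (at 0)"
    by (rule field_differentiable_divide) (use assms in auto)
  then obtain D where D: "((\<lambda>t. p t / q t) has_field_derivative D) (at 0)"
    unfolding field_differentiable_def by blast
  have "((\<lambda>t::complex. t\<^sup>2) has_field_derivative 0) (at 0)" by (auto intro!: derivative_eq_intros)
  from DERIV_mult[OF this D] show ?thesis by simp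
qed

text \<open>If the equations \<open>g1 = g2 = 0\<close> can be corrected to first order by moving in two further
  directions along which no quadratic terms arise, then Cramer's rule gives a rational curve with the
  prescribed tangent vector.\<close>

lemma tangent_dP5:
  fixes a w u w' u1 w1 w2 :: "complex ^ 5"
  assumes g: "form 1 g1" "form 1 g2"
    and Y: "\<And>u w. wedge u w \<noteq> 0 \<Longrightarrow> g1 (wedge u w) = 0 \<Longrightarrow> g2 (wedge u w) = 0 \<Longrightarrow> pt (wedge u w) \<in> dP5"
    and v: "wedge a w \<noteq> 0" "g1 (wedge a w) = 0" "g2 (wedge a w) = 0"
    and \<xi>: "g1 (wedge u w + wedge a w') = 0" "g2 (wedge u w + wedge a w') = 0"
    and iso: "g1 (wedge u1 w1) = 0" "g1 (wedge u1 w2) = 0" "g2 (wedge u1 w1) = 0" "g2 (wedge u1 w2) = 0"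
    and det: "(g1 (wedge u1 w) + g1 (wedge a w1)) * g2 (wedge a w2) -
      (g2 (wedge u1 w) + g2 (wedge a w1)) * g1 (wedge a w2) \<noteq> 0"
  shows "tangent dP5 (wedge a w) (wedge u w + wedge a w')"
proof -
  note lin = form_1_simps[OF g(1)] form_1_simps[OF g(2)]
  \<comment> \<open>Along the curve \<open>\<gamma>\<close> the equation h = 0 reduces to
    \<open>d1 t * m h t + d2 t * n h t = t^2 * r h\<close>: the terms of order 0 and 1 vanish by the
    assumptions on the point and its velocity, the quadratic ones in d1, d2 by \<open>iso\<close>.
    Below, q is the determinant of this system for g1, g2, and d1, d2 its solution by Cramer; both
    are of order t^2, so the velocity is unaffected.\<close>
  define m where "m h t = h (wedge u1 w) + t * h (wedge u1 w') + h (wedge a w1) + t * h (wedge u w1)"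
    for h :: "complex ^ (5 \<times> 5) \<Rightarrow> complex" and t :: complex
  define n where "n h t = h (wedge a w2) + t * h (wedge u w2)"
    for h :: "complex ^ (5 \<times> 5) \<Rightarrow> complex" and t :: complex
  define r where "r h = - h (wedge u w')" for h :: "complex ^ (5 \<times> 5) \<Rightarrow> complex"
  define q where "q t = m g1 t * n g2 t - m g2 t * n g1 t" for t
  define d1 where "d1 t = t\<^sup>2 * ((r g1 * n g2 t - r g2 * n g1 t) / q t)" for t
  define d2 where "d2 t = t\<^sup>2 * ((m g1 t * r g2 - m g2 t * r g1) / q t)" for t
  define A where "A t = a + t *s u + d1 t *s u1" for t
  define B where "B t = w + t *s w' + d1 t *s w1 + d2 t *s w2" for t
  define \<gamma> where "\<gamma> t = wedge (A t) (B t)" for t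
  have diff: "(\<lambda>t. m h t) field_differentiable (at 0)" "(\<lambda>t. n h t) field_differentiable (at 0)" for h
    unfolding m_def n_def
    by (intro field_differentiable_add field_differentiable_mult field_differentiable_const
        field_differentiable_ident)+
  have qd: "q field_differentiable (at 0)" unfolding q_def
    by (intro field_differentiable_diff field_differentiable_mult diff)
  have q0: "q 0 \<noteq> 0" using det by (simp add: q_def m_def n_def)
  have D1: "(d1 has_field_derivative 0) (at 0)" unfolding d1_def
    by (rule DERIV_small[OF _ qd q0])
      (intro field_differentiable_diff field_differentiable_mult diff field_differentiable_const)
  have D2: "(d2 has_field_derivative 0) (at 0)" unfolding d2_def
    by (rule DERIV_small[OF _ qd q0])
      (intro field_differentiable_diff field_differentiable_mult diff field_differentiable_const)
  have d0: "d1 0 = 0" "d2 0 = 0" by (simp_all add: d1_def d2_def)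
  have AB0: "A 0 = a" "B 0 = w" by (simp_all add: A_def B_def d0)
  have DA: "((\<lambda>t. A t $ i) has_field_derivative u $ i) (at 0)" for i
    unfolding A_def by (auto intro!: derivative_eq_intros D1)
  have DB: "((\<lambda>t. B t $ i) has_field_derivative w' $ i) (at 0)" for i
    unfolding B_def by (auto intro!: derivative_eq_intros D1 D2)
  have D\<gamma>: "curve_deriv \<gamma> (wedge u w + wedge a w')"
    unfolding curve_deriv_def
  proof
    fix ij :: "5 \<times> 5"
    obtain i j where ij: "ij = (i, j)" by fastforce
    have "((\<lambda>t. A t $ i * B t $ j - A t $ j * B t $ i) has_field_derivative
       (u $ i * B 0 $ j + w' $ j * A 0 $ i) - (u $ j * B 0 $ i + w' $ i * A 0 $ j)) (at 0)"
      by (intro DERIV_diff DERIV_mult DA DB)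
    then show "((\<lambda>t. \<gamma> t $ ij) has_field_derivative (wedge u w + wedge a w') $ ij) (at 0)"
      unfolding \<gamma>_def ij wedge_index vector_add_component AB0 by (simp add: algebra_simps)
  qed
  have exp: "h (\<gamma> t) = h (wedge a w) + t * h (wedge u w + wedge a w') - t\<^sup>2 * r h + d1 t * m h t + d2 t * n h t
      + (d1 t)\<^sup>2 * h (wedge u1 w1) + d1 t * d2 t * h (wedge u1 w2)"
    if h: "form 1 h" for h t
    unfolding \<gamma>_def A_def B_def m_def n_def r_def
    by (simp add: wedge_bilinear form_1_simps[OF h] algebra_simps power2_eq_square)
  have eqs: "g1 (\<gamma> t) = 0 \<and> g2 (\<gamma> t) = 0" if t: "q t \<noteq> 0" for t
  proof -
    have 1: "d1 t * m g1 t + d2 t * n g1 t = t\<^sup>2 * r g1"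
    proof -
      have "d1 t * m g1 t + d2 t * n g1 t = t\<^sup>2 * r g1 * (q t / q t)"
        unfolding d1_def d2_def q_def by (simp add: divide_simps) (simp add: algebra_simps)
      then show ?thesis using t by simp
    qed
    have 2: "d1 t * m g2 t + d2 t * n g2 t = t\<^sup>2 * r g2"
    proof -
      have "d1 t * m g2 t + d2 t * n g2 t = t\<^sup>2 * r g2 * (q t / q t)"
        unfolding d1_def d2_def q_def by (simp add: divide_simps) (simp add: algebra_simps)
      then show ?thesis using t by simp
    qed
    show ?thesis unfolding exp[OF g(1)] exp[OF g(2)] using v \<xi> iso 1 2 by (simp add: algebra_simps)
  qed
  have ev1: "\<forall>\<^sub>F t in nhds 0. q t \<noteq> 0"
    using field_differentiable_imp_continuous_at[OF qd] q0
    unfolding isCont_def eventually_nhds_conv_at by (auto intro: tendsto_imp_eventually_ne)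
  obtain k where k: "wedge a w $ k \<noteq> 0" using v(1) by (auto simp: vec_eq_iff)
  have "isCont (\<lambda>t. \<gamma> t $ k) 0" using D\<gamma> unfolding curve_deriv_def by (blast intro: DERIV_isCont)
  moreover have g0: "\<gamma> 0 = wedge a w" by (simp add: \<gamma>_def AB0)
  ultimately have ev2: "\<forall>\<^sub>F t in nhds 0. \<gamma> t $ k \<noteq> 0" using k
    unfolding isCont_def eventually_nhds_conv_at by (auto intro: tendsto_imp_eventually_ne)
  have "\<forall>\<^sub>F t in nhds 0. \<gamma> t \<noteq> 0 \<and> pt (\<gamma> t) \<in> dP5"
    using ev1 ev2
  proof eventually_elim
    fix t assume t: "q t \<noteq> 0" "\<gamma> t $ k \<noteq> 0"
    have n: "\<gamma> t \<noteq> 0" using t(2) by auto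
    then show "\<gamma> t \<noteq> 0 \<and> pt (\<gamma> t) \<in> dP5" using Y eqs[OF t(1)] unfolding \<gamma>_def by blast
  qed
  then show ?thesis unfolding tangent_def tangent_curve_def using D\<gamma> g0 by blast
qed

section \<open>The normal sheaf of a line in coordinates adapted to it\<close>

section \<open>Lines in adapted bases\<close>

text \<open>The line has vertex \<open>f 0\<close> and plane spanned by \<open>f 0\<close>,
  \<open>f 1\<close>, \<open>f 2\<close>. On it all coordinates vanish except \<open>P 0 1\<close>
  and \<open>P 0 2\<close>, which serve as homogeneous coordinates of the line.\<close>

locale adapted =
  fixes f \<phi> :: "5 \<Rightarrow> complex ^ 5"
  assumes dual: "dot (\<phi> i) (f j) = (if i = j then 1 else 0)"
begin

definition P :: "5 \<Rightarrow> 5 \<Rightarrow> complex ^ (5 \<times> 5) \<Rightarrow> complex" where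
  "P i j = pcoord (\<phi> i) (\<phi> j)"

definition line :: "(5 \<times> 5) subsp" where
  "line = vec.span {wedge (f 0) (f 1), wedge (f 0) (f 2)}"

definition Lpts :: "(5 \<times> 5) subsp set" where
  "Lpts = points_of line"

lemma form_P: "form 1 (P i j)"
  unfolding P_def by (rule form_pcoord)

lemmas P_lin = form_1_simps[OF form_P]

lemma P_wedge: "P i j (wedge u w) = dot (\<phi> i) u * dot (\<phi> j) w - dot (\<phi> i) w * dot (\<phi> j) u"
  unfolding P_def by (rule pcoord_wedge)

lemma wedge_expand:
  "wedge u w = P 0 1 (wedge u w) *s wedge (f 0) (f 1) + P 0 2 (wedge u w) *s wedge (f 0) (f 2)
    + P 0 3 (wedge u w) *s wedge (f 0) (f 3) + P 0 4 (wedge u w) *s wedge (f 0) (f 4)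
    + P 1 2 (wedge u w) *s wedge (f 1) (f 2) + P 1 3 (wedge u w) *s wedge (f 1) (f 3)
    + P 1 4 (wedge u w) *s wedge (f 1) (f 4) + P 2 3 (wedge u w) *s wedge (f 2) (f 3)
    + P 2 4 (wedge u w) *s wedge (f 2) (f 4) + P 3 4 (wedge u w) *s wedge (f 3) (f 4)"
proof -
  define x y where "x i = dot (\<phi> i) u" and "y i = dot (\<phi> i) w" for i
  have u: "u = x 0 *s f 0 + x 1 *s f 1 + x 2 *s f 2 + x 3 *s f 3 + x 4 *s f 4"
    using dual_basis_expand[of \<phi> f u, OF dual] unfolding sum_5 x_def .
  have w: "w = y 0 *s f 0 + y 1 *s f 1 + y 2 *s f 2 + y 3 *s f 3 + y 4 *s f 4"
    using dual_basis_expand[of \<phi> f w, OF dual] unfolding sum_5 y_def .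
  have ui: "u $ i = x 0 * f 0 $ i + x 1 * f 1 $ i + x 2 * f 2 $ i + x 3 * f 3 $ i + x 4 * f 4 $ i" for i
    using arg_cong[OF u, of "\<lambda>v. v $ i"] by simp
  have wi: "w $ i = y 0 * f 0 $ i + y 1 * f 1 $ i + y 2 * f 2 $ i + y 3 * f 3 $ i + y 4 * f 4 $ i" for i
    using arg_cong[OF w, of "\<lambda>v. v $ i"] by simp
  have "wedge u w = (x 0 * y 1 - y 0 * x 1) *s wedge (f 0) (f 1) + (x 0 * y 2 - y 0 * x 2) *s wedge (f 0) (f 2)
    + (x 0 * y 3 - y 0 * x 3) *s wedge (f 0) (f 3) + (x 0 * y 4 - y 0 * x 4) *s wedge (f 0) (f 4)
    + (x 1 * y 2 - y 1 * x 2) *s wedge (f 1) (f 2) + (x 1 * y 3 - y 1 * x 3) *s wedge (f 1) (f 3)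
    + (x 1 * y 4 - y 1 * x 4) *s wedge (f 1) (f 4) + (x 2 * y 3 - y 2 * x 3) *s wedge (f 2) (f 3)
    + (x 2 * y 4 - y 2 * x 4) *s wedge (f 2) (f 4) + (x 3 * y 4 - y 3 * x 4) *s wedge (f 3) (f 4)"
    unfolding vec_eq_iff
  proof
    fix ij :: "5 \<times> 5"
    obtain i j where ij: "ij = (i, j)" by fastforce
    show "wedge u w $ ij = ((x 0 * y 1 - y 0 * x 1) *s wedge (f 0) (f 1) + (x 0 * y 2 - y 0 * x 2) *s wedge (f 0) (f 2)
    + (x 0 * y 3 - y 0 * x 3) *s wedge (f 0) (f 3) + (x 0 * y 4 - y 0 * x 4) *s wedge (f 0) (f 4)
    + (x 1 * y 2 - y 1 * x 2) *s wedge (f 1) (f 2) + (x 1 * y 3 - y 1 * x 3) *s wedge (f 1) (f 3)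
    + (x 1 * y 4 - y 1 * x 4) *s wedge (f 1) (f 4) + (x 2 * y 3 - y 2 * x 3) *s wedge (f 2) (f 3)
    + (x 2 * y 4 - y 2 * x 4) *s wedge (f 2) (f 4) + (x 3 * y 4 - y 3 * x 4) *s wedge (f 3) (f 4)) $ ij"
      unfolding ij vector_add_component vector_smult_component wedge_index
      unfolding ui wi by algebra
  qed
  then show ?thesis unfolding P_wedge x_def y_def .
qed

lemma f_nonzero: "wedge (f 0) (\<beta> *s f 1 + \<gamma> *s f 2) = 0 \<Longrightarrow> \<beta> = 0 \<and> \<gamma> = 0"
proof -
  assume 0: "wedge (f 0) (\<beta> *s f 1 + \<gamma> *s f 2) = 0"
  have "P 0 1 (wedge (f 0) (\<beta> *s f 1 + \<gamma> *s f 2)) = \<beta>" "P 0 2 (wedge (f 0) (\<beta> *s f 1 + \<gamma> *s f 2)) = \<gamma>"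
    by (simp_all add: P_wedge dot_simps dual)
  then show ?thesis unfolding 0 P_lin by simp
qed

lemma line_Gr2: "line \<in> Gr 2"
  unfolding line_def Gr2_iff
proof (intro exI conjI)
  show "wedge (wedge (f 0) (f 1)) (wedge (f 0) (f 2)) \<noteq> 0"
    unfolding wedge_neq_0_independent
  proof (intro allI impI)
    fix a b assume "a *s wedge (f 0) (f 1) + b *s wedge (f 0) (f 2) = 0"
    then show "a = 0 \<and> b = 0" using f_nonzero[of a b] by (simp add: wedge_bilinear)
  qed
qed simp

lemma in_L:
  assumes "v \<noteq> 0"
  shows "pt v \<in> Lpts \<longleftrightarrow> (\<exists>\<beta> \<gamma>. v = wedge (f 0) (\<beta> *s f 1 + \<gamma> *s f 2))"
proof -
  have "pt v \<in> Lpts \<longleftrightarrow> v \<in> line"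
  proof -
    have "pt v \<subseteq> line \<longleftrightarrow> v \<in> line"
    proof
      show "v \<in> line \<Longrightarrow> pt v \<subseteq> line"
        by (rule vec.span_minimal) (simp_all add: line_def)
    qed (use self_in_pt in blast)
    then show ?thesis unfolding Lpts_def points_of_def using assms by simp
  qed
  then show ?thesis unfolding line_def in_span2 by (simp add: wedge_bilinear)
qed

lemma in_LE:
  assumes "v \<noteq> 0" "pt v \<in> Lpts"
  obtains "v = wedge (f 0) (P 0 1 v *s f 1 + P 0 2 v *s f 2)" "P 0 1 v \<noteq> 0 \<or> P 0 2 v \<noteq> 0"
proof -
  obtain \<beta> \<gamma> where v: "v = wedge (f 0) (\<beta> *s f 1 + \<gamma> *s f 2)" using assms in_L by blast
  have "P 0 1 v = \<beta>" "P 0 2 v = \<gamma>" unfolding v by (simp_all add: P_wedge dot_simps dual)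
  moreover have "\<beta> \<noteq> 0 \<or> \<gamma> \<noteq> 0" using v assms(1) by (auto simp: wedge_bilinear)
  ultimately show ?thesis using that v by blast
qed

lemma no_sections_L:
  assumes s: "\<And>x. x \<in> Lpts \<Longrightarrow> local_quot Lpts x (- 1) s" and v: "v \<noteq> 0" "pt v \<in> Lpts"
  shows "s v = 0"
proof -
  let ?p = "wedge (f 0) (f 1)" and ?q = "wedge (f 0) (f 2)"
  obtain \<beta> \<gamma> where vb: "v = \<beta> *s ?p + \<gamma> *s ?q" using v in_L by (auto simp: wedge_bilinear)
  have comb: "a *s ?p + b *s ?q = 0 \<Longrightarrow> a = 0 \<and> b = 0" for a b
    using f_nonzero[of a b] by (simp add: wedge_bilinear)
  have "\<exists>w x y. w = x *s ?p + y *s ?q \<and> w \<notin> pt v"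
  proof (cases "\<beta> = 0")
    case True
    have "?p \<notin> pt v"
    proof
      assume "?p \<in> pt v"
      then obtain k where "?p = k *s v" by (auto simp: in_pt)
      then have "1 *s ?p + (- (k * \<gamma>)) *s ?q = 0" unfolding vb True
        by (simp add: vector_smult_assoc vector_sneg_minus1[symmetric])
      then show False using comb by fastforce
    qed
    then show ?thesis by (intro exI[of _ ?p] exI[of _ 1] exI[of _ 0]) simp
  next
    case False
    have "?q \<notin> pt v"
    proof
      assume "?q \<in> pt v"
      then obtain k where k: "?q = k *s v" by (auto simp: in_pt)
      then have "?q = (k * \<beta>) *s ?p + (k * \<gamma>) *s ?q" unfolding vb
        by (simp add: vector_smult_assoc vector_add_ldistrib)
      then have "(k * \<beta>) *s ?p + (k * \<gamma> - 1) *s ?q = 0"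
        by (simp add: vec_eq_iff algebra_simps)
      then have "k * \<beta> = 0 \<and> k * \<gamma> - 1 = 0" by (rule comb)
      then show False using False by auto
    qed
    then show ?thesis by (intro exI[of _ ?q] exI[of _ 0] exI[of _ 1]) simp
  qed
  then obtain w x y where w: "w = x *s ?p + y *s ?q" "w \<notin> pt v" by blast
  show ?thesis
  proof (rule no_global_sections_minus_1[OF v(1) w(2) _ s])
    fix a b assume n: "a *s v + b *s w \<noteq> 0"
    have "a *s v + b *s w = wedge (f 0) ((a * \<beta> + b * x) *s f 1 + (a * \<gamma> + b * y) *s f 2)"
      unfolding vb w(1) by (simp add: vec_eq_iff wedge_def algebra_simps)
    then show "pt (a *s v + b *s w) \<in> Lpts" using in_L[OF n] by blast
  qed
qed

end

lemma form_11: "form 1 f \<Longrightarrow> form 1 g \<Longrightarrow> form 2 (\<lambda>v. f v * g v)"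
  by (rule form_mult_eq) auto

lemma form_multc: "form d f \<Longrightarrow> form d (\<lambda>v. f v * c)"
  using form_cmult[of d f c] by (simp add: mult.commute)

locale dP5_line = adapted +
  assumes om_f: "om1 (wedge (f 0) (f 1)) = 0" "om2 (wedge (f 0) (f 1)) = 0"
    "om1 (wedge (f 0) (f 2)) = 0" "om2 (wedge (f 0) (f 2)) = 0"
begin

lemmas om_lin = form_1_simps[OF form_om(1)] form_1_simps[OF form_om(2)]

lemma L_rep:
  assumes "x \<in> Lpts"
  obtains v where "v \<noteq> 0" "x = pt v"
proof -
  have "x \<in> Proj" using assms by (simp add: Lpts_def points_of_def)
  then show ?thesis using that by (rule ProjE)
qed

lemma om_L: "om1 (wedge (f 0) (\<beta> *s f 1 + \<gamma> *s f 2)) = 0" "om2 (wedge (f 0) (\<beta> *s f 1 + \<gamma> *s f 2)) = 0"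
  by (simp_all add: wedge_bilinear om_lin om_f)

lemma Lsub: "Lpts \<subseteq> dP5"
proof
  fix x assume x: "x \<in> Lpts"
  then obtain v where v: "v \<noteq> 0" "x = pt v" by (rule L_rep)
  then obtain \<beta> \<gamma> where "v = wedge (f 0) (\<beta> *s f 1 + \<gamma> *s f 2)" using x in_L by blast
  then show "x \<in> dP5" using v om_L pt_in_dP5 by blast
qed

sublocale subvariety dP5 Lpts
  by unfold_locales (use dP5_Proj Lsub in auto)

lemma line_in_dP5: "line \<in> lines_in dP5"
  using line_Gr2 Lsub by (simp add: lines_in_def Lpts_def)

end

subsection \<open>Non-free lines\<close>

text \<open>The first equation involves no index 0: it comes from the member of the pencil whose
  kernel contains the vertex \<open>f 0\<close>. In the application \<open>f 1\<close> spans with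
  \<open>f 0\<close> the tangent line of the conic.\<close>

locale nonfree_line = adapted +
  fixes \<kappa> \<sigma> :: complex
  assumes Yeq: "om1 (wedge u w) = 0 \<and> om2 (wedge u w) = 0 \<longleftrightarrow>
    P 1 3 (wedge u w) + P 2 4 (wedge u w) = 0 \<and>
    P 0 3 (wedge u w) + \<kappa> * P 1 2 (wedge u w) + \<sigma> * P 1 4 (wedge u w) = 0"
begin

definition g1 where "g1 v = P 1 3 v + P 2 4 v"
definition g2 where "g2 v = P 0 3 v + \<kappa> * P 1 2 v + \<sigma> * P 1 4 v"

lemma form_g: "form 1 g1" "form 1 g2"
  unfolding g1_def[abs_def] g2_def[abs_def] by (intro form.add form_cmult form_P)+

lemma wedge_in_Y:
  "wedge u w \<noteq> 0 \<Longrightarrow> g1 (wedge u w) = 0 \<Longrightarrow> g2 (wedge u w) = 0 \<Longrightarrow> pt (wedge u w) \<in> dP5"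
  using Yeq[of u w] by (subst pt_in_dP5) (auto simp: g1_def g2_def)

lemma in_Y:
  assumes "v \<noteq> 0" "pt v \<in> dP5"
  obtains u w where "v = wedge u w" "g1 v = 0" "g2 v = 0"
  using assms Yeq by (auto simp: pt_in_dP5 g1_def g2_def)

lemma g_simps:
  "g1 (v + w) = g1 v + g1 w" "g1 (k *s v) = k * g1 v" "g1 (v - w) = g1 v - g1 w" "g1 0 = 0"
  "g2 (v + w) = g2 v + g2 w" "g2 (k *s v) = k * g2 v" "g2 (v - w) = g2 v - g2 w" "g2 0 = 0"
  using form_1_simps[OF form_g(1)] form_1_simps[OF form_g(2)] by auto

lemma g_wedge: "g1 (wedge u w) = P 1 3 (wedge u w) + P 2 4 (wedge u w)"
  "g2 (wedge u w) = P 0 3 (wedge u w) + \<kappa> * P 1 2 (wedge u w) + \<sigma> * P 1 4 (wedge u w)"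
  by (simp_all add: g1_def g2_def)

sublocale dP5_line
proof unfold_locales
  have "om1 (wedge (f 0) (f 1)) = 0 \<and> om2 (wedge (f 0) (f 1)) = 0"
    "om1 (wedge (f 0) (f 2)) = 0 \<and> om2 (wedge (f 0) (f 2)) = 0"
    unfolding Yeq by (simp_all add: P_wedge dual)
  then show "om1 (wedge (f 0) (f 1)) = 0" "om2 (wedge (f 0) (f 1)) = 0"
    "om1 (wedge (f 0) (f 2)) = 0" "om2 (wedge (f 0) (f 2)) = 0" by auto
qed

text \<open>A field of degree \<open>k\<close> pairs the ideal sheaf with \<open>\<O>(k - 1)\<close>: the first field accounts for the
  summand \<open>\<O>(-1)\<close> of the normal sheaf, the two constant ones for \<open>\<O>(1) \<oplus> \<O>(1)\<close>.\<close>

definition fld :: "nat \<Rightarrow> complex ^ (5 \<times> 5) \<Rightarrow> complex ^ (5 \<times> 5)" where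
  "fld j v = (if j = 0 then wedge (P 0 1 v *s f 4 - P 0 2 v *s f 3) (P 0 1 v *s f 1 + P 0 2 v *s f 2)
      + (\<sigma> * (P 0 1 v * P 0 1 v)) *s wedge (f 0) (f 3)
    else if j = 1 then wedge (f 1) (f 2) - \<kappa> *s wedge (f 0) (f 3) else wedge (f 0) (f 4))"

definition deg :: "nat \<Rightarrow> nat" where
  "deg j = (if j = 0 then 2 else 0)"

text \<open>Moving the second factor along \<open>f 3\<close> corrects the second equation. The
  first is corrected by moving the vertex along \<open>f 3\<close> if \<beta> is nonzero and along
  \<open>f 4\<close> otherwise; the determinant is -\<beta> or -\<gamma>.\<close>

lemma tangent_L:
  assumes \<beta>\<gamma>: "\<beta> \<noteq> 0 \<or> \<gamma> \<noteq> 0"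
    and \<xi>: "g1 (wedge u (\<beta> *s f 1 + \<gamma> *s f 2) + wedge (f 0) w') = 0"
      "g2 (wedge u (\<beta> *s f 1 + \<gamma> *s f 2) + wedge (f 0) w') = 0"
  shows "tangent dP5 (wedge (f 0) (\<beta> *s f 1 + \<gamma> *s f 2)) (wedge u (\<beta> *s f 1 + \<gamma> *s f 2) + wedge (f 0) w')"
proof -
  have v0: "wedge (f 0) (\<beta> *s f 1 + \<gamma> *s f 2) \<noteq> 0" using f_nonzero \<beta>\<gamma> by blast
  show ?thesis
  proof (cases "\<beta> = 0")
    case False
    show ?thesis
      by (rule tangent_dP5[OF form_g wedge_in_Y v0 _ _ \<xi>, of "f 3" 0 "f 3"])
        (simp_all add: g_wedge P_wedge dot_simps dual False)
  next
    case True
    then have "\<gamma> \<noteq> 0" using \<beta>\<gamma> by simp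
    then show ?thesis
      by (intro tangent_dP5[OF form_g wedge_in_Y v0 _ _ \<xi>, of "f 4" 0 "f 3"])
        (simp_all add: g_wedge P_wedge dot_simps dual True)
  qed
qed

lemma form_fld: "form (deg j) (\<lambda>v. fld j v $ ij)"
proof -
  obtain i k where ij: "ij = (i, k)" by fastforce
  have l: "form 1 (\<lambda>v. (P 0 1 v *s f 4 - P 0 2 v *s f 3) $ i)" "form 1 (\<lambda>v. (P 0 1 v *s f 1 + P 0 2 v *s f 2) $ i)" for i
    unfolding vector_minus_component vector_add_component vector_smult_component
    by (intro form_diff form.add form_multc form_P)+
  have "form 2 (\<lambda>v. (P 0 1 v *s f 4 - P 0 2 v *s f 3) $ i * (P 0 1 v *s f 1 + P 0 2 v *s f 2) $ k -
      (P 0 1 v *s f 4 - P 0 2 v *s f 3) $ k * (P 0 1 v *s f 1 + P 0 2 v *s f 2) $ i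
      + (\<sigma> * (P 0 1 v * P 0 1 v)) * wedge (f 0) (f 3) $ (i, k))"
    by (intro form.add form_diff form_multc form_cmult form_11 l form_P)
  then show ?thesis
    by (auto simp: fld_def deg_def ij wedge_index intro: form.const)
qed

lemma tangent_field_fld: "tangent_field dP5 Lpts (deg j) (fld j)"
  unfolding tangent_field_def
proof (intro conjI allI impI)
  fix v assume v: "v \<noteq> 0" "pt v \<in> Lpts"
  define \<beta> \<gamma> where "\<beta> = P 0 1 v" and "\<gamma> = P 0 2 v"
  have vb: "v = wedge (f 0) (\<beta> *s f 1 + \<gamma> *s f 2)" "\<beta> \<noteq> 0 \<or> \<gamma> \<noteq> 0"
    using v by (auto elim: in_LE simp: \<beta>_def \<gamma>_def)
  consider "j = 0" | "j = 1" "\<beta> \<noteq> 0" | "j = 1" "\<gamma> \<noteq> 0" | "j \<noteq> 0" "j \<noteq> 1" using vb(2) by blast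
  then show "tangent dP5 v (fld j v)"
  proof cases
    case 1
    have e: "fld j v = wedge (\<beta> *s f 4 - \<gamma> *s f 3) (\<beta> *s f 1 + \<gamma> *s f 2) + wedge (f 0) ((\<sigma> * (\<beta> * \<beta>)) *s f 3)"
      using 1 by (simp add: fld_def \<beta>_def \<gamma>_def wedge_bilinear)
    show ?thesis unfolding e by (subst vb(1), rule tangent_L[OF vb(2)])
      (simp_all add: g_simps g_wedge P_wedge dot_simps dual)
  next
    case 2
    \<comment> \<open>To obtain a curve, the constant bivector of \<open>f 1\<close> and
      \<open>f 2\<close> is written as the effect of moving the vertex. The inverse of \<beta>, or
      of \<gamma> in the next case, enters only this decomposition and not the field, which stays
      constant.\<close>
    have e: "fld j v = wedge ((- inverse \<beta>) *s f 2) (\<beta> *s f 1 + \<gamma> *s f 2) + wedge (f 0) ((- \<kappa>) *s f 3)"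
      using 2 by (simp add: fld_def vec_eq_iff wedge_def field_simps)
    show ?thesis unfolding e by (subst vb(1), rule tangent_L[OF vb(2)])
      (use 2 in \<open>simp_all add: g_simps g_wedge P_wedge dot_simps dual\<close>)
  next
    case 3
    have e: "fld j v = wedge (inverse \<gamma> *s f 1) (\<beta> *s f 1 + \<gamma> *s f 2) + wedge (f 0) ((- \<kappa>) *s f 3)"
      using 3 by (simp add: fld_def vec_eq_iff wedge_def field_simps)
    show ?thesis unfolding e by (subst vb(1), rule tangent_L[OF vb(2)])
      (use 3 in \<open>simp_all add: g_simps g_wedge P_wedge dot_simps dual\<close>)
  next
    case 4
    have e: "fld j v = wedge 0 (\<beta> *s f 1 + \<gamma> *s f 2) + wedge (f 0) (f 4)"
      using 4 by (simp add: fld_def wedge_bilinear)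
    show ?thesis unfolding e by (subst vb(1), rule tangent_L[OF vb(2)])
      (simp_all add: g_simps g_wedge P_wedge dot_simps dual)
  qed
qed (rule form_fld)

definition proj :: "complex ^ (5 \<times> 5) \<Rightarrow> complex ^ (5 \<times> 5)" where
  "proj v = P 0 1 v *s wedge (f 0) (f 1) + P 0 2 v *s wedge (f 0) (f 2)"

lemma proj_L:
  assumes "v \<noteq> 0" "pt v \<in> Lpts" shows "proj v = v"
proof -
  have "v = wedge (f 0) (P 0 1 v *s f 1 + P 0 2 v *s f 2)" by (rule in_LE[OF assms])
  moreover have "proj v = wedge (f 0) (P 0 1 v *s f 1 + P 0 2 v *s f 2)"
    by (simp add: proj_def wedge_bilinear)
  ultimately show ?thesis by simp
qed

lemma proj_in_L: "P 0 1 v \<noteq> 0 \<or> P 0 2 v \<noteq> 0 \<Longrightarrow> proj v \<noteq> 0 \<and> pt (proj v) \<in> Lpts"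
proof -
  assume n: "P 0 1 v \<noteq> 0 \<or> P 0 2 v \<noteq> 0"
  have e: "proj v = wedge (f 0) (P 0 1 v *s f 1 + P 0 2 v *s f 2)" by (simp add: proj_def wedge_bilinear)
  then have "proj v \<noteq> 0" using n f_nonzero by metis
  then show ?thesis using in_L e by blast
qed

lemma form_proj: "form 1 (\<lambda>v. proj v $ i)"
  unfolding proj_def vector_add_component vector_smult_component by (intro form.add form_multc form_P)

lemma minus_proj:
  assumes v: "v = wedge u w"
  shows "v $ i - proj v $ i = P 0 3 v * wedge (f 0) (f 3) $ i + P 0 4 v * wedge (f 0) (f 4) $ i
    + P 1 2 v * wedge (f 1) (f 2) $ i + P 1 3 v * wedge (f 1) (f 3) $ i
    + P 1 4 v * wedge (f 1) (f 4) $ i + P 2 3 v * wedge (f 2) (f 3) $ i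
    + P 2 4 v * wedge (f 2) (f 4) $ i + P 3 4 v * wedge (f 3) (f 4) $ i"
  using arg_cong[OF wedge_expand[of u w], of "\<lambda>v. v $ i"] unfolding v[symmetric] proj_def by simp

lemma pluecker_relations:
  assumes v: "v = wedge u w"
  shows "P 0 1 v * P 2 3 v - P 0 2 v * P 1 3 v + P 0 3 v * P 1 2 v = 0"
    "P 0 1 v * P 2 4 v - P 0 2 v * P 1 4 v + P 0 4 v * P 1 2 v = 0"
    "P 0 1 v * P 3 4 v - P 0 3 v * P 1 4 v + P 0 4 v * P 1 3 v = 0"
    "P 0 2 v * P 3 4 v - P 0 3 v * P 2 4 v + P 0 4 v * P 2 3 v = 0"
  unfolding v P_wedge by algebra+

text \<open>Two systems are needed because the field of degree 2 is seen by \<open>P 1 4\<close>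
  with the factor -\<beta>^2 and by \<open>P 2 3\<close> with the factor \<gamma>^2, where (\<beta>,
  \<gamma>) are the coordinates of the line; each vanishes at one point.\<close>

definition gen1 where "gen1 j = (if j = 0 then P 1 4 else if j = (1::nat) then P 1 2 else P 0 4)"
definition gen2 where "gen2 j = (if j = 0 then P 2 3 else if j = (1::nat) then P 1 2 else P 0 4)"

lemma gen_L:
  assumes "v \<noteq> 0" "pt v \<in> Lpts" shows "gen1 j v = 0" "gen2 j v = 0"
proof -
  obtain \<beta> \<gamma> where v: "v = wedge (f 0) (\<beta> *s f 1 + \<gamma> *s f 2)" using assms in_L by blast
  show "gen1 j v = 0" "gen2 j v = 0"
    unfolding v by (simp_all add: gen1_def gen2_def P_wedge dot_simps dual)
qed

lemma form_gen: "form 1 (gen1 j)" "form 1 (gen2 j)"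
  unfolding gen1_def gen2_def by (auto intro: form_P[unfolded One_nat_def])

text \<open>The coefficients \<open>?A\<close> are found by expressing the remaining Pluecker coordinates through the three
  generators, using the Pluecker relations and the two linear equations.\<close>

lemma chart1: "chart dP5 Lpts (P 0 1) proj gen1"
  unfolding chart_def
proof (intro conjI allI impI)
  fix ij
  let ?W = "\<lambda>k l. wedge (f k) (f l) $ ij"
  let ?A = "\<lambda>j v. if j = 0 then P 0 1 v * P 0 1 v * (?W 1 4 - \<sigma> * ?W 0 3)
      + P 0 1 v * P 0 2 v * (?W 2 4 - ?W 1 3) - P 0 2 v * P 0 2 v * ?W 2 3 + P 0 1 v * P 0 3 v * ?W 3 4
    else if j = (1::nat) then P 0 1 v * P 0 1 v * (?W 1 2 - \<kappa> * ?W 0 3) + P 0 1 v * P 0 4 v * (?W 1 3 - ?W 2 4)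
      + (P 0 2 v * P 0 4 v - P 0 1 v * P 0 3 v) * ?W 2 3
    else P 0 1 v * P 0 1 v * ?W 0 4 - P 0 1 v * P 1 3 v * ?W 3 4"
  have fm: "form 2 (?A j)" for j
    by (cases "j = 0"; cases "j = 1") (simp_all, (intro form.add form_diff form_multc form_11 form_P)+)
  have eq: "P 0 1 v ^ 2 * (v $ ij - proj v $ ij) = (\<Sum>j<3. gen1 j v * ?A j v)"
    if vY: "v \<noteq> 0" "pt v \<in> dP5" for v
  proof -
    obtain u w where v: "v = wedge u w" and g: "g1 v = 0" "g2 v = 0" using vY by (rule in_Y)
    show ?thesis unfolding minus_proj[OF v] sum3 gen1_def
      using pluecker_relations[OF v] g unfolding g1_def g2_def by simp algebra
  qed
  show "\<exists>n A. (\<forall>j<3. form n (A j)) \<and>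
      (\<forall>v. v \<noteq> 0 \<longrightarrow> pt v \<in> dP5 \<longrightarrow> P 0 1 v ^ n * (v $ ij - proj v $ ij) = (\<Sum>j<3. gen1 j v * A j v))"
  proof (rule exI[of _ 2], rule exI[of _ ?A], intro conjI allI impI)
    show "form 2 (?A j)" for j by (rule fm)
    show "v \<noteq> 0 \<Longrightarrow> pt v \<in> dP5 \<Longrightarrow> P 0 1 v ^ 2 * (v $ ij - proj v $ ij) = (\<Sum>j<3. gen1 j v * ?A j v)" for v
      by (rule eq)
  qed
qed (use form_P form_proj form_gen proj_L gen_L proj_in_L in auto)

lemma chart2: "chart dP5 Lpts (P 0 2) proj gen2"
  unfolding chart_def
proof (intro conjI allI impI)
  fix ij
  let ?W = "\<lambda>k l. wedge (f k) (f l) $ ij"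
  let ?A = "\<lambda>j v. if j = 0 then P 0 2 v * P 0 1 v * (?W 1 3 - ?W 2 4) + P 0 1 v * P 0 1 v * (\<sigma> * ?W 0 3 - ?W 1 4)
      + P 0 2 v * P 0 2 v * ?W 2 3 - (P 0 3 v * P 0 1 v + P 0 2 v * P 0 4 v) * ?W 3 4
    else if j = (1::nat) then P 0 2 v * P 0 2 v * (?W 1 2 - \<kappa> * ?W 0 3) + P 0 2 v * P 0 3 v * (?W 1 3 - ?W 2 4)
      + (P 0 2 v * P 0 4 v - P 0 1 v * P 0 3 v) * (?W 1 4 - \<sigma> * ?W 0 3) - P 0 3 v * P 0 3 v * ?W 3 4
    else P 0 2 v * P 0 2 v * ?W 0 4"
  have fm: "form 2 (?A j)" for j
    by (cases "j = 0"; cases "j = 1") (simp_all, (intro form.add form_diff form_multc form_11 form_P)+)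
  have eq: "P 0 2 v ^ 2 * (v $ ij - proj v $ ij) = (\<Sum>j<3. gen2 j v * ?A j v)"
    if vY: "v \<noteq> 0" "pt v \<in> dP5" for v
  proof -
    obtain u w where v: "v = wedge u w" and g: "g1 v = 0" "g2 v = 0" using vY by (rule in_Y)
    show ?thesis unfolding minus_proj[OF v] sum3 gen2_def
      using pluecker_relations[OF v] g unfolding g1_def g2_def by simp algebra
  qed
  show "\<exists>n A. (\<forall>j<3. form n (A j)) \<and>
      (\<forall>v. v \<noteq> 0 \<longrightarrow> pt v \<in> dP5 \<longrightarrow> P 0 2 v ^ n * (v $ ij - proj v $ ij) = (\<Sum>j<3. gen2 j v * A j v))"
  proof (rule exI[of _ 2], rule exI[of _ ?A], intro conjI allI impI)
    show "form 2 (?A j)" for j by (rule fm)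
    show "v \<noteq> 0 \<Longrightarrow> pt v \<in> dP5 \<Longrightarrow> P 0 2 v ^ 2 * (v $ ij - proj v $ ij) = (\<Sum>j<3. gen2 j v * ?A j v)" for v
      by (rule eq)
  qed
qed (use form_P form_proj form_gen proj_L gen_L proj_in_L in auto)

lemma frame1: "frame deg fld (P 0 1) gen1 (\<lambda>j v. if j = 0 then - (P 0 1 v * P 0 1 v) else 1)"
  unfolding frame_def
proof (intro conjI allI impI)
  show "form (deg j) (\<lambda>v. if j = 0 then - (P 0 1 v * P 0 1 v) else 1)" for j
    by (cases "j = 0") (auto simp: deg_def intro: form_uminus[OF form_11[OF form_P form_P]] form.const)
  fix v i j assume "v \<noteq> 0" "pt v \<in> Lpts" "(i::nat) < 3" "(j::nat) < 3"
  then show "gen1 i (fld j v) = (if i = j then if i = 0 then - (P 0 1 v * P 0 1 v) else 1 else 0)"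
    unfolding less3 by (auto simp: gen1_def fld_def P_lin P_wedge dot_simps dual)
qed (use form_P form_gen gen_L in auto)

lemma frame2: "frame deg fld (P 0 2) gen2 (\<lambda>j v. if j = 0 then P 0 2 v * P 0 2 v else 1)"
  unfolding frame_def
proof (intro conjI allI impI)
  show "form (deg j) (\<lambda>v. if j = 0 then P 0 2 v * P 0 2 v else 1)" for j
    by (cases "j = 0") (auto simp: deg_def intro: form_11 form_P form.const)
  fix v i j assume "v \<noteq> 0" "pt v \<in> Lpts" "(i::nat) < 3" "(j::nat) < 3"
  then show "gen2 i (fld j v) = (if i = j then if i = 0 then P 0 2 v * P 0 2 v else 1 else 0)"
    unfolding less3 by (auto simp: gen2_def fld_def P_lin P_wedge dot_simps dual)
qed (use form_P form_gen gen_L in auto)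

theorem non_free_line: "non_free line"
proof -
  have "sheaf_isomorphic dP5 (normal_sheaf dP5 Lpts) (twist3 Lpts (\<lambda>j. 1 - int (deg j)))"
  proof (rule normal_sheaf_split[OF tangent_field_fld])
    fix x assume x: "x \<in> Lpts"
    then obtain v where v: "v \<noteq> 0" "x = pt v" by (rule L_rep)
    then have "P 0 1 v \<noteq> 0 \<or> P 0 2 v \<noteq> 0" using x by (auto elim: in_LE)
    then have "x \<in> basic (P 0 1) \<or> x \<in> basic (P 0 2)" using v pt_in_basic[OF form_P v(1)] by simp
    then show "\<exists>l \<rho> q \<theta>. x \<in> basic l \<and> chart dP5 Lpts l \<rho> q \<and> frame deg fld l q \<theta>"
      using chart1 chart2 frame1 frame2 by blast
  qed
  then show ?thesis by (simp add: non_free_def Let_def Lpts_def[symmetric] deg_def)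
qed

end

lemma wedge_minus_simps:
  "wedge (u - u') w = wedge u w - wedge u' w" "wedge u (w - w') = wedge u w - wedge u w'"
  "wedge (- u) w = - wedge u w" "wedge u (- w) = - wedge u w"
  by (simp_all add: vec_eq_iff wedge_def algebra_simps)

subsection \<open>Free lines\<close>

text \<open>Generic independence of the three sections is enough, so a frame where
  \<open>P 0 1\<close> is nonzero suffices, with the bivector of \<open>f 0\<close> and
  \<open>f 1\<close> as base point.\<close>

lemma (in dP5_line) free_lineI:
  assumes "\<And>j. j < 3 \<Longrightarrow> tangent_field dP5 Lpts 1 (F j)" "frame (\<lambda>j. 1) F (P 0 1) q \<theta>"
  shows "\<not> non_free line"
proof -
  have n: "wedge (f 0) (f 1) \<noteq> 0" using f_nonzero[of 1 0] by auto
  have "\<not> sheaf_isomorphic dP5 (normal_sheaf dP5 Lpts) (twist3 Lpts (\<lambda>j. if j = 0 then - 1 else 1))"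
  proof (rule normal_sheaf_not_split[OF assms])
    have "wedge (f 0) (f 1) = wedge (f 0) (1 *s f 1 + 0 *s f 2)" by simp
    then show "pt (wedge (f 0) (f 1)) \<in> Lpts" using in_L[OF n] by blast
    show "pt (wedge (f 0) (f 1)) \<in> basic (P 0 1)"
      using pt_in_basic[OF form_P n] by (simp add: P_wedge dual)
  qed (use no_sections_L in auto)
  then show ?thesis by (simp add: non_free_def Let_def Lpts_def[symmetric])
qed

lemma (in adapted) contract_L: "contract (\<phi> 0) (wedge (f 0) (\<beta> *s f 1 + \<gamma> *s f 2)) = \<beta> *s f 1 + \<gamma> *s f 2"
  by (simp add: contract_wedge dot_simps dual)

lemma form_wedge_contract: "form 1 (\<lambda>v. wedge u (contract A v) $ ij)"
proof -
  obtain i j where ij: "ij = (i, j)" by fastforce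
  show ?thesis unfolding ij wedge_index by (intro form_diff form_cmult form_multc form_contract)
qed

text \<open>At a vertex killed by no member of the pencil, the functionals that send u to
  \<open>om1 (wedge (f 0) u)\<close> and \<open>om2 (wedge (f 0) u)\<close> are independent;
  \<open>f 3\<close> and \<open>f 4\<close> are dual to them.\<close>

locale free_line_generic = dP5_line +
  assumes om_34: "om1 (wedge (f 0) (f 3)) = 1" "om2 (wedge (f 0) (f 3)) = 0"
    "om1 (wedge (f 0) (f 4)) = 0" "om2 (wedge (f 0) (f 4)) = 1"
begin

definition dir :: "nat \<Rightarrow> complex ^ 5" where
  "dir j = (if j = 0 then f 2 else if j = 1 then f 3 else f 4)"

text \<open>On the line, \<open>contract (\<phi> 0) v\<close> is the second factor w of v, so the
  first term is the velocity of moving the vertex in the direction \<open>dir j\<close>. The other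
  two project it into the kernel of both forms. Everything is linear in v, as the summand O
  requires.\<close>

definition fld :: "nat \<Rightarrow> complex ^ (5 \<times> 5) \<Rightarrow> complex ^ (5 \<times> 5)" where
  "fld j v = wedge (dir j) (contract (\<phi> 0) v) - om1 (wedge (dir j) (contract (\<phi> 0) v)) *s wedge (f 0) (f 3)
    - om2 (wedge (dir j) (contract (\<phi> 0) v)) *s wedge (f 0) (f 4)"

lemma tangent_field_fld: "tangent_field dP5 Lpts 1 (fld j)"
  unfolding tangent_field_def
proof (intro conjI allI impI)
  show "form 1 (\<lambda>v. fld j v $ i)" for i
    unfolding fld_def vector_minus_component vector_smult_component
    by (intro form_diff form_multc form_wedge_contract form_sub[OF form_om(1)] form_sub[OF form_om(2)])
  fix v assume v: "v \<noteq> 0" "pt v \<in> Lpts"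
  then obtain \<beta> \<gamma> where vb: "v = wedge (f 0) (\<beta> *s f 1 + \<gamma> *s f 2)" using in_L by blast
  let ?w = "\<beta> *s f 1 + \<gamma> *s f 2"
  have e: "fld j v = wedge (dir j) ?w +
      wedge (f 0) ((- om1 (wedge (dir j) ?w)) *s f 3 + (- om2 (wedge (dir j) ?w)) *s f 4)"
    unfolding fld_def vb contract_L by (simp add: wedge_bilinear wedge_minus_simps)
  have Y: "pt (wedge u w) \<in> dP5" if "wedge u w \<noteq> 0" "om1 (wedge u w) = 0" "om2 (wedge u w) = 0" for u w
    using that pt_in_dP5 by blast
  have v0: "wedge (f 0) ?w \<noteq> 0" using v(1) vb by simp
  have om_a: "om1 (wedge (f 0) (- (k *s f 3) - k' *s f 4)) = - k" "om2 (wedge (f 0) (- (k *s f 3) - k' *s f 4)) = - k'" for k k'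
    by (simp_all add: wedge_bilinear wedge_minus_simps om_lin om_34)
  show "tangent dP5 v (fld j v)" unfolding e
    by (subst vb, rule tangent_dP5[OF form_om Y v0 om_L, of _ _ 0 "f 3" "f 4"])
      (simp_all add: om_a om_lin(1,6) wedge_zero_left om_34 om_lin(3,8))
qed

lemma frame_fld: "frame (\<lambda>j. 1) fld (P 0 1) (\<lambda>j. P 1 (if j = 0 then 2 else if j = 1 then 3 else 4)) (\<lambda>j v. - P 0 1 v)"
  unfolding frame_def
proof (intro conjI allI impI)
  fix v i j assume v: "v \<noteq> 0" "pt v \<in> Lpts" and ij: "(i::nat) < 3" "(j::nat) < 3"
  then obtain \<beta> \<gamma> where vb: "v = wedge (f 0) (\<beta> *s f 1 + \<gamma> *s f 2)" using in_L by blast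
  show "P 1 (if i = 0 then 2 else if i = 1 then 3 else 4) (fld j v) = (if i = j then - P 0 1 v else 0)"
    using ij unfolding less3 fld_def vb contract_L by (auto simp: dir_def P_lin P_wedge dot_simps dual)
  show "P 1 (if i = 0 then 2 else if i = 1 then 3 else 4) v = 0"
    unfolding vb by (simp add: P_wedge dot_simps dual)
qed (use form_P form_uminus[OF form_P] in auto)

theorem free_line: "\<not> non_free line"
  by (rule free_lineI[OF tangent_field_fld frame_fld])

end

text \<open>Again the first equation avoids the index 0, so the vertex lies on the conic; but now
  the tangent direction of the conic will be \<open>f 4\<close>, outside the plane of the
  line.\<close>

locale free_line_special = adapted +
  fixes \<nu> :: complex
  assumes Yeq: "om1 (wedge u w) = 0 \<and> om2 (wedge u w) = 0 \<longleftrightarrow>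
    P 1 2 (wedge u w) + P 3 4 (wedge u w) = 0 \<and>
    P 0 3 (wedge u w) + \<nu> * P 1 2 (wedge u w) + P 1 4 (wedge u w) = 0"
begin

definition g1 where "g1 v = P 1 2 v + P 3 4 v"
definition g2 where "g2 v = P 0 3 v + \<nu> * P 1 2 v + P 1 4 v"

lemma form_g: "form 1 g1" "form 1 g2"
  unfolding g1_def[abs_def] g2_def[abs_def] by (intro form.add form_cmult form_P)+

lemma wedge_in_Y:
  "wedge u w \<noteq> 0 \<Longrightarrow> g1 (wedge u w) = 0 \<Longrightarrow> g2 (wedge u w) = 0 \<Longrightarrow> pt (wedge u w) \<in> dP5"
  using Yeq[of u w] by (subst pt_in_dP5) (auto simp: g1_def g2_def)

lemma g_simps:
  "g1 (v + w) = g1 v + g1 w" "g1 (k *s v) = k * g1 v" "g1 (v - w) = g1 v - g1 w" "g1 0 = 0"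
  "g2 (v + w) = g2 v + g2 w" "g2 (k *s v) = k * g2 v" "g2 (v - w) = g2 v - g2 w" "g2 0 = 0"
  using form_1_simps[OF form_g(1)] form_1_simps[OF form_g(2)] by auto

lemma g_wedge: "g1 (wedge u w) = P 1 2 (wedge u w) + P 3 4 (wedge u w)"
  "g2 (wedge u w) = P 0 3 (wedge u w) + \<nu> * P 1 2 (wedge u w) + P 1 4 (wedge u w)"
  by (simp_all add: g1_def g2_def)

sublocale dP5_line
proof unfold_locales
  have "om1 (wedge (f 0) (f 1)) = 0 \<and> om2 (wedge (f 0) (f 1)) = 0"
    "om1 (wedge (f 0) (f 2)) = 0 \<and> om2 (wedge (f 0) (f 2)) = 0"
    unfolding Yeq by (simp_all add: P_wedge dual)
  then show "om1 (wedge (f 0) (f 1)) = 0" "om2 (wedge (f 0) (f 1)) = 0"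
    "om1 (wedge (f 0) (f 2)) = 0" "om2 (wedge (f 0) (f 2)) = 0" by auto
qed

definition dir :: "nat \<Rightarrow> complex ^ 5" where
  "dir j = (if j = 0 then f 3 else f 4)"

text \<open>The first two fields move the vertex and are corrected along two bivectors on which (g1,
  g2) takes the values (1, \<nu>) and (0, 1). The bivector of \<open>f 0\<close> and
  \<open>f 4\<close> is tangent as it stands; the factor \<open>P 0 1\<close> merely raises its
  degree to 1.\<close>

definition fld :: "nat \<Rightarrow> complex ^ (5 \<times> 5) \<Rightarrow> complex ^ (5 \<times> 5)" where
  "fld j v = (if j < 2 then wedge (dir j) (contract (\<phi> 0) v) - g1 (wedge (dir j) (contract (\<phi> 0) v)) *s wedge (f 1) (f 2)
     + (\<nu> * g1 (wedge (dir j) (contract (\<phi> 0) v)) - g2 (wedge (dir j) (contract (\<phi> 0) v))) *s wedge (f 0) (f 3)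
   else P 0 1 v *s wedge (f 0) (f 4))"

lemma tangent_L:
  assumes \<beta>\<gamma>: "\<beta> \<noteq> 0 \<or> \<gamma> \<noteq> 0"
    and \<xi>: "g1 (wedge u (\<beta> *s f 1 + \<gamma> *s f 2) + wedge (f 0) w') = 0"
      "g2 (wedge u (\<beta> *s f 1 + \<gamma> *s f 2) + wedge (f 0) w') = 0"
  shows "tangent dP5 (wedge (f 0) (\<beta> *s f 1 + \<gamma> *s f 2)) (wedge u (\<beta> *s f 1 + \<gamma> *s f 2) + wedge (f 0) w')"
proof -
  have v0: "wedge (f 0) (\<beta> *s f 1 + \<gamma> *s f 2) \<noteq> 0" using f_nonzero \<beta>\<gamma> by blast
  show ?thesis
  proof (cases "\<beta> = 0")
    case False
    show ?thesis
      by (rule tangent_dP5[OF form_g wedge_in_Y v0 _ _ \<xi>, of "f 2" 0 "f 3"])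
        (simp_all add: g_wedge P_wedge dot_simps dual False)
  next
    case True
    then have "\<gamma> \<noteq> 0" using \<beta>\<gamma> by simp
    then show ?thesis
      by (intro tangent_dP5[OF form_g wedge_in_Y v0 _ _ \<xi>, of "f 1" 0 "f 3"])
        (simp_all add: g_wedge P_wedge dot_simps dual True)
  qed
qed

text \<open>The term along the bivector of \<open>f 1\<close> and \<open>f 2\<close> is absorbed
  into the motion u of the vertex, after division by whichever of \<beta>, \<gamma> is
  nonzero.\<close>

lemma tangent_L2:
  assumes \<beta>\<gamma>: "\<beta> \<noteq> 0 \<or> \<gamma> \<noteq> 0"
    and \<xi>: "g1 (wedge u (\<beta> *s f 1 + \<gamma> *s f 2) + k *s wedge (f 1) (f 2) + wedge (f 0) w') = 0"
      "g2 (wedge u (\<beta> *s f 1 + \<gamma> *s f 2) + k *s wedge (f 1) (f 2) + wedge (f 0) w') = 0"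
  shows "tangent dP5 (wedge (f 0) (\<beta> *s f 1 + \<gamma> *s f 2))
    (wedge u (\<beta> *s f 1 + \<gamma> *s f 2) + k *s wedge (f 1) (f 2) + wedge (f 0) w')"
proof (cases "\<beta> = 0")
  case False
  have e: "wedge u (\<beta> *s f 1 + \<gamma> *s f 2) + k *s wedge (f 1) (f 2) =
      wedge (u + (- k * inverse \<beta>) *s f 2) (\<beta> *s f 1 + \<gamma> *s f 2)"
    using False by (simp add: vec_eq_iff wedge_def field_simps)
  show ?thesis using \<xi> unfolding e by (rule tangent_L[OF \<beta>\<gamma>])
next
  case True
  then have "\<gamma> \<noteq> 0" using \<beta>\<gamma> by simp
  then have e: "wedge u (\<beta> *s f 1 + \<gamma> *s f 2) + k *s wedge (f 1) (f 2) =
      wedge (u + (k * inverse \<gamma>) *s f 1) (\<beta> *s f 1 + \<gamma> *s f 2)"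
    using True by (simp add: vec_eq_iff wedge_def field_simps)
  show ?thesis using \<xi> unfolding e by (rule tangent_L[OF \<beta>\<gamma>])
qed

lemma tangent_field_fld: "tangent_field dP5 Lpts 1 (fld j)"
  unfolding tangent_field_def
proof (intro conjI allI impI)
  have "form 1 (\<lambda>v. wedge (dir j) (contract (\<phi> 0) v) $ i - g1 (wedge (dir j) (contract (\<phi> 0) v)) * wedge (f 1) (f 2) $ i
     + (\<nu> * g1 (wedge (dir j) (contract (\<phi> 0) v)) - g2 (wedge (dir j) (contract (\<phi> 0) v))) * wedge (f 0) (f 3) $ i)" for i
    by (intro form.add form_diff form_multc form_cmult form_wedge_contract form_sub[OF form_g(1)] form_sub[OF form_g(2)])
  moreover have "form 1 (\<lambda>v. P 0 1 v * wedge (f 0) (f 4) $ i)" for i by (intro form_multc form_P)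
  ultimately show "form 1 (\<lambda>v. fld j v $ i)" for i
    by (cases "j < 2") (simp_all only: fld_def if_True if_False vector_add_component
        vector_minus_component vector_smult_component)
  fix v assume v: "v \<noteq> 0" "pt v \<in> Lpts"
  then obtain \<beta> \<gamma> where vb: "v = wedge (f 0) (\<beta> *s f 1 + \<gamma> *s f 2)" using in_L by blast
  have \<beta>\<gamma>: "\<beta> \<noteq> 0 \<or> \<gamma> \<noteq> 0" using v(1) vb by (auto simp: wedge_bilinear)
  let ?w = "\<beta> *s f 1 + \<gamma> *s f 2"
  show "tangent dP5 v (fld j v)"
  proof (cases "j < 2")
    case True
    have e: "fld j v = wedge (dir j) ?w + (- g1 (wedge (dir j) ?w)) *s wedge (f 1) (f 2) +
      wedge (f 0) ((\<nu> * g1 (wedge (dir j) ?w) - g2 (wedge (dir j) ?w)) *s f 3)"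
      unfolding fld_def vb contract_L using True by (simp add: wedge_scale_right wedge_minus_simps)
    have ga: "g1 (wedge (f 0) (k *s f 3)) = 0" "g2 (wedge (f 0) (k *s f 3)) = k"
      "g1 (wedge (f 1) (f 2)) = 1" "g2 (wedge (f 1) (f 2)) = \<nu>" for k
      by (simp_all add: g_wedge P_wedge dot_simps dual)
    show ?thesis unfolding e unfolding vb
      by (rule tangent_L2[OF \<beta>\<gamma>])
        (simp_all only: g_simps ga, simp_all add: algebra_simps)
  next
    case False
    have e: "fld j v = wedge 0 ?w + wedge (f 0) (\<beta> *s f 4)"
      using False by (simp add: fld_def vb wedge_bilinear) (simp add: P_lin P_wedge dual)
    show ?thesis unfolding e unfolding vb
      by (rule tangent_L[OF \<beta>\<gamma>]) (simp_all add: g_simps g_wedge P_wedge dot_simps dual)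
  qed
qed

lemma frame_fld: "frame (\<lambda>j. 1) fld (P 0 1) (\<lambda>j. if j = 0 then P 1 3 else if j = 1 then P 1 4 else P 0 4)
    (\<lambda>j v. if j < 2 then - P 0 1 v else P 0 1 v)"
  unfolding frame_def
proof (intro conjI allI impI)
  fix v i j assume v: "v \<noteq> 0" "pt v \<in> Lpts" and ij: "(i::nat) < 3" "(j::nat) < 3"
  then obtain \<beta> \<gamma> where vb: "v = wedge (f 0) (\<beta> *s f 1 + \<gamma> *s f 2)" using in_L by blast
  show "(if i = 0 then P 1 3 else if i = 1 then P 1 4 else P 0 4) (fld j v) =
      (if i = j then if i < 2 then - P 0 1 v else P 0 1 v else 0)"
    using ij unfolding less3 fld_def vb contract_L by (auto simp: dir_def P_lin P_wedge dot_simps dual)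
  show "(if i = 0 then P 1 3 else if i = 1 then P 1 4 else P 0 4) v = 0"
    unfolding vb by (simp add: P_wedge dot_simps dual)
next
  show "form 1 (if j = 0 then P 1 3 else if j = 1 then P 1 4 else P 0 4)" for j :: nat
    using form_P by auto
  show "form 1 (\<lambda>v. if j < 2 then - P 0 1 v else P 0 1 v)" for j :: nat
    using form_P form_uminus[OF form_P] by (cases "j < 2") auto
qed (use form_P in auto)

theorem free_line: "\<not> non_free line"
  by (rule free_lineI[OF tangent_field_fld frame_fld])

end

section \<open>Which lines are non-free\<close>

section \<open>Bases attached to points of the vertex conic\<close>

definition vec5 :: "complex \<Rightarrow> complex \<Rightarrow> complex \<Rightarrow> complex \<Rightarrow> complex \<Rightarrow> complex ^ 5" where
  "vec5 x0 x1 x2 x3 x4 = (\<chi> i. if i = 0 then x0 else if i = 1 then x1 else if i = 2 then x2 else if i = 3 then x3 else x4)"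

lemma vec5_index [simp]:
  "vec5 x0 x1 x2 x3 x4 $ 0 = x0" "vec5 x0 x1 x2 x3 x4 $ 1 = x1" "vec5 x0 x1 x2 x3 x4 $ 2 = x2"
  "vec5 x0 x1 x2 x3 x4 $ 3 = x3" "vec5 x0 x1 x2 x3 x4 $ 4 = x4"
  by (simp_all add: vec5_def)

lemma vec5_eqI:
  "u $ 0 = x0 \<Longrightarrow> u $ 1 = x1 \<Longrightarrow> u $ 2 = x2 \<Longrightarrow> u $ 3 = x3 \<Longrightarrow> u $ 4 = x4 \<Longrightarrow> u = vec5 x0 x1 x2 x3 x4"
  unfolding vec_eq_iff forall_5 by simp

text \<open>As a representation of \<open>SL\<^sub>2\<close>, \<open>\<complex>\<^sup>5\<close> is the sum of \<open>Sym\<^sup>2\<close>, spanned by \<open>e\<^sub>0, e\<^sub>1, e\<^sub>4\<close>, and the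
  standard representation, spanned by \<open>e\<^sub>2, e\<^sub>3\<close>; the bases below are the translates of the standard one.\<close>

definition vbasis :: "complex \<Rightarrow> complex \<Rightarrow> complex \<Rightarrow> complex \<Rightarrow> 5 \<Rightarrow> complex ^ 5" where
  "vbasis s t p q i = (if i = 0 then vec5 (s * s) (s * t) 0 0 (- (t * t))
    else if i = 1 then vec5 (2 * s * p) (s * q + t * p) 0 0 (- 2 * t * q)
    else if i = 2 then vec5 0 0 s t 0 else if i = 3 then vec5 0 0 p q 0
    else vec5 (- (p * p)) (- (p * q)) 0 0 (q * q))"

definition vcobasis :: "complex \<Rightarrow> complex \<Rightarrow> complex \<Rightarrow> complex \<Rightarrow> 5 \<Rightarrow> complex ^ 5" where
  "vcobasis s t p q i = (if i = 0 then vec5 (q * q) (- 2 * q * p) 0 0 (- (p * p))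
    else if i = 1 then vec5 (- (t * q)) (s * q + t * p) 0 0 (p * s)
    else if i = 2 then vec5 0 0 q (- p) 0 else if i = 3 then vec5 0 0 (- t) s 0
    else vec5 (- (t * t)) (2 * t * s) 0 0 (s * s))"

lemma dot_left: "dot (A + B) u = dot A u + dot B u" "dot (k *s A) u = k * dot A u"
  "dot (A - B) u = dot A u - dot B u"
  by (simp_all add: dot_def algebra_simps sum.distrib sum_distrib_left sum_subtractf)

lemma dot_vcobasis_vbasis:
  assumes d: "s * q - t * p = 1"
  shows "dot (vcobasis s t p q i) (vbasis s t p q j) = (if i = j then 1 else 0)"
proof -
  have "\<forall>i j. dot (vcobasis s t p q i) (vbasis s t p q j) = (if i = j then 1 else 0)"
    unfolding forall_5 dot_def sum_5 vbasis_def vcobasis_def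
    by (simp, intro conjI) (algebra | use d in algebra | use d in \<open>simp add: algebra_simps\<close>)+
  then show ?thesis by blast
qed

locale conic_basis =
  fixes s t p q :: complex
  assumes det: "s * q - t * p = 1"
begin

sublocale adapted "vbasis s t p q" "vcobasis s t p q"
  by unfold_locales (rule dot_vcobasis_vbasis[OF det])

text \<open>The pencil of forms is stable under \<open>SL\<^sub>2\<close>: in a translated basis the
  two forms are recombined by a matrix of determinant s q - t p = 1. The equations of the fourfold
  therefore look the same at every point of the conic.\<close>

lemma om_eq:
  "om1 (wedge u w) = s * (P 1 2 (wedge u w) - P 0 3 (wedge u w)) - p * (P 1 3 (wedge u w) - P 2 4 (wedge u w))"
  "om2 (wedge u w) = - t * (P 1 2 (wedge u w) - P 0 3 (wedge u w)) + q * (P 1 3 (wedge u w) - P 2 4 (wedge u w))"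
  unfolding om1_def om2_def wedge_index P_wedge dot_def sum_5 vcobasis_def
  using det by (simp, algebra)+

lemma Yeq: "om1 (wedge u w) = 0 \<and> om2 (wedge u w) = 0 \<longleftrightarrow>
    P 1 2 (wedge u w) - P 0 3 (wedge u w) = 0 \<and> P 1 3 (wedge u w) - P 2 4 (wedge u w) = 0"
proof -
  have "a = 0 \<and> b = 0 \<longleftrightarrow> s * a - p * b = 0 \<and> - t * a + q * b = 0" for a b
  proof
    assume "s * a - p * b = 0 \<and> - t * a + q * b = 0"
    then have "a = 0" "b = 0" using det by algebra+
    then show "a = 0 \<and> b = 0" by simp
  qed simp
  then show ?thesis unfolding om_eq by blast
qed

text \<open>The plane contains the tangent line of the conic, spanned by the basis vectors 0 and 1,
  and one more direction inside the span of the vectors 4 and 2. The unimodular partner (\<alpha>',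
  \<beta>') completes this direction to a basis, and the remaining freedom appears as the two
  parameters of the normal form.\<close>

lemma nonfree_basis:
  assumes ab: "\<alpha> * \<beta>' - \<beta> * \<alpha>' = 1"
  shows "nonfree_line
    (\<lambda>i. if i = 2 then \<alpha> *s vbasis s t p q 4 + \<beta> *s vbasis s t p q 2
      else if i = 4 then \<alpha>' *s vbasis s t p q 4 + \<beta>' *s vbasis s t p q 2 else vbasis s t p q i)
    (\<lambda>i. if i = 2 then \<beta>' *s vcobasis s t p q 4 - \<alpha>' *s vcobasis s t p q 2
      else if i = 4 then \<alpha> *s vcobasis s t p q 2 - \<beta> *s vcobasis s t p q 4 else vcobasis s t p q i) (- \<beta>) (- \<beta>')"
    (is "nonfree_line ?f ?\<phi> _ _")
proof -
  interpret N: adapted ?f ?\<phi>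
  proof
    show "dot (?\<phi> i) (?f j) = (if i = j then 1 else 0)" for i j
    proof -
      have "\<forall>i j. dot (?\<phi> i) (?f j) = (if i = j then 1 else 0)"
        unfolding forall_5 by (simp add: dot_left dot_simps dual) (use ab in algebra)
      then show ?thesis by blast
    qed
  qed
  show ?thesis
  proof
    fix u w
    show "om1 (wedge u w) = 0 \<and> om2 (wedge u w) = 0 \<longleftrightarrow> N.P 1 3 (wedge u w) + N.P 2 4 (wedge u w) = 0 \<and>
        N.P 0 3 (wedge u w) + - \<beta> * N.P 1 2 (wedge u w) + - \<beta>' * N.P 1 4 (wedge u w) = 0"
    proof -
      have "N.P 1 3 (wedge u w) + N.P 2 4 (wedge u w) = P 1 3 (wedge u w) - P 2 4 (wedge u w)"
        unfolding N.P_wedge P_wedge by (simp add: dot_left) (use ab in algebra)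
      moreover have "N.P 0 3 (wedge u w) + - \<beta> * N.P 1 2 (wedge u w) + - \<beta>' * N.P 1 4 (wedge u w) =
          - (P 1 2 (wedge u w) - P 0 3 (wedge u w))"
        unfolding N.P_wedge P_wedge by (simp add: dot_left) (use ab in algebra)
      ultimately show ?thesis unfolding Yeq by auto
    qed
  qed
qed

text \<open>The plane is the graph of a linear map into the tangent direction, with slopes m and n.
  The multiples of the vector 0 do not change bivectors containing it, hence not the line; they and
  the new vector 3 are adjusted so that the equations take the normal form.\<close>

lemma special_basis:
  "free_line_special
    (\<lambda>i. if i = 0 then vbasis s t p q 0 else if i = 1 then vbasis s t p q 2 + m *s vbasis s t p q 1 - (m * n) *s vbasis s t p q 0
      else if i = 2 then vbasis s t p q 4 + n *s vbasis s t p q 1 - (n * n) *s vbasis s t p q 0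
      else if i = 3 then vbasis s t p q 3 - n *s vbasis s t p q 2 + m *s vbasis s t p q 4 else vbasis s t p q 1)
    (\<lambda>i. if i = 0 then vcobasis s t p q 0 + (m * n) *s (vcobasis s t p q 2 + n *s vcobasis s t p q 3)
        + (n * n) *s (vcobasis s t p q 4 - m *s vcobasis s t p q 3)
      else if i = 1 then vcobasis s t p q 2 + n *s vcobasis s t p q 3
      else if i = 2 then vcobasis s t p q 4 - m *s vcobasis s t p q 3
      else if i = 3 then vcobasis s t p q 3
      else vcobasis s t p q 1 - m *s (vcobasis s t p q 2 + n *s vcobasis s t p q 3) - n *s (vcobasis s t p q 4 - m *s vcobasis s t p q 3))
    (2 * n)"
    (is "free_line_special ?f ?\<phi> _")
proof -
  interpret N: adapted ?f ?\<phi>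
  proof
    show "dot (?\<phi> i) (?f j) = (if i = j then 1 else 0)" for i j
    proof -
      have "\<forall>i j. dot (?\<phi> i) (?f j) = (if i = j then 1 else 0)"
        unfolding forall_5 by (simp add: dot_left dot_simps dual algebra_simps)
      then show ?thesis by blast
    qed
  qed
  show ?thesis
  proof
    fix u w
    show "om1 (wedge u w) = 0 \<and> om2 (wedge u w) = 0 \<longleftrightarrow> N.P 1 2 (wedge u w) + N.P 3 4 (wedge u w) = 0 \<and>
        N.P 0 3 (wedge u w) + 2 * n * N.P 1 2 (wedge u w) + N.P 1 4 (wedge u w) = 0"
    proof -
      have 1: "N.P 1 2 (wedge u w) + N.P 3 4 (wedge u w) = - (P 1 3 (wedge u w) - P 2 4 (wedge u w))"
        unfolding N.P_wedge P_wedge by (simp add: dot_left) algebra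
      \<comment> \<open>Adding n times the first equation removes the coordinate with indices 3, 4
        and doubles the coefficient of the one with indices 1, 2; this is the origin of 2 n.\<close>
      have 2: "N.P 0 3 (wedge u w) + 2 * n * N.P 1 2 (wedge u w) + N.P 1 4 (wedge u w) =
          - (P 1 2 (wedge u w) - P 0 3 (wedge u w)) + n * (N.P 1 2 (wedge u w) + N.P 3 4 (wedge u w))"
        unfolding N.P_wedge P_wedge by (simp add: dot_left) algebra
      show ?thesis unfolding Yeq 2 unfolding 1 by auto
    qed
  qed
qed

end

section \<open>Classification of the lines\<close>

definition Zline :: "complex \<Rightarrow> complex \<Rightarrow> complex \<Rightarrow> complex \<Rightarrow> complex \<Rightarrow> complex \<Rightarrow> (5 \<times> 5) subsp" where
  "Zline s t p q \<alpha> \<beta> = vec.span {wedge (vbasis s t p q 0) (vbasis s t p q 1),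
     wedge (vbasis s t p q 0) (\<alpha> *s vbasis s t p q 4 + \<beta> *s vbasis s t p q 2)}"

lemma (in conic_basis) Zline_non_free:
  assumes "\<alpha> \<noteq> 0 \<or> \<beta> \<noteq> 0"
  shows "non_free (Zline s t p q \<alpha> \<beta>)" "Zline s t p q \<alpha> \<beta> \<in> lines_in dP5"
proof -
  have "\<exists>\<alpha>' \<beta>'. \<alpha> * \<beta>' - \<beta> * \<alpha>' = 1"
  proof (cases "\<alpha> = 0")
    case True
    then show ?thesis using assms by (intro exI[of _ "- inverse \<beta>"] exI[of _ 0]) simp
  next
    case False
    then show ?thesis by (intro exI[of _ 0] exI[of _ "inverse \<alpha>"]) simp
  qed
  then obtain \<alpha>' \<beta>' where ab: "\<alpha> * \<beta>' - \<beta> * \<alpha>' = 1" by blast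
  interpret N: nonfree_line "\<lambda>i. if i = 2 then \<alpha> *s vbasis s t p q 4 + \<beta> *s vbasis s t p q 2
      else if i = 4 then \<alpha>' *s vbasis s t p q 4 + \<beta>' *s vbasis s t p q 2 else vbasis s t p q i"
    "\<lambda>i. if i = 2 then \<beta>' *s vcobasis s t p q 4 - \<alpha>' *s vcobasis s t p q 2
      else if i = 4 then \<alpha> *s vcobasis s t p q 2 - \<beta> *s vcobasis s t p q 4 else vcobasis s t p q i" "- \<beta>" "- \<beta>'"
    by (rule nonfree_basis[OF ab])
  have "N.line = Zline s t p q \<alpha> \<beta>" by (simp add: N.line_def Zline_def)
  then show "non_free (Zline s t p q \<alpha> \<beta>)" "Zline s t p q \<alpha> \<beta> \<in> lines_in dP5"
    using N.non_free_line N.line_in_dP5 by simp_all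
qed

lemma (in conic_basis) special_line_free:
  "\<not> non_free (vec.span {wedge (vbasis s t p q 0) (vbasis s t p q 2 + m *s vbasis s t p q 1),
     wedge (vbasis s t p q 0) (vbasis s t p q 4 + n *s vbasis s t p q 1)})"
proof -
  let ?f = "\<lambda>i::5. if i = 0 then vbasis s t p q 0 else if i = 1 then vbasis s t p q 2 + m *s vbasis s t p q 1 - (m * n) *s vbasis s t p q 0
      else if i = 2 then vbasis s t p q 4 + n *s vbasis s t p q 1 - (n * n) *s vbasis s t p q 0
      else if i = 3 then vbasis s t p q 3 - n *s vbasis s t p q 2 + m *s vbasis s t p q 4 else vbasis s t p q 1"
  let ?\<phi> = "\<lambda>i::5. if i = 0 then vcobasis s t p q 0 + (m * n) *s (vcobasis s t p q 2 + n *s vcobasis s t p q 3)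
        + (n * n) *s (vcobasis s t p q 4 - m *s vcobasis s t p q 3)
      else if i = 1 then vcobasis s t p q 2 + n *s vcobasis s t p q 3
      else if i = 2 then vcobasis s t p q 4 - m *s vcobasis s t p q 3
      else if i = 3 then vcobasis s t p q 3
      else vcobasis s t p q 1 - m *s (vcobasis s t p q 2 + n *s vcobasis s t p q 3) - n *s (vcobasis s t p q 4 - m *s vcobasis s t p q 3)"
  interpret N: free_line_special ?f ?\<phi> "2 * n" by (rule special_basis)
  have "N.line = vec.span {wedge (vbasis s t p q 0) (vbasis s t p q 2 + m *s vbasis s t p q 1),
     wedge (vbasis s t p q 0) (vbasis s t p q 4 + n *s vbasis s t p q 1)}"
    by (simp add: N.line_def wedge_bilinear wedge_minus_simps)
  then show ?thesis using N.free_line by simp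
qed

lemma lin_dep_2:
  fixes x y z w :: complex
  assumes "x * w = y * z"
  shows "\<exists>r r'. (r \<noteq> 0 \<or> r' \<noteq> 0) \<and> r * x + r' * z = 0 \<and> r * y + r' * w = 0"
proof (cases "x = 0 \<and> y = 0")
  case True
  then show ?thesis by (intro exI[of _ 1] exI[of _ 0]) simp
next
  case False
  then consider "x \<noteq> 0" | "y \<noteq> 0" by blast
  then show ?thesis
  proof cases
    case 1
    then show ?thesis using assms by (intro exI[of _ "- z"] exI[of _ x]) (simp add: algebra_simps)
  next
    case 2
    then show ?thesis using assms by (intro exI[of _ "- w"] exI[of _ y]) (simp add: algebra_simps)
  qed
qed

text \<open>The plane of the line lies in the hyperplane spanned by all basis vectors but the fourth; the
  determinant \<open>?D\<close> vanishes iff it contains the tangent line of the conic.\<close>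

lemma (in conic_basis) conic_vertex_line:
  assumes line: "wedge (wedge (vbasis s t p q 0) b) (wedge (vbasis s t p q 0) c) \<noteq> 0"
    and om: "om1 (wedge (vbasis s t p q 0) b) = 0" "om2 (wedge (vbasis s t p q 0) b) = 0"
      "om1 (wedge (vbasis s t p q 0) c) = 0" "om2 (wedge (vbasis s t p q 0) c) = 0"
    and nf: "non_free (vec.span {wedge (vbasis s t p q 0) b, wedge (vbasis s t p q 0) c})"
  shows "\<exists>\<alpha> \<beta>. (\<alpha> \<noteq> 0 \<or> \<beta> \<noteq> 0) \<and>
    vec.span {wedge (vbasis s t p q 0) b, wedge (vbasis s t p q 0) c} = Zline s t p q \<alpha> \<beta>"
proof -
  let ?f = "vbasis s t p q" and ?\<phi> = "vcobasis s t p q"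
  define x y where "x i = dot (?\<phi> i) b" and "y i = dot (?\<phi> i) c" for i
  have b: "b = x 0 *s ?f 0 + x 1 *s ?f 1 + x 2 *s ?f 2 + x 3 *s ?f 3 + x 4 *s ?f 4"
    using dual_basis_expand[of ?\<phi> ?f b, OF dual] unfolding sum_5 x_def .
  have c: "c = y 0 *s ?f 0 + y 1 *s ?f 1 + y 2 *s ?f 2 + y 3 *s ?f 3 + y 4 *s ?f 4"
    using dual_basis_expand[of ?\<phi> ?f c, OF dual] unfolding sum_5 y_def .
  have x3: "x 3 = 0" using om(1,2) Yeq[of "?f 0" b] by (simp add: P_wedge dual x_def)
  have y3: "y 3 = 0" using om(3,4) Yeq[of "?f 0" c] by (simp add: P_wedge dual y_def)
  let ?W = "\<lambda>i. wedge (?f 0) (?f i)"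
  have ab: "wedge (?f 0) b = x 1 *s ?W 1 + x 2 *s ?W 2 + x 4 *s ?W 4"
    by (subst b) (simp add: wedge_bilinear x3)
  have ac: "wedge (?f 0) c = y 1 *s ?W 1 + y 2 *s ?W 2 + y 4 *s ?W 4"
    by (subst c) (simp add: wedge_bilinear y3)
  have ind: "r = 0 \<and> r' = 0" if "r *s wedge (?f 0) b + r' *s wedge (?f 0) c = 0" for r r'
    using line that unfolding wedge_neq_0_independent by blast
  let ?D = "x 2 * y 4 - x 4 * y 2"
  show ?thesis
  proof (cases "?D = 0")
    case False
    \<comment> \<open>The inverse of the 2x2 matrix of coordinates 2 and 4 row-reduces the
      generators to the shape of \<open>special_line_free\<close>, against the assumption that the
      line is non-free.\<close>
    have "vec.span {wedge (?f 0) (?f 2 + ((y 4 * x 1 - x 4 * y 1) / ?D) *s ?f 1),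
        wedge (?f 0) (?f 4 + ((- y 2 * x 1 + x 2 * y 1) / ?D) *s ?f 1)} =
      vec.span {wedge (?f 0) b, wedge (?f 0) c}"
    proof (rule span2_change[of _ "y 4 / ?D" _ "- x 4 / ?D" _ _ "- y 2 / ?D" "x 2 / ?D"])
      have 1: "y 4 / ?D * x 2 + - x 4 / ?D * y 2 = 1" "- y 2 / ?D * x 2 + x 2 / ?D * y 2 = 0"
        "y 4 / ?D * x 4 + - x 4 / ?D * y 4 = 0" "- y 2 / ?D * x 4 + x 2 / ?D * y 4 = 1"
        using False by (simp_all add: divide_simps)
      have e: "r *s wedge (?f 0) b + r' *s wedge (?f 0) c = (r * x 1 + r' * y 1) *s ?W 1 +
          (r * x 2 + r' * y 2) *s ?W 2 + (r * x 4 + r' * y 4) *s ?W 4" for r r'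
        unfolding ab ac by (simp add: vec_eq_iff algebra_simps)
      have m: "y 4 / ?D * x 1 + - x 4 / ?D * y 1 = (y 4 * x 1 - x 4 * y 1) / ?D"
        "- y 2 / ?D * x 1 + x 2 / ?D * y 1 = (- y 2 * x 1 + x 2 * y 1) / ?D"
        by (simp_all add: diff_divide_distrib add_divide_distrib)
      show "wedge (?f 0) (?f 2 + ((y 4 * x 1 - x 4 * y 1) / ?D) *s ?f 1) =
        (y 4 / ?D) *s wedge (?f 0) b + (- x 4 / ?D) *s wedge (?f 0) c"
        unfolding e 1 m by (simp add: wedge_add_right wedge_scale_right add.commute)
      show "wedge (?f 0) (?f 4 + ((- y 2 * x 1 + x 2 * y 1) / ?D) *s ?f 1) =
        (- y 2 / ?D) *s wedge (?f 0) b + (x 2 / ?D) *s wedge (?f 0) c"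
        unfolding e 1 m by (simp add: wedge_add_right wedge_scale_right add.commute)
      have "y 4 / ?D * (x 2 / ?D) - - x 4 / ?D * (- y 2 / ?D) = 1 / ?D"
        using False by (simp add: divide_simps)
      then show "y 4 / ?D * (x 2 / ?D) - - x 4 / ?D * (- y 2 / ?D) \<noteq> 0" using False by simp
    qed
    then show ?thesis using nf special_line_free by metis
  next
    case True
    then obtain r r' where r: "r \<noteq> 0 \<or> r' \<noteq> 0" "r * x 2 + r' * y 2 = 0" "r * x 4 + r' * y 4 = 0"
      using lin_dep_2[of "x 2" "y 4" "x 4" "y 2"] by auto
    define z where "z = r * x 1 + r' * y 1"
    have e: "a *s wedge (?f 0) b + a' *s wedge (?f 0) c = (a * x 1 + a' * y 1) *s ?W 1 +
        (a * x 2 + a' * y 2) *s ?W 2 + (a * x 4 + a' * y 4) *s ?W 4" for a a'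
      unfolding ab ac by (simp add: vec_eq_iff algebra_simps)
    \<comment> \<open>A combination without coordinates 2 and 4 is a multiple of the bivector of
      \<open>?f 0\<close> and \<open>?f 1\<close>, so the plane contains the tangent line.\<close>
    have rz: "r *s wedge (?f 0) b + r' *s wedge (?f 0) c = z *s ?W 1" unfolding e r(2,3) z_def by simp
    have z: "z \<noteq> 0" using ind[of r r'] r(1) rz by auto
    have "\<exists>k k'. r * k' - r' * k \<noteq> 0"
    proof (cases "r = 0")
      case True
      then show ?thesis using r(1) by (intro exI[of _ 1]) auto
    next
      case False
      then show ?thesis by (intro exI[of _ 0] exI[of _ 1]) auto
    qed
    then obtain k k' where k: "r * k' - r' * k \<noteq> 0" by blast
    define h \<alpha> \<beta> where "h = k * x 1 + k' * y 1" and "\<alpha> = k * x 4 + k' * y 4" and "\<beta> = k * x 2 + k' * y 2"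
    have kh: "k *s wedge (?f 0) b + k' *s wedge (?f 0) c = h *s ?W 1 + \<beta> *s ?W 2 + \<alpha> *s ?W 4"
      unfolding e h_def \<alpha>_def \<beta>_def ..
    have W1: "?W 1 = (r / z) *s wedge (?f 0) b + (r' / z) *s wedge (?f 0) c"
    proof -
      have "?W 1 = inverse z *s (z *s ?W 1)" using z by (simp add: vector_smult_assoc)
      also have "\<dots> = (r / z) *s wedge (?f 0) b + (r' / z) *s wedge (?f 0) c"
        unfolding rz[symmetric] by (simp add: vec_eq_iff field_simps)
      finally show ?thesis .
    qed
    \<comment> \<open>Any complementary combination serves as second generator once its component
      along \<open>?W 1\<close> is removed.\<close>
    have W2: "wedge (?f 0) (\<alpha> *s ?f 4 + \<beta> *s ?f 2) =
        (k - h * r / z) *s wedge (?f 0) b + (k' - h * r' / z) *s wedge (?f 0) c"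
    proof -
      have "wedge (?f 0) (\<alpha> *s ?f 4 + \<beta> *s ?f 2) = (k *s wedge (?f 0) b + k' *s wedge (?f 0) c) - h *s ?W 1"
        unfolding kh by (simp add: wedge_add_right wedge_scale_right)
      also have "\<dots> = (k - h * r / z) *s wedge (?f 0) b + (k' - h * r' / z) *s wedge (?f 0) c"
        by (subst W1) (simp add: vec_eq_iff algebra_simps)
      finally show ?thesis .
    qed
    have d: "r / z * (k' - h * r' / z) - r' / z * (k - h * r / z) = (r * k' - r' * k) / z"
      using z by (simp add: field_simps)
    have "\<alpha> \<noteq> 0 \<or> \<beta> \<noteq> 0"
    proof (rule ccontr)
      assume "\<not> (\<alpha> \<noteq> 0 \<or> \<beta> \<noteq> 0)"
      then have "(k - h * r / z) *s wedge (?f 0) b + (k' - h * r' / z) *s wedge (?f 0) c = 0"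
        using W2 by (simp add: wedge_zero_right)
      then have "k - h * r / z = 0 \<and> k' - h * r' / z = 0" by (rule ind)
      then have "r / z * (k' - h * r' / z) - r' / z * (k - h * r / z) = 0" by simp
      then show False using d k z by simp
    qed
    moreover have "vec.span {?W 1, wedge (?f 0) (\<alpha> *s ?f 4 + \<beta> *s ?f 2)} = vec.span {wedge (?f 0) b, wedge (?f 0) c}"
      by (rule span2_change[OF W1 W2]) (use d k z in simp)
    ultimately show ?thesis unfolding Zline_def by blast
  qed
qed

text \<open>When no member of the pencil kills a, vectors d and e dual to the two functionals exist.
  Together with a, b, c they form a basis: the forms separate d and e from the rest, and the
  bivectors of a with b and c are independent.\<close>

lemma generic_vertex_line:
  assumes line: "wedge (wedge a b) (wedge a c) \<noteq> 0"
    and om: "om1 (wedge a b) = 0" "om2 (wedge a b) = 0" "om1 (wedge a c) = 0" "om2 (wedge a c) = 0"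
    and indep: "\<And>x y. x \<noteq> 0 \<or> y \<noteq> 0 \<Longrightarrow> \<exists>u. x * om1 (wedge a u) + y * om2 (wedge a u) \<noteq> 0"
  shows "\<not> non_free (vec.span {wedge a b, wedge a c})"
proof -
  note lin = form_1_simps[OF form_om(1)] form_1_simps[OF form_om(2)] wedge_bilinear wedge_minus_simps
  obtain u where u: "om1 (wedge a u) \<noteq> 0" using indep[of 1 0] by auto
  define u' where "u' = inverse (om1 (wedge a u)) *s u"
  have u': "om1 (wedge a u') = 1" using u by (simp add: u'_def lin)
  define k where "k = om2 (wedge a u')"
  obtain w where w: "- k * om1 (wedge a w) + om2 (wedge a w) \<noteq> 0" using indep[of "- k" 1] by auto
  let ?w = "- k * om1 (wedge a w) + om2 (wedge a w)"
  \<comment> \<open>Elimination: \<open>?w\<close> is the second functional after subtracting k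
    times the first, so it vanishes on \<open>u'\<close>; subtracting a multiple of
    \<open>u'\<close> from w makes the first functional 0, and division by \<open>?w\<close> makes
    the second one 1.\<close>
  define e where "e = inverse ?w *s (w - om1 (wedge a w) *s u')"
  define d where "d = u' - k *s e"
  have e: "om1 (wedge a e) = 0" "om2 (wedge a e) = 1"
  proof -
    show "om1 (wedge a e) = 0" unfolding e_def by (simp add: lin u')
    have "om2 (wedge a e) = inverse ?w * ?w"
      unfolding e_def k_def by (simp add: lin algebra_simps)
    then show "om2 (wedge a e) = 1" using left_inverse[OF w] by (rule trans)
  qed
  have d: "om1 (wedge a d) = 1" "om2 (wedge a d) = 0"
    unfolding d_def by (simp_all add: lin u' e flip: k_def)
  define f :: "5 \<Rightarrow> complex ^ 5" where
    "f i = (if i = 0 then a else if i = 1 then b else if i = 2 then c else if i = 3 then d else e)" for i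
  have "\<exists>\<phi>. \<forall>i j. dot (\<phi> i) (f j) = (if i = j then 1 else 0)"
  proof (rule dual_basis_ex)
    fix r :: "5 \<Rightarrow> complex" assume "(\<Sum>i\<in>UNIV. r i *s f i) = 0"
    then have 0: "r 0 *s a + r 1 *s b + r 2 *s c + r 3 *s d + r 4 *s e = 0" by (simp add: sum_5 f_def)
    have "wedge a (r 0 *s a + r 1 *s b + r 2 *s c + r 3 *s d + r 4 *s e) =
      r 1 *s wedge a b + r 2 *s wedge a c + r 3 *s wedge a d + r 4 *s wedge a e"
      by (simp add: wedge_bilinear)
    then have W: "r 1 *s wedge a b + r 2 *s wedge a c + r 3 *s wedge a d + r 4 *s wedge a e = 0"
      unfolding 0 by (simp add: wedge_bilinear)
    have "om1 (r 1 *s wedge a b + r 2 *s wedge a c + r 3 *s wedge a d + r 4 *s wedge a e) = r 3"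
      "om2 (r 1 *s wedge a b + r 2 *s wedge a c + r 3 *s wedge a d + r 4 *s wedge a e) = r 4"
      by (simp_all add: lin om d e)
    then have r34: "r 3 = 0" "r 4 = 0" unfolding W by (simp_all add: lin)
    then have "r 1 *s wedge a b + r 2 *s wedge a c = 0" using W by simp
    then have r12: "r 1 = 0" "r 2 = 0" using line unfolding wedge_neq_0_independent by blast+
    have "a \<noteq> 0" using d(1) by (auto simp: lin)
    moreover have "r 0 *s a = 0" using 0 r34 r12 by simp
    ultimately have "r 0 = 0" by (simp add: vec_eq_iff) metis
    then show "\<forall>i. r i = 0" unfolding forall_5 using r12 r34 by simp
  qed
  then obtain \<phi> where \<phi>: "\<And>i j. dot (\<phi> i) (f j) = (if i = j then 1 else 0)" by blast
  interpret free_line_generic f \<phi>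
    by unfold_locales (use \<phi> om d e in \<open>simp_all add: f_def\<close>)
  have "line = vec.span {wedge a b, wedge a c}" by (simp add: line_def f_def)
  then show ?thesis using free_line by simp
qed

text \<open>A point whose contractions with the two forms are dependent is in the kernel of a form of the
  pencil, hence on the vertex conic.\<close>

lemma dependent_vertex:
  fixes a :: "complex ^ 5"
  assumes a: "a \<noteq> 0" and st: "s \<noteq> 0 \<or> t \<noteq> 0"
    and dep: "\<And>u. t * om1 (wedge a u) + s * om2 (wedge a u) = 0"
  shows "\<exists>k. k \<noteq> 0 \<and> a = k *s vec5 (s * s) (s * t) 0 0 (- (t * t))"
proof -
  have eq: "t * (a $ 1 * u $ 2 - a $ 2 * u $ 1 - (a $ 0 * u $ 3 - a $ 3 * u $ 0)) +
      s * (a $ 1 * u $ 3 - a $ 3 * u $ 1 - (a $ 2 * u $ 4 - a $ 4 * u $ 2)) = 0" for u :: "complex ^ 5"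
    using dep[of u] by (simp add: om1_def om2_def wedge_index)
  have e0: "t * a $ 3 = 0" using eq[of "vec5 1 0 0 0 0"] by simp
  have e1: "t * a $ 2 + s * a $ 3 = 0" using eq[of "vec5 0 1 0 0 0"] by (simp add: algebra_simps neg_eq_iff_add_eq_0)
  have e2: "t * a $ 1 + s * a $ 4 = 0" using eq[of "vec5 0 0 1 0 0"] by simp
  have e3: "- t * a $ 0 + s * a $ 1 = 0" using eq[of "vec5 0 0 0 1 0"] by simp
  have e4: "s * a $ 2 = 0" using eq[of "vec5 0 0 0 0 1"] by simp
  have a23: "a $ 2 = 0" "a $ 3 = 0" using e0 e1 e4 st by auto
  show ?thesis
  proof (cases "t = 0")
    case True
    then have s: "s \<noteq> 0" using st by simp
    have "a $ 4 = 0" "a $ 1 = 0" using e2 e3 True s by auto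
    then have "a = (a $ 0 / (s * s)) *s vec5 (s * s) (s * t) 0 0 (- (t * t))"
      unfolding vec_eq_iff forall_5 using True s a23 by simp
    moreover from this have "a $ 0 / (s * s) \<noteq> 0" using a by (metis vector_smult_lzero)
    ultimately show ?thesis by blast
  next
    case False
    have "a $ 1 = - s * a $ 4 / t" using e2 False by (simp add: field_simps add_eq_0_iff)
    moreover have "a $ 0 = s * a $ 1 / t" using e3 False by (simp add: field_simps)
    ultimately have "a = (- a $ 4 / (t * t)) *s vec5 (s * s) (s * t) 0 0 (- (t * t))"
      unfolding vec_eq_iff forall_5 using False a23 by (simp add: field_simps)
    moreover from this have "- a $ 4 / (t * t) \<noteq> 0" using a by (metis vector_smult_lzero)
    ultimately show ?thesis by blast
  qed
qed

theorem non_free_lines: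
  "\<Lambda> \<in> lines_in dP5 \<and> non_free \<Lambda> \<longleftrightarrow>
    (\<exists>s t p q \<alpha> \<beta>. s * q - t * p = 1 \<and> (\<alpha> \<noteq> 0 \<or> \<beta> \<noteq> 0) \<and> \<Lambda> = Zline s t p q \<alpha> \<beta>)"
proof
  assume "\<exists>s t p q \<alpha> \<beta>. s * q - t * p = 1 \<and> (\<alpha> \<noteq> 0 \<or> \<beta> \<noteq> 0) \<and> \<Lambda> = Zline s t p q \<alpha> \<beta>"
  then show "\<Lambda> \<in> lines_in dP5 \<and> non_free \<Lambda>"
    using conic_basis.Zline_non_free by (auto simp: conic_basis_def)
next
  assume \<Lambda>: "\<Lambda> \<in> lines_in dP5 \<and> non_free \<Lambda>"
  then obtain a b c where L: "\<Lambda> = vec.span {wedge a b, wedge a c}" "wedge (wedge a b) (wedge a c) \<noteq> 0"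
    "om1 (wedge a b) = 0" "om2 (wedge a b) = 0" "om1 (wedge a c) = 0" "om2 (wedge a c) = 0"
    using line_vertex by blast
  \<comment> \<open>A non-free line cannot satisfy the independence hypothesis of
    \<open>generic_vertex_line\<close>, so some member of the pencil kills a; its coefficients are
    the conic parameters of a.\<close>
  then obtain t s where st: "t \<noteq> 0 \<or> s \<noteq> 0" "\<And>u. t * om1 (wedge a u) + s * om2 (wedge a u) = 0"
    using generic_vertex_line[OF L(2-6)] \<Lambda> by blast
  have "a \<noteq> 0" using L(2) by (auto simp: wedge_bilinear)
  then obtain k where k: "k \<noteq> 0" "a = k *s vec5 (s * s) (s * t) 0 0 (- (t * t))"
    using dependent_vertex[of a s t] st by blast
  have "\<exists>p q. s * q - t * p = 1"
  proof (cases "s = 0")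
    case True
    then show ?thesis using st(1) by (intro exI[of _ "- inverse t"]) simp
  next
    case False
    then show ?thesis by (intro exI[of _ 0] exI[of _ "inverse s"]) simp
  qed
  then obtain p q where det: "s * q - t * p = 1" by blast
  interpret conic_basis s t p q by unfold_locales (rule det)
  \<comment> \<open>The scalar between a and the standard vector of the conic is moved to the other
    factor.\<close>
  have a: "wedge a u = wedge (vbasis s t p q 0) (k *s u)" for u
    unfolding k(2) by (simp add: vbasis_def wedge_bilinear)
  have "\<exists>\<alpha> \<beta>. (\<alpha> \<noteq> 0 \<or> \<beta> \<noteq> 0) \<and> \<Lambda> = Zline s t p q \<alpha> \<beta>"
    unfolding L(1) a by (rule conic_vertex_line) (use L \<Lambda> in \<open>simp_all add: a\<close>)
  then show "\<exists>s t p q \<alpha> \<beta>. s * q - t * p = 1 \<and> (\<alpha> \<noteq> 0 \<or> \<beta> \<noteq> 0) \<and> \<Lambda> = Zline s t p q \<alpha> \<beta>"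
    using det by blast
qed

section \<open>The vertex conic and the scroll over it\<close>

section \<open>The vertex conic\<close>

lemma zero_or_one_2: "i = 0 \<or> i = (1::2)"
  using exhaust_2[of i] by auto

definition vec2 :: "complex \<Rightarrow> complex \<Rightarrow> complex ^ 2" where
  "vec2 x y = (\<chi> i. if i = 0 then x else y)"

lemma vec2_index [simp]: "vec2 x y $ 0 = x" "vec2 x y $ 1 = y"
  by (simp_all add: vec2_def)

lemma vec2_eq: "vec2 (v $ 0) (v $ 1) = v"
  unfolding vec_eq_iff using zero_or_one_2 by (metis vec2_index)

lemma vec2_neq_0: "vec2 x y \<noteq> 0 \<longleftrightarrow> x \<noteq> 0 \<or> y \<noteq> 0"
  unfolding vec_eq_iff using zero_or_one_2 by (metis vec2_index zero_index)

lemma vec2_scale: "k *s vec2 x y = vec2 (k * x) (k * y)"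
  by (simp add: vec_eq_iff vec2_def)

lemma vec5_scale: "k *s vec5 x0 x1 x2 x3 x4 = vec5 (k * x0) (k * x1) (k * x2) (k * x3) (k * x4)"
  by (simp add: vec_eq_iff vec5_def)

lemma form_vec2: "form d f \<Longrightarrow> form d g \<Longrightarrow> form d (\<lambda>v. vec2 (f v) (g v) $ i)"
  by (cases "i = 0") (simp_all add: vec2_def)

lemma form_vec5:
  "form d f0 \<Longrightarrow> form d f1 \<Longrightarrow> form d f2 \<Longrightarrow> form d f3 \<Longrightarrow> form d f4 \<Longrightarrow>
   form d (\<lambda>v. vec5 (f0 v) (f1 v) (f2 v) (f3 v) (f4 v) $ i)"
  by (cases "i = 0"; cases "i = 1"; cases "i = 2"; cases "i = 3") (simp_all add: vec5_def)

lemma rep_scale: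
  assumes "v \<noteq> 0" obtains c where "c \<noteq> 0" "rep (pt v) = c *s v"
proof -
  have r: "rep (pt v) \<noteq> 0" "pt (rep (pt v)) = pt v" using rep[OF pt_in_Proj[OF assms]] by auto
  then show ?thesis using that pt_eq_iff[OF assms r(1)] by auto
qed

definition conic_vec :: "complex \<Rightarrow> complex \<Rightarrow> complex ^ 5" where
  "conic_vec s t = vec5 (s * s) (s * t) 0 0 (- (t * t))"

lemma conic_vec_neq_0: "s \<noteq> 0 \<or> t \<noteq> 0 \<Longrightarrow> conic_vec s t \<noteq> 0"
  by (auto simp: conic_vec_def vec_eq_iff forall_5)

lemma vertex_conic_Proj: "vertex_conic \<subseteq> Proj"
  by (auto simp: vertex_conic_def)

lemma in_vertex_conic: "x \<in> vertex_conic \<longleftrightarrow> (\<exists>s t. (s \<noteq> 0 \<or> t \<noteq> 0) \<and> x = pt (conic_vec s t))"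
proof
  assume x: "x \<in> vertex_conic"
  then have "x \<in> Proj" by (simp add: vertex_conic_def)
  then obtain a where a: "a \<noteq> 0" "x = pt a" "a \<in> x" by (rule ProjE)
  then have eq: "a $ 0 * a $ 4 + (a $ 1)\<^sup>2 = 0" "a $ 2 = 0" "a $ 3 = 0"
    using x unfolding vertex_conic_def by blast+
  show "\<exists>s t. (s \<noteq> 0 \<or> t \<noteq> 0) \<and> x = pt (conic_vec s t)"
  proof (cases "a $ 0 = 0")
    case True
    then have 1: "a $ 1 = 0" using eq by simp
    then have 4: "a $ 4 \<noteq> 0" using a(1) True eq by (auto simp: vec_eq_iff forall_5)
    have "conic_vec 0 1 = (- inverse (a $ 4)) *s a"
      unfolding conic_vec_def by (rule vec5_eqI[symmetric]) (use True 1 4 eq in simp_all)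
    then have "pt (conic_vec 0 1) = pt a" using pt_scale[of "- inverse (a $ 4)" a] 4 by simp
    then have "x = pt (conic_vec 0 1)" using a(2) by simp
    then show ?thesis by (intro exI[of _ 0] exI[of _ 1]) simp
  next
    case False
    have "conic_vec (a $ 0) (a $ 1) = a $ 0 *s a"
      unfolding conic_vec_def by (rule vec5_eqI[symmetric]) (use eq in \<open>simp_all add: power2_eq_square add_eq_0_iff2\<close>)
    then have "x = pt (conic_vec (a $ 0) (a $ 1))" using a(2) False by simp
    then show ?thesis using False by blast
  qed
next
  assume "\<exists>s t. (s \<noteq> 0 \<or> t \<noteq> 0) \<and> x = pt (conic_vec s t)"
  then obtain s t where st: "s \<noteq> 0 \<or> t \<noteq> 0" "x = pt (conic_vec s t)" by blast
  then show "x \<in> vertex_conic" using conic_vec_neq_0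
    by (auto simp: vertex_conic_def in_pt conic_vec_def power2_eq_square algebra_simps)
qed

lemma vertex_conic_rep:
  assumes "v \<noteq> 0" "pt v \<in> vertex_conic"
  obtains s t k where "s \<noteq> 0 \<or> t \<noteq> 0" "k \<noteq> 0" "v = k *s conic_vec s t"
  using assms in_vertex_conic pt_eq_iff conic_vec_neq_0 by metis

definition to_conic :: "2 subsp \<Rightarrow> 5 subsp" where
  "to_conic x = pt (conic_vec (rep x $ 0) (rep x $ 1))"

text \<open>On \<open>conic_vec s t\<close> the pairs of entries (0, 1) and (1, minus 4) are s (s,
  t) and t (s, t), so the pair selected returns the point (s : t).\<close>

definition from_conic :: "5 subsp \<Rightarrow> 2 subsp" where
  "from_conic x = (if rep x $ 0 \<noteq> 0 then pt (vec2 (rep x $ 0) (rep x $ 1)) else pt (vec2 (rep x $ 1) (- rep x $ 4)))"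

lemma to_conic_pt: "v \<noteq> 0 \<Longrightarrow> to_conic (pt v) = pt (conic_vec (v $ 0) (v $ 1))"
proof -
  assume "v \<noteq> 0"
  then obtain c where c: "c \<noteq> 0" "rep (pt v) = c *s v" by (rule rep_scale)
  have "conic_vec (c * v $ 0) (c * v $ 1) = (c * c) *s conic_vec (v $ 0) (v $ 1)"
    by (simp add: conic_vec_def vec5_scale algebra_simps)
  then show ?thesis unfolding to_conic_def c(2) using c(1) by simp
qed

lemma from_conic_pt:
  assumes "s \<noteq> 0 \<or> t \<noteq> 0" shows "from_conic (pt (conic_vec s t)) = pt (vec2 s t)"
proof -
  obtain c where c: "c \<noteq> 0" "rep (pt (conic_vec s t)) = c *s conic_vec s t" by (rule rep_scale[OF conic_vec_neq_0[OF assms]])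
  show ?thesis
  proof (cases "s = 0")
    case True
    have "vec2 0 (c * (t * t)) = (c * t) *s vec2 s t" using True by (simp add: vec2_scale mult.assoc)
    then show ?thesis using True c assms by (simp add: from_conic_def conic_vec_def)
  next
    case False
    have "vec2 (c * (s * s)) (c * (s * t)) = (c * s) *s vec2 s t" by (simp add: vec2_scale mult.assoc)
    then show ?thesis using False c by (simp add: from_conic_def conic_vec_def)
  qed
qed

lemma P1_rep:
  assumes "x \<in> (Proj :: 2 subsp set)"
  obtains s t where "s \<noteq> 0 \<or> t \<noteq> 0" "x = pt (vec2 s t)"
  using assms by (metis ProjE vec2_eq vec2_neq_0)

theorem isomorphic_vertex_conic: "isomorphic vertex_conic (Proj :: 2 subsp set)"
proof -
  have "isomorphism vertex_conic (Proj :: 2 subsp set) from_conic"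
  proof (rule isomorphismI[where \<psi> = to_conic])
    show "morphism vertex_conic (Proj :: 2 subsp set) from_conic"
    proof (rule morphismI[OF vertex_conic_Proj])
      fix x assume "x \<in> vertex_conic"
      then obtain s t where st: "s \<noteq> 0 \<or> t \<noteq> 0" "x = pt (conic_vec s t)" using in_vertex_conic by blast
      then show "from_conic x \<in> Proj" using from_conic_pt[OF st(1)] vec2_neq_0[of s t] by simp
      show "\<exists>e g d F. form e g \<and> x \<in> basic g \<and> (\<forall>i. form d (\<lambda>v. F v $ i)) \<and>
        (\<forall>v. v \<noteq> 0 \<longrightarrow> pt v \<in> vertex_conic \<inter> basic g \<longrightarrow> F v \<noteq> 0 \<and> from_conic (pt v) = pt (F v))"
      proof (cases "s = 0")
        case False
        show ?thesis
        proof (intro exI conjI allI impI)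
          show "x \<in> basic (\<lambda>v. v $ 0)" using pt_in_basic[OF form.coord conic_vec_neq_0[OF st(1)]] st False by (simp add: conic_vec_def)
          show "form 1 (\<lambda>v. vec2 (v $ 0) (v $ 1) $ i)" for i by (intro form_vec2 form.coord)
          fix v :: "complex ^ 5" assume v: "v \<noteq> 0" "pt v \<in> vertex_conic \<inter> basic (\<lambda>v. v $ 0)"
          then obtain s t k where k: "s \<noteq> 0 \<or> t \<noteq> 0" "k \<noteq> 0" "v = k *s conic_vec s t" using vertex_conic_rep by blast
          have v0: "v $ 0 \<noteq> 0" using v pt_in_basic[OF form.coord v(1)] by blast
          then have s: "s \<noteq> 0" using k by (simp add: conic_vec_def)
          have e: "vec2 (v $ 0) (v $ 1) = (k * s) *s vec2 s t" by (simp add: k(3) conic_vec_def vec2_scale algebra_simps)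
          show "vec2 (v $ 0) (v $ 1) \<noteq> 0" using v0 vec2_neq_0 by blast
          show "from_conic (pt v) = pt (vec2 (v $ 0) (v $ 1))"
            unfolding e using from_conic_pt[OF k(1)] k s by simp
        qed (rule form.coord)
      next
        case True
        then have t: "t \<noteq> 0" using st by simp
        show ?thesis
        proof (intro exI conjI allI impI)
          show "x \<in> basic (\<lambda>v. v $ 4)" using pt_in_basic[OF form.coord conic_vec_neq_0[OF st(1)]] st t by (simp add: conic_vec_def)
          show "form 1 (\<lambda>v. vec2 (v $ 1) (- v $ 4) $ i)" for i by (intro form_vec2 form_uminus form.coord)
          fix v :: "complex ^ 5" assume v: "v \<noteq> 0" "pt v \<in> vertex_conic \<inter> basic (\<lambda>v. v $ 4)"
          then obtain s t k where k: "s \<noteq> 0 \<or> t \<noteq> 0" "k \<noteq> 0" "v = k *s conic_vec s t" using vertex_conic_rep by blast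
          have v4: "v $ 4 \<noteq> 0" using v pt_in_basic[OF form.coord v(1)] by blast
          then have t: "t \<noteq> 0" using k by (simp add: conic_vec_def)
          have e: "vec2 (v $ 1) (- v $ 4) = (k * t) *s vec2 s t" by (simp add: k(3) conic_vec_def vec2_scale algebra_simps)
          show "vec2 (v $ 1) (- v $ 4) \<noteq> 0" using v4 vec2_neq_0 by auto
          show "from_conic (pt v) = pt (vec2 (v $ 1) (- v $ 4))"
            unfolding e using from_conic_pt[OF k(1)] k t by simp
        qed (rule form.coord)
      qed
    qed simp
    show "morphism (Proj :: 2 subsp set) vertex_conic to_conic"
    proof (rule morphismI[OF _ vertex_conic_Proj])
      fix x :: "2 subsp" assume x: "x \<in> Proj"
      then obtain s t where st: "s \<noteq> 0 \<or> t \<noteq> 0" "x = pt (vec2 s t)" by (rule P1_rep)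
      then show "to_conic x \<in> vertex_conic" using to_conic_pt[of "vec2 s t"] vec2_neq_0 in_vertex_conic by auto
      show "\<exists>e g d F. form e g \<and> x \<in> basic g \<and> (\<forall>i. form d (\<lambda>v. F v $ i)) \<and>
        (\<forall>v. v \<noteq> 0 \<longrightarrow> pt v \<in> Proj \<inter> basic g \<longrightarrow> F v \<noteq> 0 \<and> to_conic (pt v) = pt (F v))"
      proof (intro exI conjI allI impI)
        show "x \<in> basic (\<lambda>v. 1)" using x by simp
        show "form 2 (\<lambda>v. conic_vec (v $ 0) (v $ 1) $ i)" for i
          unfolding conic_vec_def by (intro form_vec5 form_uminus form_11 form.coord form.zero)
        fix v :: "complex ^ 2" assume v: "v \<noteq> 0"
        then have "v $ 0 \<noteq> 0 \<or> v $ 1 \<noteq> 0" using vec2_eq vec2_neq_0 by metis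
        then show "conic_vec (v $ 0) (v $ 1) \<noteq> 0" by (rule conic_vec_neq_0)
        show "to_conic (pt v) = pt (conic_vec (v $ 0) (v $ 1))" by (rule to_conic_pt[OF v])
      qed (rule form.const)
    qed simp
    show "to_conic (from_conic x) = x" if "x \<in> vertex_conic" for x
    proof -
      obtain s t where st: "s \<noteq> 0 \<or> t \<noteq> 0" "x = pt (conic_vec s t)" using \<open>x \<in> vertex_conic\<close> in_vertex_conic by blast
      then show ?thesis using from_conic_pt[OF st(1)] to_conic_pt[of "vec2 s t"] vec2_neq_0 by auto
    qed
    show "from_conic (to_conic y) = y" if "y \<in> Proj" for y
    proof -
      obtain s t where st: "s \<noteq> 0 \<or> t \<noteq> 0" "y = pt (vec2 s t)" using \<open>y \<in> Proj\<close> by (rule P1_rep)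
      then show ?thesis using from_conic_pt[OF st(1)] to_conic_pt[of "vec2 s t"] vec2_neq_0 by auto
    qed
  qed (use vertex_conic_Proj in auto)
  then show ?thesis unfolding isomorphic_def by blast
qed

section \<open>The locus of non-free lines as a rational normal scroll\<close>

abbreviation e2 :: "5 \<Rightarrow> 5 \<Rightarrow> complex ^ (5 \<times> 5)" where
  "e2 i j \<equiv> wedge (axis i 1) (axis j 1)"

abbreviation e4 :: "5 \<Rightarrow> 5 \<Rightarrow> 5 \<Rightarrow> 5 \<Rightarrow> complex ^ ((5 \<times> 5) \<times> (5 \<times> 5))" where
  "e4 i j k l \<equiv> wedge (e2 i j) (e2 k l)"

text \<open>The span of the scroll \<open>S(2, 5)\<close>; the coefficients are those of the bivector
  \<open>(a \<and> b) \<and> (a \<and> c)\<close> in \<open>scroll_vec_wedge\<close>.\<close>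

definition scroll_lin :: "complex \<Rightarrow> complex \<Rightarrow> complex \<Rightarrow> complex \<Rightarrow> complex \<Rightarrow> complex \<Rightarrow> complex \<Rightarrow> complex \<Rightarrow> complex \<Rightarrow>
    complex ^ ((5 \<times> 5) \<times> (5 \<times> 5))" where
  "scroll_lin x0 x1 x2 y0 y1 y2 y3 y4 y5 =
     x0 *s e4 0 1 0 4 + x1 *s e4 0 1 1 4 - x2 *s e4 0 4 1 4
     + y0 *s e4 0 1 0 2
     + y1 *s (e4 0 1 0 3 + e4 0 1 1 2 - 2 *s e4 0 4 0 2)
     + y2 *s (e4 0 1 1 3 + e4 0 1 2 4 - 2 *s e4 0 4 0 3 - 2 *s e4 0 4 1 2 - e4 1 4 0 2)
     + y3 *s (e4 0 1 3 4 - 2 *s e4 0 4 1 3 - 2 *s e4 0 4 2 4 - e4 1 4 0 3 - e4 1 4 1 2)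
     + y4 *s (- 2 *s e4 0 4 3 4 - e4 1 4 1 3 - e4 1 4 2 4)
     - y5 *s e4 1 4 3 4"

text \<open>These nine entries are coordinates on the span of the scroll, dual to the arguments of
  \<open>scroll_lin\<close>; signs compensate those in its terms.\<close>

definition X0 :: "complex ^ ((5 \<times> 5) \<times> (5 \<times> 5)) \<Rightarrow> complex" where "X0 v = v $ ((0, 1), (0, 4))"
definition X1 :: "complex ^ ((5 \<times> 5) \<times> (5 \<times> 5)) \<Rightarrow> complex" where "X1 v = v $ ((0, 1), (1, 4))"
definition X2 :: "complex ^ ((5 \<times> 5) \<times> (5 \<times> 5)) \<Rightarrow> complex" where "X2 v = - v $ ((0, 4), (1, 4))"
definition Y0 :: "complex ^ ((5 \<times> 5) \<times> (5 \<times> 5)) \<Rightarrow> complex" where "Y0 v = v $ ((0, 1), (0, 2))"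
definition Y1 :: "complex ^ ((5 \<times> 5) \<times> (5 \<times> 5)) \<Rightarrow> complex" where "Y1 v = v $ ((0, 1), (0, 3))"
definition Y2 :: "complex ^ ((5 \<times> 5) \<times> (5 \<times> 5)) \<Rightarrow> complex" where "Y2 v = v $ ((0, 1), (1, 3))"
definition Y3 :: "complex ^ ((5 \<times> 5) \<times> (5 \<times> 5)) \<Rightarrow> complex" where "Y3 v = v $ ((0, 1), (3, 4))"
definition Y4 :: "complex ^ ((5 \<times> 5) \<times> (5 \<times> 5)) \<Rightarrow> complex" where "Y4 v = - v $ ((1, 4), (1, 3))"
definition Y5 :: "complex ^ ((5 \<times> 5) \<times> (5 \<times> 5)) \<Rightarrow> complex" where "Y5 v = - v $ ((1, 4), (3, 4))"

lemmas XY_defs = X0_def X1_def X2_def Y0_def Y1_def Y2_def Y3_def Y4_def Y5_def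

lemma form_XY: "form 1 X0" "form 1 X1" "form 1 X2" "form 1 Y0" "form 1 Y1" "form 1 Y2" "form 1 Y3" "form 1 Y4" "form 1 Y5"
  unfolding XY_defs[abs_def] by (intro form_uminus form.coord)+

lemma XY_scroll_lin:
  "X0 (scroll_lin x0 x1 x2 y0 y1 y2 y3 y4 y5) = x0" "X1 (scroll_lin x0 x1 x2 y0 y1 y2 y3 y4 y5) = x1"
  "X2 (scroll_lin x0 x1 x2 y0 y1 y2 y3 y4 y5) = x2" "Y0 (scroll_lin x0 x1 x2 y0 y1 y2 y3 y4 y5) = y0"
  "Y1 (scroll_lin x0 x1 x2 y0 y1 y2 y3 y4 y5) = y1" "Y2 (scroll_lin x0 x1 x2 y0 y1 y2 y3 y4 y5) = y2"
  "Y3 (scroll_lin x0 x1 x2 y0 y1 y2 y3 y4 y5) = y3" "Y4 (scroll_lin x0 x1 x2 y0 y1 y2 y3 y4 y5) = y4"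
  "Y5 (scroll_lin x0 x1 x2 y0 y1 y2 y3 y4 y5) = y5"
  by (simp_all add: XY_defs scroll_lin_def wedge_index axis_def)

lemma scroll_lin_scale: "k *s scroll_lin x0 x1 x2 y0 y1 y2 y3 y4 y5 =
    scroll_lin (k * x0) (k * x1) (k * x2) (k * y0) (k * y1) (k * y2) (k * y3) (k * y4) (k * y5)"
  by (simp add: scroll_lin_def vec_eq_iff algebra_simps)

lemma form_scroll_lin:
  assumes "form d f0" "form d f1" "form d f2" "form d h0" "form d h1" "form d h2" "form d h3" "form d h4" "form d h5"
  shows "form d (\<lambda>v. scroll_lin (f0 v) (f1 v) (f2 v) (h0 v) (h1 v) (h2 v) (h3 v) (h4 v) (h5 v) $ i)"
  unfolding scroll_lin_def vector_add_component vector_minus_component vector_smult_component[of _ "_ :: complex ^ ((5 \<times> 5) \<times> (5 \<times> 5))"]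
  by (intro form.add form_diff form_multc assms)

definition scroll_vec :: "complex \<Rightarrow> complex \<Rightarrow> complex \<Rightarrow> complex \<Rightarrow> complex ^ ((5 \<times> 5) \<times> (5 \<times> 5))" where
  "scroll_vec s t \<alpha> \<beta> = scroll_lin (\<alpha> * (s * s)) (\<alpha> * (s * t)) (\<alpha> * (t * t)) (\<beta> * s ^ 5) (\<beta> * (s ^ 4 * t)) (\<beta> * (s ^ 3 * t ^ 2))
     (\<beta> * (s ^ 2 * t ^ 3)) (\<beta> * (s * t ^ 4)) (\<beta> * t ^ 5)"

lemma XY_scroll_vec [simp]:
  "X0 (scroll_vec s t \<alpha> \<beta>) = \<alpha> * (s * s)" "X1 (scroll_vec s t \<alpha> \<beta>) = \<alpha> * (s * t)" "X2 (scroll_vec s t \<alpha> \<beta>) = \<alpha> * (t * t)"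
  "Y0 (scroll_vec s t \<alpha> \<beta>) = \<beta> * s ^ 5" "Y1 (scroll_vec s t \<alpha> \<beta>) = \<beta> * (s ^ 4 * t)" "Y2 (scroll_vec s t \<alpha> \<beta>) = \<beta> * (s ^ 3 * t ^ 2)"
  "Y3 (scroll_vec s t \<alpha> \<beta>) = \<beta> * (s ^ 2 * t ^ 3)" "Y4 (scroll_vec s t \<alpha> \<beta>) = \<beta> * (s * t ^ 4)" "Y5 (scroll_vec s t \<alpha> \<beta>) = \<beta> * t ^ 5"
  by (simp_all add: scroll_vec_def XY_scroll_lin)

lemma scroll_vec_scale: "k *s scroll_vec s t \<alpha> \<beta> = scroll_vec s t (k * \<alpha>) (k * \<beta>)"
  by (simp add: scroll_vec_def scroll_lin_scale algebra_simps)

lemma XY_0: "X0 0 = 0" "X2 0 = 0" "Y0 0 = 0" "Y5 0 = 0"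
  by (simp_all add: XY_defs)

lemma scroll_vec_neq_0: "s \<noteq> 0 \<or> t \<noteq> 0 \<Longrightarrow> \<alpha> \<noteq> 0 \<or> \<beta> \<noteq> 0 \<Longrightarrow> scroll_vec s t \<alpha> \<beta> \<noteq> 0"
proof
  assume *: "s \<noteq> 0 \<or> t \<noteq> 0" "\<alpha> \<noteq> 0 \<or> \<beta> \<noteq> 0" and 0: "scroll_vec s t \<alpha> \<beta> = 0"
  have "\<alpha> * (s * s) = 0" "\<alpha> * (t * t) = 0" "\<beta> * s ^ 5 = 0" "\<beta> * t ^ 5 = 0"
    using XY_scroll_vec[of s t \<alpha> \<beta>] XY_0 unfolding 0 by simp_all
  then show False using * by auto
qed

definition scroll :: "((5 \<times> 5) \<times> (5 \<times> 5)) subsp set" where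
  "scroll = {pt (scroll_vec s t \<alpha> \<beta>) | s t \<alpha> \<beta>. (s \<noteq> 0 \<or> t \<noteq> 0) \<and> (\<alpha> \<noteq> 0 \<or> \<beta> \<noteq> 0)}"

lemma vbasis_wedges:
  assumes d: "s * q - t * p = 1"
  shows "wedge (vbasis s t p q 0) (vbasis s t p q 1) = (s * s) *s e2 0 1 - (2 * s * t) *s e2 0 4 - (t * t) *s e2 1 4"
    and "wedge (vbasis s t p q 0) (vbasis s t p q 2) = (s * s * s) *s e2 0 2 + (s * s * t) *s (e2 0 3 + e2 1 2)
      + (s * t * t) *s (e2 1 3 + e2 2 4) + (t * t * t) *s e2 3 4"
    and "wedge (vbasis s t p q 0) (vbasis s t p q 4) = (- s * p) *s e2 0 1 + (s * q + t * p) *s e2 0 4 + (t * q) *s e2 1 4"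
  unfolding vec_eq_iff split_paired_All forall_5
  by (simp_all add: wedge_index vbasis_def axis_def algebra_simps)
    (use d in \<open>(algebra | intro conjI)+\<close>)

text \<open>The result does not depend on the auxiliary p, q. With determinant 1, the bivectors of
  the vector 0 with 1 and with 2 contain neither; the one with 4 does, but its wedge with the first
  is s q - t p times a vector free of p and q.\<close>

lemma scroll_vec_wedge:
  assumes d: "s * q - t * p = 1"
  shows "wedge (wedge (vbasis s t p q 0) (vbasis s t p q 1)) (wedge (vbasis s t p q 0) (\<alpha> *s vbasis s t p q 4 + \<beta> *s vbasis s t p q 2)) = scroll_vec s t \<alpha> \<beta>"
proof -
  have 1: "wedge (wedge (vbasis s t p q 0) (vbasis s t p q 1)) (wedge (vbasis s t p q 0) (vbasis s t p q 4)) =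
    (s * s) *s e4 0 1 0 4 + (s * t) *s e4 0 1 1 4 - (t * t) *s e4 0 4 1 4"
    (is "_ = ?r")
  proof -
    have "wedge (wedge (vbasis s t p q 0) (vbasis s t p q 1)) (wedge (vbasis s t p q 0) (vbasis s t p q 4)) = (s * q - t * p) *s ?r"
      unfolding vbasis_wedges[OF d] by (simp add: vec_eq_iff wedge_def[of "_ :: complex ^ (5 \<times> 5)"] algebra_simps)
    then show ?thesis unfolding d by simp
  qed
  have 2: "wedge (wedge (vbasis s t p q 0) (vbasis s t p q 1)) (wedge (vbasis s t p q 0) (vbasis s t p q 2)) = scroll_vec s t 0 1"
    unfolding vbasis_wedges[OF d] scroll_vec_def scroll_lin_def
    by (simp add: vec_eq_iff wedge_def[of "_ :: complex ^ (5 \<times> 5)"] algebra_simps power_numeral_reduce)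
  have 3: "scroll_vec s t \<alpha> \<beta> = \<alpha> *s ((s * s) *s e4 0 1 0 4 + (s * t) *s e4 0 1 1 4 - (t * t) *s e4 0 4 1 4) + \<beta> *s scroll_vec s t 0 1"
    by (simp add: scroll_vec_def scroll_lin_def vec_eq_iff algebra_simps)
  show ?thesis unfolding 3 1[symmetric] 2[symmetric] by (simp add: wedge_bilinear)
qed

theorem non_free_locus_eq: "non_free_locus = scroll"
proof -
  have pl: "pluecker (Zline s t p q \<alpha> \<beta>) = pt (scroll_vec s t \<alpha> \<beta>)"
    if "s * q - t * p = 1" "\<alpha> \<noteq> 0 \<or> \<beta> \<noteq> 0" for s t p q \<alpha> \<beta>
  proof -
    have "s \<noteq> 0 \<or> t \<noteq> 0" using that(1) by auto
    then have "scroll_vec s t \<alpha> \<beta> \<noteq> 0" using that(2) by (rule scroll_vec_neq_0)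
    then show ?thesis unfolding Zline_def by (simp add: pluecker_span2 scroll_vec_wedge[OF that(1)])
  qed
  have 1: "h \<in> non_free_locus \<longleftrightarrow> (\<exists>\<Lambda>. h = pluecker \<Lambda> \<and> \<Lambda> \<in> lines_in dP5 \<and> non_free \<Lambda>)" for h
    unfolding non_free_locus_def H1_def by blast
  have 2: "(\<exists>\<Lambda>. h = pluecker \<Lambda> \<and> \<Lambda> \<in> lines_in dP5 \<and> non_free \<Lambda>) \<longleftrightarrow> h \<in> scroll" for h
  proof
    assume "\<exists>\<Lambda>. h = pluecker \<Lambda> \<and> \<Lambda> \<in> lines_in dP5 \<and> non_free \<Lambda>"
    then obtain \<Lambda> where h: "h = pluecker \<Lambda>" and \<Lambda>: "\<Lambda> \<in> lines_in dP5 \<and> non_free \<Lambda>" by blast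
    obtain s t p q \<alpha> \<beta> where *: "s * q - t * p = 1" "\<alpha> \<noteq> 0 \<or> \<beta> \<noteq> 0" "\<Lambda> = Zline s t p q \<alpha> \<beta>"
      using \<Lambda> unfolding non_free_lines by blast
    have "s \<noteq> 0 \<or> t \<noteq> 0" using *(1) by auto
    then show "h \<in> scroll" unfolding scroll_def h *(3) pl[OF *(1,2)] using *(2) by blast
  next
    assume "h \<in> scroll"
    then obtain s t \<alpha> \<beta> where *: "s \<noteq> 0 \<or> t \<noteq> 0" "\<alpha> \<noteq> 0 \<or> \<beta> \<noteq> 0" "h = pt (scroll_vec s t \<alpha> \<beta>)"
      unfolding scroll_def by blast
    have "\<exists>p q. s * q - t * p = 1"
    proof (cases "s = 0")
      case True
      then show ?thesis using *(1) by (intro exI[of _ "- inverse t"]) simp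
    next
      case False
      then show ?thesis by (intro exI[of _ 0] exI[of _ "inverse s"]) simp
    qed
    then obtain p q where d: "s * q - t * p = 1" by blast
    have "Zline s t p q \<alpha> \<beta> \<in> lines_in dP5 \<and> non_free (Zline s t p q \<alpha> \<beta>)"
      unfolding non_free_lines using d *(2) by blast
    moreover have "h = pluecker (Zline s t p q \<alpha> \<beta>)" using pl[OF d *(2)] *(3) by simp
    ultimately show "\<exists>\<Lambda>. h = pluecker \<Lambda> \<and> \<Lambda> \<in> lines_in dP5 \<and> non_free \<Lambda>" by blast
  qed
  show ?thesis by (rule set_eqI) (simp only: 1 2)
qed

lemma scroll_Proj: "scroll \<subseteq> Proj"
  unfolding scroll_def using scroll_vec_neq_0 by auto

lemma scroll_rep:
  assumes "v \<noteq> 0" "pt v \<in> scroll"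
  obtains s t \<alpha> \<beta> where "s \<noteq> 0 \<or> t \<noteq> 0" "\<alpha> \<noteq> 0 \<or> \<beta> \<noteq> 0" "v = scroll_vec s t \<alpha> \<beta>"
proof -
  obtain s t \<alpha> \<beta> where *: "s \<noteq> 0 \<or> t \<noteq> 0" "\<alpha> \<noteq> 0 \<or> \<beta> \<noteq> 0" "pt v = pt (scroll_vec s t \<alpha> \<beta>)"
    using assms unfolding scroll_def by blast
  then obtain k where "k \<noteq> 0" "v = k *s scroll_vec s t \<alpha> \<beta>"
    using pt_eq_iff[OF scroll_vec_neq_0[OF *(1,2)] assms(1)] by blast
  then show ?thesis using that[of s t "k * \<alpha>" "k * \<beta>"] * by (auto simp: scroll_vec_scale)
qed

subsection \<open>Closedness\<close>

text \<open>With \<open>row2\<close> this is the 2x7 matrix of \<open>S(2, 5)\<close>: a block of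
  width 2 from the conic and one of width 5 from the quintic, with rows in the ratio s : t.\<close>

definition row1 :: "(complex ^ ((5 \<times> 5) \<times> (5 \<times> 5)) \<Rightarrow> complex) list" where
  "row1 = [X0, X1, Y0, Y1, Y2, Y3, Y4]"

definition row2 :: "(complex ^ ((5 \<times> 5) \<times> (5 \<times> 5)) \<Rightarrow> complex) list" where
  "row2 = [X1, X2, Y1, Y2, Y3, Y4, Y5]"

definition scroll_retract :: "complex ^ ((5 \<times> 5) \<times> (5 \<times> 5)) \<Rightarrow> complex ^ ((5 \<times> 5) \<times> (5 \<times> 5))" where
  "scroll_retract v = scroll_lin (X0 v) (X1 v) (X2 v) (Y0 v) (Y1 v) (Y2 v) (Y3 v) (Y4 v) (Y5 v)"

text \<open>The determinantal equations of the scroll: linear ones for its span, and the 2x2 minors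
  of the matrix with rows \<open>row1\<close> and \<open>row2\<close>.\<close>

definition scroll_forms :: "(complex ^ ((5 \<times> 5) \<times> (5 \<times> 5)) \<Rightarrow> complex) set" where
  "scroll_forms = {\<lambda>v. v $ i - scroll_retract v $ i | i. True} \<union>
     {\<lambda>v. (row1 ! i) v * (row2 ! j) v - (row1 ! j) v * (row2 ! i) v | i j. i < 7 \<and> j < 7}"

lemma less7: "i < (7::nat) \<longleftrightarrow> i = 0 \<or> i = 1 \<or> i = 2 \<or> i = 3 \<or> i = 4 \<or> i = 5 \<or> i = 6"
  by auto

lemma rows_scroll_vec:
  "i < 7 \<Longrightarrow> t * (row1 ! i) (scroll_vec s t \<alpha> \<beta>) = s * (row2 ! i) (scroll_vec s t \<alpha> \<beta>)"
  unfolding less7 by (auto simp: row1_def row2_def power_numeral_reduce)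

theorem scroll_closed: "closedin zariski scroll"
proof -
  have "scroll = {x \<in> Proj. \<forall>v\<in>x - {0}. \<forall>g\<in>scroll_forms. g v = 0}" (is "_ = ?C")
  proof
    show "scroll \<subseteq> ?C"
    proof
      fix x assume x: "x \<in> scroll"
      then have xP: "x \<in> Proj" using scroll_Proj by blast
      have "g v = 0" if v: "v \<in> x - {0}" and g: "g \<in> scroll_forms" for v g
      proof -
        have "x = pt v" using xP v Proj_eq_pt by blast
        then have "v \<noteq> 0" "pt v \<in> scroll" using v x by auto
        then obtain s t \<alpha> \<beta> where st: "s \<noteq> 0 \<or> t \<noteq> 0" and vJ: "v = scroll_vec s t \<alpha> \<beta>"
          by (rule scroll_rep)
        have ret: "scroll_retract v = v" unfolding vJ scroll_retract_def XY_scroll_vec by (simp add: scroll_vec_def)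
        have minor: "(row1 ! i) v * (row2 ! j) v - (row1 ! j) v * (row2 ! i) v = 0" if "i < 7" "j < 7" for i j
        proof -
          have i: "t * (row1 ! i) v = s * (row2 ! i) v" and j: "t * (row1 ! j) v = s * (row2 ! j) v"
            unfolding vJ using rows_scroll_vec that by auto
          have "s * ((row1 ! i) v * (row2 ! j) v - (row1 ! j) v * (row2 ! i) v) = 0"
            "t * ((row1 ! i) v * (row2 ! j) v - (row1 ! j) v * (row2 ! i) v) = 0"
            using i j by algebra+
          then show ?thesis using st by auto
        qed
        show ?thesis using g ret minor unfolding scroll_forms_def by auto
      qed
      then show "x \<in> ?C" using xP by blast
    qed
    show "?C \<subseteq> scroll"
    proof
      fix x assume x: "x \<in> ?C"
      then have "x \<in> Proj" by blast
      then obtain v where v: "v \<noteq> 0" "x = pt v" "v \<in> x" by (rule ProjE)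
      have g: "g v = 0" if "g \<in> scroll_forms" for g using x v that by blast
      have "v $ i - scroll_retract v $ i = 0" for i
        by (rule g[of "\<lambda>v. v $ i - scroll_retract v $ i"]) (unfold scroll_forms_def, blast)
      then have vJ: "v = scroll_lin (X0 v) (X1 v) (X2 v) (Y0 v) (Y1 v) (Y2 v) (Y3 v) (Y4 v) (Y5 v)"
        unfolding scroll_retract_def[symmetric] by (simp add: vec_eq_iff)
      have minor: "(row1 ! i) v * (row2 ! j) v - (row1 ! j) v * (row2 ! i) v = 0" if "i < 7" "j < 7" for i j
        by (rule g[of "\<lambda>v. (row1 ! i) v * (row2 ! j) v - (row1 ! j) v * (row2 ! i) v"])
          (unfold scroll_forms_def, use that in blast)
      have "\<exists>i<7. (row1 ! i) v \<noteq> 0 \<or> (row2 ! i) v \<noteq> 0"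
      proof (rule ccontr)
        assume "\<not> ?thesis"
        then have z: "(row1 ! i) v = 0" "(row2 ! i) v = 0" if "i < 7" for i using that by auto
        have "X0 v = 0" "X1 v = 0" "Y0 v = 0" "Y1 v = 0" "Y2 v = 0" "Y3 v = 0" "Y4 v = 0"
          using z(1)[of 0] z(1)[of 1] z(1)[of 2] z(1)[of 3] z(1)[of 4] z(1)[of 5] z(1)[of 6] by (simp_all add: row1_def)
        moreover have "X2 v = 0" "Y5 v = 0" using z(2)[of 1] z(2)[of 6] by (simp_all add: row2_def)
        ultimately have "v = 0" by (subst vJ) (simp add: scroll_lin_def)
        then show False using v by blast
      qed
      then obtain i0 where i0: "i0 < 7" "(row1 ! i0) v \<noteq> 0 \<or> (row2 ! i0) v \<noteq> 0" by blast
      \<comment> \<open>A nonzero column of the rank 1 matrix gives the ratio of its rows, hence a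
        point of the conic. The relations between the rows then turn both blocks into geometric
        progressions, whose scale factors are \<alpha> and \<beta>.\<close>
      define s t where "s = (row1 ! i0) v" and "t = (row2 ! i0) v"
      have st: "s \<noteq> 0 \<or> t \<noteq> 0" using i0 by (simp add: s_def t_def)
      have rel: "t * (row1 ! i) v = s * (row2 ! i) v" if "i < 7" for i
        using minor[OF i0(1) that] unfolding s_def t_def by (simp add: algebra_simps)
      have rels: "t * X0 v = s * X1 v" "t * X1 v = s * X2 v" "t * Y0 v = s * Y1 v" "t * Y1 v = s * Y2 v"
        "t * Y2 v = s * Y3 v" "t * Y3 v = s * Y4 v" "t * Y4 v = s * Y5 v"
        using rel[of 0] rel[of 1] rel[of 2] rel[of 3] rel[of 4] rel[of 5] rel[of 6]
        by (simp_all add: row1_def row2_def)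
      have "\<exists>\<alpha> \<beta>. v = scroll_vec s t \<alpha> \<beta>"
      proof (cases "s = 0")
        case True
        then have t: "t \<noteq> 0" using st by simp
        have "v = scroll_vec s t (X2 v / (t * t)) (Y5 v / t ^ 5)"
          by (subst vJ) (use rels True t in \<open>simp add: scroll_vec_def\<close>)
        then show ?thesis by blast
      next
        case False
        have r: "X1 v = t * X0 v / s" "X2 v = t * X1 v / s" "Y1 v = t * Y0 v / s" "Y2 v = t * Y1 v / s"
          "Y3 v = t * Y2 v / s" "Y4 v = t * Y3 v / s" "Y5 v = t * Y4 v / s"
          using rels False by (simp_all add: field_simps)
        have "v = scroll_vec s t (X0 v / (s * s)) (Y0 v / s ^ 5)"
          by (subst vJ, unfold r(7), unfold r(6), unfold r(5), unfold r(4), unfold r(3), unfold r(2), unfold r(1))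
            (use False in \<open>simp add: scroll_vec_def power_numeral_reduce mult_ac\<close>)
        then show ?thesis by blast
      qed
      then obtain \<alpha> \<beta> where e: "v = scroll_vec s t \<alpha> \<beta>" by blast
      have "\<alpha> \<noteq> 0 \<or> \<beta> \<noteq> 0"
      proof (rule ccontr)
        assume "\<not> (\<alpha> \<noteq> 0 \<or> \<beta> \<noteq> 0)"
        then have "v = 0" using e by (simp add: scroll_vec_def scroll_lin_def)
        then show False using v by blast
      qed
      then show "x \<in> scroll" unfolding scroll_def using v e st by blast
    qed
  qed
  moreover have "\<exists>d. form d g" if g: "g \<in> scroll_forms" for g
  proof -
    have r: "form 1 (row1 ! i)" "form 1 (row2 ! i)" if "i < 7" for i
      using that form_XY unfolding less7 by (auto simp: row1_def row2_def)
    have "form 1 (\<lambda>v. v $ i - scroll_retract v $ i)" for i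
      unfolding scroll_retract_def by (intro form_diff form_scroll_lin form_XY form.coord)
    moreover have "form 2 (\<lambda>v. (row1 ! i) v * (row2 ! j) v - (row1 ! j) v * (row2 ! i) v)" if "i < 7" "j < 7" for i j
      using that by (intro form_diff form_11 r)
    ultimately show ?thesis using g unfolding scroll_forms_def by blast
  qed
  ultimately show ?thesis using closedin_forms[of scroll_forms] by simp
qed

subsection \<open>The fibration\<close>

definition tens :: "complex ^ 'n \<Rightarrow> complex ^ 'm \<Rightarrow> complex ^ ('n::finite \<times> 'm::finite)" where
  "tens u w = (\<chi> ij. u $ fst ij * w $ snd ij)"

lemma tens_index: "tens u w $ (i, j) = u $ i * w $ j"
  by (simp add: tens_def)

lemma tens_scale: "tens (k *s u) w = k *s tens u w" "tens u (k *s w) = k *s tens u w"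
  by (simp_all add: vec_eq_iff tens_def)

lemma tens_neq_0: "u \<noteq> 0 \<Longrightarrow> w \<noteq> 0 \<Longrightarrow> tens u w \<noteq> 0"
proof
  assume "u \<noteq> 0" "w \<noteq> 0" and 0: "tens u w = 0"
  then obtain i j where "u $ i \<noteq> 0" "w $ j \<noteq> 0" by (auto simp: vec_eq_iff)
  then show False using arg_cong[OF 0, of "\<lambda>v. v $ (i, j)"] by (simp add: tens_index)
qed

lemma segre_pt: "segre (pt u) (pt w) = pt (tens u w)"
proof -
  let ?S = "{tens a b | a b. a \<in> pt u \<and> b \<in> pt w}"
  have "?S \<subseteq> pt (tens u w)"
  proof clarify
    fix a b assume "a \<in> pt u" "b \<in> pt w"
    then obtain k l where "a = k *s u" "b = l *s w" by (auto simp: in_pt)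
    then have "tens a b = (k * l) *s tens u w" by (simp add: tens_scale vector_smult_assoc)
    then show "tens a b \<in> pt (tens u w)" unfolding in_pt by blast
  qed
  then have "vec.span ?S \<subseteq> pt (tens u w)" by (simp add: vec.span_minimal)
  moreover have "tens u w \<in> ?S" using self_in_pt[of u] self_in_pt[of w] by blast
  then have "pt (tens u w) \<subseteq> vec.span ?S" by (simp add: vec.span_mono)
  ultimately show ?thesis unfolding segre_def tens_def by blast
qed

text \<open>On the scroll the three vectors are \<alpha>, \<beta> s^3 and \<beta> t^3 times
  \<open>conic_vec s t\<close>; the case distinction selects a nonzero one.\<close>

definition vertex :: "((5 \<times> 5) \<times> (5 \<times> 5)) subsp \<Rightarrow> 5 subsp" where
  "vertex x = (if X0 (rep x) \<noteq> 0 \<or> X2 (rep x) \<noteq> 0 then pt (vec5 (X0 (rep x)) (X1 (rep x)) 0 0 (- X2 (rep x)))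
    else if Y0 (rep x) \<noteq> 0 then pt (vec5 (Y0 (rep x)) (Y1 (rep x)) 0 0 (- Y2 (rep x)))
    else pt (vec5 (Y3 (rep x)) (Y4 (rep x)) 0 0 (- Y5 (rep x))))"

lemma rep_scroll_vec:
  assumes "s \<noteq> 0 \<or> t \<noteq> 0" "\<alpha> \<noteq> 0 \<or> \<beta> \<noteq> 0"
  obtains c where "c \<noteq> 0" "rep (pt (scroll_vec s t \<alpha> \<beta>)) = scroll_vec s t (c * \<alpha>) (c * \<beta>)"
  using rep_scale[OF scroll_vec_neq_0[OF assms]] that by (metis scroll_vec_scale)

lemma conic_vec_scroll_vec:
  "vec5 (\<alpha> * (s * s)) (\<alpha> * (s * t)) 0 0 (- (\<alpha> * (t * t))) = \<alpha> *s conic_vec s t"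
  "vec5 (\<beta> * s ^ 5) (\<beta> * (s ^ 4 * t)) 0 0 (- (\<beta> * (s ^ 3 * t ^ 2))) = (\<beta> * s ^ 3) *s conic_vec s t"
  "vec5 (\<beta> * (s ^ 2 * t ^ 3)) (\<beta> * (s * t ^ 4)) 0 0 (- (\<beta> * t ^ 5)) = (\<beta> * t ^ 3) *s conic_vec s t"
  by (simp_all add: conic_vec_def vec5_scale power_numeral_reduce mult_ac)

lemma vertex_scroll_vec:
  assumes "s \<noteq> 0 \<or> t \<noteq> 0" "\<alpha> \<noteq> 0 \<or> \<beta> \<noteq> 0"
  shows "vertex (pt (scroll_vec s t \<alpha> \<beta>)) = pt (conic_vec s t)"
proof -
  obtain c where c: "c \<noteq> 0" and r: "rep (pt (scroll_vec s t \<alpha> \<beta>)) = scroll_vec s t (c * \<alpha>) (c * \<beta>)"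
    using assms by (rule rep_scroll_vec)
  show ?thesis unfolding vertex_def r XY_scroll_vec conic_vec_scroll_vec using assms c by auto
qed

lemma vertex_conic: "x \<in> scroll \<Longrightarrow> vertex x \<in> vertex_conic"
proof -
  assume "x \<in> scroll"
  then obtain s t \<alpha> \<beta> where *: "s \<noteq> 0 \<or> t \<noteq> 0" "\<alpha> \<noteq> 0 \<or> \<beta> \<noteq> 0" "x = pt (scroll_vec s t \<alpha> \<beta>)"
    unfolding scroll_def by blast
  show ?thesis unfolding *(3) vertex_scroll_vec[OF *(1,2)] in_vertex_conic using *(1) by blast
qed

lemma morphism_vertex: "morphism scroll vertex_conic vertex"
proof (rule morphismI[OF scroll_Proj vertex_conic_Proj vertex_conic])
  fix x assume "x \<in> scroll"
  then obtain s t \<alpha> \<beta> where st: "s \<noteq> 0 \<or> t \<noteq> 0" "\<alpha> \<noteq> 0 \<or> \<beta> \<noteq> 0" "x = pt (scroll_vec s t \<alpha> \<beta>)"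
    unfolding scroll_def by blast
  have n: "scroll_vec s t \<alpha> \<beta> \<noteq> 0" by (rule scroll_vec_neq_0[OF st(1,2)])
  have chart: "\<exists>e g d F. form e g \<and> x \<in> basic g \<and> (\<forall>i. form d (\<lambda>v. F v $ i)) \<and>
      (\<forall>v. v \<noteq> 0 \<longrightarrow> pt v \<in> scroll \<inter> basic g \<longrightarrow> F v \<noteq> 0 \<and> vertex (pt v) = pt (F v))"
    if g: "form 1 g" "g (scroll_vec s t \<alpha> \<beta>) \<noteq> 0" and F: "\<And>i. form 1 (\<lambda>v. F v $ i)"
      and k: "\<And>s t \<alpha> \<beta>. g (scroll_vec s t \<alpha> \<beta>) \<noteq> 0 \<Longrightarrow> \<exists>k. k \<noteq> 0 \<and> F (scroll_vec s t \<alpha> \<beta>) = k *s conic_vec s t" for g F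
  proof (intro exI conjI allI impI)
    show "x \<in> basic g" using pt_in_basic[OF g(1) n] g st(3) by blast
    fix v assume v: "v \<noteq> 0" "pt v \<in> scroll \<inter> basic g"
    then have vs: "pt v \<in> scroll" by blast
    obtain s t \<alpha> \<beta> where w: "s \<noteq> 0 \<or> t \<noteq> 0" "\<alpha> \<noteq> 0 \<or> \<beta> \<noteq> 0" "v = scroll_vec s t \<alpha> \<beta>"
      using v(1) vs by (rule scroll_rep)
    have "g v \<noteq> 0" using v pt_in_basic[OF g(1) v(1)] by blast
    then obtain k where k: "k \<noteq> 0" "F v = k *s conic_vec s t" using k w(3) by blast
    show "vertex (pt v) = pt (F v)" unfolding k(2) using k(1) vertex_scroll_vec[OF w(1,2)] w(3) by simp
    show "F v \<noteq> 0" using k conic_vec_neq_0[OF w(1)] by (auto simp: vec_eq_iff)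
  qed (use g F in auto)
  have fX: "form 1 (\<lambda>v. vec5 (X0 v) (X1 v) 0 0 (- X2 v) $ i)"
    and fY: "form 1 (\<lambda>v. vec5 (Y0 v) (Y1 v) 0 0 (- Y2 v) $ i)"
    and fZ: "form 1 (\<lambda>v. vec5 (Y3 v) (Y4 v) 0 0 (- Y5 v) $ i)" for i
    by (intro form_vec5 form_XY form_uminus form.zero)+
  consider "X0 (scroll_vec s t \<alpha> \<beta>) \<noteq> 0" | "X2 (scroll_vec s t \<alpha> \<beta>) \<noteq> 0" | "Y0 (scroll_vec s t \<alpha> \<beta>) \<noteq> 0" | "Y5 (scroll_vec s t \<alpha> \<beta>) \<noteq> 0"
    using st by auto
  then show "\<exists>e g d F. form e g \<and> x \<in> basic g \<and> (\<forall>i. form d (\<lambda>v. F v $ i)) \<and>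
      (\<forall>v. v \<noteq> 0 \<longrightarrow> pt v \<in> scroll \<inter> basic g \<longrightarrow> F v \<noteq> 0 \<and> vertex (pt v) = pt (F v))"
  proof cases
    case 1 show ?thesis by (rule chart[OF form_XY(1) 1 fX]) (unfold XY_scroll_vec conic_vec_scroll_vec, rule exI, rule conjI[rotated], rule refl, simp)
  next
    case 2 show ?thesis by (rule chart[OF form_XY(3) 2 fX]) (unfold XY_scroll_vec conic_vec_scroll_vec, rule exI, rule conjI[rotated], rule refl, simp)
  next
    case 3 show ?thesis by (rule chart[OF form_XY(4) 3 fY]) (unfold XY_scroll_vec conic_vec_scroll_vec, rule exI, rule conjI[rotated], rule refl, simp)
  next
    case 4 show ?thesis by (rule chart[OF form_XY(9) 4 fZ]) (unfold XY_scroll_vec conic_vec_scroll_vec, rule exI, rule conjI[rotated], rule refl, simp)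
  qed
qed

text \<open>The two trivialising open sets are the complements of the two points of the conic with
  \<open>s = 0\<close> and with \<open>t = 0\<close>; the flag \<open>b\<close> selects one of them.\<close>

definition lead_param :: "bool \<Rightarrow> complex \<Rightarrow> complex \<Rightarrow> complex" where
  "lead_param b s t = (if b then s else t)"

definition conic_chart :: "bool \<Rightarrow> 5 subsp set" where
  "conic_chart b = vertex_conic \<inter> basic (\<lambda>a. a $ (if b then 0 else 4))"

definition x_lead :: "bool \<Rightarrow> complex ^ ((5 \<times> 5) \<times> (5 \<times> 5)) \<Rightarrow> complex" where
  "x_lead b = (if b then X0 else X2)"

definition y_lead :: "bool \<Rightarrow> complex ^ ((5 \<times> 5) \<times> (5 \<times> 5)) \<Rightarrow> complex" where
  "y_lead b = (if b then Y0 else Y5)"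

text \<open>The fibre coordinate is (\<alpha> m^2 : \<beta> m^5), where m is the parameter that is
  nonzero on the chart. It is well defined because scaling (s, t) by k has the same effect as
  scaling \<alpha> by k^2 and \<beta> by k^5.\<close>

definition trivialise :: "bool \<Rightarrow> ((5 \<times> 5) \<times> (5 \<times> 5)) subsp \<Rightarrow> (5 \<times> 2) subsp" where
  "trivialise b x = segre (vertex x) (pt (vec2 (x_lead b (rep x)) (y_lead b (rep x))))"

definition q_lead :: "bool \<Rightarrow> 2 \<Rightarrow> complex ^ (5 \<times> 2) \<Rightarrow> complex" where
  "q_lead b j q = (if b then q $ (0, j) else - q $ (4, j))"

text \<open>On the product, the selected entries of column j are (s, t) times m w, where w is the
  j-th fibre coordinate. The cube in the third argument equalises the degrees, 4 + 2 = 1 + 5, and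
  produces the relative factor m^3 that undoes (\<alpha> m^2 : \<beta> m^5). Both columns are
  provided since w may be zero.\<close>

definition untriv_vec :: "bool \<Rightarrow> 2 \<Rightarrow> complex ^ (5 \<times> 2) \<Rightarrow> complex ^ ((5 \<times> 5) \<times> (5 \<times> 5))" where
  "untriv_vec b j q = scroll_vec (if b then q $ (0, j) else q $ (1, j)) (if b then q $ (1, j) else - q $ (4, j))
     (q_lead b 0 q * q_lead b j q ^ 3) (q_lead b 1 q)"

definition untrivialise :: "bool \<Rightarrow> (5 \<times> 2) subsp \<Rightarrow> ((5 \<times> 5) \<times> (5 \<times> 5)) subsp" where
  "untrivialise b y = (if q_lead b 0 (rep y) \<noteq> 0 then pt (untriv_vec b 0 (rep y)) else pt (untriv_vec b 1 (rep y)))"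

lemma lead_param_neq_0: "lead_param b s t \<noteq> 0 \<Longrightarrow> s \<noteq> 0 \<or> t \<noteq> 0"
  by (auto simp: lead_param_def split: if_splits)

lemma xy_lead_scroll_vec: "x_lead b (scroll_vec s t \<alpha> \<beta>) = \<alpha> * lead_param b s t ^ 2" "y_lead b (scroll_vec s t \<alpha> \<beta>) = \<beta> * lead_param b s t ^ 5"
  by (simp_all add: x_lead_def y_lead_def lead_param_def power2_eq_square)

lemma in_conic_chart: "s \<noteq> 0 \<or> t \<noteq> 0 \<Longrightarrow> pt (conic_vec s t) \<in> conic_chart b \<longleftrightarrow> lead_param b s t \<noteq> 0"
proof -
  assume st: "s \<noteq> 0 \<or> t \<noteq> 0"
  then have "pt (conic_vec s t) \<in> vertex_conic" using in_vertex_conic by blast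
  then show ?thesis using pt_in_basic[OF form.coord conic_vec_neq_0[OF st]]
    by (cases b) (simp_all add: conic_chart_def lead_param_def conic_vec_def)
qed

lemma trivialise_scroll_vec:
  assumes m: "lead_param b s t \<noteq> 0" and ab: "\<alpha> \<noteq> 0 \<or> \<beta> \<noteq> 0"
  shows "trivialise b (pt (scroll_vec s t \<alpha> \<beta>)) = pt (tens (conic_vec s t) (vec2 (\<alpha> * lead_param b s t ^ 2) (\<beta> * lead_param b s t ^ 5)))"
proof -
  note st = lead_param_neq_0[OF m]
  obtain c where c: "c \<noteq> 0" and r: "rep (pt (scroll_vec s t \<alpha> \<beta>)) = scroll_vec s t (c * \<alpha>) (c * \<beta>)"
    using st ab by (rule rep_scroll_vec)
  have e: "vec2 (c * \<alpha> * lead_param b s t ^ 2) (c * \<beta> * lead_param b s t ^ 5) = c *s vec2 (\<alpha> * lead_param b s t ^ 2) (\<beta> * lead_param b s t ^ 5)"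
    by (simp add: vec2_scale mult.assoc)
  show ?thesis unfolding trivialise_def r vertex_scroll_vec[OF st ab] xy_lead_scroll_vec e using c by (simp add: segre_pt)
qed

lemma scroll_vec_rescale: "scroll_vec (k * s) (k * t) \<alpha> \<beta> = scroll_vec s t (k ^ 2 * \<alpha>) (k ^ 5 * \<beta>)"
  by (simp add: scroll_vec_def power_mult_distrib power_numeral_reduce mult_ac)

lemma q_lead_tens: "q_lead b j (tens (conic_vec s t) w) = lead_param b s t ^ 2 * w $ j"
  by (simp add: q_lead_def lead_param_def tens_index conic_vec_def power2_eq_square)

lemma untriv_vec_tens:
  "untriv_vec b j (tens (conic_vec s t) (vec2 \<alpha> \<beta>)) =
    (lead_param b s t ^ 7 * vec2 \<alpha> \<beta> $ j ^ 5) *s scroll_vec s t (lead_param b s t ^ 3 * \<alpha>) \<beta>"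
proof -
  let ?w = "vec2 \<alpha> \<beta> $ j" and ?m = "lead_param b s t"
  have 1: "(if b then tens (conic_vec s t) (vec2 \<alpha> \<beta>) $ (0, j) else tens (conic_vec s t) (vec2 \<alpha> \<beta>) $ (1, j)) = (?m * ?w) * s"
    "(if b then tens (conic_vec s t) (vec2 \<alpha> \<beta>) $ (1, j) else - tens (conic_vec s t) (vec2 \<alpha> \<beta>) $ (4, j)) = (?m * ?w) * t"
    by (simp_all add: tens_index conic_vec_def lead_param_def)
  show ?thesis unfolding untriv_vec_def 1 scroll_vec_rescale q_lead_tens vec2_index scroll_vec_scale
    by (simp add: power_mult_distrib power_numeral_reduce mult_ac)
qed

lemma untrivialise_tens:
  assumes m: "lead_param b s t \<noteq> 0" and ab: "\<alpha> \<noteq> 0 \<or> \<beta> \<noteq> 0"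
  shows "untrivialise b (pt (tens (conic_vec s t) (vec2 \<alpha> \<beta>))) = pt (scroll_vec s t (lead_param b s t ^ 3 * \<alpha>) \<beta>)"
proof -
  have "tens (conic_vec s t) (vec2 \<alpha> \<beta>) \<noteq> 0"
    by (intro tens_neq_0 conic_vec_neq_0 lead_param_neq_0[OF m]) (use ab vec2_neq_0 in blast)
  then obtain c where c: "c \<noteq> 0" and "rep (pt (tens (conic_vec s t) (vec2 \<alpha> \<beta>))) = c *s tens (conic_vec s t) (vec2 \<alpha> \<beta>)"
    by (rule rep_scale)
  then have r: "rep (pt (tens (conic_vec s t) (vec2 \<alpha> \<beta>))) = tens (conic_vec s t) (vec2 (c * \<alpha>) (c * \<beta>))"
    by (simp add: vec2_scale[symmetric] tens_scale)
  have e: "scroll_vec s t (lead_param b s t ^ 3 * (c * \<alpha>)) (c * \<beta>) = c *s scroll_vec s t (lead_param b s t ^ 3 * \<alpha>) \<beta>"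
    by (simp add: scroll_vec_scale mult_ac)
  show ?thesis unfolding untrivialise_def r untriv_vec_tens q_lead_tens vec2_index e using c m ab
    by (auto simp: vector_smult_assoc)
qed

lemma product_conic_chart: "y \<in> product (conic_chart b) (Proj :: 2 subsp set) \<longleftrightarrow>
  (\<exists>s t \<alpha> \<beta>. lead_param b s t \<noteq> 0 \<and> (\<alpha> \<noteq> 0 \<or> \<beta> \<noteq> 0) \<and> y = pt (tens (conic_vec s t) (vec2 \<alpha> \<beta>)))"
proof
  assume "y \<in> product (conic_chart b) (Proj :: 2 subsp set)"
  then obtain x z where xz: "x \<in> conic_chart b" "z \<in> (Proj :: 2 subsp set)" "y = segre x z" by (auto simp: product_def)
  have "x \<in> vertex_conic" using xz(1) by (simp add: conic_chart_def)
  then obtain s t where st: "s \<noteq> 0 \<or> t \<noteq> 0" "x = pt (conic_vec s t)" using in_vertex_conic by blast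
  obtain \<alpha> \<beta> where ab: "\<alpha> \<noteq> 0 \<or> \<beta> \<noteq> 0" "z = pt (vec2 \<alpha> \<beta>)" using xz(2) by (rule P1_rep)
  have "lead_param b s t \<noteq> 0" using in_conic_chart[OF st(1)] xz(1) st(2) by blast
  then show "\<exists>s t \<alpha> \<beta>. lead_param b s t \<noteq> 0 \<and> (\<alpha> \<noteq> 0 \<or> \<beta> \<noteq> 0) \<and> y = pt (tens (conic_vec s t) (vec2 \<alpha> \<beta>))"
    using ab xz(3) st(2) segre_pt by blast
next
  assume "\<exists>s t \<alpha> \<beta>. lead_param b s t \<noteq> 0 \<and> (\<alpha> \<noteq> 0 \<or> \<beta> \<noteq> 0) \<and> y = pt (tens (conic_vec s t) (vec2 \<alpha> \<beta>))"
  then obtain s t \<alpha> \<beta> where *: "lead_param b s t \<noteq> 0" "\<alpha> \<noteq> 0 \<or> \<beta> \<noteq> 0" "y = pt (tens (conic_vec s t) (vec2 \<alpha> \<beta>))" by blast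
  have "pt (conic_vec s t) \<in> conic_chart b" using in_conic_chart[OF lead_param_neq_0[OF *(1)]] *(1) by blast
  moreover have "pt (vec2 \<alpha> \<beta>) \<in> Proj" using *(2) vec2_neq_0 by simp
  ultimately show "y \<in> product (conic_chart b) (Proj :: 2 subsp set)"
    unfolding product_def *(3) segre_pt[symmetric] by blast
qed

lemma product_conic_chart_Proj: "product (conic_chart b) (Proj :: 2 subsp set) \<subseteq> Proj"
proof
  fix y assume "y \<in> product (conic_chart b) (Proj :: 2 subsp set)"
  then obtain s t \<alpha> \<beta> where *: "lead_param b s t \<noteq> 0" "\<alpha> \<noteq> 0 \<or> \<beta> \<noteq> 0" "y = pt (tens (conic_vec s t) (vec2 \<alpha> \<beta>))"
    unfolding product_conic_chart by blast
  have "tens (conic_vec s t) (vec2 \<alpha> \<beta>) \<noteq> 0"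
    by (intro tens_neq_0 conic_vec_neq_0 lead_param_neq_0[OF *(1)]) (use *(2) vec2_neq_0 in blast)
  then show "y \<in> Proj" unfolding *(3) by (rule pt_in_Proj)
qed

lemma product_conic_chart_rep:
  assumes "v \<noteq> 0" "pt v \<in> product (conic_chart b) (Proj :: 2 subsp set)"
  obtains s t \<alpha> \<beta> where "lead_param b s t \<noteq> 0" "\<alpha> \<noteq> 0 \<or> \<beta> \<noteq> 0" "v = tens (conic_vec s t) (vec2 \<alpha> \<beta>)"
proof -
  obtain s t \<alpha> \<beta> where *: "lead_param b s t \<noteq> 0" "\<alpha> \<noteq> 0 \<or> \<beta> \<noteq> 0" "pt v = pt (tens (conic_vec s t) (vec2 \<alpha> \<beta>))"
    using assms(2) unfolding product_conic_chart by blast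
  have "tens (conic_vec s t) (vec2 \<alpha> \<beta>) \<noteq> 0"
    by (intro tens_neq_0 conic_vec_neq_0 lead_param_neq_0[OF *(1)]) (use *(2) vec2_neq_0 in blast)
  then obtain k where k: "k \<noteq> 0" "v = k *s tens (conic_vec s t) (vec2 \<alpha> \<beta>)"
    using pt_eq_iff[OF _ assms(1)] *(3) by blast
  have "v = tens (conic_vec s t) (vec2 (k * \<alpha>) (k * \<beta>))" by (simp add: k(2) vec2_scale[symmetric] tens_scale)
  then show ?thesis using that[of s t "k * \<alpha>" "k * \<beta>"] * k(1) by simp
qed

definition scroll_over :: "bool \<Rightarrow> ((5 \<times> 5) \<times> (5 \<times> 5)) subsp set" where
  "scroll_over b = {z \<in> scroll. vertex z \<in> conic_chart b}"

lemma scroll_over_Proj: "scroll_over b \<subseteq> Proj"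
  using scroll_Proj by (auto simp: scroll_over_def)

lemma scroll_over_rep:
  assumes "v \<noteq> 0" "pt v \<in> scroll_over b"
  obtains s t \<alpha> \<beta> where "lead_param b s t \<noteq> 0" "\<alpha> \<noteq> 0 \<or> \<beta> \<noteq> 0" "v = scroll_vec s t \<alpha> \<beta>"
proof -
  have v: "pt v \<in> scroll" "vertex (pt v) \<in> conic_chart b" using assms(2) by (auto simp: scroll_over_def)
  obtain s t \<alpha> \<beta> where *: "s \<noteq> 0 \<or> t \<noteq> 0" "\<alpha> \<noteq> 0 \<or> \<beta> \<noteq> 0" "v = scroll_vec s t \<alpha> \<beta>"
    using assms(1) v(1) by (rule scroll_rep)
  then have "lead_param b s t \<noteq> 0" using v(2) vertex_scroll_vec[OF *(1,2)] in_conic_chart[OF *(1)] by simp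
  then show ?thesis using that * by blast
qed

lemma scroll_vec_in_scroll_over: "lead_param b s t \<noteq> 0 \<Longrightarrow> \<alpha> \<noteq> 0 \<or> \<beta> \<noteq> 0 \<Longrightarrow> pt (scroll_vec s t \<alpha> \<beta>) \<in> scroll_over b"
  unfolding scroll_over_def mem_Collect_eq scroll_def
  using vertex_scroll_vec in_conic_chart lead_param_neq_0 by (metis (no_types, lifting))

lemma form_xy_lead: "form 1 (x_lead b)" "form 1 (y_lead b)"
  by (simp_all only: x_lead_def y_lead_def split: if_split) (simp_all only: form_XY simp_thms)

lemma form_tens: "(\<And>i. form d (\<lambda>v. F v $ i)) \<Longrightarrow> (\<And>j. form e (\<lambda>v. G v $ j)) \<Longrightarrow>
    d + e = m \<Longrightarrow> form m (\<lambda>v. tens (F v) (G v) $ ij)"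
  unfolding tens_def vec_lambda_beta by (rule form_mult_eq)

lemma morphism_trivialise: "morphism (scroll_over b) (product (conic_chart b) (Proj :: 2 subsp set)) (trivialise b)"
proof (rule morphismI[OF scroll_over_Proj product_conic_chart_Proj])
  fix x assume x: "x \<in> scroll_over b"
  then have "x \<in> Proj" using scroll_over_Proj by blast
  then obtain v0 where v0: "v0 \<noteq> 0" "x = pt v0" by (rule ProjE)
  then have "pt v0 \<in> scroll_over b" using x by simp
  with v0(1) obtain s t \<alpha> \<beta> where st: "lead_param b s t \<noteq> 0" "\<alpha> \<noteq> 0 \<or> \<beta> \<noteq> 0" "v0 = scroll_vec s t \<alpha> \<beta>"
    by (rule scroll_over_rep)
  show "trivialise b x \<in> product (conic_chart b) (Proj :: 2 subsp set)"
    unfolding v0(2) st(3) trivialise_scroll_vec[OF st(1,2)] product_conic_chart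
    by (rule exI[of _ s], rule exI[of _ t], rule exI[of _ "\<alpha> * lead_param b s t ^ 2"], rule exI[of _ "\<beta> * lead_param b s t ^ 5"])
      (use st in auto)
  have chart: "\<exists>e g d F. form e g \<and> x \<in> basic g \<and> (\<forall>i. form d (\<lambda>v. F v $ i)) \<and>
      (\<forall>v. v \<noteq> 0 \<longrightarrow> pt v \<in> scroll_over b \<inter> basic g \<longrightarrow> F v \<noteq> 0 \<and> trivialise b (pt v) = pt (F v))"
    if g: "form 1 g" "g (scroll_vec s t \<alpha> \<beta>) \<noteq> 0" and G: "\<And>i. form 1 (\<lambda>v. G v $ i)"
      and k: "\<And>s t \<alpha> \<beta>. g (scroll_vec s t \<alpha> \<beta>) \<noteq> 0 \<Longrightarrow> \<exists>k. k \<noteq> 0 \<and> G (scroll_vec s t \<alpha> \<beta>) = k *s conic_vec s t" for g G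
  proof (intro exI conjI allI impI)
    show "x \<in> basic g" using pt_in_basic[OF g(1) v0(1)] g(2) v0(2) st(3) by blast
    show "form 2 (\<lambda>v. tens (G v) (vec2 (x_lead b v) (y_lead b v)) $ i)" for i
      by (rule form_tens[OF G form_vec2[OF form_xy_lead]]) simp
    fix v assume v: "v \<noteq> 0" "pt v \<in> scroll_over b \<inter> basic g"
    then have vs: "pt v \<in> scroll_over b" by blast
    obtain s t \<alpha> \<beta> where w: "lead_param b s t \<noteq> 0" "\<alpha> \<noteq> 0 \<or> \<beta> \<noteq> 0" "v = scroll_vec s t \<alpha> \<beta>"
      using v(1) vs by (rule scroll_over_rep)
    have "g v \<noteq> 0" using v pt_in_basic[OF g(1) v(1)] by blast
    then obtain k where k: "k \<noteq> 0" "G v = k *s conic_vec s t" using k w(3) by blast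
    have e: "tens (G v) (vec2 (x_lead b v) (y_lead b v)) = k *s tens (conic_vec s t) (vec2 (\<alpha> * lead_param b s t ^ 2) (\<beta> * lead_param b s t ^ 5))"
      unfolding k(2) tens_scale unfolding w(3) xy_lead_scroll_vec ..
    show "trivialise b (pt v) = pt (tens (G v) (vec2 (x_lead b v) (y_lead b v)))"
      unfolding e using k(1) trivialise_scroll_vec[OF w(1,2)] w(3) by simp
    have "G v \<noteq> 0" using k conic_vec_neq_0[OF lead_param_neq_0[OF w(1)]] by (auto simp: vec_eq_iff)
    moreover have "vec2 (x_lead b v) (y_lead b v) \<noteq> 0" using w by (simp add: vec2_neq_0 xy_lead_scroll_vec)
    ultimately show "tens (G v) (vec2 (x_lead b v) (y_lead b v)) \<noteq> 0" by (rule tens_neq_0)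
  qed (use g in auto)
  have fX: "form 1 (\<lambda>v. vec5 (X0 v) (X1 v) 0 0 (- X2 v) $ i)"
    and fY: "form 1 (\<lambda>v. vec5 (Y0 v) (Y1 v) 0 0 (- Y2 v) $ i)"
    and fZ: "form 1 (\<lambda>v. vec5 (Y3 v) (Y4 v) 0 0 (- Y5 v) $ i)" for i
    by (intro form_vec5 form_XY form_uminus form.zero)+
  consider "\<alpha> \<noteq> 0" | "\<beta> \<noteq> 0" "b" | "\<beta> \<noteq> 0" "\<not> b" using st(2) by blast
  then show "\<exists>e g d F. form e g \<and> x \<in> basic g \<and> (\<forall>i. form d (\<lambda>v. F v $ i)) \<and>
      (\<forall>v. v \<noteq> 0 \<longrightarrow> pt v \<in> scroll_over b \<inter> basic g \<longrightarrow> F v \<noteq> 0 \<and> trivialise b (pt v) = pt (F v))"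
  proof cases
    case 1
    show ?thesis proof (rule chart[OF form_xy_lead(1) _ fX])
      show "x_lead b (scroll_vec s t \<alpha> \<beta>) \<noteq> 0" using 1 st(1) by (simp add: xy_lead_scroll_vec)
    qed (unfold xy_lead_scroll_vec XY_scroll_vec conic_vec_scroll_vec, rule exI, rule conjI[rotated], rule refl, simp)
  next
    case 2
    show ?thesis proof (rule chart[OF form_XY(4) _ fY])
      show "Y0 (scroll_vec s t \<alpha> \<beta>) \<noteq> 0" using 2 st(1) by (simp add: lead_param_def)
    qed (unfold XY_scroll_vec conic_vec_scroll_vec, rule exI, rule conjI[rotated], rule refl, simp)
  next
    case 3
    show ?thesis proof (rule chart[OF form_XY(9) _ fZ])
      show "Y5 (scroll_vec s t \<alpha> \<beta>) \<noteq> 0" using 3 st(1) by (simp add: lead_param_def)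
    qed (unfold XY_scroll_vec conic_vec_scroll_vec, rule exI, rule conjI[rotated], rule refl, simp)
  qed
qed

lemma form_q_lead: "form 1 (q_lead b j)"
  unfolding q_lead_def[abs_def]
  by (cases b; simp only: if_True if_False; intro form_uminus form.coord)

lemma form_untriv_vec: "form 6 (\<lambda>v. untriv_vec b j v $ i)"
proof -
  have pcoord: "form k (\<lambda>v. a v ^ k)" if "form 1 a" for k and a :: "complex ^ (5 \<times> 2) \<Rightarrow> complex"
    using form_power[OF that, of k] by simp
  define \<sigma> \<tau> where "\<sigma> = (\<lambda>q :: complex ^ (5 \<times> 2). if b then q $ (0, j) else q $ (1, j))"
    and "\<tau> = (\<lambda>q :: complex ^ (5 \<times> 2). if b then q $ (1, j) else - q $ (4, j))"
  have s: "form 1 \<sigma>" unfolding \<sigma>_def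
    by (cases b; simp only: if_True if_False; intro form_uminus form.coord)
  have t: "form 1 \<tau>" unfolding \<tau>_def
    by (cases b; simp only: if_True if_False; intro form_uminus form.coord)
  have A: "form 4 (\<lambda>q. q_lead b 0 q * q_lead b j q ^ 3)" by (rule form_mult_eq[OF form_q_lead pcoord[OF form_q_lead]]) simp
  have B: "form 6 (\<lambda>q. q_lead b 1 q * h q)" if "form 5 h" for h by (rule form_mult_eq[OF form_q_lead that]) simp
  have C: "form 6 (\<lambda>q. q_lead b 0 q * q_lead b j q ^ 3 * h q)" if "form 2 h" for h by (rule form_mult_eq[OF A that]) simp
  have D: "form 5 (\<lambda>q. \<sigma> q ^ 4 * \<tau> q)" "form 5 (\<lambda>q. \<sigma> q ^ 3 * \<tau> q ^ 2)" "form 5 (\<lambda>q. \<sigma> q ^ 2 * \<tau> q ^ 3)"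
    "form 5 (\<lambda>q. \<sigma> q * \<tau> q ^ 4)"
    by (rule form_mult_eq[OF pcoord[OF s] t], simp, rule form_mult_eq[OF pcoord[OF s] pcoord[OF t]], simp,
        rule form_mult_eq[OF pcoord[OF s] pcoord[OF t]], simp, rule form_mult_eq[OF s pcoord[OF t]], simp)
  have "form 6 (\<lambda>q. scroll_vec (\<sigma> q) (\<tau> q) (q_lead b 0 q * q_lead b j q ^ 3) (q_lead b 1 q) $ i)"
    unfolding scroll_vec_def by (intro form_scroll_lin C B form_11 s t D pcoord)
  then show ?thesis by (simp add: untriv_vec_def \<sigma>_def \<tau>_def)
qed

lemma morphism_untrivialise: "morphism (product (conic_chart b) (Proj :: 2 subsp set)) (scroll_over b) (untrivialise b)"
proof (rule morphismI[OF product_conic_chart_Proj scroll_over_Proj])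
  fix y assume "y \<in> product (conic_chart b) (Proj :: 2 subsp set)"
  then obtain s t \<alpha> \<beta> where st: "lead_param b s t \<noteq> 0" "\<alpha> \<noteq> 0 \<or> \<beta> \<noteq> 0" "y = pt (tens (conic_vec s t) (vec2 \<alpha> \<beta>))"
    unfolding product_conic_chart by blast
  show "untrivialise b y \<in> scroll_over b"
    unfolding st(3) untrivialise_tens[OF st(1,2)] by (rule scroll_vec_in_scroll_over) (use st in auto)
  have n: "tens (conic_vec s t) (vec2 \<alpha> \<beta>) \<noteq> 0"
    by (intro tens_neq_0 conic_vec_neq_0 lead_param_neq_0[OF st(1)]) (use st(2) vec2_neq_0 in blast)
  have "\<exists>j. vec2 \<alpha> \<beta> $ j \<noteq> 0" using st(2) by (metis vec2_index)
  then obtain j where j: "vec2 \<alpha> \<beta> $ j \<noteq> 0" by blast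
  show "\<exists>e g d F. form e g \<and> y \<in> basic g \<and> (\<forall>i. form d (\<lambda>v. F v $ i)) \<and>
      (\<forall>v. v \<noteq> 0 \<longrightarrow> pt v \<in> product (conic_chart b) (Proj :: 2 subsp set) \<inter> basic g \<longrightarrow> F v \<noteq> 0 \<and> untrivialise b (pt v) = pt (F v))"
  proof (intro exI conjI allI impI)
    show "y \<in> basic (q_lead b j)" using pt_in_basic[OF form_q_lead n] st j by (simp add: q_lead_tens)
    show "form 6 (\<lambda>v. untriv_vec b j v $ i)" for i by (rule form_untriv_vec)
    fix v :: "complex ^ (5 \<times> 2)" assume v: "v \<noteq> 0" "pt v \<in> product (conic_chart b) (Proj :: 2 subsp set) \<inter> basic (q_lead b j)"
    then have vp: "pt v \<in> product (conic_chart b) (Proj :: 2 subsp set)" by blast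
    obtain s t \<alpha> \<beta> where w: "lead_param b s t \<noteq> 0" "\<alpha> \<noteq> 0 \<or> \<beta> \<noteq> 0" "v = tens (conic_vec s t) (vec2 \<alpha> \<beta>)"
      using v(1) vp by (rule product_conic_chart_rep)
    have "q_lead b j v \<noteq> 0" using v pt_in_basic[OF form_q_lead v(1)] by blast
    then have k: "lead_param b s t ^ 7 * vec2 \<alpha> \<beta> $ j ^ 5 \<noteq> 0" using w(1) unfolding w(3) q_lead_tens by simp
    show "untrivialise b (pt v) = pt (untriv_vec b j v)"
      unfolding w(3) untrivialise_tens[OF w(1,2)] untriv_vec_tens by (rule pt_scale[OF k, symmetric])
    have "scroll_vec s t (lead_param b s t ^ 3 * \<alpha>) \<beta> \<noteq> 0" by (rule scroll_vec_neq_0[OF lead_param_neq_0[OF w(1)]]) (use w in auto)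
    then show "untriv_vec b j v \<noteq> 0" unfolding w(3) untriv_vec_tens using k by (auto simp: vec_eq_iff)
  qed (rule form_q_lead)
qed

lemma isomorphism_trivialise: "isomorphism (scroll_over b) (product (conic_chart b) (Proj :: 2 subsp set)) (trivialise b)"
proof (rule isomorphismI[OF scroll_over_Proj product_conic_chart_Proj morphism_trivialise morphism_untrivialise])
  fix x assume x: "x \<in> scroll_over b"
  then have "x \<in> Proj" using scroll_over_Proj by blast
  then obtain v where v: "v \<noteq> 0" "x = pt v" by (rule ProjE)
  then have "pt v \<in> scroll_over b" using x by simp
  with v(1) obtain s t \<alpha> \<beta> where st: "lead_param b s t \<noteq> 0" "\<alpha> \<noteq> 0 \<or> \<beta> \<noteq> 0" "v = scroll_vec s t \<alpha> \<beta>"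
    by (rule scroll_over_rep)
  let ?m = "lead_param b s t"
  have e: "scroll_vec s t (?m ^ 3 * (\<alpha> * ?m ^ 2)) (\<beta> * ?m ^ 5) = ?m ^ 5 *s scroll_vec s t \<alpha> \<beta>"
    by (simp add: scroll_vec_scale power_numeral_reduce mult_ac)
  have "\<alpha> * ?m ^ 2 \<noteq> 0 \<or> \<beta> * ?m ^ 5 \<noteq> 0" using st by auto
  then show "untrivialise b (trivialise b x) = x"
    unfolding v(2) st(3) trivialise_scroll_vec[OF st(1,2)] using untrivialise_tens[OF st(1)] e st(1) by simp
next
  fix y assume "y \<in> product (conic_chart b) (Proj :: 2 subsp set)"
  then obtain s t \<alpha> \<beta> where st: "lead_param b s t \<noteq> 0" "\<alpha> \<noteq> 0 \<or> \<beta> \<noteq> 0" "y = pt (tens (conic_vec s t) (vec2 \<alpha> \<beta>))"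
    unfolding product_conic_chart by blast
  let ?m = "lead_param b s t"
  have e: "vec2 (?m ^ 3 * \<alpha> * ?m ^ 2) (\<beta> * ?m ^ 5) = ?m ^ 5 *s vec2 \<alpha> \<beta>"
    by (simp add: vec2_scale power_numeral_reduce mult_ac)
  have ab: "?m ^ 3 * \<alpha> \<noteq> 0 \<or> \<beta> \<noteq> 0" using st by auto
  show "trivialise b (untrivialise b y) = y"
    unfolding st(3) untrivialise_tens[OF st(1,2)] trivialise_scroll_vec[OF st(1) ab] e tens_scale using st(1) by simp
qed

theorem P1_fibration_vertex: "P1_fibration scroll vertex_conic vertex"
  unfolding P1_fibration_def
proof (intro conjI ballI)
  fix x assume "x \<in> vertex_conic"
  then obtain s t where st: "s \<noteq> 0 \<or> t \<noteq> 0" "x = pt (conic_vec s t)" using in_vertex_conic by blast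
  obtain b where b: "lead_param b s t \<noteq> 0"
    using st(1) by (metis lead_param_def)
  show "\<exists>U \<Phi>. zopen vertex_conic U \<and> x \<in> U \<and>
        isomorphism {z \<in> scroll. vertex z \<in> U} (product U (Proj :: 2 subsp set)) \<Phi> \<and>
        (\<forall>z\<in>scroll. vertex z \<in> U \<longrightarrow> (\<exists>t\<in>Proj. \<Phi> z = segre (vertex z) t))"
  proof (intro exI conjI ballI impI)
    show "zopen vertex_conic (conic_chart b)" unfolding conic_chart_def by (rule zopen_basic[OF form.coord])
    show "x \<in> conic_chart b" using in_conic_chart[OF st(1)] b st(2) by simp
    show "isomorphism {z \<in> scroll. vertex z \<in> conic_chart b} (product (conic_chart b) (Proj :: 2 subsp set)) (trivialise b)"
      using isomorphism_trivialise unfolding scroll_over_def .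
    fix z assume z: "z \<in> scroll" "vertex z \<in> conic_chart b"
    have "z \<in> Proj" using z scroll_Proj by blast
    then have r: "rep z \<noteq> 0" "pt (rep z) = z" using rep by auto
    then have "pt (rep z) \<in> scroll_over b" using z by (simp add: scroll_over_def)
    with r(1) obtain s t \<alpha> \<beta> where w: "lead_param b s t \<noteq> 0" "\<alpha> \<noteq> 0 \<or> \<beta> \<noteq> 0" "rep z = scroll_vec s t \<alpha> \<beta>"
      by (rule scroll_over_rep)
    have "vec2 (x_lead b (rep z)) (y_lead b (rep z)) \<noteq> 0" using w by (simp add: vec2_neq_0 xy_lead_scroll_vec)
    then show "\<exists>t\<in>Proj. trivialise b z = segre (vertex z) t" unfolding trivialise_def using pt_in_Proj by blast
  qed
qed (rule morphism_vertex)

text \<open>The locus was computed as a set in the Pluecker embedding and coincides with the scroll,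
  so the scroll itself serves as total space and the identity as isomorphism; the fibration sends a
  non-free line to its vertex.\<close>

theorem corollary3p2:
  shows "isomorphic vertex_conic (Proj :: 2 subsp set) \<and>
    (\<exists>(E :: ((5 \<times> 5) \<times> (5 \<times> 5)) subsp set) \<pi>.
       closedin zariski E \<and> P1_fibration E vertex_conic \<pi> \<and> isomorphic non_free_locus E)"
  using isomorphic_vertex_conic scroll_closed P1_fibration_vertex isomorphic_refl[OF scroll_Proj]
  unfolding non_free_locus_eq by blast

end
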